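(* Let $U_0$ be a constant, and let $u_s(t,y)$ be the (smooth) solution of the heat problem $$\partial_t u_s-\partial_y^2u_s=0\ \ (t>0,\ y>0),\qquad u_s|_{y=0}=0,\qquad \lim_{y\to+\infty}u_s=U_0,\qquad u_s|_{t=0}=U_s(y),$$ satisfying $$u_s-U_0\in C^0\big(\mathbb{R}^+; W_0^{4,\infty}(\mathbb{R}^+)\big)\cap C^1\big(\mathbb{R}^+; W_0^{2,\infty}(\mathbb{R}^+)\big).$$ Assume that the initial shear layer $U_s(y)$ has a non-degenerate critical point in $\mathbb{R}^+$, i.e. there is $a>0$ with $U_s'(a)=0$ and $U_s''(a)\neq 0$. Let $T(t,s)$ denote the solution operator of the Prandtl equations linearized around the shear flow $(u_s(t,y),0)$. Then there exists $\sigma>0$ such that for all $\delta>0$, $$\sup_{0\leq s< t\leq\delta}\big\|e^{-\sigma(t-s)\sqrt{|\partial_x|}}\,T(t,s)\big\|_{\mathcal{L}(\mathcal{H}_\alpha^m,\mathcal{H}_0^{m-\mu})}=+\infty,\qquad \forall\, \alpha,m\geq0,\ \mu\in[0,\tfrac{1}{2}).$$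
   Context: Variables: $t$ is time, $x\in\mathbb{T}=\mathbb{R}/2\pi\mathbb{Z}$ is the tangential variable, $y\in\mathbb{R}^+$ (the half-line) is the normal variable. The time regularity of $u_s$ is understood up to and including the initial time $t=0$. Function spaces: for $\alpha\ge 0$, $m\geq0$, $$W_\alpha^{m,\infty}(\mathbb{R}^+)=\{f=f(y),\ y\in\mathbb{R}^+:\ \|f\|_{W_\alpha^{m,\infty}}:=\|e^{\alpha y}f(y)\|_{W^{m,\infty}(\mathbb{R}^+)}<\infty\},$$ $$\mathcal{H}_\alpha^m=\{f=f(x,y),\ (x,y)\in\mathbb{T}\times\mathbb{R}^+:\ \|f\|_{\mathcal{H}_\alpha^m}:=\|f\|_{H^m(\mathbb{T}_x;\,W_\alpha^{0,\infty}(\mathbb{R}^+_y))}<\infty\}.$$ In particular $W_0^{m,\infty}=W^{m,\infty}(\mathbb{R}^+)$ (the subscript $0$ means weight exponent $\alpha=0$). The same definition of $\mathcal{H}_0^{r}$ is used for real, possibly negative, order $r$, with the usual Sobolev space in $x$ on the torus. Linearized Prandtl equations around the shear flow $(u_s(t,y),0)$: $$\partial_t u+u_s\partial_xu+v\,\partial_yu_s-\partial_y^2u=0,\qquad \partial_xu+\partial_yv=0,\qquad (u,v)|_{y=0}=0,\qquad \lim_{y\to+\infty}u=0,$$ for $(x,y)\in\mathbb{T}\times\mathbb{R}^+$; thus $v(t,x,y)=-\int_0^y\partial_xu(t,x,z)\,dz$. Solution operator: $T(t,s)u_0:=u(t,\cdot)$, where $u$ is the solution of the linearized problem with $u|_{t=s}=u_0$.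 $e^{-\sigma(t-s)\sqrt{|\partial_x|}}$ is the Fourier multiplier in $x$ with symbol $e^{-\sigma(t-s)\sqrt{|k|}}$, $k\in\mathbb{Z}$. $\mathcal{L}(X,Y)$ denotes bounded linear operators from $X$ to $Y$ with operator norm; the norm is $+\infty$ when the operator does not define a bounded operator from $X$ to $Y$. *)

theory Defs
  imports "HOL-Probability.Essential_Supremum"
begin

section \<open>Weighted Sobolev spaces on the half-line\<close>

definition halfline :: "real measure" where
  "halfline = restrict_space lborel {0<..}"

definition Linf_norm :: "(real \<Rightarrow> 'a::real_normed_vector) \<Rightarrow> ennreal" where
  "Linf_norm f = esssup halfline (\<lambda>y. ennreal (norm (f y)))"

text \<open>Test functions: smooth, with compact support in the open half-line.\<close>

definition test_function :: "(real \<Rightarrow> real) \<Rightarrow> bool" where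
  "test_function \<phi> \<longleftrightarrow>
     (\<forall>n. (deriv ^^ n) \<phi> differentiable_on UNIV) \<and>
     (\<exists>a b. 0 < a \<and> (\<forall>y. y \<notin> {a..b} \<longrightarrow> \<phi> y = 0))"

definition weak_derivative ::
    "(real \<Rightarrow> 'a::{banach, second_countable_topology}) \<Rightarrow> (real \<Rightarrow> 'a) \<Rightarrow> bool" where
  "weak_derivative f g \<longleftrightarrow>
     (\<forall>\<phi>. test_function \<phi> \<longrightarrow>
        (LINT y|halfline. deriv \<phi> y *\<^sub>R f y) = - (LINT y|halfline. \<phi> y *\<^sub>R g y))"

text \<open>
  The extended norm \<open>\<parallel>e\<^bsup>\<alpha>y\<^esup> f\<parallel>\<close> in \<open>W\<^bsup>m,\<infinity>\<^esup>\<close> of the half-line; it is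
  \<open>\<infinity>\<close> if \<open>f\<close> is not in the space. The \<open>g j\<close> are the successive weak derivatives of
  \<open>e\<^bsup>\<alpha>y\<^esup> f\<close>; they are unique up to null sets whenever the sum is finite, so the infimum
  only serves to return \<open>\<infinity>\<close> when they do not exist.
\<close>

definition W_norm ::
    "real \<Rightarrow> nat \<Rightarrow> (real \<Rightarrow> 'a::{banach, second_countable_topology}) \<Rightarrow> ennreal" where
  "W_norm \<alpha> m f =
     (INF g \<in> {g :: nat \<Rightarrow> real \<Rightarrow> 'a.
                 (\<forall>y>0. g 0 y = exp (\<alpha> * y) *\<^sub>R f y) \<and>
                 (\<forall>j\<le>m. g j \<in> borel_measurable halfline) \<and>
                 (\<forall>j<m. weak_derivative (g j) (g (Suc j)))}.
        \<Sum>j\<le>m. Linf_norm (g j))"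

text \<open>\<open>w \<in> C\<^sup>0(\<real>\<^sup>+; W\<^sub>\<alpha>\<^bsup>m,\<infinity>\<^esup>)\<close> and \<open>w \<in> C\<^sup>1(\<real>\<^sup>+; W\<^sub>\<alpha>\<^bsup>m,\<infinity>\<^esup>)\<close>, the initial time included.\<close>

definition C0_W ::
    "real \<Rightarrow> nat \<Rightarrow> (real \<Rightarrow> real \<Rightarrow> 'a::{banach, second_countable_topology}) \<Rightarrow> bool" where
  "C0_W \<alpha> m w \<longleftrightarrow>
     (\<forall>t\<ge>0. W_norm \<alpha> m (w t) < \<infinity> \<and>
       ((\<lambda>\<tau>. W_norm \<alpha> m (\<lambda>y. w \<tau> y - w t y)) \<longlongrightarrow> 0) (at t within {0..}))"

definition C1_W ::
    "real \<Rightarrow> nat \<Rightarrow> (real \<Rightarrow> real \<Rightarrow> 'a::{banach, second_countable_topology}) \<Rightarrow> bool" where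
  "C1_W \<alpha> m w \<longleftrightarrow>
     C0_W \<alpha> m w \<and>
     (\<exists>w'. C0_W \<alpha> m w' \<and>
       (\<forall>t\<ge>0. ((\<lambda>\<tau>. W_norm \<alpha> m (\<lambda>y. (w \<tau> y - w t y) /\<^sub>R (\<tau> - t) - w' t y)) \<longlongrightarrow> 0)
                (at t within {0..})))"


section \<open>Functions on the torus times the half-line\<close>

text \<open>
  Functions on the torus are \<open>2\<pi>\<close>-periodic functions on the real line; functions of
  \<open>(x, y)\<close> are complex-valued.
\<close>

definition fourier_coeff :: "(real \<Rightarrow> real \<Rightarrow> complex) \<Rightarrow> int \<Rightarrow> real \<Rightarrow> complex" where
  "fourier_coeff f k y =
     (LINT x:{0..2*pi}|lborel. cis (- (of_int k * x)) * f x y) / of_real (2 * pi)"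

definition fourier_multiplier ::
    "(int \<Rightarrow> complex) \<Rightarrow> (real \<Rightarrow> real \<Rightarrow> complex) \<Rightarrow> real \<Rightarrow> real \<Rightarrow> complex" where
  "fourier_multiplier p f x y =
     (\<Sum>\<^sub>\<infinity>k\<in>UNIV. p k * fourier_coeff f k y * cis (of_int k * x))"

definition ennreal_sqrt :: "ennreal \<Rightarrow> ennreal" where
  "ennreal_sqrt c = (if c = \<infinity> then \<infinity> else ennreal (sqrt (enn2real c)))"

text \<open>The norm of \<open>L\<^sup>2(\<T>; W\<^sub>\<alpha>\<^bsup>0,\<infinity>\<^esup>)\<close>.\<close>

definition L2_W_norm :: "real \<Rightarrow> (real \<Rightarrow> real \<Rightarrow> complex) \<Rightarrow> ennreal" where
  "L2_W_norm \<alpha> g =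
     ennreal_sqrt (\<integral>\<^sup>+x\<in>{0..2*pi}. (W_norm \<alpha> 0 (g x))\<^sup>2 \<partial>lborel)"

text \<open>
  The extended norm of \<open>H\<^sup>r(\<T>; W\<^sub>\<alpha>\<^bsup>0,\<infinity>\<^esup>)\<close> for a real order \<open>r\<close> of either
  sign, i.e. \<open>\<parallel>(1 - \<partial>\<^sub>x\<^sup>2)\<^bsup>r/2\<^esup> f\<parallel>\<close> in \<open>L\<^sup>2(\<T>; W\<^sub>\<alpha>\<^bsup>0,\<infinity>\<^esup>)\<close>.
  The function \<open>g\<close> below is \<open>(1 - \<partial>\<^sub>x\<^sup>2)\<^bsup>r/2\<^esup> f\<close>: among the functions with finite
  norm it is determined up to null sets by its Fourier coefficients. The Fourier series of
  \<open>g\<close> need not converge pointwise when \<open>r > 0\<close>, so \<open>fourier_multiplier\<close> is not used.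
\<close>

definition H_norm :: "real \<Rightarrow> real \<Rightarrow> (real \<Rightarrow> real \<Rightarrow> complex) \<Rightarrow> ennreal" where
  "H_norm \<alpha> r f =
     (INF g \<in> {g :: real \<Rightarrow> real \<Rightarrow> complex.
                 (AE y in halfline. set_integrable lborel {0..2*pi} (\<lambda>x. f x y)) \<and>
                 (\<lambda>(x, y). g x y) \<in> borel_measurable borel \<and>
                 (\<forall>k. AE y in halfline.
                    fourier_coeff g k y =
                      of_real ((1 + (of_int k)\<^sup>2) powr (r / 2)) * fourier_coeff f k y)}.
        L2_W_norm \<alpha> g)"


section \<open>The shear flow\<close>

text \<open>
  \<open>D i j\<close> is the mixed partial derivative of order \<open>i\<close> in \<open>t\<close> and \<open>j\<close> in \<open>y\<close>.
\<close>

definition smooth_quadrant :: "(real \<Rightarrow> real \<Rightarrow> real) \<Rightarrow> bool" where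
  "smooth_quadrant u \<longleftrightarrow>
     (\<exists>D :: nat \<Rightarrow> nat \<Rightarrow> real \<Rightarrow> real \<Rightarrow> real.
        (\<forall>t>0. \<forall>y>0. D 0 0 t y = u t y) \<and>
        (\<forall>i j. continuous_on ({0<..} \<times> {0<..}) (\<lambda>(t, y). D i j t y)) \<and>
        (\<forall>i j. \<forall>t>0. \<forall>y>0.
           ((\<lambda>\<tau>. D i j \<tau> y) has_real_derivative D (Suc i) j t y) (at t) \<and>
           ((\<lambda>z. D i j t z) has_real_derivative D i (Suc j) t y) (at y)))"

text \<open>
  Continuity up to the boundary of the quadrant makes the boundary and initial values
  traces of the solution, and selects the continuous representative of each \<open>us t\<close>.
\<close>

definition heat_solution ::
    "real \<Rightarrow> (real \<Rightarrow> real) \<Rightarrow> (real \<Rightarrow> real \<Rightarrow> real) \<Rightarrow> bool" where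
  "heat_solution U0 Us us \<longleftrightarrow>
     smooth_quadrant us \<and>
     continuous_on ({0..} \<times> {0..}) (\<lambda>(t, y). us t y) \<and>
     (\<forall>t>0. \<forall>y>0. deriv (\<lambda>\<tau>. us \<tau> y) t - deriv (deriv (us t)) y = 0) \<and>
     (\<forall>t\<ge>0. us t 0 = 0) \<and>
     (\<forall>t\<ge>0. (us t \<longlongrightarrow> U0) at_top) \<and>
     (\<forall>y\<ge>0. us 0 y = Us y)"

definition nondegenerate_critical_point :: "(real \<Rightarrow> real) \<Rightarrow> real \<Rightarrow> bool" where
  "nondegenerate_critical_point U a \<longleftrightarrow>
     (U has_real_derivative 0) (at a) \<and>
     (\<exists>d. d \<noteq> 0 \<and> (deriv U has_real_derivative d) (at a))"


section \<open>The linearized Prandtl equations\<close>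

text \<open>
  Bounded classical solutions on the time interval \<open>[s, T]\<close>: the equations hold on
  \<open>(s, T] \<times> \<T> \<times> (0, \<infinity>)\<close>, and \<open>u\<close> is continuous up to \<open>t = s\<close> and \<open>y = 0\<close>.
  Boundedness excludes spurious solutions of Tychonoff type. The conditions
  \<open>\<partial>\<^sub>x u + \<partial>\<^sub>y v = 0\<close> and \<open>v|\<^bsub>y=0\<^esub> = 0\<close> give \<open>v = -\<integral>\<^sub>0\<^sup>y \<partial>\<^sub>x u dz\<close>.
\<close>

definition linearized_prandtl ::
    "(real \<Rightarrow> real \<Rightarrow> real) \<Rightarrow> real \<Rightarrow> real \<Rightarrow>
     (real \<Rightarrow> real \<Rightarrow> real \<Rightarrow> complex) \<Rightarrow> (real \<Rightarrow> real \<Rightarrow> real \<Rightarrow> complex) \<Rightarrow> bool" where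
  "linearized_prandtl us s T u v \<longleftrightarrow>
     (\<forall>t\<in>{s..T}. \<forall>x. \<forall>y\<ge>0. u t (x + 2 * pi) y = u t x y) \<and>
     (\<forall>t\<in>{s<..T}. \<forall>x. \<forall>y\<ge>0. v t (x + 2 * pi) y = v t x y) \<and>
     continuous_on ({s..T} \<times> UNIV \<times> {0..}) (\<lambda>(t, x, y). u t x y) \<and>
     continuous_on ({s<..T} \<times> UNIV \<times> {0..}) (\<lambda>(t, x, y). v t x y) \<and>
     (\<exists>B. \<forall>t\<in>{s..T}. \<forall>x. \<forall>y\<ge>0. norm (u t x y) \<le> B) \<and>
     (\<exists>ut ux uy uyy.
        continuous_on ({s<..T} \<times> UNIV \<times> {0<..}) (\<lambda>(t, x, y). ut t x y) \<and>
        continuous_on ({s<..T} \<times> UNIV \<times> {0<..}) (\<lambda>(t, x, y). ux t x y) \<and>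
        continuous_on ({s<..T} \<times> UNIV \<times> {0<..}) (\<lambda>(t, x, y). uy t x y) \<and>
        continuous_on ({s<..T} \<times> UNIV \<times> {0<..}) (\<lambda>(t, x, y). uyy t x y) \<and>
        (\<forall>t\<in>{s<..T}. \<forall>x. \<forall>y>0.
           ((\<lambda>\<tau>. u \<tau> x y) has_vector_derivative ut t x y) (at t within {s..T}) \<and>
           ((\<lambda>\<xi>. u t \<xi> y) has_vector_derivative ux t x y) (at x) \<and>
           ((\<lambda>z. u t x z) has_vector_derivative uy t x y) (at y) \<and>
           ((\<lambda>z. uy t x z) has_vector_derivative uyy t x y) (at y) \<and>
           ((\<lambda>z. v t x z) has_vector_derivative - ux t x y) (at y) \<and>
           ut t x y + of_real (us t y) * ux t x y + v t x y * of_real (deriv (us t) y)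
             - uyy t x y = 0)) \<and>
     (\<forall>t\<in>{s<..T}. \<forall>x. u t x 0 = 0 \<and> v t x 0 = 0) \<and>
     (\<forall>t\<in>{s<..T}. \<forall>x. ((\<lambda>y. u t x y) \<longlongrightarrow> 0) at_top)"

text \<open>
  The graph of the solution operator \<open>T(t,s)\<close>, i.e. \<open>w = T(t,s) u0\<close>. Under the assumptions on
  the shear flow, bounded classical solutions are determined by their initial data.
\<close>

definition solution_operator ::
    "(real \<Rightarrow> real \<Rightarrow> real) \<Rightarrow> real \<Rightarrow> real \<Rightarrow>
     (real \<Rightarrow> real \<Rightarrow> complex) \<Rightarrow> (real \<Rightarrow> real \<Rightarrow> complex) \<Rightarrow> bool" where
  "solution_operator us t s u0 w \<longleftrightarrow>
     (\<exists>u v. linearized_prandtl us s t u v \<and> u s = u0 \<and> u t = w)"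

text \<open>The graph of \<open>e\<^bsup>-\<sigma>(t-s)\<surd>|\<partial>\<^sub>x|\<^esup> T(t,s)\<close>.\<close>

definition regularized_solution_operator ::
    "(real \<Rightarrow> real \<Rightarrow> real) \<Rightarrow> real \<Rightarrow> real \<Rightarrow> real \<Rightarrow>
     (real \<Rightarrow> real \<Rightarrow> complex) \<Rightarrow> (real \<Rightarrow> real \<Rightarrow> complex) \<Rightarrow> bool" where
  "regularized_solution_operator us \<sigma> t s u0 w \<longleftrightarrow>
     (\<exists>w'. solution_operator us t s u0 w' \<and>
       w = fourier_multiplier
             (\<lambda>k. of_real (exp (- \<sigma> * (t - s) * sqrt \<bar>of_int k\<bar>))) w')"

text \<open>
  The operator norm, from the space with extended norm \<open>NX\<close> to the one with extended norm
  \<open>NY\<close>, of the operator with graph \<open>R\<close>. It is \<open>\<infinity>\<close> if no bound holds, in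
  particular if some element of the first space is mapped outside the second one. The
  operator need not be given on all of the first space.
\<close>

definition operator_norm ::
    "('a \<Rightarrow> ennreal) \<Rightarrow> ('b \<Rightarrow> ennreal) \<Rightarrow> ('a \<Rightarrow> 'b \<Rightarrow> bool) \<Rightarrow> ennreal" where
  "operator_norm NX NY R =
     (INF C \<in> {C :: real. 0 \<le> C \<and>
                 (\<forall>f h. NX f < \<infinity> \<and> R f h \<longrightarrow> NY h \<le> ennreal C * NX f)}.
        ennreal C)"

end

theory Submission
  imports Defs "HOL-Probability.Probability" "HOL-Real_Asymp.Real_Asymp"
begin

text \<open>
  At a small time \<open>t0\<close> the shear flow still has a non-degenerate critical point \<open>a0\<close>. For the
  Fourier mode \<open>k = N\<^sup>2\<close> the adjoint of the linearized equation has, near \<open>a0\<close>, an approximate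
  solution \<open>test\<close> that decays like \<open>exp (- Re rate * N * (t - t0))\<close> and concentrates at the scale
  \<open>N\<^bsup>-1/2\<^esup>\<close>; it is an explicit Gaussian-like profile in the variable \<open>\<partial>\<^sub>yu\<^sub>s\<close>. Pairing it with the
  solution whose initial datum is its localized complex conjugate gives a functional that is almost
  constant in time, of size at least of the order of \<open>N\<^bsup>1/2\<^esup>\<close>. If the operator norms were bounded for some
  \<open>\<sigma> \<le> Re rate / 2\<close>, the solution would be at most \<open>N\<^bsup>2\<mu>\<^esup> exp (\<sigma> N (t - t0))\<close>, so that after the
  time \<open>N\<^bsup>-1/2\<^esup>\<close> the pairing would be exponentially small, and its total variation would be
  of the order of \<open>N\<^bsup>2\<mu> - 1/2\<^esup>\<close>, less than its initial size as \<open>\<mu> < 1/2\<close>. The mode itself is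
  constructed by a Dyson series for the equation on the half-line, the nonlocal term being
  localized by a corrector.
\<close>

section \<open>Gaussian averages and the heat equation\<close>

text \<open>Only the dual profile is approximate. An approximate growing solution would have to be
  corrected by the evolution itself, whose size is the unknown; an exact solution tested against an
  explicit profile needs only the bound that is to be refuted. The nonlocal adjoint term becomes
  local when \<open>\<partial>\<^sub>yu\<^sub>s\<close> times the profile is a total derivative. In
  the statement \<open>\<sigma>\<close> precedes \<open>\<delta>\<close>, so the critical points at
  times tending to 0 must have second derivatives bounded below by one \<open>d\<close>. Time 0
  itself is avoided because only four bounded derivatives are known there, while at positive times
  the flow can be expanded to any order. The window is a compromise: the critical point drifts by a
  distance of order \<open>t - t0\<close>, so a profile centred at the fixed \<open>a0\<close> is
  accurate only while \<open>N * (t - t0)^2\<close> stays bounded, whereas the gain needs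
  \<open>N * (t - t0)\<close> large. The solution operator is a graph, and a bound on its norm
  concerns only data that have a solution; hence the existence proof for the chosen mode.\<close>

abbreviation gauss :: "real measure" where "gauss \<equiv> std_normal_distribution"

lemma prob_space_gauss: "prob_space gauss"
  using real_dist_normal_dist real_distribution_def by blast

lemma has_vector_derivative_iff_quotient:
  "(f has_vector_derivative D) (at x within S) \<longleftrightarrow>
     ((\<lambda>y. (f y - f x) /\<^sub>R (y - x)) \<longlongrightarrow> D) (at x within S)"
proof -
  have "norm ((f y - f x - (y - x) *\<^sub>R D) /\<^sub>R norm (y - x)) = norm ((f y - f x) /\<^sub>R (y - x) - D)"
    if "y \<noteq> x" for y
  proof -
    have "(f y - f x) /\<^sub>R (y - x) - D = (f y - f x - (y - x) *\<^sub>R D) /\<^sub>R (y - x)"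
      using that by (simp add: scaleR_diff_right)
    then show ?thesis by simp
  qed
  then have "((\<lambda>y. norm ((f y - (f x + (y - x) *\<^sub>R D)) /\<^sub>R norm (y - x))) \<longlongrightarrow> 0) (at x within S) \<longleftrightarrow>
      ((\<lambda>y. norm ((f y - f x) /\<^sub>R (y - x) - D)) \<longlongrightarrow> 0) (at x within S)"
    by (intro filterlim_cong refl) (auto simp: eventually_at_filter diff_diff_eq[symmetric])
  then show ?thesis
    using Lim_null[of "\<lambda>y. (f y - f x) /\<^sub>R (y - x)" D "at x within S"]
      bounded_linear_scaleR_left[of D]
      tendsto_norm_zero_iff[of "\<lambda>y. (f y - f x) /\<^sub>R (y - x) - D" "at x within S"]
      tendsto_norm_zero_iff[of "\<lambda>y. (f y - (f x + (y - x) *\<^sub>R D)) /\<^sub>R norm (y - x)" "at x within S"]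
    unfolding has_vector_derivative_def has_derivative_within divide_inverse mult_1_left by argo
qed

text \<open>A Lipschitz bound based at the single point \<open>x0\<close> dominates the difference
  quotients, so differentiability is asked for only almost everywhere. The point where a reflected
  profile has a kink is thereby covered.\<close>

lemma has_vector_derivative_integral:
  fixes h :: "real \<Rightarrow> 'a \<Rightarrow> 'b::{banach, second_countable_topology}"
  assumes int: "\<And>x. x \<in> S \<Longrightarrow> integrable M (h x)" and x0: "x0 \<in> S"
    and lip: "\<And>x \<omega>. x \<in> S \<Longrightarrow> \<omega> \<in> space M \<Longrightarrow> norm (h x \<omega> - h x0 \<omega>) \<le> g \<omega> * \<bar>x - x0\<bar>"
    and g: "integrable M g"
    and der: "AE \<omega> in M. ((\<lambda>x. h x \<omega>) has_vector_derivative h' \<omega>) (at x0 within S)"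
    and h': "h' \<in> borel_measurable M"
  shows "((\<lambda>x. \<integral>\<omega>. h x \<omega> \<partial>M) has_vector_derivative (\<integral>\<omega>. h' \<omega> \<partial>M)) (at x0 within S)"
  unfolding has_vector_derivative_iff_quotient tendsto_at_iff_sequentially
proof (intro allI impI)
  fix X assume X: "\<forall>i. X i \<in> S - {x0}" "X \<longlonglongrightarrow> x0"
  have "(\<lambda>i. \<integral>\<omega>. (h (X i) \<omega> - h x0 \<omega>) /\<^sub>R (X i - x0) \<partial>M) \<longlonglongrightarrow> (\<integral>\<omega>. h' \<omega> \<partial>M)"
  proof (rule integral_dominated_convergence[where w = g])
    show "h' \<in> borel_measurable M" "integrable M g" by fact+
    show "(\<lambda>\<omega>. (h (X i) \<omega> - h x0 \<omega>) /\<^sub>R (X i - x0)) \<in> borel_measurable M" for i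
      using int[of "X i"] int[OF x0] X by auto
    show "AE \<omega> in M. (\<lambda>i. (h (X i) \<omega> - h x0 \<omega>) /\<^sub>R (X i - x0)) \<longlonglongrightarrow> h' \<omega>"
      using der
    proof eventually_elim
      case (elim \<omega>)
      then show ?case
        unfolding has_vector_derivative_iff_quotient tendsto_at_iff_sequentially
        using X by (auto simp: o_def)
    qed
    show "AE \<omega> in M. norm ((h (X i) \<omega> - h x0 \<omega>) /\<^sub>R (X i - x0)) \<le> g \<omega>" for i
    proof (rule AE_I2)
      fix \<omega> assume "\<omega> \<in> space M"
      then show "norm ((h (X i) \<omega> - h x0 \<omega>) /\<^sub>R (X i - x0)) \<le> g \<omega>"
        using lip[of "X i" \<omega>] X by (auto simp: divide_simps)
    qed
  qed
  moreover have "(\<integral>\<omega>. (h (X i) \<omega> - h x0 \<omega>) /\<^sub>R (X i - x0) \<partial>M) =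
     ((\<integral>\<omega>. h (X i) \<omega> \<partial>M) - (\<integral>\<omega>. h x0 \<omega> \<partial>M)) /\<^sub>R (X i - x0)" for i
    using int[of "X i"] int[OF x0] X by (simp add: Bochner_Integration.integral_diff)
  ultimately have "(\<lambda>i. ((\<integral>\<omega>. h (X i) \<omega> \<partial>M) - (\<integral>\<omega>. h x0 \<omega> \<partial>M)) /\<^sub>R (X i - x0))
      \<longlonglongrightarrow> (\<integral>\<omega>. h' \<omega> \<partial>M)"
    by (simp only:)
  then show "((\<lambda>y. ((\<integral>\<omega>. h y \<omega> \<partial>M) - (\<integral>\<omega>. h x0 \<omega> \<partial>M)) /\<^sub>R (y - x0)) \<circ> X) \<longlonglongrightarrow> (\<integral>\<omega>. h' \<omega> \<partial>M)"
    by (simp only: o_def)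
qed

lemma integrable_gauss_abs: "integrable gauss (\<lambda>z. \<bar>z\<bar>)"
  using integrable_std_normal_moment_abs[of 1]
  by (subst integrable_density) (auto simp: ac_simps)

text \<open>The derivative of the density is \<open>- z\<close> times the density, so the difference
  of the two integrands is the exact derivative of density times \<open>g\<close>, whose boundary
  terms on \<open>{- n..n}\<close> tend to 0. The point \<open>p\<close> allows for a kink of
  \<open>g\<close>.\<close>

lemma gauss_integration_by_parts:
  fixes g g' :: "real \<Rightarrow> complex"
  assumes cont: "continuous_on UNIV g"
    and der: "\<And>z. z \<noteq> p \<Longrightarrow> (g has_vector_derivative g' z) (at z)"
    and bg: "\<And>z. norm (g z) \<le> K" and bg': "\<And>z. norm (g' z) \<le> K'"
    and m: "g' \<in> borel_measurable borel"
  shows "(LINT z|gauss. g' z) = (LINT z|gauss. z *\<^sub>R g z)"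
proof -
  let ?d = "std_normal_density"
  define f where "f z = ?d z *\<^sub>R g' z - (z * ?d z) *\<^sub>R g z" for z
  have mg: "g \<in> borel_measurable borel" using cont by (rule borel_measurable_continuous_onI)
  have i1: "integrable lborel (\<lambda>z. ?d z *\<^sub>R g' z)"
  proof (rule Bochner_Integration.integrable_bound[where f="\<lambda>z. K' * (?d z * \<bar>z\<bar> ^ 0)"])
    show "integrable lborel (\<lambda>z. K' * (?d z * \<bar>z\<bar>^0))"
      by (intro integrable_mult_right integrable_std_normal_moment_abs)
    have "K' \<ge> 0" using bg'[of 0] norm_ge_zero order_trans by blast
    then show "AE x in lborel. norm (?d x *\<^sub>R g' x) \<le> norm (K' * (?d x * \<bar>x\<bar> ^ 0))"
      using bg' by (auto simp: abs_mult mult.commute intro!: mult_right_mono)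
  qed (use m in measurable)
  have i2: "integrable lborel (\<lambda>z. (z * ?d z) *\<^sub>R g z)"
  proof (rule Bochner_Integration.integrable_bound[where f="\<lambda>z. K * (?d z * \<bar>z\<bar> ^ 1)"])
    show "integrable lborel (\<lambda>z. K * (?d z * \<bar>z\<bar>^1))"
      by (intro integrable_mult_right integrable_std_normal_moment_abs)
    have K: "K \<ge> 0" using bg[of 0] norm_ge_zero order_trans by blast
    show "AE x in lborel. norm ((x * ?d x) *\<^sub>R g x) \<le> norm (K * (?d x * \<bar>x\<bar> ^ 1))"
    proof (rule AE_I2)
      fix x
      have "norm ((x * ?d x) *\<^sub>R g x) = (\<bar>x\<bar> * ?d x) * norm (g x)" by (simp add: abs_mult)
      also have "\<dots> \<le> (\<bar>x\<bar> * ?d x) * K" using bg by (intro mult_left_mono) auto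
      also have "\<dots> = norm (K * (?d x * \<bar>x\<bar> ^ 1))" using K by (simp add: abs_mult)
      finally show "norm ((x * ?d x) *\<^sub>R g x) \<le> norm (K * (?d x * \<bar>x\<bar> ^ 1))" .
    qed
  qed (use mg in measurable)
  have intf: "integrable lborel f" unfolding f_def by (intro Bochner_Integration.integrable_diff i1 i2)
  define F where "F z = ?d z *\<^sub>R g z" for z
  have dd: "(?d has_real_derivative - (z * ?d z)) (at z)" for z
    unfolding std_normal_density_def
    by (auto intro!: derivative_eq_intros simp: field_simps)
  have cd: "continuous_on A ?d" for A
    by (meson DERIV_continuous continuous_at_imp_continuous_on dd)
  have Fd: "(F has_vector_derivative f z) (at z)" if "z \<noteq> p" for z
  proof -
    have "((\<lambda>z. ?d z *\<^sub>R g z) has_vector_derivative (?d z *\<^sub>R g' z + (- (z * ?d z)) *\<^sub>R g z)) (at z)"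
      by (rule has_vector_derivative_scaleR[OF dd der[OF that]])
    then show ?thesis by (simp add: F_def[abs_def] f_def)
  qed
  have FTC: "(LINT z|lborel. indicator {- real n..real n} z *\<^sub>R f z) = F n - F (- real n)" for n
  proof -
    have "(f has_integral F n - F (- real n)) {- real n..real n}"
    proof (rule fundamental_theorem_of_calculus_interior_strong[of "{p}"])
      show "continuous_on {- real n..real n} F" unfolding F_def
        by (intro continuous_intros cd continuous_on_subset[OF cont]) auto
    qed (auto intro: Fd)
    moreover have "set_integrable lborel {- real n..real n} f"
      using intf unfolding set_integrable_def by (intro integrable_mult_indicator) auto
    ultimately show ?thesis
      using set_borel_integral_eq_integral(2)[of "{- real n..real n}" f]
      by (simp add: set_lebesgue_integral_def integral_unique)
  qed
  have "(\<lambda>n. LINT z|lborel. indicator {- real n..real n} z *\<^sub>R f z) \<longlonglongrightarrow> (LINT z|lborel. f z)"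
  proof (rule integral_dominated_convergence[where w="\<lambda>z. norm (f z)"])
    show "AE x in lborel. (\<lambda>i. indicator {- real i..real i} x *\<^sub>R f x) \<longlonglongrightarrow> f x"
    proof (rule AE_I2)
      fix x
      obtain N where N: "\<bar>x\<bar> \<le> real N" using real_arch_simple by blast
      show "(\<lambda>i. indicator {- real i..real i} x *\<^sub>R f x) \<longlonglongrightarrow> f x"
        by (rule tendsto_eventually, rule eventually_sequentiallyI[of N]) (use N in \<open>auto simp: indicator_def\<close>)
    qed
  qed (use intf in \<open>auto simp: indicator_def\<close>)
  moreover have "(\<lambda>n. F (real n) - F (- real n)) \<longlonglongrightarrow> 0 - 0"
  proof (rule tendsto_diff)
    have d0: "(\<lambda>n. ?d (real n) * K) \<longlonglongrightarrow> 0"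
      unfolding std_normal_density_def by real_asymp
    have sym: "?d (- x) = ?d x" for x by (simp add: std_normal_density_def)
    show "(\<lambda>n. F (real n)) \<longlonglongrightarrow> 0"
      by (rule Lim_null_comparison[OF _ d0]) (auto simp: F_def intro!: mult_left_mono bg always_eventually)
    show "(\<lambda>n. F (- real n)) \<longlonglongrightarrow> 0"
      by (rule Lim_null_comparison[OF _ d0]) (auto simp: F_def sym intro!: mult_left_mono bg always_eventually)
  qed
  ultimately have "(LINT z|lborel. f z) = 0" using LIMSEQ_unique FTC by fastforce
  then have "(LINT z|lborel. ?d z *\<^sub>R g' z) = (LINT z|lborel. (z * ?d z) *\<^sub>R g z)"
    unfolding f_def using i1 i2 by (simp add: Bochner_Integration.integral_diff)
  then show ?thesis
    using m mg by (simp add: integral_density mult.commute)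
qed

text \<open>The heat semigroup at time \<open>r\<close>, written as the mean over a Gaussian
  displacement of variance \<open>2 * r\<close>. Integrating over one fixed measure reduces
  regularity in \<open>r\<close> and \<open>y\<close> to dominated convergence and includes time
  0.\<close>

definition heat :: "(real \<Rightarrow> complex) \<Rightarrow> real \<Rightarrow> real \<Rightarrow> complex" where
  "heat g r y = (LINT z|gauss. g (y + sqrt (2 * r) * z))"

lemma lipschitz_except_origin:
  fixes f f' :: "real \<Rightarrow> complex"
  assumes cont: "continuous_on UNIV f"
    and der: "\<And>x. x \<noteq> 0 \<Longrightarrow> (f has_vector_derivative f' x) (at x)"
    and b: "\<And>x. norm (f' x) \<le> K"
  shows "norm (f x - f y) \<le> K * \<bar>x - y\<bar>"
proof -
  have *: "norm (f b - f a) \<le> K * (b - a)" if "a < b" "0 \<notin> {a<..<b}" for a b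
  proof -
    have "norm (f b - f a) \<le> K * b - K * a"
      by (rule differentiable_bound_general[where f'=f' and \<phi>'="\<lambda>_. K"])
        (use that cont in \<open>auto intro!: continuous_intros der b derivative_eq_intros
           simp: has_real_derivative_iff_has_vector_derivative[symmetric] intro: continuous_on_subset\<close>)
    then show ?thesis by (simp add: right_diff_distrib)
  qed
  have **: "norm (f b - f a) \<le> K * (b - a)" if "a < b" for a b
  proof (cases "0 \<in> {a<..<b}")
    case True
    have "norm (f b - f a) \<le> norm (f b - f 0) + norm (f 0 - f a)"
      using norm_triangle_ineq[of "f b - f 0" "f 0 - f a"] by simp
    also have "\<dots> \<le> K * (b - 0) + K * (0 - a)" using True by (intro add_mono *) auto
    finally show ?thesis by (simp add: algebra_simps)
  qed (use that * in auto)
  consider "x < y" | "x = y" | "x > y" by linarith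
  then show ?thesis
    by cases (use **[of x y] **[of y x] in \<open>auto simp: norm_minus_commute\<close>)
qed

lemma integrable_gauss_bounded:
  fixes g :: "real \<Rightarrow> complex"
  assumes "g \<in> borel_measurable borel" "\<And>z. norm (g z) \<le> K"
  shows "integrable gauss g"
proof -
  interpret prob_space gauss by (rule prob_space_gauss)
  show ?thesis
    by (rule integrable_const_bound[of _ K]) (use assms in \<open>auto\<close>)
qed

lemma AE_gauss_I: "countable A \<Longrightarrow> (\<And>z. z \<notin> A \<Longrightarrow> P z) \<Longrightarrow> AE z in gauss. P z"
proof -
  assume A: "countable A" "\<And>z. z \<notin> A \<Longrightarrow> P z"
  have "AE z in lborel. z \<notin> A" using A(1) by (metis AE_not_in countable_imp_null_set_lborel)
  then have "AE z in lborel. P z" by eventually_elim (use A in auto)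
  then show ?thesis by (subst AE_density) auto
qed

lemma heat_0 [simp]: "heat g 0 y = g y"
proof -
  interpret prob_space gauss by (rule prob_space_gauss)
  show ?thesis using prob_space by (simp add: heat_def)
qed

text \<open>Convergence of the data is asked for away from one point \<open>p\<close>, where
  reflected profiles may jump. The Gaussian argument meets \<open>p\<close> with probability 0 if
  \<open>r0 > 0\<close>, and never if \<open>r0 = 0\<close> and
  \<open>y0 \<noteq> p\<close>.\<close>

lemma heat_tendsto:
  fixes g :: "nat \<Rightarrow> real \<Rightarrow> complex"
  assumes m: "\<And>n. g n \<in> borel_measurable borel" and m': "g' \<in> borel_measurable borel"
    and b: "\<And>n x. norm (g n x) \<le> K"
    and r: "r \<longlonglongrightarrow> r0" and y: "y \<longlonglongrightarrow> y0" and r0: "r0 > 0 \<or> (r0 = 0 \<and> y0 \<noteq> p)"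
    and lim: "\<And>x xs. x \<noteq> p \<Longrightarrow> xs \<longlonglongrightarrow> x \<Longrightarrow> (\<lambda>n. g n (xs n)) \<longlonglongrightarrow> g' x"
  shows "(\<lambda>n. heat (g n) (r n) (y n)) \<longlonglongrightarrow> heat g' r0 y0"
  unfolding heat_def
proof (rule integral_dominated_convergence[where w = "\<lambda>_. K"])
  interpret prob_space gauss by (rule prob_space_gauss)
  show "integrable gauss (\<lambda>_. K)" by simp
  show "(\<lambda>z. g' (y0 + sqrt (2 * r0) * z)) \<in> borel_measurable gauss" using m' by measurable
  show "(\<lambda>z. g n (y n + sqrt (2 * r n) * z)) \<in> borel_measurable gauss" for n using m[of n] by measurable
  show "AE z in gauss. norm (g n (y n + sqrt (2 * r n) * z)) \<le> K" for n using b by simp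
  \<comment> \<open>The excluded value solves \<open>y0 + sqrt (2 * r0) * z = p\<close>. For
    \<open>r0 = 0\<close> it is 0 because of division by 0, and there \<open>y0 \<noteq> p\<close>
    does the work.\<close>
  show "AE z in gauss. (\<lambda>n. g n (y n + sqrt (2 * r n) * z)) \<longlonglongrightarrow> g' (y0 + sqrt (2 * r0) * z)"
  proof (rule AE_gauss_I[of "{(p - y0) / sqrt (2 * r0)}"])
    fix z assume z: "z \<notin> {(p - y0) / sqrt (2 * r0)}"
    show "(\<lambda>n. g n (y n + sqrt (2 * r n) * z)) \<longlonglongrightarrow> g' (y0 + sqrt (2 * r0) * z)"
    proof (rule lim)
      show "y0 + sqrt (2 * r0) * z \<noteq> p" using r0 z by (auto simp: field_simps)
    qed (intro tendsto_intros y r)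
  qed simp
qed

lemma heat_has_space_derivative:
  fixes f f' :: "real \<Rightarrow> complex"
  assumes cont: "continuous_on UNIV f"
    and der: "\<And>x. x \<noteq> 0 \<Longrightarrow> (f has_vector_derivative f' x) (at x)"
    and b: "\<And>x. norm (f x) \<le> K" "\<And>x. norm (f' x) \<le> K'"
    and m: "f' \<in> borel_measurable borel"
    and r: "r > 0 \<or> (r = 0 \<and> y \<noteq> 0)"
  shows "((\<lambda>y. heat f r y) has_vector_derivative heat f' r y) (at y)"
  unfolding heat_def
proof (rule has_vector_derivative_integral[where g = "\<lambda>_. K'"])
  interpret prob_space gauss by (rule prob_space_gauss)
  show "integrable gauss (\<lambda>_. K')" by simp
  have mf: "f \<in> borel_measurable borel" using cont by (rule borel_measurable_continuous_onI)
  show "integrable gauss (\<lambda>z. f (x + sqrt (2 * r) * z))" for x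
    by (rule integrable_gauss_bounded[of _ K]) (use mf b in \<open>auto intro: measurable_compose[rotated]\<close>)
  show "norm (f (x + sqrt (2 * r) * \<omega>) - f (y + sqrt (2 * r) * \<omega>)) \<le> K' * \<bar>x - y\<bar>" for x \<omega>
    using lipschitz_except_origin[OF cont der b(2), of "x + sqrt (2 * r) * \<omega>" "y + sqrt (2 * r) * \<omega>"]
    by simp
  show "(\<lambda>z. f' (y + sqrt (2 * r) * z)) \<in> borel_measurable gauss" using m by measurable
  show "AE z in gauss. ((\<lambda>y. f (y + sqrt (2 * r) * z)) has_vector_derivative f' (y + sqrt (2 * r) * z)) (at y)"
  proof (rule AE_gauss_I[of "{- y / sqrt (2 * r)}"])
    fix z assume z: "z \<notin> {- y / sqrt (2 * r)}"
    have "y + sqrt (2 * r) * z \<noteq> 0" using r z by (auto simp: field_simps)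
    note 1 = der[OF this]
    have "((\<lambda>y. y + sqrt (2 * r) * z) has_vector_derivative 1) (at y)" by (auto intro!: derivative_eq_intros)
    from vector_diff_chain_at[OF this 1]
    show "((\<lambda>y. f (y + sqrt (2 * r) * z)) has_vector_derivative f' (y + sqrt (2 * r) * z)) (at y)"
      by (simp add: o_def)
  qed simp
qed simp_all

text \<open>Differentiation in \<open>r\<close> brings down \<open>z / c\<close> with
  \<open>c = sqrt (2 * r)\<close> and one derivative of \<open>f\<close>; Gaussian integration by
  parts trades the factor \<open>z\<close> for \<open>c\<close> times a second derivative.\<close>

lemma heat_has_time_derivative:
  fixes f f1 f2 :: "real \<Rightarrow> complex"
  assumes cont: "continuous_on UNIV f" "continuous_on UNIV f1"
    and der: "\<And>x. x \<noteq> 0 \<Longrightarrow> (f has_vector_derivative f1 x) (at x)"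
             "\<And>x. x \<noteq> 0 \<Longrightarrow> (f1 has_vector_derivative f2 x) (at x)"
    and b: "\<And>x. norm (f x) \<le> K" "\<And>x. norm (f1 x) \<le> K" "\<And>x. norm (f2 x) \<le> K"
    and m: "f2 \<in> borel_measurable borel" and r: "r > 0"
  shows "((\<lambda>r. heat f r y) has_vector_derivative heat f2 r y) (at r within {0..})"
proof -
  interpret prob_space gauss by (rule prob_space_gauss)
  define c where "c = sqrt (2 * r)"
  have c: "c > 0" using r by (simp add: c_def)
  have mf: "f \<in> borel_measurable borel" "f1 \<in> borel_measurable borel"
    using cont by (auto intro: borel_measurable_continuous_onI)
  have "((\<lambda>r. heat f r y) has_vector_derivative (LINT z|gauss. (z / c) *\<^sub>R f1 (y + c * z))) (at r within {0..})"
    unfolding heat_def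
  proof (rule has_vector_derivative_integral[where g = "\<lambda>z. K * 2 / c * \<bar>z\<bar>"])
    show "integrable gauss (\<lambda>z. f (y + sqrt (2 * x) * z))" for x
      by (rule integrable_gauss_bounded[of _ K]) (use mf b in \<open>auto intro: measurable_compose[rotated]\<close>)
    show "integrable gauss (\<lambda>z. K * 2 / c * \<bar>z\<bar>)"
      using integrable_gauss_abs by simp
    show "(\<lambda>z. (z / c) *\<^sub>R f1 (y + c * z)) \<in> borel_measurable gauss" using mf by measurable
    show "norm (f (y + sqrt (2 * x) * z) - f (y + sqrt (2 * r) * z)) \<le> K * 2 / c * \<bar>z\<bar> * \<bar>x - r\<bar>"
      if "x \<in> {0..}" for x z
    proof -
      have K: "K \<ge> 0" using b(1)[of 0] norm_ge_zero order_trans by blast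
      \<comment> \<open>Multiplying by the conjugate \<open>sqrt (2 * x) + c\<close>, which is at
        least \<open>c\<close>, bounds the increment of the square root for all
        \<open>x \<ge> 0\<close>, also near 0 where its derivative blows up.\<close>
      have "\<bar>sqrt (2 * x) - c\<bar> * c \<le> \<bar>sqrt (2 * x) - c\<bar> * (sqrt (2 * x) + c)"
        using that by (intro mult_left_mono) auto
      also have "\<dots> = \<bar>(sqrt (2 * x))\<^sup>2 - c\<^sup>2\<bar>"
proof -
        have "(sqrt (2 * x) - c) * (sqrt (2 * x) + c) = (sqrt (2 * x))\<^sup>2 - c\<^sup>2"
          by (simp add: power2_eq_square algebra_simps)
        then show ?thesis using that c by (metis abs_mult abs_of_nonneg add_nonneg_nonneg less_imp_le
              real_sqrt_ge_zero atLeast_iff mult_nonneg_nonneg zero_le_numeral)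
      qed
      also have "\<dots> = 2 * \<bar>x - r\<bar>" using that r by (auto simp: c_def abs_if)
      finally have *: "\<bar>sqrt (2 * x) - c\<bar> \<le> 2 * \<bar>x - r\<bar> / c" using c by (simp add: field_simps)
      have "norm (f (y + sqrt (2 * x) * z) - f (y + sqrt (2 * r) * z)) \<le> K * \<bar>(sqrt (2 * x) - c) * z\<bar>"
        using lipschitz_except_origin[OF cont(1) der(1) b(2), of "y + sqrt (2 * x) * z" "y + sqrt (2 * r) * z"]
        by (simp add: c_def algebra_simps)
      also have "\<dots> \<le> K * (2 * \<bar>x - r\<bar> / c * \<bar>z\<bar>)"
        unfolding abs_mult by (intro mult_left_mono mult_right_mono * K) auto
      finally show ?thesis by (simp add: field_simps)
    qed
    show "AE z in gauss. ((\<lambda>r. f (y + sqrt (2 * r) * z)) has_vector_derivative (z / c) *\<^sub>R f1 (y + c * z)) (at r within {0..})"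
    proof (rule AE_gauss_I[of "{- y / c}"])
      fix z assume z: "z \<notin> {- y / c}"
      have "y + c * z \<noteq> 0" using c z by (auto simp: field_simps)
      from der(1)[OF this] have 1: "(f has_vector_derivative f1 (y + c * z)) (at (y + sqrt (2 * r) * z))"
        by (simp add: c_def)
      have "((\<lambda>r. y + sqrt (2 * r) * z) has_real_derivative z / c) (at r)"
        using r by (auto intro!: derivative_eq_intros simp: c_def field_simps)
      then have "((\<lambda>r. y + sqrt (2 * r) * z) has_vector_derivative z / c) (at r)"
        by (simp add: has_real_derivative_iff_has_vector_derivative)
      from vector_diff_chain_at[OF this 1]
      show "((\<lambda>r. f (y + sqrt (2 * r) * z)) has_vector_derivative (z / c) *\<^sub>R f1 (y + c * z)) (at r within {0..})"
        by (auto simp: o_def intro: has_vector_derivative_at_within)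
    qed simp
  qed (use r in auto)
  moreover have "(LINT z|gauss. (z / c) *\<^sub>R f1 (y + c * z)) = heat f2 r y"
  proof -
    have "(LINT z|gauss. c *\<^sub>R f2 (y + c * z)) = (LINT z|gauss. z *\<^sub>R f1 (y + c * z))"
    proof (rule gauss_integration_by_parts[where p = "- y / c" and K = K and K' = "c * K"])
      show "continuous_on UNIV (\<lambda>z. f1 (y + c * z))"
        by (intro continuous_on_compose2[OF cont(2)] continuous_intros) auto
      show "((\<lambda>z. f1 (y + c * z)) has_vector_derivative c *\<^sub>R f2 (y + c * z)) (at z)" if "z \<noteq> - y / c" for z
      proof -
        have "y + c * z \<noteq> 0" using c that by (auto simp: field_simps)
        from der(2)[OF this] have 1: "(f1 has_vector_derivative f2 (y + c * z)) (at (y + c * z))" .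
        have "((\<lambda>z. y + c * z) has_vector_derivative c) (at z)"
          by (auto intro!: derivative_eq_intros simp: has_real_derivative_iff_has_vector_derivative[symmetric])
        from vector_diff_chain_at[OF this 1] show ?thesis by (simp add: o_def)
      qed
    qed (use b c m in auto)
    from arg_cong[OF this, of "\<lambda>u. u /\<^sub>R c"]
    have "heat f2 r y = (LINT z|gauss. z *\<^sub>R f1 (y + c * z)) /\<^sub>R c"
      using c by (simp add: heat_def c_def[symmetric])
    moreover have "(z / c) *\<^sub>R w = (z *\<^sub>R w) /\<^sub>R c" for z and w :: complex
      by (simp add: divide_inverse mult.commute)
    ultimately show ?thesis by (simp only: integral_scaleR_right)
  qed
  ultimately show ?thesis by simp
qed

lemma heat_odd_0: assumes "\<And>x. g (- x) = - g x" shows "heat g r 0 = 0"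
proof -
  have "(LINT z|lborel. std_normal_density z *\<^sub>R g (sqrt (2 * r) * z)) =
        (LINT z|lborel. std_normal_density (- z) *\<^sub>R g (sqrt (2 * r) * - z))"
    by (subst lborel_integral_real_affine[where c = "-1" and t = 0]) auto
  also have "\<dots> = - (LINT z|lborel. std_normal_density z *\<^sub>R g (sqrt (2 * r) * z))"
    using assms by (simp add: std_normal_density_def)
  finally have *: "(LINT z|lborel. std_normal_density z *\<^sub>R g (sqrt (2 * r) * z)) = 0"
    by simp
  show ?thesis
  proof (cases "(\<lambda>z. g (sqrt (2 * r) * z)) \<in> borel_measurable borel")
    case True
    then show ?thesis using * by (simp add: heat_def integral_density)
  next
    case False
    \<comment> \<open>Here the integral takes its default value 0, which is the claimed
      value.\<close>
    then have "\<not> integrable gauss (\<lambda>z. g (sqrt (2 * r) * z))"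
      by (auto dest: borel_measurable_integrable)
    then show ?thesis by (simp add: heat_def not_integrable_integral_eq)
  qed
qed

text \<open>The exponent is the price of a displacement \<open>sqrt (2 * r) * z\<close> with
  \<open>r \<le> 1\<close> against the weight \<open>exp (- \<bar>y\<bar>)\<close>. Completing the
  square majorizes the integrand by a Gaussian of variance 2.\<close>

lemma integrable_gauss_exp: "integrable gauss (\<lambda>z. exp (sqrt 2 * \<bar>z\<bar>))"
proof (subst integrable_density)
  show "integrable lborel (\<lambda>x. std_normal_density x *\<^sub>R exp (sqrt 2 * \<bar>x\<bar>))"
  proof (rule Bochner_Integration.integrable_bound[where f = "\<lambda>x. exp 2 * sqrt 2 * normal_density 0 (sqrt 2) x"])
    show "integrable lborel (\<lambda>x. exp 2 * sqrt 2 * normal_density 0 (sqrt 2) x)"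
      by (intro integrable_mult_right integrable_normal_density) auto
    show "AE x in lborel. norm (std_normal_density x *\<^sub>R exp (sqrt 2 * \<bar>x\<bar>)) \<le> norm (exp 2 * sqrt 2 * normal_density 0 (sqrt 2) x)"
    proof (rule AE_I2)
      fix x :: real
      have "0 \<le> (\<bar>x\<bar> / 2 - sqrt 2)\<^sup>2" by simp
      also have "\<dots> = x\<^sup>2 / 4 + 2 - sqrt 2 * \<bar>x\<bar>" by (simp add: power2_eq_square algebra_simps)
      finally have "exp (- x\<^sup>2 / 2 + sqrt 2 * \<bar>x\<bar>) \<le> exp (2 - x\<^sup>2 / 4)" by simp
      then have "(1 / sqrt (2 * pi)) * exp (- x\<^sup>2 / 2 + sqrt 2 * \<bar>x\<bar>) \<le> (1 / sqrt (2 * pi)) * exp (2 - x\<^sup>2 / 4)"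
        by (intro mult_left_mono) auto
      moreover have "std_normal_density x *\<^sub>R exp (sqrt 2 * \<bar>x\<bar>) = (1 / sqrt (2 * pi)) * exp (- x\<^sup>2 / 2 + sqrt 2 * \<bar>x\<bar>)"
        unfolding std_normal_density_def exp_add by simp
      moreover have "exp 2 * sqrt 2 * normal_density 0 (sqrt 2) x = (1 / sqrt (2 * pi)) * exp (2 - x\<^sup>2 / 4)"
      proof -
        have "sqrt (2 * pi * 2) = sqrt (2 * pi) * sqrt 2" by (rule real_sqrt_mult)
        moreover have "exp (2 - x\<^sup>2 / 4) = exp 2 * exp (- x\<^sup>2 / 4)" by (simp flip: exp_add)
        ultimately show ?thesis unfolding normal_density_def by simp
      qed
      moreover have "\<bar>(1 / sqrt (2 * pi)) * exp u\<bar> = (1 / sqrt (2 * pi)) * exp u" for u by simp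
      ultimately show "norm (std_normal_density x *\<^sub>R exp (sqrt 2 * \<bar>x\<bar>)) \<le> norm (exp 2 * sqrt 2 * normal_density 0 (sqrt 2) x)"
        by (simp only: real_norm_def)
    qed
  qed simp
qed auto

definition gauss_exp_moment :: real where
  "gauss_exp_moment = (LINT z|gauss. exp (sqrt 2 * \<bar>z\<bar>))"

lemma gauss_exp_moment_nonneg: "gauss_exp_moment \<ge> 0"
  unfolding gauss_exp_moment_def by (rule integral_nonneg_AE) simp

lemma norm_heat_le_exp:
  assumes m: "g \<in> borel_measurable borel" and b: "\<And>x. norm (g x) \<le> K * exp (- \<bar>x\<bar>)"
    and r: "0 \<le> r" "r \<le> 1"
  shows "norm (heat g r y) \<le> K * gauss_exp_moment * exp (- \<bar>y\<bar>)"
proof -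
  have K: "K \<ge> 0" using order_trans[OF norm_ge_zero b[of 0]] by simp
  have "norm (heat g r y) \<le> (LINT z|gauss. K * exp (- \<bar>y\<bar>) * exp (sqrt 2 * \<bar>z\<bar>))"
    unfolding heat_def
  proof (rule Bochner_Integration.integral_norm_bound_integral)
    have bb: "norm (g (y + sqrt (2 * r) * x)) \<le> K * exp (- \<bar>y\<bar>) * exp (sqrt 2 * \<bar>x\<bar>)" for x
    proof -
      have "sqrt (2 * r) \<le> sqrt 2" using r by simp
      then have "\<bar>sqrt (2 * r) * x\<bar> \<le> sqrt 2 * \<bar>x\<bar>" using r unfolding abs_mult
        by (intro mult_right_mono) auto
      then have "- \<bar>y + sqrt (2 * r) * x\<bar> \<le> - \<bar>y\<bar> + sqrt 2 * \<bar>x\<bar>" by linarith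
      then have "exp (- \<bar>y + sqrt (2 * r) * x\<bar>) \<le> exp (- \<bar>y\<bar>) * exp (sqrt 2 * \<bar>x\<bar>)"
        by (simp flip: exp_add)
      then have "K * exp (- \<bar>y + sqrt (2 * r) * x\<bar>) \<le> K * (exp (- \<bar>y\<bar>) * exp (sqrt 2 * \<bar>x\<bar>))"
        using K by (rule mult_left_mono)
      then show ?thesis using b[of "y + sqrt (2 * r) * x"] by (simp add: ac_simps)
    qed
    show "integrable gauss (\<lambda>z. K * exp (- \<bar>y\<bar>) * exp (sqrt 2 * \<bar>z\<bar>))"
      by (intro integrable_mult_right integrable_gauss_exp)
    then show "integrable gauss (\<lambda>z. g (y + sqrt (2 * r) * z))"
    proof (rule Bochner_Integration.integrable_bound)
      show "AE x in gauss. norm (g (y + sqrt (2 * r) * x)) \<le> norm (K * exp (- \<bar>y\<bar>) * exp (sqrt 2 * \<bar>x\<bar>))"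
        using order_trans[OF bb abs_ge_self] by (intro AE_I2) (simp only: real_norm_def)
    qed (use m in measurable)
    show "norm (g (y + sqrt (2 * r) * x)) \<le> K * exp (- \<bar>y\<bar>) * exp (sqrt 2 * \<bar>x\<bar>)" for x by (rule bb)
  qed
  then show ?thesis by (simp add: gauss_exp_moment_def ac_simps)
qed

text \<open>The time derivative is known for positive times only, so the fundamental theorem is used
  with differentiability inside the interval and continuity at its ends.\<close>

lemma heat_eq_integral:
  fixes f f1 f2 :: "real \<Rightarrow> complex"
  assumes cont: "continuous_on UNIV f" "continuous_on UNIV f1"
    and der: "\<And>x. x \<noteq> 0 \<Longrightarrow> (f has_vector_derivative f1 x) (at x)"
             "\<And>x. x \<noteq> 0 \<Longrightarrow> (f1 has_vector_derivative f2 x) (at x)"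
    and b: "\<And>x. norm (f x) \<le> K" "\<And>x. norm (f1 x) \<le> K" "\<And>x. norm (f2 x) \<le> K"
    and m: "f2 \<in> borel_measurable borel" and t: "\<tau> \<le> t"
  shows "((\<lambda>r. heat f2 (r - \<tau>) y) has_integral (heat f (t - \<tau>) y - f y)) {\<tau>..t}"
proof -
  have mf: "f \<in> borel_measurable borel" using cont by (auto intro: borel_measurable_continuous_onI)
  have "((\<lambda>r. heat f2 (r - \<tau>) y) has_integral (heat f (t - \<tau>) y - heat f (\<tau> - \<tau>) y)) {\<tau>..t}"
  proof (rule fundamental_theorem_of_calculus_interior[OF t])
    show "continuous_on {\<tau>..t} (\<lambda>r. heat f (r - \<tau>) y)"
    proof (rule continuous_on_sequentiallyI)
      fix u a assume u: "\<forall>n. u n \<in> {\<tau>..t}" "a \<in> {\<tau>..t}" "u \<longlonglongrightarrow> a"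
      have "(\<lambda>n. LINT z|gauss. f (y + sqrt (2 * (u n - \<tau>)) * z)) \<longlonglongrightarrow> (LINT z|gauss. f (y + sqrt (2 * (a - \<tau>)) * z))"
      proof (rule integral_dominated_convergence[where w = "\<lambda>_. K"])
        interpret prob_space gauss by (rule prob_space_gauss)
        show "integrable gauss (\<lambda>_. K)" by simp
        show "AE z in gauss. (\<lambda>n. f (y + sqrt (2 * (u n - \<tau>)) * z)) \<longlonglongrightarrow> f (y + sqrt (2 * (a - \<tau>)) * z)"
          by (rule AE_I2, rule continuous_on_tendsto_compose[OF cont(1)]) (auto intro!: tendsto_intros u)
      qed (use mf b in auto)
      then show "(\<lambda>n. heat f (u n - \<tau>) y) \<longlonglongrightarrow> heat f (a - \<tau>) y" by (simp add: heat_def)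
    qed
    show "((\<lambda>r. heat f (r - \<tau>) y) has_vector_derivative heat f2 (r - \<tau>) y) (at r)"
      if "r \<in> {\<tau><..<t}" for r
    proof -
      have "((\<lambda>r. heat f r y) has_vector_derivative heat f2 (r - \<tau>) y) (at (r - \<tau>) within {0..})"
        using that by (intro heat_has_time_derivative[OF cont der b m]) auto
      moreover have "at (r - \<tau>) within {0..} = at (r - \<tau>)"
        using that by (intro at_within_interior) auto
      ultimately have 1: "((\<lambda>r. heat f r y) has_vector_derivative heat f2 (r - \<tau>) y) (at (r - \<tau>))" by simp
      have "((\<lambda>r. r - \<tau>) has_vector_derivative 1) (at r)" by (auto intro!: derivative_eq_intros)
      from vector_diff_chain_at[OF this 1] show ?thesis by (simp add: o_def)
    qed
  qed
  then show ?thesis by simp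
qed

section \<open>Duhamel integrals on the half-line\<close>

lemma continuous_on_slice_snd:
  assumes "continuous_on (A \<times> B) (\<lambda>(t, y). f t y)" "t \<in> A" shows "continuous_on B (f t)"
proof -
  have "continuous_on B (\<lambda>y. (t, y))" by (intro continuous_on_Pair continuous_on_const continuous_on_id)
  from continuous_on_compose2[OF assms(1) this] assms(2) show ?thesis by auto
qed

lemma continuous_on_slice_fst:
  assumes "continuous_on (A \<times> B) (\<lambda>(t, y). f t y)" "y \<in> B" shows "continuous_on A (\<lambda>t. f t y)"
proof -
  have "continuous_on A (\<lambda>t. (t, y))" by (intro continuous_on_Pair continuous_on_const continuous_on_id)
  from continuous_on_compose2[OF assms(1) this] assms(2) show ?thesis by auto
qed

lemma exp_minus_mult: "exp (a - b) = exp a * exp (- b)" for a b :: real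
  by (simp flip: exp_add)

text \<open>The sign makes the extension of a function odd and that of its derivative even, so that
  extension commutes with differentiation. Oddness turns the Dirichlet problem into the heat flow on
  the whole line. At order 2 the extension is odd again and may jump at the origin.\<close>

definition reflect :: "nat \<Rightarrow> (real \<Rightarrow> complex) \<Rightarrow> real \<Rightarrow> complex" where
  "reflect j g x = (if 0 \<le> x then g x else (- 1) ^ Suc j * g (- x))"

section \<open>Reflected profiles on a short time interval\<close>

locale time_interval =
  fixes t0 T \<Lambda> :: real
  assumes t0_less: "t0 < T" and T_le: "T \<le> t0 + 1" and \<Lambda>_pos: "\<Lambda> > 0"
begin

text \<open>The index \<open>j\<close> is the order of the derivative in \<open>y\<close>. Order 2
  is continuous only off the wall, since nothing makes it vanish at \<open>y = 0\<close> and its odd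
  reflection jumps there. The weight \<open>exp (\<Lambda> * (t - t0))\<close> is the usual one for
  Volterra equations: a large \<open>\<Lambda>\<close> makes the iteration contract on the whole
  interval.\<close>

definition profile :: "real \<Rightarrow> (nat \<Rightarrow> real \<Rightarrow> real \<Rightarrow> complex) \<Rightarrow> bool" where
  "profile \<kappa> g \<longleftrightarrow>
     (\<forall>t\<in>{t0..T}. g 0 t 0 = 0) \<and>
     (\<forall>j<2. continuous_on ({t0..T} \<times> {0..}) (\<lambda>(t, y). g j t y)) \<and>
     continuous_on ({t0..T} \<times> {0<..}) (\<lambda>(t, y). g 2 t y) \<and>
     (\<forall>t\<in>{t0..T}. \<forall>y>0. \<forall>j<2. (g j t has_vector_derivative g (Suc j) t y) (at y)) \<and>
     (\<forall>j\<le>2. \<forall>t\<in>{t0..T}. \<forall>y\<ge>0. norm (g j t y) \<le> \<kappa> * exp (\<Lambda> * (t - t0) - y))"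

lemma profileD:
  assumes "profile \<kappa> g"
  shows "t \<in> {t0..T} \<Longrightarrow> g 0 t 0 = 0"
    and "j < 2 \<Longrightarrow> continuous_on ({t0..T} \<times> {0..}) (\<lambda>(t, y). g j t y)"
    and "j \<le> 2 \<Longrightarrow> continuous_on ({t0..T} \<times> {0<..}) (\<lambda>(t, y). g j t y)"
    and "t \<in> {t0..T} \<Longrightarrow> y > 0 \<Longrightarrow> j < 2 \<Longrightarrow> (g j t has_vector_derivative g (Suc j) t y) (at y)"
    and "j \<le> 2 \<Longrightarrow> t \<in> {t0..T} \<Longrightarrow> y \<ge> 0 \<Longrightarrow> norm (g j t y) \<le> \<kappa> * exp (\<Lambda> * (t - t0) - y)"
    and "\<kappa> \<ge> 0"
proof -
  show "continuous_on ({t0..T} \<times> {0<..}) (\<lambda>(t, y). g j t y)" if "j \<le> 2"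
  proof (cases "j = 2")
    case False
    then have "continuous_on ({t0..T} \<times> {0..}) (\<lambda>(t, y). g j t y)" using assms that by (simp add: profile_def)
    then show ?thesis by (rule continuous_on_subset) auto
  qed (use assms in \<open>simp add: profile_def\<close>)
  have "0 \<le> \<kappa> * exp (\<Lambda> * (t0 - t0) - 0)" using assms t0_less unfolding profile_def
    by (metis atLeastAtMost_iff less_imp_le norm_ge_zero order_refl order_trans zero_le_numeral)
  then show "\<kappa> \<ge> 0" by simp
qed (use assms in \<open>auto simp: profile_def\<close>)

context
  fixes \<kappa> g assumes g: "profile \<kappa> g"
begin

lemma continuous_profile_slice:
  assumes "t \<in> {t0..T}" shows "j < 2 \<Longrightarrow> continuous_on {0..} (g j t)" "j \<le> 2 \<Longrightarrow> continuous_on {0<..} (g j t)"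
  using continuous_on_slice_snd[OF profileD(2)[OF g]] continuous_on_slice_snd[OF profileD(3)[OF g]] assms
  by blast+

lemma reflect_measurable:
  assumes "t \<in> {t0..T}" "j \<le> 2" shows "reflect j (g j t) \<in> borel_measurable borel"
proof -
  define h where "h x = indicator {0<..} x *\<^sub>R g j t x" for x
  have m[measurable]: "h \<in> borel_measurable borel"
    unfolding h_def
    using continuous_profile_slice(2)[OF assms] by (intro borel_measurable_continuous_on_indicator) auto
  have "reflect j (g j t) = (\<lambda>x. h x + (- 1) ^ Suc j * h (- x) + indicator {0} x *\<^sub>R g j t 0)"
    by (auto simp: reflect_def fun_eq_iff h_def indicator_def)
  also have "\<dots> \<in> borel_measurable borel" by measurable
  finally show ?thesis .
qed

lemma norm_reflect_le:
  assumes "t \<in> {t0..T}" "j \<le> 2"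
  shows "norm (reflect j (g j t) x) \<le> \<kappa> * exp (\<Lambda> * (t - t0)) * exp (- \<bar>x\<bar>)"
    and "norm (reflect j (g j t) x) \<le> \<kappa> * exp \<Lambda>"
proof -
  show 1: "norm (reflect j (g j t) x) \<le> \<kappa> * exp (\<Lambda> * (t - t0)) * exp (- \<bar>x\<bar>)"
    using profileD(5)[OF g assms(2,1), of "\<bar>x\<bar>"]
    by (auto simp: reflect_def norm_mult norm_power exp_minus_mult mult.assoc split: if_splits)
  have "\<kappa> * exp (\<Lambda> * (t - t0)) * exp (- \<bar>x\<bar>) \<le> \<kappa> * exp (\<Lambda> * 1) * 1"
    using assms T_le \<Lambda>_pos profileD(6)[OF g]
    by (intro mult_mono mult_left_mono) (auto intro!: mult_left_mono)
  then show "norm (reflect j (g j t) x) \<le> \<kappa> * exp \<Lambda>" using 1 by simp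
qed

lemma reflect_tendsto:
  assumes "\<And>n. s n \<in> {t0..T}" "s \<longlonglongrightarrow> s0" "s0 \<in> {t0..T}" "j \<le> 2" "xs \<longlonglongrightarrow> x" "x \<noteq> 0"
  shows "(\<lambda>n. reflect j (g j (s n)) (xs n)) \<longlonglongrightarrow> reflect j (g j s0) x"
proof -
  have c: "(\<lambda>n. g j (s n) (ys n)) \<longlonglongrightarrow> g j s0 y" if "ys \<longlonglongrightarrow> y" "y > 0" for ys y
    using continuous_on_tendsto_compose[OF profileD(3)[OF g assms(4)], of "\<lambda>n. (s n, ys n)" "(s0, y)" sequentially]
      tendsto_Pair[OF assms(2) that(1)] assms(1,3) that order_tendstoD(1)[OF that]
    by (auto elim!: eventually_mono)
  consider "x > 0" | "x < 0" using assms by linarith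
  then show ?thesis
  proof cases
    case 1
    have "\<forall>\<^sub>F n in sequentially. xs n > 0" using order_tendstoD(1)[OF assms(5) 1] .
    then have "\<forall>\<^sub>F n in sequentially. g j (s n) (xs n) = reflect j (g j (s n)) (xs n)"
      by eventually_elim (simp add: reflect_def)
    from Lim_transform_eventually[OF c[OF assms(5) 1] this] show ?thesis using 1 by (simp add: reflect_def)
  next
    case 2
    have "\<forall>\<^sub>F n in sequentially. xs n < 0" using order_tendstoD(2)[OF assms(5) 2] .
    then have e: "\<forall>\<^sub>F n in sequentially. (- 1) ^ Suc j * g j (s n) (- xs n) = reflect j (g j (s n)) (xs n)"
      by eventually_elim (simp add: reflect_def)
    have "(\<lambda>n. (- 1) ^ Suc j * g j (s n) (- xs n)) \<longlonglongrightarrow> (- 1) ^ Suc j * g j s0 (- x)"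
      using 2 by (intro tendsto_intros c assms) auto
    from Lim_transform_eventually[OF this e] show ?thesis using 2 by (simp add: reflect_def)
  qed
qed

lemma reflect_has_vector_derivative:
  assumes "t \<in> {t0..T}" "j < 2" "x \<noteq> 0"
  shows "(reflect j (g j t) has_vector_derivative reflect (Suc j) (g (Suc j) t) x) (at x)"
proof (cases "x > 0")
  case True
  have "(g j t has_vector_derivative reflect (Suc j) (g (Suc j) t) x) (at x)"
    using profileD(4)[OF g assms(1) True assms(2)] True by (simp add: reflect_def)
  then show ?thesis
    by (rule has_vector_derivative_transform_within_open[where S = "{0<..}"]) (use True in \<open>auto simp: reflect_def\<close>)
next
  case False
  then have x: "- x > 0" using assms by auto
  have "((\<lambda>x. - x) has_vector_derivative - 1) (at x)"
    by (auto intro!: derivative_eq_intros)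
  from vector_diff_chain_at[OF this profileD(4)[OF g assms(1) x assms(2)]]
  have "((\<lambda>x. g j t (- x)) has_vector_derivative - g (Suc j) t (- x)) (at x)" by (simp add: o_def)
  then have "((\<lambda>x. (- 1) ^ Suc j * g j t (- x)) has_vector_derivative (- 1) ^ Suc j * (- g (Suc j) t (- x))) (at x)"
    by (rule has_vector_derivative_mult_right)
  moreover have "(- 1) ^ Suc j * (- g (Suc j) t (- x)) = reflect (Suc j) (g (Suc j) t) x"
    using x by (simp add: reflect_def)
  ultimately have "((\<lambda>x. (- 1) ^ Suc j * g j t (- x)) has_vector_derivative reflect (Suc j) (g (Suc j) t) x) (at x)"
    by simp
  then show ?thesis
    by (rule has_vector_derivative_transform_within_open[where S = "{..<0}"]) (use x in \<open>auto simp: reflect_def\<close>)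
qed

text \<open>Order 0 is continuous at the origin because of the Dirichlet condition, order 1 because
  its reflection is even.\<close>

lemma continuous_reflect:
  assumes t: "t \<in> {t0..T}" "j < 2" shows "continuous_on UNIV (reflect j (g j t))"
proof -
  have "continuous_on ({..0} \<union> {0..}) (\<lambda>x. if x \<le> 0 then (- 1) ^ Suc j * g j t (- x) else g j t x)"
  proof (rule continuous_on_cases)
    show "continuous_on {..0} (\<lambda>x. (- 1) ^ Suc j * g j t (- x))"
      by (intro continuous_intros continuous_on_compose2[OF continuous_profile_slice(1)[OF t]]) auto
    show "continuous_on {0..} (g j t)" by (rule continuous_profile_slice(1)[OF t])
    have "j = 0 \<or> j = 1" using t by auto
    then show "\<forall>x. x \<in> {..0} \<and> \<not> x \<le> 0 \<or> x \<in> {0..} \<and> x \<le> 0 \<longrightarrow> (- 1) ^ Suc j * g j t (- x) = g j t x"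
      using profileD(1)[OF g t(1)] by auto
  qed auto
  moreover have "{..0} \<union> {0::real..} = UNIV" by auto
  ultimately have "continuous_on UNIV (\<lambda>x. if x \<le> 0 then (- 1) ^ Suc j * g j t (- x) else g j t x)" by simp
  moreover have "(\<lambda>x. if x \<le> 0 then (- 1) ^ Suc j * g j t (- x) else g j t x) = reflect j (g j t)"
  proof -
    have "j = 0 \<or> j = 1" using t by auto
    then show ?thesis using profileD(1)[OF g t(1)] by (auto simp: reflect_def fun_eq_iff)
  qed
  ultimately show ?thesis by (simp only:)
qed

lemma heat_reflect_tendsto:
  assumes "\<And>n. s n \<in> {t0..T}" "\<And>n. s n \<le> t n" "s \<longlonglongrightarrow> s1" "t \<longlonglongrightarrow> t1" "y \<longlonglongrightarrow> y1" "s1 \<in> {t0..T}"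
    "s1 < t1 \<or> (s1 = t1 \<and> y1 \<noteq> 0)" "j \<le> 2"
  shows "(\<lambda>n. heat (reflect j (g j (s n))) (t n - s n) (y n)) \<longlonglongrightarrow> heat (reflect j (g j s1)) (t1 - s1) y1"
proof (rule heat_tendsto[where p = 0 and K = "\<kappa> * exp \<Lambda>"])
  show "(\<lambda>n. reflect j (g j (s n)) (xs n)) \<longlonglongrightarrow> reflect j (g j s1) x" if "x \<noteq> 0" "xs \<longlonglongrightarrow> x" for x xs
    by (rule reflect_tendsto) (use assms that in auto)
qed (use assms in \<open>auto intro!: reflect_measurable norm_reflect_le tendsto_intros\<close>)

lemma norm_heat_reflect_le:
  assumes "s \<in> {t0..T}" "s \<le> t" "t \<le> T" "j \<le> 2"
  shows "norm (heat (reflect j (g j s)) (t - s) y) \<le> \<kappa> * exp (\<Lambda> * (s - t0)) * gauss_exp_moment * exp (- \<bar>y\<bar>)"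
  by (rule norm_heat_le_exp) (use assms T_le in \<open>auto intro!: reflect_measurable norm_reflect_le(1)\<close>)

end

text \<open>The solution of the Dirichlet heat problem with source \<open>g 0\<close> and zero data,
  with its derivatives in \<open>y\<close>. The heat flow commutes with differentiation, so order
  \<open>j\<close> is written with the reflected derivative \<open>g j\<close>.\<close>

definition duhamel :: "(nat \<Rightarrow> real \<Rightarrow> real \<Rightarrow> complex) \<Rightarrow> nat \<Rightarrow> real \<Rightarrow> real \<Rightarrow> complex" where
  "duhamel g j t y = (LINT s|lborel. indicator {t0..<t} s *\<^sub>R heat (reflect j (g j s)) (t - s) y)"

text \<open>The factor \<open>1 / \<Lambda>\<close> obtained here is the source of smallness in the
  iteration.\<close>

lemma integrable_exp_interval:
  "integrable lborel (\<lambda>s. indicator {t0..<t} s *\<^sub>R exp (\<Lambda> * (s - t0)))" (is ?A)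
  "(LINT s|lborel. indicator {t0..<t} s *\<^sub>R exp (\<Lambda> * (s - t0))) \<le> exp (\<Lambda> * (t - t0)) / \<Lambda>" (is ?B)
proof -
  have "?A \<and> ?B"
  proof (cases "t0 \<le> t")
    case True
    note [simp] = has_real_derivative_iff_has_vector_derivative[symmetric]
    have int: "integrable lborel (\<lambda>s. indicator {t0..t} s *\<^sub>R exp (\<Lambda> * (s - t0)))"
      by (rule borel_integrable_compact) (auto intro!: continuous_intros)
    have "AE s in lborel. s \<noteq> t" by (rule AE_lborel_singleton)
    then have ae: "AE s in lborel. indicator {t0..<t} s *\<^sub>R exp (\<Lambda> * (s - t0)) = indicator {t0..t} s *\<^sub>R exp (\<Lambda> * (s - t0))"
      by eventually_elim (auto simp: indicator_def)
    have i: "integrable lborel (\<lambda>s. indicator {t0..<t} s *\<^sub>R exp (\<Lambda> * (s - t0)))"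
      using int by (rule integrable_cong_AE_imp) (use ae in \<open>auto\<close>)
    have "(LINT s|lborel. indicator {t0..<t} s *\<^sub>R exp (\<Lambda> * (s - t0))) =
        (LINT s|lborel. indicator {t0..t} s *\<^sub>R exp (\<Lambda> * (s - t0)))"
      by (rule integral_cong_AE) (use ae in auto)
    also have "\<dots> = exp (\<Lambda> * (t - t0)) / \<Lambda> - exp (\<Lambda> * (t0 - t0)) / \<Lambda>"
      by (rule integral_FTC_atLeastAtMost[OF True])
        (use \<Lambda>_pos in \<open>auto intro!: continuous_intros derivative_eq_intros
          simp: has_real_derivative_iff_has_vector_derivative[symmetric]\<close>)
    also have "\<dots> \<le> exp (\<Lambda> * (t - t0)) / \<Lambda>" using \<Lambda>_pos by simp
    finally show ?thesis using i by auto
  qed (use \<Lambda>_pos in auto)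
  then show ?A ?B by auto
qed

section \<open>Regularity of Duhamel integrals\<close>

context
  fixes \<kappa> g assumes g: "profile \<kappa> g"
begin

lemma duhamel_integrand_measurable:
  assumes "t \<in> {t0..T}" "j \<le> 2"
  shows "(\<lambda>s. indicator {t0..<t} s *\<^sub>R heat (reflect j (g j s)) (t - s) y) \<in> borel_measurable borel"
proof (rule borel_measurable_continuous_on_indicator)
  show "continuous_on {t0..<t} (\<lambda>s. heat (reflect j (g j s)) (t - s) y)"
  proof (rule continuous_on_sequentiallyI)
    fix u a assume u: "\<forall>n. u n \<in> {t0..<t}" "a \<in> {t0..<t}" "u \<longlonglongrightarrow> a"
    have "u n \<le> T" for n using u(1) assms(1) by (metis atLeastAtMost_iff atLeastLessThan_iff less_imp_le order_trans)
    then show "(\<lambda>n. heat (reflect j (g j (u n))) (t - u n) y) \<longlonglongrightarrow> heat (reflect j (g j a)) (t - a) y"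
      by (intro heat_reflect_tendsto[OF g]) (use u assms in \<open>auto intro: less_imp_le\<close>)
  qed
qed simp

lemma norm_duhamel_integrand:
  assumes "t \<in> {t0..T}" "j \<le> 2"
  shows "norm (indicator {t0..<t} s *\<^sub>R heat (reflect j (g j s)) (t - s) y) \<le>
    \<kappa> * gauss_exp_moment * exp (- \<bar>y\<bar>) * (indicator {t0..<t} s *\<^sub>R exp (\<Lambda> * (s - t0)))"
  using norm_heat_reflect_le[OF g, of s t j y] assms by (auto simp: indicator_def ac_simps)

lemma integrable_duhamel_integrand:
  assumes "t \<in> {t0..T}" "j \<le> 2"
  shows "integrable lborel (\<lambda>s. indicator {t0..<t} s *\<^sub>R heat (reflect j (g j s)) (t - s) y)"
proof (rule Bochner_Integration.integrable_bound)
  show "integrable lborel (\<lambda>s. \<kappa> * gauss_exp_moment * exp (- \<bar>y\<bar>) * (indicator {t0..<t} s *\<^sub>R exp (\<Lambda> * (s - t0))))"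
    by (intro integrable_mult_right integrable_exp_interval)
  show "AE s in lborel. norm (indicator {t0..<t} s *\<^sub>R heat (reflect j (g j s)) (t - s) y) \<le>
     norm (\<kappa> * gauss_exp_moment * exp (- \<bar>y\<bar>) * (indicator {t0..<t} s *\<^sub>R exp (\<Lambda> * (s - t0))))"
    using order_trans[OF norm_duhamel_integrand[OF assms] abs_ge_self] by (intro AE_I2) (simp only: real_norm_def)
qed (use duhamel_integrand_measurable[OF assms] in simp)

lemma norm_duhamel_le:
  assumes "t \<in> {t0..T}" "j \<le> 2"
  shows "norm (duhamel g j t y) \<le> \<kappa> * gauss_exp_moment / \<Lambda> * exp (\<Lambda> * (t - t0) - \<bar>y\<bar>)"
proof -
  have "norm (duhamel g j t y) \<le>
     (LINT s|lborel. \<kappa> * gauss_exp_moment * exp (- \<bar>y\<bar>) * (indicator {t0..<t} s *\<^sub>R exp (\<Lambda> * (s - t0))))"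
    unfolding duhamel_def
    by (rule Bochner_Integration.integral_norm_bound_integral)
      (intro integrable_duhamel_integrand assms integrable_mult_right integrable_exp_interval norm_duhamel_integrand)+
  also have "\<dots> = \<kappa> * gauss_exp_moment * exp (- \<bar>y\<bar>) * (LINT s|lborel. indicator {t0..<t} s *\<^sub>R exp (\<Lambda> * (s - t0)))"
    by (rule integral_mult_right_zero)
  also have "\<dots> \<le> \<kappa> * gauss_exp_moment * exp (- \<bar>y\<bar>) * (exp (\<Lambda> * (t - t0)) / \<Lambda>)"
    by (intro mult_left_mono integrable_exp_interval mult_nonneg_nonneg profileD(6)[OF g] gauss_exp_moment_nonneg) auto
  finally show ?thesis by (simp add: exp_minus_mult field_simps)
qed

lemma continuous_duhamel:
  assumes "j \<le> 2" shows "continuous_on ({t0..T} \<times> UNIV) (\<lambda>(t, y). duhamel g j t y)"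
proof (rule continuous_on_sequentiallyI)
  fix u a assume u: "\<forall>n. u n \<in> {t0..T} \<times> (UNIV :: real set)" "a \<in> {t0..T} \<times> UNIV" "u \<longlonglongrightarrow> a"
  obtain t y where a: "a = (t, y)" by force
  have t: "t \<in> {t0..T}" "\<And>n. fst (u n) \<in> {t0..T}" using u a by (auto simp: mem_Times_iff)
  have lim: "(\<lambda>n. fst (u n)) \<longlonglongrightarrow> t" "(\<lambda>n. snd (u n)) \<longlonglongrightarrow> y"
    using tendsto_fst[OF u(3)] tendsto_snd[OF u(3)] a by auto
  have "(\<lambda>n. duhamel g j (fst (u n)) (snd (u n))) \<longlonglongrightarrow> duhamel g j t y"
    unfolding duhamel_def
  proof (rule integral_dominated_convergence[where
      w = "\<lambda>s. \<kappa> * gauss_exp_moment * (indicator {t0..<T} s *\<^sub>R exp (\<Lambda> * (s - t0)))"])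
    show "integrable lborel (\<lambda>s. \<kappa> * gauss_exp_moment * (indicator {t0..<T} s *\<^sub>R exp (\<Lambda> * (s - t0))))"
      by (intro integrable_mult_right integrable_exp_interval)
    show "AE s in lborel. norm (indicator {t0..<fst (u i)} s *\<^sub>R heat (reflect j (g j s)) (fst (u i) - s) (snd (u i)))
       \<le> \<kappa> * gauss_exp_moment * (indicator {t0..<T} s *\<^sub>R exp (\<Lambda> * (s - t0)))" for i
    proof (rule AE_I2)
      fix s
      have "norm (indicator {t0..<fst (u i)} s *\<^sub>R heat (reflect j (g j s)) (fst (u i) - s) (snd (u i)))
        \<le> \<kappa> * gauss_exp_moment * exp (- \<bar>snd (u i)\<bar>) * (indicator {t0..<fst (u i)} s *\<^sub>R exp (\<Lambda> * (s - t0)))"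
        by (rule norm_duhamel_integrand) (use t assms in auto)
      also have "\<dots> \<le> \<kappa> * gauss_exp_moment * 1 * (indicator {t0..<T} s *\<^sub>R exp (\<Lambda> * (s - t0)))"
        using t(2)[of i] profileD(6)[OF g] gauss_exp_moment_nonneg
        by (intro mult_mono mult_left_mono mult_nonneg_nonneg) (auto simp: indicator_def)
      finally show "norm (indicator {t0..<fst (u i)} s *\<^sub>R heat (reflect j (g j s)) (fst (u i) - s) (snd (u i)))
       \<le> \<kappa> * gauss_exp_moment * (indicator {t0..<T} s *\<^sub>R exp (\<Lambda> * (s - t0)))" by simp
    qed
    \<comment> \<open>At \<open>s = t\<close> the indicators need not converge and the heat flow is
      at time 0; this single \<open>s\<close> is discarded.\<close>
    have "AE s in lborel. s \<noteq> t" by (rule AE_lborel_singleton)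
    then show "AE s in lborel. (\<lambda>n. indicator {t0..<fst (u n)} s *\<^sub>R heat (reflect j (g j s)) (fst (u n) - s) (snd (u n)))
       \<longlonglongrightarrow> indicator {t0..<t} s *\<^sub>R heat (reflect j (g j s)) (t - s) y"
    proof eventually_elim
      case (elim s)
      consider "s < t0" | "t0 \<le> s" "s < t" | "s > t" using elim by linarith
      then show ?case
      proof cases
        case 2
        have ev: "\<forall>\<^sub>F n in sequentially. s < fst (u n)" using order_tendstoD(1)[OF lim(1) 2(2)] .
        then obtain N where N: "\<And>n. n \<ge> N \<Longrightarrow> s < fst (u n)" by (auto simp: eventually_sequentially)
        have "(\<lambda>n. heat (reflect j (g j s)) (fst (u (n + N)) - s) (snd (u (n + N)))) \<longlonglongrightarrow> heat (reflect j (g j s)) (t - s) y"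
          by (rule heat_reflect_tendsto[OF g]) (use 2 t N assms lim in \<open>auto intro: less_imp_le LIMSEQ_ignore_initial_segment\<close>)
        then have "(\<lambda>n. heat (reflect j (g j s)) (fst (u n) - s) (snd (u n))) \<longlonglongrightarrow> heat (reflect j (g j s)) (t - s) y"
          by (rule LIMSEQ_offset)
        moreover have "\<forall>\<^sub>F n in sequentially. heat (reflect j (g j s)) (fst (u n) - s) (snd (u n)) =
           indicator {t0..<fst (u n)} s *\<^sub>R heat (reflect j (g j s)) (fst (u n) - s) (snd (u n))"
          using ev by eventually_elim (use 2 in simp)
        ultimately show ?thesis using 2 by (auto intro: Lim_transform_eventually)
      next
        case 3
        have "\<forall>\<^sub>F n in sequentially. fst (u n) < s" using order_tendstoD(2)[OF lim(1) 3] .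
        then have "\<forall>\<^sub>F n in sequentially. indicator {t0..<fst (u n)} s *\<^sub>R heat (reflect j (g j s)) (fst (u n) - s) (snd (u n)) = 0"
          by eventually_elim auto
        then show ?thesis using 3 by (auto intro: tendsto_eventually)
      qed auto
    qed
  qed (use duhamel_integrand_measurable t assms in auto)
  then show "(\<lambda>n. case u n of (t, y) \<Rightarrow> duhamel g j t y) \<longlonglongrightarrow> (case a of (t, y) \<Rightarrow> duhamel g j t y)"
    by (simp add: a case_prod_beta)
qed

text \<open>Differentiation passes under two integrals, first the Gaussian one for each
  \<open>s\<close> and then the one over \<open>s\<close>. The Lipschitz constant is the bound for
  the next order, which is uniform up to \<open>s = t\<close>.\<close>

lemma duhamel_has_space_derivative:
  assumes t: "t \<in> {t0..T}" and j: "j < 2"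
  shows "(duhamel g j t has_vector_derivative duhamel g (Suc j) t y) (at y)"
proof -
  let ?K = "\<kappa> * exp \<Lambda>"
  have D: "((\<lambda>y. heat (reflect j (g j s)) (t - s) y) has_vector_derivative heat (reflect (Suc j) (g (Suc j) s)) (t - s) y) (at y)"
    if "s \<in> {t0..<t}" for s y
  proof -
    have s: "s \<in> {t0..T}" using that t by auto
    show ?thesis
      by (rule heat_has_space_derivative[where K = ?K and K' = ?K])
        (use that j in \<open>auto intro!: continuous_reflect[OF g s] reflect_has_vector_derivative[OF g s]
           norm_reflect_le(2)[OF g s] reflect_measurable[OF g s]\<close>)
  qed
  have B: "norm (heat (reflect (Suc j) (g (Suc j) s)) (t - s) y) \<le> ?K * gauss_exp_moment" if "s \<in> {t0..<t}" for s y
  proof -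
    have "norm (heat (reflect (Suc j) (g (Suc j) s)) (t - s) y) \<le> \<kappa> * exp (\<Lambda> * (s - t0)) * gauss_exp_moment * exp (- \<bar>y\<bar>)"
      by (rule norm_heat_reflect_le[OF g]) (use that t j in auto)
    also have "\<dots> \<le> \<kappa> * exp (\<Lambda> * 1) * gauss_exp_moment * 1"
      using that t T_le \<Lambda>_pos profileD(6)[OF g] gauss_exp_moment_nonneg
      by (intro mult_mono mult_left_mono mult_nonneg_nonneg) auto
    finally show ?thesis by simp
  qed
  have "((\<lambda>y. duhamel g j t y) has_vector_derivative duhamel g (Suc j) t y) (at y)"
    unfolding duhamel_def
  proof (rule has_vector_derivative_integral[where g = "\<lambda>s. ?K * gauss_exp_moment * indicator {t0..<t} s"])
    show "integrable lborel (\<lambda>s. ?K * gauss_exp_moment * indicator {t0..<t} s)"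
      by (intro integrable_mult_right integrable_real_indicator) (use t in auto)
    show "integrable lborel (\<lambda>s. indicator {t0..<t} s *\<^sub>R heat (reflect j (g j s)) (t - s) x)" for x
      using t j by (intro integrable_duhamel_integrand) auto
    show "norm (indicator {t0..<t} s *\<^sub>R heat (reflect j (g j s)) (t - s) x - indicator {t0..<t} s *\<^sub>R heat (reflect j (g j s)) (t - s) y)
       \<le> ?K * gauss_exp_moment * indicator {t0..<t} s * \<bar>x - y\<bar>" for x s
    proof (cases "s \<in> {t0..<t}")
      case True
      have "norm (heat (reflect j (g j s)) (t - s) x - heat (reflect j (g j s)) (t - s) y) \<le> ?K * gauss_exp_moment * \<bar>x - y\<bar>"
        by (rule lipschitz_except_origin[OF _ D[OF True] B[OF True]])
          (meson D[OF True] continuous_at_imp_continuous_on has_vector_derivative_continuous)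
      then show ?thesis using True by simp
    qed simp
    show "(\<lambda>s. indicator {t0..<t} s *\<^sub>R heat (reflect (Suc j) (g (Suc j) s)) (t - s) y) \<in> borel_measurable lborel"
      using duhamel_integrand_measurable[OF t, of "Suc j"] j by simp
    show "AE s in lborel. ((\<lambda>x. indicator {t0..<t} s *\<^sub>R heat (reflect j (g j s)) (t - s) x) has_vector_derivative
        indicator {t0..<t} s *\<^sub>R heat (reflect (Suc j) (g (Suc j) s)) (t - s) y) (at y)"
      using D by (intro AE_I2) (auto simp: indicator_def)
  qed simp
  then show ?thesis by simp
qed

lemma duhamel_0: "duhamel g 0 t 0 = 0" if "t \<in> {t0..T}"
proof -
  have "heat (reflect 0 (g 0 s)) r 0 = 0" if "s \<in> {t0..T}" for s r
    by (rule heat_odd_0) (use profileD(1)[OF g that] in \<open>auto simp: reflect_def\<close>)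
  then show ?thesis unfolding duhamel_def using that
    by (intro integral_eq_zero_AE AE_I2) (auto simp: indicator_def)
qed

lemma duhamel_initial: "duhamel g j t0 y = 0"
  by (simp add: duhamel_def)

lemma profile_duhamel: "profile (\<kappa> * gauss_exp_moment / \<Lambda>) (duhamel g)"
  unfolding profile_def
proof (intro conjI ballI allI impI)
  show "continuous_on ({t0..T} \<times> {0..}) (\<lambda>(t, y). duhamel g j t y)" if "j < 2" for j
    using that by (intro continuous_on_subset[OF continuous_duhamel[of j]]) auto
  show "continuous_on ({t0..T} \<times> {0<..}) (\<lambda>(t, y). duhamel g 2 t y)"
    by (intro continuous_on_subset[OF continuous_duhamel[of 2]]) auto
  show "norm (duhamel g j t y) \<le> \<kappa> * gauss_exp_moment / \<Lambda> * exp (\<Lambda> * (t - t0) - y)"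
    if "j \<le> 2" "t \<in> {t0..T}" "0 \<le> y" for j t y
    using norm_duhamel_le[OF that(2,1), of y] that by simp
qed (auto intro: duhamel_0 duhamel_has_space_derivative)

text \<open>Differentiating the integral at its moving endpoint is avoided. Each heat term is
  expanded in time by \<open>heat_eq_integral\<close>; Fubini over the triangle \<open>s < r\<close>
  then writes \<open>duhamel g 0 t y\<close> as the time integral of
  \<open>g 0 + duhamel g 2\<close>, which is continuous in time.\<close>

lemma duhamel_has_time_derivative:
  assumes y: "y > 0" and t: "t \<in> {t0..T}"
  shows "((\<lambda>t. duhamel g 0 t y) has_vector_derivative g 0 t y + duhamel g 2 t y) (at t within {t0..T})"
proof -
  let ?U = "\<lambda>j s t. heat (reflect j (g j s)) (t - s) y"
  let ?K = "\<kappa> * exp \<Lambda>"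
  define h where "h r = g 0 r y + duhamel g 2 r y" for r
  have cg: "continuous_on {t0..T} (\<lambda>r. g 0 r y)"
    by (rule continuous_on_slice_fst[OF profileD(2)[OF g]]) (use y in auto)
  have cd: "continuous_on {t0..T} (\<lambda>r. duhamel g 2 r y)"
    by (rule continuous_on_slice_fst[OF continuous_duhamel]) auto
  have ch: "continuous_on {t0..T} h" unfolding h_def by (intro continuous_intros cg cd)
  have eq: "duhamel g 0 t y = integral {t0..t} h" if t: "t \<in> {t0..T}" for t
  proof -
    \<comment> \<open>The triangle of integration: the first entry is the time of the source, the
      second the running time.\<close>
    define A where "A = {p :: real \<times> real. t0 \<le> fst p \<and> fst p < snd p \<and> snd p \<le> t}"
    define X where "X s r = indicator A (s, r) *\<^sub>R ?U 2 s r" for s r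
    have A: "A \<in> sets borel"
    proof -
      have "{p :: real \<times> real. t0 \<le> fst p} \<in> sets borel" "{p :: real \<times> real. snd p \<le> t} \<in> sets borel"
        by (auto intro!: borel_closed closed_Collect_le continuous_intros)
      moreover have "{p :: real \<times> real. fst p < snd p} \<in> sets borel"
        by (auto intro!: borel_open open_Collect_less continuous_intros)
      moreover have "A = {p. t0 \<le> fst p} \<inter> ({p. fst p < snd p} \<inter> {p. snd p \<le> t})" by (auto simp: A_def)
      ultimately show ?thesis by (simp only: sets.Int)
    qed
    have Xm: "case_prod X \<in> borel_measurable (lborel \<Otimes>\<^sub>M lborel)"
    proof -
      have "(\<lambda>p. indicator A p *\<^sub>R ?U 2 (fst p) (snd p)) \<in> borel_measurable borel"
      proof (rule borel_measurable_continuous_on_indicator[OF A], rule continuous_on_sequentiallyI)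
        fix u a assume u: "\<forall>n. u n \<in> A" "a \<in> A" "u \<longlonglongrightarrow> a"
        have uT: "fst (u n) \<le> T" for n
          using u(1)[rule_format, of n] t unfolding A_def by auto
        show "(\<lambda>n. ?U 2 (fst (u n)) (snd (u n))) \<longlonglongrightarrow> ?U 2 (fst a) (snd a)"
          by (rule heat_reflect_tendsto[OF g])
            (use u t uT in \<open>auto simp: A_def intro: tendsto_fst tendsto_snd less_imp_le order_trans[OF less_imp_le]\<close>)
      qed
      then show ?thesis by (simp add: X_def[abs_def] case_prod_beta' borel_prod lborel_prod)
    qed
    have Xb: "norm (X s r) \<le> ?K * gauss_exp_moment * indicator ({t0..t} \<times> {t0..t}) (s, r)" for s r
    proof (cases "(s, r) \<in> A")
      case True
      then have sr: "t0 \<le> s" "s < r" "r \<le> t" by (auto simp: A_def)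
      have "norm (?U 2 s r) \<le> \<kappa> * exp (\<Lambda> * (s - t0)) * gauss_exp_moment * exp (- \<bar>y\<bar>)"
        by (rule norm_heat_reflect_le[OF g]) (use sr t in auto)
      also have "\<dots> \<le> \<kappa> * exp (\<Lambda> * 1) * gauss_exp_moment * 1"
        using sr t T_le \<Lambda>_pos profileD(6)[OF g] gauss_exp_moment_nonneg
        by (intro mult_mono mult_left_mono mult_nonneg_nonneg) auto
      finally show ?thesis using True sr by (simp add: X_def)
    qed (use profileD(6)[OF g] gauss_exp_moment_nonneg in \<open>auto simp: X_def\<close>)
    have Xi: "integrable (lborel \<Otimes>\<^sub>M lborel) (case_prod X)"
    proof (rule Bochner_Integration.integrable_bound[OF _ Xm])
      have "emeasure (lborel \<Otimes>\<^sub>M lborel) ({t0..t} \<times> {t0..t}) < \<infinity>"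
        using t by (subst lborel.emeasure_pair_measure_Times) (auto simp: ennreal_mult_less_top)
      then show "integrable (lborel \<Otimes>\<^sub>M lborel) (\<lambda>p. ?K * gauss_exp_moment * indicator ({t0..t} \<times> {t0..t}) p)"
        by (intro integrable_mult_right integrable_real_indicator) auto
      show "AE p in lborel \<Otimes>\<^sub>M lborel. norm (case_prod X p) \<le> norm (?K * gauss_exp_moment * indicator ({t0..t} \<times> {t0..t}) p)"
      proof (rule AE_I2)
        fix p show "norm (case_prod X p) \<le> norm (?K * gauss_exp_moment * indicator ({t0..t} \<times> {t0..t}) p)"
          using order_trans[OF Xb abs_ge_self, of "fst p" "snd p"]
          by (simp only: case_prod_beta real_norm_def prod.collapse)
      qed
    qed
    have inner1: "indicator {t0..<t} s *\<^sub>R ?U 0 s t = indicator {t0..<t} s *\<^sub>R g 0 s y + (LINT r|lborel. X s r)" for s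
    proof (cases "s \<in> {t0..<t}")
      case True
      then have s: "s \<in> {t0..T}" "s \<le> t" using t by auto
      have "((\<lambda>r. ?U 2 s r) has_integral (?U 0 s t - reflect 0 (g 0 s) y)) {s..t}"
        by (rule heat_eq_integral[where ?f1.0 = "reflect 1 (g 1 s)" and K = ?K])
          (use reflect_has_vector_derivative[OF g s(1), of 0] reflect_has_vector_derivative[OF g s(1), of 1] s
            in \<open>auto intro!: continuous_reflect[OF g] norm_reflect_le(2)[OF g] reflect_measurable[OF g] simp: numeral_2_eq_2\<close>)
      then have 1: "?U 0 s t - g 0 s y = integral {s..t} (?U 2 s)"
        using y by (simp add: integral_unique reflect_def)
      have si: "set_integrable lborel {s..t} (?U 2 s)"
      proof -
        have cts: "continuous_on {s..t} (?U 2 s)"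
          by (rule continuous_on_sequentiallyI, rule heat_reflect_tendsto[OF g]) (use s y in auto)
        show ?thesis unfolding set_integrable_def by (rule borel_integrable_compact[OF compact_Icc cts])
      qed
      have "integral {s..t} (?U 2 s) = (LINT r:{s..t}|lborel. ?U 2 s r)"
        using set_borel_integral_eq_integral(2)[OF si] by simp
      also have "\<dots> = (LINT r|lborel. X s r)"
        unfolding set_lebesgue_integral_def
      proof (rule integral_cong_AE)
        have "AE r in lborel. r \<noteq> s" by (rule AE_lborel_singleton)
        then show "AE r in lborel. indicator {s..t} r *\<^sub>R ?U 2 s r = X s r"
          by eventually_elim (use True in \<open>auto simp: X_def A_def indicator_def\<close>)
        show "(\<lambda>r. indicator {s..t} r *\<^sub>R ?U 2 s r) \<in> borel_measurable lborel"
          using si unfolding set_integrable_def by (rule borel_measurable_integrable)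
        show "X s \<in> borel_measurable lborel"
          using measurable_compose[OF measurable_Pair1' Xm, of s] by simp
      qed
      finally show ?thesis using 1 True by (simp add: algebra_simps)
    next
      case False
      then have "X s r = 0" for r by (auto simp: X_def A_def indicator_def)
      then show ?thesis using False by simp
    qed
    have inner2: "(LINT s|lborel. X s r) = indicator {t0..t} r *\<^sub>R duhamel g 2 r y" for r
    proof (cases "r \<in> {t0..t}")
      case True
      then have "X s r = indicator {t0..<r} s *\<^sub>R ?U 2 s r" for s
        by (auto simp: X_def A_def indicator_def)
      then show ?thesis using True by (simp add: duhamel_def)
    next
      case False
      then have "X s r = 0" for s by (auto simp: X_def A_def indicator_def)
      then show ?thesis using False by simp
    qed
    have i1: "integrable lborel (\<lambda>s. indicator {t0..t} s *\<^sub>R g 0 s y)"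
      by (rule borel_integrable_compact) (use cg t in \<open>auto intro: continuous_on_subset\<close>)
    have i1': "integrable lborel (\<lambda>s. indicator {t0..<t} s *\<^sub>R g 0 s y)"
      and e1: "(LINT s|lborel. indicator {t0..<t} s *\<^sub>R g 0 s y) = (LINT s|lborel. indicator {t0..t} s *\<^sub>R g 0 s y)"
    proof -
      have eq: "(\<lambda>s. indicator {t0..<t} s *\<^sub>R g 0 s y) = (\<lambda>s. indicator {t0..<t} s *\<^sub>R (indicator {t0..t} s *\<^sub>R g 0 s y))"
        by (auto simp: indicator_def)
      show i: "integrable lborel (\<lambda>s. indicator {t0..<t} s *\<^sub>R g 0 s y)"
        unfolding eq by (rule integrable_mult_indicator[OF _ i1]) auto
      have "AE s in lborel. s \<noteq> t" by (rule AE_lborel_singleton)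
      then have ae: "AE s in lborel. indicator {t0..<t} s *\<^sub>R g 0 s y = indicator {t0..t} s *\<^sub>R g 0 s y"
        by eventually_elim (auto simp: indicator_def)
      show "(LINT s|lborel. indicator {t0..<t} s *\<^sub>R g 0 s y) = (LINT s|lborel. indicator {t0..t} s *\<^sub>R g 0 s y)"
        by (rule integral_cong_AE[OF _ _ ae]) (use i i1 in \<open>auto dest: borel_measurable_integrable\<close>)
    qed
    have i2: "integrable lborel (\<lambda>r. indicator {t0..t} r *\<^sub>R duhamel g 2 r y)"
      by (rule borel_integrable_compact) (use cd t in \<open>auto intro: continuous_on_subset\<close>)
    have "duhamel g 0 t y = (LINT s|lborel. indicator {t0..<t} s *\<^sub>R g 0 s y + (LINT r|lborel. X s r))"
      unfolding duhamel_def inner1 ..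
    also have "\<dots> = (LINT s|lborel. indicator {t0..<t} s *\<^sub>R g 0 s y) + (LINT s|lborel. LINT r|lborel. X s r)"
      using lborel_pair.integrable_fst[OF Xi] i1' by (intro Bochner_Integration.integral_add) auto
    also have "(LINT s|lborel. LINT r|lborel. X s r) = (LINT r|lborel. LINT s|lborel. X s r)"
      using lborel_pair.Fubini_integral[OF Xi] by simp
    also have "\<dots> = (LINT r|lborel. indicator {t0..t} r *\<^sub>R duhamel g 2 r y)" unfolding inner2 ..
    finally have "duhamel g 0 t y = (LINT r|lborel. indicator {t0..t} r *\<^sub>R g 0 r y + indicator {t0..t} r *\<^sub>R duhamel g 2 r y)"
      using i1 i2 by (simp add: e1)
    also have "\<dots> = (LINT r:{t0..t}|lborel. h r)"
      by (simp add: set_lebesgue_integral_def h_def scaleR_add_right)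
    also have "\<dots> = integral {t0..t} h"
    proof (rule set_borel_integral_eq_integral(2))
      show "set_integrable lborel {t0..t} h" unfolding set_integrable_def
        by (rule borel_integrable_compact) (use ch t in \<open>auto intro: continuous_on_subset\<close>)
    qed
    finally show ?thesis .
  qed
  have "((\<lambda>t. integral {t0..t} h) has_vector_derivative h t) (at t within {t0..T})"
    by (rule integral_has_vector_derivative[OF ch t])
  then show ?thesis unfolding h_def[symmetric]
    by (rule has_vector_derivative_transform[OF t eq, rotated])
qed

end

end

section \<open>A cutoff near the wall and the tails of decaying profiles\<close>

text \<open>A family closed under differentiation, so that every derivative of the cutoff is known
  by its four coefficients.\<close>

definition cubic_exp :: "real \<Rightarrow> real \<Rightarrow> real \<Rightarrow> real \<Rightarrow> real \<Rightarrow> complex" where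
  "cubic_exp a b c d y = of_real ((a * y^3 + b * y\<^sup>2 + c * y + d) * exp (- 2 * y))"

lemma cubic_exp_deriv:
  "(cubic_exp a b c d has_vector_derivative
     cubic_exp (- 2 * a) (3 * a - 2 * b) (2 * b - 2 * c) (c - 2 * d) y) (at y)"
proof -
  have "((\<lambda>y. (a * y^3 + b * y\<^sup>2 + c * y + d) * exp (- 2 * y)) has_real_derivative
     (- 2 * a * y^3 + (3 * a - 2 * b) * y\<^sup>2 + (2 * b - 2 * c) * y + (c - 2 * d)) * exp (- 2 * y)) (at y)"
    by (auto intro!: derivative_eq_intros simp: algebra_simps power2_eq_square power3_eq_cube)
  from has_vector_derivative_of_real[OF this] show ?thesis
    by (simp add: cubic_exp_def[abs_def])
qed

lemma continuous_cubic_exp: "continuous_on A (cubic_exp a b c d)"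
  unfolding cubic_exp_def by (intro continuous_intros)

lemma power_le_fact_exp: "y ^ n \<le> fact n * exp y" if "y \<ge> 0" for y :: real
proof -
  have "sum (\<lambda>n. y ^ n /\<^sub>R fact n) {n} \<le> (\<Sum>n. y ^ n /\<^sub>R fact n)"
    by (intro sum_le_suminf summable_exp_generic) (use that in auto)
  then have "y ^ n / fact n \<le> exp y" by (simp add: exp_def divide_inverse mult.commute)
  then show ?thesis by (simp add: field_simps)
qed

text \<open>The 6 is \<open>3!\<close> in \<open>y^n \<le> n! * exp y\<close>. Without a constant
  coefficient one factor \<open>y\<close> splits off, and what remains is bounded.\<close>

lemma norm_cubic_exp_le:
  assumes y: "y \<ge> 0"
  shows "norm (cubic_exp a b c d y) \<le> 6 * (\<bar>a\<bar> + \<bar>b\<bar> + \<bar>c\<bar> + \<bar>d\<bar>) * exp (- y)"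
    and "norm (cubic_exp a b c 0 y) \<le> 6 * (\<bar>a\<bar> + \<bar>b\<bar> + \<bar>c\<bar>) * y"
proof -
  have "1 \<le> exp y" using y one_le_exp_iff by blast
  then have e4: "1 \<le> 6 * exp y" by linarith
  have e: "y^3 \<le> 6 * exp y" "y\<^sup>2 \<le> 6 * exp y" "y \<le> 6 * exp y"
  proof -
    have pos: "0 < exp y" by simp
    show "y^3 \<le> 6 * exp y" using power_le_fact_exp[OF y, of 3] by (simp add: fact_numeral)
    show "y\<^sup>2 \<le> 6 * exp y" using power_le_fact_exp[OF y, of 2] pos by (simp add: fact_numeral, linarith)
    show "y \<le> 6 * exp y" using power_le_fact_exp[OF y, of 1] pos by (simp, linarith)
  qed
  note e = e e4
  have "\<bar>a * y^3 + b * y\<^sup>2 + c * y + d\<bar> \<le> \<bar>a\<bar> * y^3 + \<bar>b\<bar> * y\<^sup>2 + \<bar>c\<bar> * y + \<bar>d\<bar> * 1"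
  proof -
    have "\<bar>a * y^3\<bar> = \<bar>a\<bar> * y^3" "\<bar>b * y\<^sup>2\<bar> = \<bar>b\<bar> * y\<^sup>2" "\<bar>c * y\<bar> = \<bar>c\<bar> * y"
      using y by (simp_all add: abs_mult)
    then show ?thesis by linarith
  qed
  also have "\<dots> \<le> \<bar>a\<bar> * (6 * exp y) + \<bar>b\<bar> * (6 * exp y) + \<bar>c\<bar> * (6 * exp y) + \<bar>d\<bar> * (6 * exp y)"
    by (intro add_mono mult_left_mono e) auto
  finally have 1: "\<bar>a * y^3 + b * y\<^sup>2 + c * y + d\<bar> \<le> 6 * (\<bar>a\<bar> + \<bar>b\<bar> + \<bar>c\<bar> + \<bar>d\<bar>) * exp y"
    by (simp add: algebra_simps)
  have "norm (cubic_exp a b c d y) = \<bar>a * y^3 + b * y\<^sup>2 + c * y + d\<bar> * exp (- 2 * y)"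
    by (simp add: cubic_exp_def abs_mult norm_mult del: of_real_add of_real_mult of_real_power flip: of_real_mult)
  also have "\<dots> \<le> 6 * (\<bar>a\<bar> + \<bar>b\<bar> + \<bar>c\<bar> + \<bar>d\<bar>) * exp y * exp (- 2 * y)"
    using 1 by (intro mult_right_mono) auto
  also have "\<dots> = 6 * (\<bar>a\<bar> + \<bar>b\<bar> + \<bar>c\<bar> + \<bar>d\<bar>) * exp (- y)"
    by (simp add: mult.assoc flip: exp_add)
  finally show "norm (cubic_exp a b c d y) \<le> 6 * (\<bar>a\<bar> + \<bar>b\<bar> + \<bar>c\<bar> + \<bar>d\<bar>) * exp (- y)" .
  have "cubic_exp a b c 0 y = cubic_exp 0 a b c y * y"
    by (simp add: cubic_exp_def algebra_simps power2_eq_square power3_eq_cube)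
  moreover have "norm (cubic_exp 0 a b c y) \<le> 6 * (\<bar>a\<bar> + \<bar>b\<bar> + \<bar>c\<bar>) * 1"
  proof -
    have "\<bar>0 * y^3 + a * y\<^sup>2 + b * y + c\<bar> \<le> \<bar>a\<bar> * y\<^sup>2 + \<bar>b\<bar> * y + \<bar>c\<bar> * 1"
    proof -
      have "\<bar>a * y\<^sup>2\<bar> = \<bar>a\<bar> * y\<^sup>2" "\<bar>b * y\<bar> = \<bar>b\<bar> * y"
        using y by (simp_all add: abs_mult)
      then show ?thesis by linarith
    qed
    also have "\<dots> \<le> \<bar>a\<bar> * (6 * exp y) + \<bar>b\<bar> * (6 * exp y) + \<bar>c\<bar> * (6 * exp y)"
      by (intro add_mono mult_left_mono e) auto
    finally have 1: "\<bar>0 * y^3 + a * y\<^sup>2 + b * y + c\<bar> \<le> 6 * (\<bar>a\<bar> + \<bar>b\<bar> + \<bar>c\<bar>) * exp y"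
      by (simp add: algebra_simps)
    have "norm (cubic_exp 0 a b c y) = \<bar>0 * y^3 + a * y\<^sup>2 + b * y + c\<bar> * exp (- 2 * y)"
      by (simp add: cubic_exp_def abs_mult norm_mult del: of_real_add of_real_mult of_real_power flip: of_real_mult)
    also have "\<dots> \<le> 6 * (\<bar>a\<bar> + \<bar>b\<bar> + \<bar>c\<bar>) * exp y * exp (- 2 * y)"
      using 1 by (intro mult_right_mono) auto
    also have "\<dots> = 6 * (\<bar>a\<bar> + \<bar>b\<bar> + \<bar>c\<bar>) * exp (- y)" by (simp add: mult.assoc flip: exp_add)
    also have "\<dots> \<le> 6 * (\<bar>a\<bar> + \<bar>b\<bar> + \<bar>c\<bar>) * 1" using y by (intro mult_left_mono) auto
    finally show ?thesis .
  qed
  ultimately show "norm (cubic_exp a b c 0 y) \<le> 6 * (\<bar>a\<bar> + \<bar>b\<bar> + \<bar>c\<bar>) * y"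
    using y by (simp add: norm_mult mult_right_mono)
qed

text \<open>\<open>cutoff 0\<close> is \<open>e\<^bsup>-2y\<^esup>\<close> times a Taylor polynomial of \<open>e\<^bsup>2y\<^esup>\<close>, so that
  \<open>1 - cutoff 0\<close> vanishes to fourth order at the wall.\<close>

definition cutoff :: "nat \<Rightarrow> real \<Rightarrow> complex" where
  "cutoff j = [cubic_exp (4/3) 2 2 1, cubic_exp (- (8/3)) 0 0 0, cubic_exp (16/3) (- 8) 0 0,
     cubic_exp (- (32/3)) 32 (- 16) 0, cubic_exp (64/3) (- 96) 96 (- 16),
     cubic_exp (- (128/3)) 256 (- 384) 128] ! j"

lemma cutoff_deriv: "j < 5 \<Longrightarrow> (cutoff j has_vector_derivative cutoff (Suc j) y) (at y)"
proof -
  assume "j < 5"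
  then consider "j = 0" | "j = 1" | "j = 2" | "j = 3" | "j = 4" by linarith
  then show ?thesis
  proof cases
    case 1 then show ?thesis using cubic_exp_deriv[of "4/3" 2 2 1 y] by (simp add: cutoff_def)
  next
    case 2 then show ?thesis using cubic_exp_deriv[of "- (8/3)" 0 0 0 y] by (simp add: cutoff_def)
  next
    case 3 then show ?thesis using cubic_exp_deriv[of "16/3" "- 8" 0 0 y] by (simp add: cutoff_def eval_nat_numeral)
  next
    case 4 then show ?thesis using cubic_exp_deriv[of "- (32/3)" 32 "- 16" 0 y] by (simp add: cutoff_def eval_nat_numeral)
  next
    case 5 then show ?thesis using cubic_exp_deriv[of "64/3" "- 96" 96 "- 16" y] by (simp add: cutoff_def eval_nat_numeral)
  qed
qed

text \<open>The worst case is \<open>j = 5\<close>, where 6 times the sum of the coefficients is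
  4864.\<close>

lemma norm_cutoff_le: "j \<le> 5 \<Longrightarrow> y \<ge> 0 \<Longrightarrow> norm (cutoff j y) \<le> 5000 * exp (- y)"
proof -
  assume a: "j \<le> 5" "y \<ge> 0"
  then have cs: "j = 0 \<or> j = 1 \<or> j = 2 \<or> j = 3 \<or> j = 4 \<or> j = 5" by linarith
  have *: "norm (cubic_exp a b c d y) \<le> 5000 * exp (- y)" if "6 * (\<bar>a\<bar> + \<bar>b\<bar> + \<bar>c\<bar> + \<bar>d\<bar>) \<le> 5000" for a b c d
    by (rule order_trans[OF norm_cubic_exp_le(1)[OF a(2)] mult_right_mono[OF that]]) simp
  show ?thesis using cs
    by (elim disjE) (auto simp: cutoff_def eval_nat_numeral intro!: *)
qed

text \<open>These are the derivatives whose constant coefficient is 0. Their vanishing at the wall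
  keeps the correction terms compatible with the boundary condition.\<close>

lemma norm_cutoff_near_wall: "j \<in> {1, 2, 3} \<Longrightarrow> y \<ge> 0 \<Longrightarrow> norm (cutoff j y) \<le> 5000 * y"
proof -
  assume a: "j \<in> {1, 2, 3}" "y \<ge> 0"
  have *: "norm (cubic_exp a b c 0 y) \<le> 5000 * y" if "6 * (\<bar>a\<bar> + \<bar>b\<bar> + \<bar>c\<bar>) \<le> 5000" for a b c
    by (rule order_trans[OF norm_cubic_exp_le(2)[OF a(2)] mult_right_mono[OF that a(2)]])
  show ?thesis using a(1) by (auto simp: cutoff_def eval_nat_numeral intro!: *)
qed

lemma cutoff_0_0: "cutoff 0 0 = 1" by (simp add: cutoff_def cubic_exp_def)

lemma norm_cutoff_0_diff: assumes "y \<ge> 0" shows "norm (cutoff 0 y - 1) \<le> 5000 * y"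
proof -
  have "norm (cutoff 0 y - cutoff 0 0) \<le> 5000 * y - 5000 * 0" if "y > 0"
  proof (rule differentiable_bound_general[OF that, where f' = "cutoff 1" and \<phi>' = "\<lambda>_. 5000"])
    show "(cutoff 0 has_vector_derivative cutoff 1 x) (at x)" for x
      using cutoff_deriv[of 0 x] by simp
    show "continuous_on {0..y} (cutoff 0)"
      by (simp add: cutoff_def continuous_cubic_exp)
    show "norm (cutoff 1 x) \<le> 5000" if "0 < x" for x
    proof -
      have "norm (cutoff 1 x) \<le> 5000 * exp (- x)" using that by (intro norm_cutoff_le) auto
      also have "\<dots> \<le> 5000 * 1" using that by (intro mult_left_mono) auto
      finally show ?thesis by simp
    qed
  qed (auto intro!: continuous_intros derivative_eq_intros simp: has_real_derivative_iff_has_vector_derivative[symmetric])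
  then show ?thesis using assms by (cases "y = 0") (auto simp: cutoff_0_0)
qed

lemma continuous_cutoff: "j \<le> 5 \<Longrightarrow> continuous_on A (cutoff j)"
proof -
  assume a: "j \<le> 5"
  then consider "j = 0" | "j = 1" | "j = 2" | "j = 3" | "j = 4" | "j = 5" by linarith
  then show ?thesis
    by cases (auto simp: cutoff_def eval_nat_numeral intro: continuous_cubic_exp)
qed

section \<open>Tails and total mass of a profile\<close>

context time_interval begin

definition tail :: "(nat \<Rightarrow> real \<Rightarrow> real \<Rightarrow> complex) \<Rightarrow> real \<Rightarrow> real \<Rightarrow> complex" where
  "tail w t y = integral {y..} (w 0 t)"

definition mass :: "(nat \<Rightarrow> real \<Rightarrow> real \<Rightarrow> complex) \<Rightarrow> real \<Rightarrow> complex" where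
  "mass w t = tail w t 0"

definition mass_integral :: "(nat \<Rightarrow> real \<Rightarrow> real \<Rightarrow> complex) \<Rightarrow> real \<Rightarrow> complex" where
  "mass_integral w t = integral {t0..t} (mass w)"

context
  fixes \<kappa> w assumes w: "profile \<kappa> w"
begin

lemma exp_bound_integral:
  "(\<lambda>z. \<kappa> * exp (\<Lambda> * (t - t0) - z)) integrable_on {y..}"
  "integral {y..} (\<lambda>z. \<kappa> * exp (\<Lambda> * (t - t0) - z)) = \<kappa> * exp (\<Lambda> * (t - t0) - y)"
proof -
  have "((\<lambda>z. \<kappa> * exp (\<Lambda> * (t - t0)) * exp (- 1 * z)) has_integral \<kappa> * exp (\<Lambda> * (t - t0)) * (exp (- 1 * y) / 1)) {y..}"
    by (intro has_integral_mult_right has_integral_exp_minus_to_infinity) simp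
  then have "((\<lambda>z. \<kappa> * exp (\<Lambda> * (t - t0) - z)) has_integral \<kappa> * exp (\<Lambda> * (t - t0) - y)) {y..}"
    by (simp add: exp_minus_mult mult.assoc)
  then show "(\<lambda>z. \<kappa> * exp (\<Lambda> * (t - t0) - z)) integrable_on {y..}"
    "integral {y..} (\<lambda>z. \<kappa> * exp (\<Lambda> * (t - t0) - z)) = \<kappa> * exp (\<Lambda> * (t - t0) - y)"
    by (blast intro: integral_unique)+
qed

lemma profile_integrable_tail:
  assumes "t \<in> {t0..T}" "y \<ge> 0" shows "w 0 t integrable_on {y..}"
proof (rule measurable_bounded_by_integrable_imp_integrable[OF _ exp_bound_integral(1)[of t y]])
  show "w 0 t \<in> borel_measurable (lebesgue_on {y..})"
    by (intro continuous_imp_measurable_on_sets_lebesgue continuous_on_subset[OF continuous_profile_slice(1)[OF w assms(1)]])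
      (use assms in auto)
  show "norm (w 0 t z) \<le> \<kappa> * exp (\<Lambda> * (t - t0) - z)" if "z \<in> {y..}" for z
    using profileD(5)[OF w, of 0 t z] assms that by auto
qed auto

lemma norm_tail_le:
  assumes "t \<in> {t0..T}" "y \<ge> 0" shows "norm (tail w t y) \<le> \<kappa> * exp (\<Lambda> * (t - t0) - y)"
proof -
  have "norm (tail w t y) \<le> integral {y..} (\<lambda>z. \<kappa> * exp (\<Lambda> * (t - t0) - z))"
    unfolding tail_def
    by (rule integral_norm_bound_integral[OF profile_integrable_tail[OF assms] exp_bound_integral(1)])
      (use profileD(5)[OF w, of 0 t] assms in auto)
  then show ?thesis by (simp only: exp_bound_integral(2))
qed

lemma profile_integrable_Icc:
  assumes "t \<in> {t0..T}" "a \<ge> 0" shows "w 0 t integrable_on {a..b}"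
  by (intro integrable_continuous_interval continuous_on_subset[OF continuous_profile_slice(1)[OF w assms(1)]])
    (use assms in auto)

lemma tail_eq:
  assumes "t \<in> {t0..T}" "a \<ge> 0" "a \<le> b" shows "tail w t a = integral {a..b} (w 0 t) + tail w t b"
proof -
  have "(w 0 t has_integral (integral {a..b} (w 0 t) + integral {b..} (w 0 t))) ({a..b} \<union> {b..})"
  proof (rule has_integral_Un)
    have "{a..b} \<inter> {b..} = {b}" using assms by auto
    then show "negligible ({a..b} \<inter> {b..})" by simp
  qed (use assms in \<open>auto intro!: integrable_integral profile_integrable_tail profile_integrable_Icc\<close>)
  moreover have "{a..b} \<union> {b..} = {a..}" using assms by auto
  ultimately show ?thesis by (simp add: tail_def integral_unique)
qed

lemma tail_has_derivative:
  assumes t: "t \<in> {t0..T}" and y: "y > 0"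
  shows "(tail w t has_vector_derivative - w 0 t y) (at y)"
proof -
  have "((\<lambda>y. integral {0..y} (w 0 t)) has_vector_derivative w 0 t y) (at y within {0..y + 1})"
    by (intro integral_has_vector_derivative continuous_on_subset[OF continuous_profile_slice(1)[OF w t]])
      (use y in auto)
  moreover have "at y within {0..y+1} = at y" using y by (intro at_within_interior) auto
  ultimately have "((\<lambda>y. integral {0..y} (w 0 t)) has_vector_derivative w 0 t y) (at y)" by simp
  then have "((\<lambda>y. tail w t 0 - integral {0..y} (w 0 t)) has_vector_derivative 0 - w 0 t y) (at y)"
    by (intro has_vector_derivative_diff has_vector_derivative_const)
  then have "((\<lambda>y. tail w t 0 - integral {0..y} (w 0 t)) has_vector_derivative - w 0 t y) (at y)" by simp
  then show ?thesis
    by (rule has_vector_derivative_transform_within_open[where S = "{0<..}"])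
      (use y in \<open>auto simp: tail_eq[OF t order_refl less_imp_le]\<close>)
qed

lemma norm_profile_le_const:
  assumes "t \<in> {t0..T}" "y \<ge> 0" "j \<le> 2" shows "norm (w j t y) \<le> \<kappa> * exp \<Lambda>"
proof -
  have "\<Lambda> * (t - t0) \<le> \<Lambda> * 1" using assms T_le \<Lambda>_pos by (intro mult_left_mono) auto
  then have "\<kappa> * exp (\<Lambda> * (t - t0) - y) \<le> \<kappa> * exp (\<Lambda> * 1)"
    using assms profileD(6)[OF w] by (intro mult_left_mono) auto
  then show ?thesis using profileD(5)[OF w assms(3,1,2)] by simp
qed

lemma norm_integral_profile_le:
  assumes "t \<in> {t0..T}" "0 \<le> a" "a \<le> b" shows "norm (tail w t a - tail w t b) \<le> \<kappa> * exp \<Lambda> * (b - a)"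
proof -
  have "norm (integral {a..b} (w 0 t)) \<le> \<kappa> * exp \<Lambda> * (b - a)"
    by (rule integral_bound[OF assms(3)])
      (use assms norm_profile_le_const in \<open>auto intro!: continuous_on_subset[OF continuous_profile_slice(1)[OF w assms(1)]]\<close>)
  then show ?thesis using tail_eq[OF assms] by simp
qed

lemma continuous_tail: "continuous_on ({t0..T} \<times> {0..}) (\<lambda>(t, y). tail w t y)"
proof (rule continuous_on_sequentiallyI)
  fix u a assume u: "\<forall>n. u n \<in> {t0..T} \<times> {0::real..}" "a \<in> {t0..T} \<times> {0..}" "u \<longlonglongrightarrow> a"
  obtain t y where a: "a = (t, y)" by force
  have m: "t \<in> {t0..T}" "\<And>n. fst (u n) \<in> {t0..T}" "y \<ge> 0" "\<And>n. snd (u n) \<ge> 0" using u a by (auto simp: mem_Times_iff)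
  have lim: "(\<lambda>n. fst (u n)) \<longlonglongrightarrow> t" "(\<lambda>n. snd (u n)) \<longlonglongrightarrow> y"
    using tendsto_fst[OF u(3)] tendsto_snd[OF u(3)] a by auto
  \<comment> \<open>Time and space are separated: dominated convergence at the fixed lower limit
    \<open>y\<close>, then a Lipschitz bound in the lower limit that is uniform in time.\<close>
  have 1: "(\<lambda>n. tail w (fst (u n)) y) \<longlonglongrightarrow> tail w t y"
    unfolding tail_def
  proof (rule dominated_convergence(2)[where h = "\<lambda>z. \<kappa> * exp (\<Lambda> * (T - t0) - z)"])
    show "norm (w 0 (fst (u n)) z) \<le> \<kappa> * exp (\<Lambda> * (T - t0) - z)" if "z \<in> {y..}" for n z
    proof -
      have "norm (w 0 (fst (u n)) z) \<le> \<kappa> * exp (\<Lambda> * (fst (u n) - t0) - z)"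
        using profileD(5)[OF w, of 0 "fst (u n)" z] m that by auto
      also have "\<dots> \<le> \<kappa> * exp (\<Lambda> * (T - t0) - z)"
        using m(2)[of n] \<Lambda>_pos profileD(6)[OF w] by (intro mult_left_mono) auto
      finally show ?thesis .
    qed
    show "(\<lambda>n. w 0 (fst (u n)) z) \<longlonglongrightarrow> w 0 t z" if "z \<in> {y..}" for z
    proof -
      have "continuous_on {t0..T} (\<lambda>t. w 0 t z)"
        by (rule continuous_on_slice_fst[OF profileD(2)[OF w]]) (use that m in auto)
      then show ?thesis by (rule continuous_on_tendsto_compose) (use lim m in auto)
    qed
  qed (use m in \<open>auto intro!: profile_integrable_tail exp_bound_integral\<close>)
  have 2: "(\<lambda>n. tail w (fst (u n)) (snd (u n)) - tail w (fst (u n)) y) \<longlonglongrightarrow> 0"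
  proof (rule Lim_null_comparison)
    show "\<forall>\<^sub>F n in sequentially. norm (tail w (fst (u n)) (snd (u n)) - tail w (fst (u n)) y)
        \<le> \<kappa> * exp \<Lambda> * \<bar>snd (u n) - y\<bar>"
    proof (rule always_eventually, rule allI)
      fix n
      show "norm (tail w (fst (u n)) (snd (u n)) - tail w (fst (u n)) y) \<le> \<kappa> * exp \<Lambda> * \<bar>snd (u n) - y\<bar>"
        using norm_integral_profile_le[OF m(2)[of n], of "snd (u n)" y]
          norm_integral_profile_le[OF m(2)[of n], of y "snd (u n)"] m(3) m(4)[of n]
        by (cases "snd (u n) \<le> y") (auto simp: norm_minus_commute)
    qed
    have "(\<lambda>n. \<kappa> * exp \<Lambda> * \<bar>snd (u n) - y\<bar>) \<longlonglongrightarrow> \<kappa> * exp \<Lambda> * \<bar>y - y\<bar>"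
      by (intro tendsto_intros lim)
    then show "(\<lambda>n. \<kappa> * exp \<Lambda> * \<bar>snd (u n) - y\<bar>) \<longlonglongrightarrow> 0" by simp
  qed
  from tendsto_add[OF 1 2] show "(\<lambda>n. case u n of (t, y) \<Rightarrow> tail w t y) \<longlonglongrightarrow> (case a of (t, y) \<Rightarrow> tail w t y)"
    by (simp add: a case_prod_beta)
qed

lemma continuous_mass: "continuous_on {t0..T} (mass w)"
  unfolding mass_def[abs_def] by (rule continuous_on_slice_fst[OF continuous_tail]) simp

lemma norm_mass_le: "t \<in> {t0..T} \<Longrightarrow> norm (mass w t) \<le> \<kappa> * exp (\<Lambda> * (t - t0))"
  using norm_tail_le[of t 0] by (simp add: mass_def)

lemma mass_integral_has_derivative:
  "t \<in> {t0..T} \<Longrightarrow> (mass_integral w has_vector_derivative mass w t) (at t within {t0..T})"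
  unfolding mass_integral_def[abs_def] by (rule integral_has_vector_derivative[OF continuous_mass])

lemma norm_mass_integral_le:
  assumes t: "t \<in> {t0..T}" shows "norm (mass_integral w t) \<le> \<kappa> * exp (\<Lambda> * (t - t0))"
proof -
  have k: "\<kappa> \<ge> 0" by (rule profileD(6)[OF w])
  have "norm (integral {t0..t} (mass w)) \<le> (\<kappa> * exp (\<Lambda> * (t - t0))) * (t - t0)"
  proof (rule integral_bound)
    show "norm (mass w s) \<le> \<kappa> * exp (\<Lambda> * (t - t0))" if "s \<in> {t0..t}" for s
    proof -
      have "norm (mass w s) \<le> \<kappa> * exp (\<Lambda> * (s - t0))" using that t by (intro norm_mass_le) auto
      also have "\<dots> \<le> \<kappa> * exp (\<Lambda> * (t - t0))"
        using that k \<Lambda>_pos by (intro mult_left_mono) auto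
      finally show ?thesis .
    qed
  qed (use t in \<open>auto intro: continuous_on_subset[OF continuous_mass]\<close>)
  also have "\<dots> \<le> (\<kappa> * exp (\<Lambda> * (t - t0))) * 1"
    using t T_le k by (intro mult_left_mono) auto
  finally show ?thesis by (simp add: mass_integral_def)
qed

end
end

section \<open>Existence for a single Fourier mode\<close>

lemma norm_mult_le: "norm a \<le> A \<Longrightarrow> norm b \<le> B \<Longrightarrow> norm (a * b) \<le> A * B" for a b :: complex
  by (simp add: norm_mult mult_mono')
lemma norm_add_le: "norm a \<le> A \<Longrightarrow> norm b \<le> B \<Longrightarrow> norm (a + b) \<le> A + B" for a b :: complex
  by (meson add_mono norm_triangle_le)
lemma norm_diff_le: "norm a \<le> A \<Longrightarrow> norm b \<le> B \<Longrightarrow> norm (a - b) \<le> A + B" for a b :: complex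
  by (meson add_mono norm_triangle_le_diff)

lemma continuous_on_wall:
  fixes f :: "real \<Rightarrow> real \<Rightarrow> complex"
  assumes "continuous_on (A \<times> {0<..}) (\<lambda>(t, y). f t y)" and b: "\<And>t y. t \<in> A \<Longrightarrow> y \<ge> 0 \<Longrightarrow> norm (f t y) \<le> C * y"
  shows "continuous_on (A \<times> {0..}) (\<lambda>(t, y). f t y)"
proof (rule continuous_on_sequentiallyI)
  fix u a assume u: "\<forall>n. u n \<in> A \<times> {0::real..}" "a \<in> A \<times> {0..}" "u \<longlonglongrightarrow> a"
  obtain t y where a: "a = (t, y)" by force
  show "(\<lambda>n. case u n of (t, y) \<Rightarrow> f t y) \<longlonglongrightarrow> (case a of (t, y) \<Rightarrow> f t y)"
  proof (cases "y = 0")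
    case True
    have f0: "f t 0 = 0" using b[of t 0] u(2) a by auto
    have "(\<lambda>n. C * snd (u n)) \<longlonglongrightarrow> C * snd a" by (intro tendsto_intros tendsto_snd u)
    then have "(\<lambda>n. C * snd (u n)) \<longlonglongrightarrow> 0" by (simp add: a True)
    moreover have "\<forall>\<^sub>F n in sequentially. norm (case u n of (t, y) \<Rightarrow> f t y) \<le> C * snd (u n)"
      using u(1) b by (auto intro!: always_eventually simp: case_prod_beta mem_Times_iff)
    ultimately have "(\<lambda>n. case u n of (t, y) \<Rightarrow> f t y) \<longlonglongrightarrow> 0" by (rule Lim_null_comparison[rotated])
    then show ?thesis by (simp add: a True f0)
  next
    case False
    then have a': "a \<in> A \<times> {0<..}" using u(2) a by auto
    have "(\<lambda>n. snd (u n)) \<longlonglongrightarrow> y" using tendsto_snd[OF u(3)] a by simp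
    moreover have "0 < y" using a' a by auto
    ultimately have "\<forall>\<^sub>F n in sequentially. snd (u n) > 0" by (rule order_tendstoD(1))
    then have "\<forall>\<^sub>F n in sequentially. u n \<in> A \<times> {0<..}"
      by eventually_elim (use u(1) in \<open>auto simp: mem_Times_iff\<close>)
    then show ?thesis by (rule continuous_on_tendsto_compose[OF assms(1) u(3) a'])
  qed
qed

section \<open>The mode equation, with the derivatives \<open>s j\<close> of the shear flow and
  \<open>c = \<i> * k\<close> as coefficients\<close>

locale mode_problem = time_interval t0 T \<Lambda> for t0 T \<Lambda> :: real +
  fixes s :: "nat \<Rightarrow> real \<Rightarrow> real \<Rightarrow> complex" and c :: complex and K :: real
  assumes s_deriv: "\<And>j t y. j < 4 \<Longrightarrow> t \<in> {t0..T} \<Longrightarrow> y > 0 \<Longrightarrow> (s j t has_vector_derivative s (Suc j) t y) (at y)"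
    and s_cont: "\<And>j. j \<le> 4 \<Longrightarrow> continuous_on ({t0..T} \<times> {0<..}) (\<lambda>(t, y). s j t y)"
    and s_bound: "\<And>j t y. j \<le> 4 \<Longrightarrow> t \<in> {t0..T} \<Longrightarrow> y \<ge> 0 \<Longrightarrow> norm (s j t y) \<le> K"
    and s_wall: "\<And>t y. t \<in> {t0..T} \<Longrightarrow> y \<ge> 0 \<Longrightarrow> norm (s 0 t y) \<le> K * y"
begin

lemma K_nonneg: "K \<ge> 0"
  using s_bound[of 0 t0 0] t0_less norm_ge_zero order_trans by (meson atLeastAtMost_iff less_imp_le order_refl zero_le)

text \<open>
  As \<open>y \<rightarrow> \<infinity>\<close> the primitive \<open>\<psi>\<close> of \<open>u\<close> tends to a constant, so the nonlocal term \<open>s 1 t y * \<psi> t y\<close>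
  decays no faster than \<open>s 1\<close>. The substitution \<open>u = w + h \<partial>\<^sub>y((1 - cutoff 0) s)\<close> with
  \<open>h = c * mass_integral w\<close> turns \<open>\<psi>\<close> into \<open>- tail w\<close> up to terms supported near the wall, and
  \<open>w\<close> decays exponentially. The three entries of each list are the derivatives in \<open>y\<close> of order
  0, 1 and 2.
\<close>

definition far_field :: "nat \<Rightarrow> real \<Rightarrow> real \<Rightarrow> complex" where
  "far_field j t y = [cutoff 1 y * s 0 t y + cutoff 0 y * s 1 t y,
     cutoff 2 y * s 0 t y + 2 * cutoff 1 y * s 1 t y + cutoff 0 y * s 2 t y,
     cutoff 3 y * s 0 t y + 3 * cutoff 2 y * s 1 t y + 3 * cutoff 1 y * s 2 t y + cutoff 0 y * s 3 t y] ! j"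

text \<open>The pair \<open>u = s 1\<close>, \<open>\<psi> = s 0\<close> solves the mode equation
  exactly: the two products with \<open>c\<close> cancel, and the flow solves the heat equation.
  With \<open>1 - cutoff 0\<close> in front of \<open>s 0\<close>, the defect consists of terms that
  contain a derivative of the cutoff, and these decay exponentially.\<close>

definition corrector_residual :: "nat \<Rightarrow> real \<Rightarrow> real \<Rightarrow> complex" where
  "corrector_residual j t y =
    [2 * cutoff 1 y * s 2 t y + 3 * cutoff 2 y * s 1 t y + cutoff 3 y * s 0 t y - c * (cutoff 1 y * s 0 t y * s 0 t y),
     2 * cutoff 1 y * s 3 t y + 5 * cutoff 2 y * s 2 t y + 4 * cutoff 3 y * s 1 t y + cutoff 4 y * s 0 t y
       - c * (cutoff 2 y * s 0 t y * s 0 t y + 2 * cutoff 1 y * s 0 t y * s 1 t y),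
     2 * cutoff 1 y * s 4 t y + 7 * cutoff 2 y * s 3 t y + 9 * cutoff 3 y * s 2 t y + 5 * cutoff 4 y * s 1 t y
       + cutoff 5 y * s 0 t y
       - c * (cutoff 3 y * s 0 t y * s 0 t y + 4 * cutoff 2 y * s 0 t y * s 1 t y
              + 2 * cutoff 1 y * s 1 t y * s 1 t y + 2 * cutoff 1 y * s 0 t y * s 2 t y)] ! j"

text \<open>The right-hand side of the heat equation for \<open>w\<close>, with its derivatives.
  Because \<open>tail w t\<close> has derivative \<open>- w 0 t\<close>, the terms
  \<open>s 1 * w 0\<close> cancel at order 1. The factor of \<open>mass w t\<close> carries a
  cutoff, since its non-decaying part is taken by the time derivative of \<open>h\<close>.\<close>

definition forcing :: "(nat \<Rightarrow> real \<Rightarrow> real \<Rightarrow> complex) \<Rightarrow> nat \<Rightarrow> real \<Rightarrow> real \<Rightarrow> complex" where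
  "forcing w j t y = c *
    ([- (s 0 t y * w 0 t y) - s 1 t y * tail w t y,
      - (s 0 t y * w 1 t y) - s 2 t y * tail w t y,
      - (s 1 t y * w 1 t y) - s 0 t y * w 2 t y - s 3 t y * tail w t y + s 2 t y * w 0 t y] ! j
     + mass w t * far_field j t y) - c * mass_integral w t * corrector_residual j t y"

text \<open>The numbers are 4 products of size \<open>K\<close>, and 5000 times the coefficient sums
  8, 24 and 9 that occur at order 2, the worst order.\<close>

definition forcing_const :: real where
  "forcing_const = norm c * (4 * K + 40000 * K) + norm c * (120000 * K + norm c * (45000 * K * K))"

lemma less_3_cases: "j \<le> 2 \<Longrightarrow> j = 0 \<or> j = 1 \<or> j = (2::nat)" by linarith

lemma norm_far_field_le:
  assumes "j \<le> 2" "t \<in> {t0..T}" "y \<ge> 0"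
  shows "norm (far_field j t y) \<le> 40000 * K * exp (- y)"
proof -
  let ?X = "5000 * exp (- y)"
  note b = norm_cutoff_le[OF _ assms(3)] s_bound[OF _ assms(2,3)]
  have n: "norm (2::complex) \<le> 2" "norm (3::complex) \<le> 3" by auto
  have "0 \<le> K * exp (- y)" using K_nonneg by simp
  moreover have "norm (far_field 0 t y) \<le> ?X * K + ?X * K"
    unfolding far_field_def nth_Cons_0 by (intro norm_add_le norm_mult_le b) auto
  moreover have "norm (far_field 1 t y) \<le> ?X * K + 2 * ?X * K + ?X * K"
    unfolding far_field_def nth_Cons_0 One_nat_def nth_Cons_Suc by (intro norm_add_le norm_mult_le b n) auto
  moreover have "norm (far_field 2 t y) \<le> ?X * K + 3 * ?X * K + 3 * ?X * K + ?X * K"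
    unfolding far_field_def nth_Cons_0 numeral_2_eq_2 nth_Cons_Suc by (intro norm_add_le norm_mult_le b n) auto
  ultimately show ?thesis using less_3_cases[OF assms(1)] by (elim disjE) (simp_all add: mult_ac)
qed

lemma norm_corrector_residual_le:
  assumes "j \<le> 2" "t \<in> {t0..T}" "y \<ge> 0"
  shows "norm (corrector_residual j t y) \<le> (120000 * K + norm c * (45000 * K * K)) * exp (- y)"
proof -
  let ?X = "5000 * exp (- y)"
  note b = norm_cutoff_le[OF _ assms(3)] s_bound[OF _ assms(2,3)]
  have n: "norm (2::complex) \<le> 2" "norm (3::complex) \<le> 3" "norm (4::complex) \<le> 4" "norm (5::complex) \<le> 5"
    "norm (7::complex) \<le> 7" "norm (9::complex) \<le> 9" by auto
  have p: "0 \<le> K * exp (- y)" "0 \<le> norm c * (K * K * exp (- y))" using K_nonneg by simp_all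
  have 0: "norm (corrector_residual 0 t y) \<le> 2 * ?X * K + 3 * ?X * K + ?X * K + norm c * (?X * K * K)"
    unfolding corrector_residual_def nth_Cons_0 by (intro norm_add_le norm_diff_le norm_mult_le b n order_refl) auto
  have 1: "norm (corrector_residual 1 t y) \<le> 2 * ?X * K + 5 * ?X * K + 4 * ?X * K + ?X * K
      + norm c * (?X * K * K + 2 * ?X * K * K)"
    unfolding corrector_residual_def nth_Cons_0 One_nat_def nth_Cons_Suc
    by (intro norm_add_le norm_diff_le norm_mult_le b n order_refl) auto
  have 2: "norm (corrector_residual 2 t y) \<le> 2 * ?X * K + 7 * ?X * K + 9 * ?X * K + 5 * ?X * K + ?X * K
      + norm c * (?X * K * K + 4 * ?X * K * K + 2 * ?X * K * K + 2 * ?X * K * K)"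
    unfolding corrector_residual_def nth_Cons_0 numeral_2_eq_2 nth_Cons_Suc
    by (intro norm_add_le norm_diff_le norm_mult_le b n[unfolded numeral_2_eq_2] order_refl) auto
  define P where "P = K * exp (- y)"
  define Q where "Q = norm c * (K * K * exp (- y))"
  have PQ: "P \<ge> 0" "Q \<ge> 0" using p by (simp_all add: P_def Q_def)
  have "2 * ?X * K + 3 * ?X * K + ?X * K + norm c * (?X * K * K) = 30000 * P + 5000 * Q"
    "2 * ?X * K + 5 * ?X * K + 4 * ?X * K + ?X * K + norm c * (?X * K * K + 2 * ?X * K * K) = 60000 * P + 15000 * Q"
    "2 * ?X * K + 7 * ?X * K + 9 * ?X * K + 5 * ?X * K + ?X * K
      + norm c * (?X * K * K + 4 * ?X * K * K + 2 * ?X * K * K + 2 * ?X * K * K) = 120000 * P + 45000 * Q"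
    "(120000 * K + norm c * (45000 * K * K)) * exp (- y) = 120000 * P + 45000 * Q"
    by (simp_all add: P_def Q_def algebra_simps)
  then show ?thesis using 0 1 2 PQ less_3_cases[OF assms(1)] by (elim disjE) simp_all
qed

context
  fixes \<kappa> w assumes w: "profile \<kappa> w"
begin

lemma norm_forcing_le:
  assumes "j \<le> 2" "t \<in> {t0..T}" "y \<ge> 0"
  shows "norm (forcing w j t y) \<le> forcing_const * \<kappa> * exp (\<Lambda> * (t - t0) - y)"
proof -
  let ?E = "\<kappa> * exp (\<Lambda> * (t - t0))"
  let ?F = "\<kappa> * exp (\<Lambda> * (t - t0) - y)"
  have EF: "?E * exp (- y) = ?F" by (simp add: exp_minus_mult)
  note b = s_bound[OF _ assms(2,3)] profileD(5)[OF w _ assms(2,3)] norm_tail_le[OF w assms(2,3)]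
  define A where "A = [- (s 0 t y * w 0 t y) - s 1 t y * tail w t y,
      - (s 0 t y * w 1 t y) - s 2 t y * tail w t y,
      - (s 1 t y * w 1 t y) - s 0 t y * w 2 t y - s 3 t y * tail w t y + s 2 t y * w 0 t y] ! j"
  have p: "0 \<le> K * ?F" using K_nonneg profileD(6)[OF w] by simp
  have *: "norm (- (s 0 t y * w 0 t y) - s 1 t y * tail w t y) \<le> K * ?F + K * ?F"
     "norm (- (s 0 t y * w 1 t y) - s 2 t y * tail w t y) \<le> K * ?F + K * ?F"
     "norm (- (s 1 t y * w 1 t y) - s 0 t y * w 2 t y - s 3 t y * tail w t y + s 2 t y * w 0 t y)
        \<le> K * ?F + K * ?F + K * ?F + K * ?F"
    by (intro norm_add_le norm_diff_le norm_mult_le b, (subst norm_minus_cancel)?, intro norm_mult_le b; simp)+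
  have "norm A \<le> 4 * (K * ?F)"
    using less_3_cases[OF assms(1)] * p unfolding A_def by (elim disjE) (simp_all add: eval_nat_numeral)
  then have "norm (c * (A + mass w t * far_field j t y) - c * mass_integral w t * corrector_residual j t y)
     \<le> norm c * (4 * (K * ?F) + ?E * (40000 * K * exp (- y)))
      + norm c * ?E * ((120000 * K + norm c * (45000 * K * K)) * exp (- y))"
    by (intro norm_add_le norm_diff_le norm_mult_le order_refl norm_mass_le[OF w assms(2)] norm_mass_integral_le[OF w assms(2)]
        norm_far_field_le norm_corrector_residual_le assms)
  also have "\<dots> = forcing_const * ?F"
    unfolding forcing_const_def EF[symmetric] by (simp add: algebra_simps)
  finally show ?thesis by (simp add: forcing_def A_def mult.assoc)
qed

text \<open>At the wall \<open>tail w t\<close> equals \<open>mass w t\<close> and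
  \<open>cutoff 0\<close> equals 1, so the contributions that do not vanish cancel, and every
  remaining product has a factor of size \<open>y\<close>. The coefficients \<open>s 1\<close> and
  \<open>s 2\<close> may be discontinuous at the wall; the linear bound supplies both the boundary
  value and continuity there.\<close>

lemma norm_forcing_wall:
  assumes "j < 2" "t \<in> {t0..T}" "y \<ge> 0"
  shows "norm (forcing w j t y) \<le> (norm c * (20000 * K * (\<kappa> * exp \<Lambda>))
      + norm c * (\<kappa> * exp \<Lambda>) * (65000 * K + norm c * (15000 * K * K))) * y"
proof -
  let ?k = "\<kappa> * exp \<Lambda>"
  have k: "?k \<ge> 0" using profileD(6)[OF w] by simp
  note b = s_bound[OF _ assms(2,3)] norm_profile_le_const[OF w assms(2,3)] s_wall[OF assms(2,3)]
    norm_cutoff_near_wall[OF _ assms(3)]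
  have cb: "norm (cutoff j y) \<le> 5000" if "j \<le> 5" for j
  proof -
    have "5000 * exp (- y) \<le> 5000 * 1" using assms by (intro mult_left_mono) auto
    then show ?thesis using norm_cutoff_le[OF that assms(3)] by linarith
  qed
  have n: "norm (2::complex) \<le> 2" "norm (3::complex) \<le> 3" "norm (4::complex) \<le> 4" "norm (5::complex) \<le> 5" by auto
  have m: "norm (mass w t) \<le> ?k" "norm (mass_integral w t) \<le> ?k"
  proof -
    have "\<kappa> * exp (\<Lambda> * (t - t0)) \<le> ?k"
      using assms T_le \<Lambda>_pos profileD(6)[OF w] by (intro mult_left_mono) auto
    then show "norm (mass w t) \<le> ?k" "norm (mass_integral w t) \<le> ?k"
      using norm_mass_le[OF w assms(2)] norm_mass_integral_le[OF w assms(2)] by linarith+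
  qed
  have tl: "norm (mass w t * cutoff 0 y - tail w t y) \<le> 5001 * (?k * y)"
  proof -
    have 1: "norm (mass w t - tail w t y) \<le> ?k * y"
      using norm_integral_profile_le[OF w assms(2), of 0 y] assms(3) by (simp add: mass_def)
    have 2: "norm (mass w t * (cutoff 0 y - 1)) \<le> ?k * (5000 * y)"
      by (intro norm_mult_le m norm_cutoff_0_diff assms)
    have "mass w t * cutoff 0 y - tail w t y = (mass w t - tail w t y) + mass w t * (cutoff 0 y - 1)"
      by (simp add: algebra_simps)
    then show ?thesis using norm_add_le[OF 1 2] by (simp add: algebra_simps)
  qed
  have p: "0 \<le> K * (?k * y)" "0 \<le> K * y" "0 \<le> norm c * (K * K * y)" using K_nonneg k assms by simp_all
  have f0: "norm (forcing w 0 t y) \<le> norm c * (K * y * ?k + K * (5001 * (?k * y)) + ?k * (5000 * y * K))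
     + norm c * ?k * (2 * (5000 * y) * K + 3 * (5000 * y) * K + 5000 * y * K + norm c * (5000 * y * K * K))"
  proof -
    have e: "forcing w 0 t y = c * (- (s 0 t y * w 0 t y) + s 1 t y * (mass w t * cutoff 0 y - tail w t y)
        + mass w t * (cutoff 1 y * s 0 t y)) - c * mass_integral w t * corrector_residual 0 t y"
      by (simp add: forcing_def far_field_def algebra_simps)
    show ?thesis
      unfolding e unfolding corrector_residual_def nth_Cons_0
      by (intro norm_add_le norm_diff_le norm_mult_le order_refl m tl n b,
          (subst norm_minus_cancel, intro norm_mult_le b)?; simp)
  qed
  have f1: "norm (forcing w 1 t y) \<le> norm c * (K * y * ?k + K * (5001 * (?k * y)) + ?k * (5000 * y * K + 2 * (5000 * y) * K))
     + norm c * ?k * (2 * (5000 * y) * K + 5 * (5000 * y) * K + 4 * (5000 * y) * K + 5000 * (K * y)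
         + norm c * (5000 * y * K * K + 2 * (5000 * y) * K * K))"
  proof -
    have e: "forcing w 1 t y = c * (- (s 0 t y * w 1 t y) + s 2 t y * (mass w t * cutoff 0 y - tail w t y)
        + mass w t * (cutoff 2 y * s 0 t y + 2 * cutoff 1 y * s 1 t y)) - c * mass_integral w t * corrector_residual 1 t y"
      by (simp add: forcing_def far_field_def algebra_simps)
    show ?thesis
      unfolding e unfolding corrector_residual_def nth_Cons_0 One_nat_def nth_Cons_Suc
      by (intro norm_add_le norm_diff_le norm_mult_le order_refl m tl n b[unfolded One_nat_def] cb,
          (subst norm_minus_cancel, intro norm_mult_le b[unfolded One_nat_def])?; simp)
  qed
  define P where "P = norm c * (K * (?k * y))"
  define Q where "Q = norm c * norm c * (K * K * (?k * y))"
  have PQ: "P \<ge> 0" "Q \<ge> 0" using K_nonneg k assms by (simp_all add: P_def Q_def)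
  have "norm c * (K * y * ?k + K * (5001 * (?k * y)) + ?k * (5000 * y * K))
     + norm c * ?k * (2 * (5000 * y) * K + 3 * (5000 * y) * K + 5000 * y * K + norm c * (5000 * y * K * K)) = 40002 * P + 5000 * Q"
    "norm c * (K * y * ?k + K * (5001 * (?k * y)) + ?k * (5000 * y * K + 2 * (5000 * y) * K))
     + norm c * ?k * (2 * (5000 * y) * K + 5 * (5000 * y) * K + 4 * (5000 * y) * K + 5000 * (K * y)
         + norm c * (5000 * y * K * K + 2 * (5000 * y) * K * K)) = 80002 * P + 15000 * Q"
    "(norm c * (20000 * K * ?k) + norm c * ?k * (65000 * K + norm c * (15000 * K * K))) * y = 85000 * P + 15000 * Q"
    by (simp_all add: P_def Q_def algebra_simps)
  moreover have "j = 0 \<or> j = 1" using assms(1) by auto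
  ultimately show ?thesis using f0 f1 PQ by (elim disjE) simp_all
qed

lemma forcing_has_derivative:
  assumes "t \<in> {t0..T}" "y > 0" "j < 2"
  shows "(forcing w j t has_vector_derivative forcing w (Suc j) t y) (at y)"
proof -
  note [derivative_intros] = s_deriv[OF _ assms(1,2)] profileD(4)[OF w assms(1,2)] tail_has_derivative[OF w assms(1,2)]
    cutoff_deriv has_vector_derivative_mult has_vector_derivative_mult_right
  note d = has_vector_derivative_eq_rhs
  have "j = 0 \<or> j = 1" using assms(3) by auto
  then show ?thesis
  proof
    assume j: "j = 0"
    have "((\<lambda>y. c * (- (s 0 t y * w 0 t y) - s 1 t y * tail w t y
       + mass w t * (cutoff 1 y * s 0 t y + cutoff 0 y * s 1 t y)) - c * mass_integral w t *
       (2 * cutoff 1 y * s 2 t y + 3 * cutoff 2 y * s 1 t y + cutoff 3 y * s 0 t y - c * (cutoff 1 y * s 0 t y * s 0 t y)))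
      has_vector_derivative forcing w 1 t y) (at y)"
      by (rule d, (rule derivative_intros | simp)+)
        (simp add: forcing_def far_field_def corrector_residual_def eval_nat_numeral algebra_simps)
    then show ?thesis by (simp add: j forcing_def[abs_def] far_field_def corrector_residual_def)
  next
    assume j: "j = 1"
    have "((\<lambda>y. c * (- (s 0 t y * w 1 t y) - s 2 t y * tail w t y
       + mass w t * (cutoff 2 y * s 0 t y + 2 * cutoff 1 y * s 1 t y + cutoff 0 y * s 2 t y)) - c * mass_integral w t *
       (2 * cutoff 1 y * s 3 t y + 5 * cutoff 2 y * s 2 t y + 4 * cutoff 3 y * s 1 t y + cutoff 4 y * s 0 t y
         - c * (cutoff 2 y * s 0 t y * s 0 t y + 2 * cutoff 1 y * s 0 t y * s 1 t y)))
      has_vector_derivative forcing w 2 t y) (at y)"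
      by (rule d, (rule derivative_intros | simp)+)
        (simp add: forcing_def far_field_def corrector_residual_def eval_nat_numeral algebra_simps)
    then show ?thesis by (simp add: j forcing_def[abs_def] far_field_def corrector_residual_def eval_nat_numeral)
  qed
qed

lemma continuous_forcing:
  assumes "j \<le> 2" shows "continuous_on ({t0..T} \<times> {0<..}) (\<lambda>(t, y). forcing w j t y)"
proof -
  have f: "continuous_on ({t0..T} \<times> {0<..}) (\<lambda>p. s i (fst p) (snd p))" if "i \<le> 4" for i
    using s_cont[OF that] by (simp add: case_prod_beta')
  have g: "continuous_on ({t0..T} \<times> {0<..}) (\<lambda>p. w i (fst p) (snd p))" if "i \<le> 2" for i
    using profileD(3)[OF w that] by (simp add: case_prod_beta')
  have h: "continuous_on ({t0..T} \<times> {0<..}) (\<lambda>p. tail w (fst p) (snd p))"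
    using continuous_on_subset[OF continuous_tail[OF w], of "{t0..T} \<times> {0<..}"] by (force simp: case_prod_beta')
  have i: "continuous_on ({t0..T} \<times> {0<..}) (\<lambda>p. cutoff i (snd p))" if "i \<le> 5" for i
    by (rule continuous_on_compose2[OF continuous_cutoff[OF that, of UNIV]]) (auto intro: continuous_intros)
  have m: "continuous_on ({t0..T} \<times> {0::real<..}) (\<lambda>p. mass w (fst p))"
    by (rule continuous_on_compose2[OF continuous_mass[OF w]]) (auto intro: continuous_intros)
  have "continuous_on {t0..T} (mass_integral w)"
    by (meson continuous_on_eq_continuous_within has_vector_derivative_continuous mass_integral_has_derivative[OF w])
  then have n: "continuous_on ({t0..T} \<times> {0::real<..}) (\<lambda>p. mass_integral w (fst p))"
    by (rule continuous_on_compose2) (auto intro: continuous_intros)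
  show ?thesis
    using less_3_cases[OF assms]
    by (elim disjE) (simp_all add: case_prod_beta' forcing_def far_field_def corrector_residual_def eval_nat_numeral
        f g h i m n continuous_intros)
qed

lemma profile_forcing: "profile (forcing_const * \<kappa>) (forcing w)"
  unfolding profile_def
proof (intro conjI ballI allI impI)
  show "forcing w 0 t 0 = 0" if "t \<in> {t0..T}" for t
    using norm_forcing_wall[of 0 t 0] that by simp
  show "continuous_on ({t0..T} \<times> {0..}) (\<lambda>(t, y). forcing w j t y)" if "j < 2" for j
    by (rule continuous_on_wall[OF continuous_forcing norm_forcing_wall]) (use that in auto)
  show "continuous_on ({t0..T} \<times> {0<..}) (\<lambda>(t, y). forcing w 2 t y)"
    by (rule continuous_forcing) simp
qed (auto intro: forcing_has_derivative norm_forcing_le)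

end
end

section \<open>Sums and series of profiles\<close>

context time_interval begin

lemma profile_add:
  assumes "profile \<kappa> a" "profile \<kappa>' b"
  shows "profile (\<kappa> + \<kappa>') (\<lambda>j t y. a j t y + b j t y)"
  unfolding profile_def
proof (intro conjI ballI allI impI)
  show "a 0 t 0 + b 0 t 0 = 0" if "t \<in> {t0..T}" for t
    using that profileD(1)[OF assms(1)] profileD(1)[OF assms(2)] by simp
  show "continuous_on ({t0..T} \<times> {0..}) (\<lambda>(t, y). a j t y + b j t y)" if "j < 2" for j
    using continuous_on_add[OF profileD(2)[OF assms(1) that] profileD(2)[OF assms(2) that]]
    by (simp add: case_prod_beta')
  show "continuous_on ({t0..T} \<times> {0<..}) (\<lambda>(t, y). a 2 t y + b 2 t y)"
    using continuous_on_add[OF profileD(3)[OF assms(1), of 2] profileD(3)[OF assms(2), of 2]]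
    by (simp add: case_prod_beta')
  show "((\<lambda>y. a j t y + b j t y) has_vector_derivative a (Suc j) t y + b (Suc j) t y) (at y)"
    if "t \<in> {t0..T}" "y > 0" "j < 2" for j t y
    by (intro has_vector_derivative_add profileD(4)[OF assms(1)] profileD(4)[OF assms(2)] that)
  show "norm (a j t y + b j t y) \<le> (\<kappa> + \<kappa>') * exp (\<Lambda> * (t - t0) - y)"
    if "j \<le> 2" "t \<in> {t0..T}" "y \<ge> 0" for j t y
    using norm_add_le[OF profileD(5)[OF assms(1) that] profileD(5)[OF assms(2) that]]
    by (simp add: distrib_right)
qed

lemma profile_sum:
  assumes "\<And>n. profile (\<kappa> n) (e n)"
  shows "profile (\<Sum>i<n::nat. \<kappa> i) (\<lambda>j t y. \<Sum>i<n. e i j t y)"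
proof (induction n)
  case 0
  show ?case by (simp add: profile_def case_prod_beta')
next
  case (Suc n)
  from profile_add[OF this assms[of n]] show ?case by simp
qed

text \<open>The weighted bounds give uniform convergence of all three orders on the closed strip by
  the Weierstrass test, hence continuity and differentiation term by term.\<close>

lemma profile_suminf:
  assumes e: "\<And>n. profile (\<kappa> n) (e n)" and \<kappa>: "summable \<kappa>"
  shows "profile (\<Sum>n. \<kappa> n) (\<lambda>j t y. \<Sum>n. e n j t y)"
    and "\<And>j t y. j \<le> 2 \<Longrightarrow> t \<in> {t0..T} \<Longrightarrow> y \<ge> 0 \<Longrightarrow> summable (\<lambda>n. e n j t y)"
proof -
  have b: "norm (e n j t y) \<le> \<kappa> n * exp \<Lambda>" if "j \<le> 2" "t \<in> {t0..T}" "y \<ge> 0" for n j t y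
    using norm_profile_le_const[OF e] that by blast
  have ks: "summable (\<lambda>n. \<kappa> n * C)" for C by (intro summable_mult2 \<kappa>)
  show sm: "summable (\<lambda>n. e n j t y)" if "j \<le> 2" "t \<in> {t0..T}" "y \<ge> 0" for j t y
    by (rule summable_comparison_test'[OF ks[of "exp \<Lambda>"], of 0]) (use b that in auto)
  have ul: "uniform_limit ({t0..T} \<times> {0..}) (\<lambda>n p. \<Sum>i<n. e i j (fst p) (snd p)) (\<lambda>p. \<Sum>i. e i j (fst p) (snd p)) sequentially"
    if "j \<le> 2" for j
    by (rule Weierstrass_m_test[OF _ ks[of "exp \<Lambda>"]]) (use b that in auto)
  have cs: "continuous_on A (\<lambda>(t, y). \<Sum>n. e n j t y)"
    if "A \<subseteq> {t0..T} \<times> {0..}" "j \<le> 2" "\<And>n. continuous_on A (\<lambda>(t, y). e n j t y)" for A j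
  proof -
    have "continuous_on A (\<lambda>p. e n j (fst p) (snd p))" for n using that(3)[of n] by (simp add: case_prod_beta')
    then have "\<forall>n. continuous_on A (\<lambda>p. \<Sum>i<n. e i j (fst p) (snd p))" by (intro allI continuous_on_sum)
    from uniform_limit_theorem[OF always_eventually[OF this] uniform_limit_on_subset[OF ul[OF that(2)] that(1)]]
    show ?thesis by (simp add: case_prod_beta')
  qed
  show "profile (\<Sum>n. \<kappa> n) (\<lambda>j t y. \<Sum>n. e n j t y)"
    unfolding profile_def
  proof (intro conjI ballI allI impI)
    show "(\<Sum>n. e n 0 t 0) = 0" if "t \<in> {t0..T}" for t
      using profileD(1)[OF e that] by simp
    show "continuous_on ({t0..T} \<times> {0..}) (\<lambda>(t, y). \<Sum>n. e n j t y)" if "j < 2" for j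
      by (rule cs) (use that profileD(2)[OF e] in auto)
    show "continuous_on ({t0..T} \<times> {0<..}) (\<lambda>(t, y). \<Sum>n. e n 2 t y)"
      by (rule cs) (use profileD(3)[OF e] in auto)
    show "((\<lambda>y. \<Sum>n. e n j t y) has_vector_derivative (\<Sum>n. e n (Suc j) t y)) (at y)"
      if t: "t \<in> {t0..T}" "y > 0" "j < 2" for j t y
    proof -
      have "\<exists>g. \<forall>x\<in>{0<..}. (\<lambda>n. e n j t x) sums g x \<and>
          (g has_derivative (\<lambda>h. h *\<^sub>R (\<Sum>n. e n (Suc j) t x))) (at x within {0<..})"
      proof (rule has_derivative_series[where f' = "\<lambda>n x h. h *\<^sub>R e n (Suc j) t x"])
        show "(e n j t has_derivative (\<lambda>h. h *\<^sub>R e n (Suc j) t x)) (at x within {0<..})" if "x \<in> {0<..}" for n x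
          using profileD(4)[OF e, of t x j n] that t has_vector_derivative_at_within
          by (auto simp: has_vector_derivative_def intro: has_derivative_at_withinI)
        show "\<forall>\<^sub>F n in sequentially. \<forall>x\<in>{0<..}. \<forall>h. norm ((\<Sum>i<n. h *\<^sub>R e i (Suc j) t x) - h *\<^sub>R (\<Sum>n. e n (Suc j) t x)) \<le> \<epsilon> * norm h"
          if "\<epsilon> > 0" for \<epsilon>
        proof -
          have "Suc j \<le> 2" using t by simp
          from uniform_limitD[OF ul[OF this] that] show ?thesis
        proof eventually_elim
          case (elim n)
          show ?case
          proof (intro ballI allI)
            fix x :: real and h :: real assume x: "x \<in> {0<..}"
            have "norm ((\<Sum>i<n. e i (Suc j) t x) - (\<Sum>n. e n (Suc j) t x)) \<le> \<epsilon>"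
              using bspec[OF elim, of "(t, x)"] t x by (simp add: dist_norm)
            then have "norm (h *\<^sub>R ((\<Sum>i<n. e i (Suc j) t x) - (\<Sum>n. e n (Suc j) t x))) \<le> \<epsilon> * norm h"
              by (simp add: mult.commute[of \<epsilon>] mult_left_mono)
            then show "norm ((\<Sum>i<n. h *\<^sub>R e i (Suc j) t x) - h *\<^sub>R (\<Sum>n. e n (Suc j) t x)) \<le> \<epsilon> * norm h"
              by (simp add: scaleR_diff_right scaleR_sum_right)
          qed
        qed
        qed
        show "(\<lambda>n. e n j t y) sums (\<Sum>n. e n j t y)" using sm[of j t y] t by (auto intro: summable_sums)
      qed (use t in auto)
      then obtain g where g: "\<And>x. x > 0 \<Longrightarrow> (\<lambda>n. e n j t x) sums g x"
        "(g has_derivative (\<lambda>h. h *\<^sub>R (\<Sum>n. e n (Suc j) t y))) (at y within {0<..})" using t by auto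
      have "at y within {0<..} = at y" using t by (intro at_within_open) auto
      then have "(g has_vector_derivative (\<Sum>n. e n (Suc j) t y)) (at y)"
        using g(2) by (simp add: has_vector_derivative_def)
      then show ?thesis
        by (rule has_vector_derivative_transform_within_open[where S = "{0<..}"]) (use t g(1) sums_unique in auto)
    qed
    show "norm (\<Sum>n. e n j t y) \<le> (\<Sum>n. \<kappa> n) * exp (\<Lambda> * (t - t0) - y)"
      if "j \<le> 2" "t \<in> {t0..T}" "y \<ge> 0" for j t y
    proof -
      have s: "summable (\<lambda>n. norm (e n j t y))"
        by (rule summable_comparison_test'[OF ks[of "exp (\<Lambda> * (t - t0) - y)"], of 0]) (use profileD(5)[OF e] that in auto)
      have "norm (\<Sum>n. e n j t y) \<le> (\<Sum>n. norm (e n j t y))" by (rule summable_norm[OF s])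
      also have "\<dots> \<le> (\<Sum>n. \<kappa> n * exp (\<Lambda> * (t - t0) - y))"
        by (intro suminf_le profileD(5)[OF e] that s ks)
      finally show ?thesis by (simp add: suminf_mult2[OF \<kappa>])
    qed
  qed
qed

lemma duhamel_cong:
  assumes "\<And>s y. s \<in> {t0..T} \<Longrightarrow> y \<ge> 0 \<Longrightarrow> f j s y = g j s y" and "t \<le> T"
  shows "duhamel f j t y = duhamel g j t y"
proof -
  have "reflect j (f j s) = reflect j (g j s)" if "s \<in> {t0..T}" for s
    using assms(1)[OF that] by (auto simp: reflect_def fun_eq_iff)
  then show ?thesis unfolding duhamel_def using assms(2)
    by (intro Bochner_Integration.integral_cong) (auto simp: indicator_def)
qed

lemma duhamel_add:
  assumes a: "profile \<kappa> a" and b: "profile \<kappa>' b" and t: "t \<in> {t0..T}" and j: "j \<le> 2"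
  shows "duhamel (\<lambda>j t y. a j t y + b j t y) j t y = duhamel a j t y + duhamel b j t y"
proof -
  have r: "reflect j (\<lambda>y. a j s y + b j s y) = (\<lambda>x. reflect j (a j s) x + reflect j (b j s) x)" for s
    by (auto simp: reflect_def fun_eq_iff distrib_left)
  have "heat (reflect j (\<lambda>y. a j s y + b j s y)) r y = heat (reflect j (a j s)) r y + heat (reflect j (b j s)) r y"
    if s: "s \<in> {t0..T}" for s r
    unfolding r heat_def
  proof (rule Bochner_Integration.integral_add)
    show "integrable gauss (\<lambda>z. reflect j (a j s) (y + sqrt (2 * r) * z))"
      by (rule integrable_gauss_bounded[OF measurable_compose[OF _ reflect_measurable[OF a s j]] norm_reflect_le(2)[OF a s j]]) simp
    show "integrable gauss (\<lambda>z. reflect j (b j s) (y + sqrt (2 * r) * z))"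
      by (rule integrable_gauss_bounded[OF measurable_compose[OF _ reflect_measurable[OF b s j]] norm_reflect_le(2)[OF b s j]]) simp
  qed
  then have "duhamel (\<lambda>j t y. a j t y + b j t y) j t y =
     (LINT s|lborel. indicator {t0..<t} s *\<^sub>R heat (reflect j (a j s)) (t - s) y
        + indicator {t0..<t} s *\<^sub>R heat (reflect j (b j s)) (t - s) y)"
    unfolding duhamel_def using t by (intro Bochner_Integration.integral_cong) (auto simp: indicator_def)
  also have "\<dots> = duhamel a j t y + duhamel b j t y"
    unfolding duhamel_def
    by (intro Bochner_Integration.integral_add integrable_duhamel_integrand[OF a t j] integrable_duhamel_integrand[OF b t j])
  finally show ?thesis .
qed

lemma tail_add:
  assumes a: "profile \<kappa> a" and b: "profile \<kappa>' b" and t: "t \<in> {t0..T}" and y: "y \<ge> 0"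
  shows "tail (\<lambda>j t y. a j t y + b j t y) t y = tail a t y + tail b t y"
  unfolding tail_def
  by (rule Henstock_Kurzweil_Integration.integral_add[OF profile_integrable_tail[OF a t y] profile_integrable_tail[OF b t y]])

lemma mass_integral_add:
  assumes a: "profile \<kappa> a" and b: "profile \<kappa>' b" and t: "t \<in> {t0..T}"
  shows "mass_integral (\<lambda>j t y. a j t y + b j t y) t = mass_integral a t + mass_integral b t"
proof -
  have "mass_integral (\<lambda>j t y. a j t y + b j t y) t = integral {t0..t} (\<lambda>s. mass a s + mass b s)"
    unfolding mass_integral_def
    by (rule Henstock_Kurzweil_Integration.integral_cong) (use t tail_add[OF a b] in \<open>auto simp: mass_def\<close>)
  also have "\<dots> = mass_integral a t + mass_integral b t"
    unfolding mass_integral_def using t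
    by (intro Henstock_Kurzweil_Integration.integral_add integrable_continuous_interval
        continuous_on_subset[OF continuous_mass[OF a]] continuous_on_subset[OF continuous_mass[OF b]]) auto
  finally show ?thesis .
qed

end

section \<open>The Dyson series and the solution of the mode equation\<close>

context mode_problem begin

lemma forcing_cong:
  assumes eq: "\<And>j t y. j \<le> 2 \<Longrightarrow> t \<in> {t0..T} \<Longrightarrow> y \<ge> 0 \<Longrightarrow> a j t y = b j t y"
    and t: "t \<in> {t0..T}" and y: "y \<ge> 0" and j: "j \<le> 2"
  shows "forcing a j t y = forcing b j t y"
proof -
  have tl: "tail a s y = tail b s y" if "s \<in> {t0..T}" "y \<ge> 0" for s y
    unfolding tail_def by (rule Henstock_Kurzweil_Integration.integral_cong) (use eq that in auto)
  have "mass_integral a t = mass_integral b t"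
    unfolding mass_integral_def by (rule Henstock_Kurzweil_Integration.integral_cong) (use tl t in \<open>auto simp: mass_def\<close>)
  then show ?thesis
    using less_3_cases[OF j] tl[OF t y] tl[OF t order_refl] eq[OF _ t y]
    by (elim disjE) (simp_all add: forcing_def mass_def eval_nat_numeral)
qed

lemma forcing_add:
  assumes a: "profile \<kappa> a" and b: "profile \<kappa>' b" and t: "t \<in> {t0..T}" and y: "y \<ge> 0" and j: "j \<le> 2"
  shows "forcing (\<lambda>j t y. a j t y + b j t y) j t y = forcing a j t y + forcing b j t y"
  using less_3_cases[OF j] tail_add[OF a b t y] tail_add[OF a b t, of 0] mass_integral_add[OF a b t]
  by (elim disjE) (simp_all add: forcing_def mass_def eval_nat_numeral algebra_simps)

text \<open>The terms of the series are the iterates of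
  \<open>\<lambda>g. duhamel (forcing g)\<close> on \<open>duhamel G\<close>. The smallness
  condition halves the weighted bound at each step, so the series converges geometrically.\<close>

theorem forced_solution:
  assumes small: "forcing_const * gauss_exp_moment / \<Lambda> \<le> 1 / 2"
    and G: "profile \<kappa>G G"
  obtains \<kappa> W where "profile \<kappa> W"
    and "\<And>y. W 0 t0 y = 0"
    and "\<And>t y. t \<in> {t0..T} \<Longrightarrow> y > 0 \<Longrightarrow>
      ((\<lambda>t. W 0 t y) has_vector_derivative G 0 t y + forcing W 0 t y + W 2 t y) (at t within {t0..T})"
proof -
  define e where "e n = ((\<lambda>g. duhamel (forcing g)) ^^ n) (duhamel G)" for n
  define \<kappa>0 where "\<kappa>0 = \<kappa>G * gauss_exp_moment / \<Lambda>"
  define \<kappa> where "\<kappa> n = \<kappa>0 * (1/2)^n" for n :: nat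
  have k0: "\<kappa>0 \<ge> 0" unfolding \<kappa>0_def using profileD(6)[OF G] gauss_exp_moment_nonneg \<Lambda>_pos by simp
  have weaken: "profile b g" if "profile a g" "a \<le> b" for a b g
  proof -
    have "a * exp x \<le> b * exp x" for x :: real using that by (intro mult_right_mono) auto
    then show ?thesis using that(1) unfolding profile_def by (meson order_trans)
  qed
  have step: "profile (\<kappa>' / 2) (duhamel (forcing g))" if "profile \<kappa>' g" for \<kappa>' g
  proof (rule weaken[OF profile_duhamel[OF profile_forcing[OF that]]])
    show "forcing_const * \<kappa>' * gauss_exp_moment / \<Lambda> \<le> \<kappa>' / 2"
      using mult_left_mono[OF small profileD(6)[OF that]] by (simp add: ac_simps)
  qed
  have e: "profile (\<kappa> n) (e n)" for n
  proof (induction n)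
    case 0 show ?case using profile_duhamel[OF G] by (simp add: e_def \<kappa>_def \<kappa>0_def)
  next
    case (Suc n) from step[OF this] show ?case by (simp add: e_def \<kappa>_def)
  qed
  have sk: "summable \<kappa>" unfolding \<kappa>_def by (intro summable_mult summable_geometric) simp
  define W where "W = (\<lambda>j t y. \<Sum>n. e n j t y)"
  define P where "P n = (\<lambda>j t y. \<Sum>i<n. e i j t y)" for n
  define R where "R n = (\<lambda>j t y. \<Sum>i. e (i + n) j t y)" for n
  have W: "profile (suminf \<kappa>) W" unfolding W_def by (rule profile_suminf(1)[OF e sk])
  have P: "profile (\<Sum>i<n. \<kappa> i) (P n)" for n unfolding P_def by (rule profile_sum[OF e])
  have skn: "summable (\<lambda>i. \<kappa> (i + n))" for n using sk by (simp add: summable_iff_shift)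
  have "(\<Sum>i. \<kappa> (i + n)) = 2 * \<kappa>0 * (1/2)^n" for n
    using suminf_mult[of "\<lambda>i. (1/2::real)^i" "\<kappa>0 * (1/2)^n"] suminf_geometric[of "1/2::real"]
    by (simp add: \<kappa>_def power_add mult_ac summable_geometric)
  then have R: "profile (2 * \<kappa>0 * (1/2)^n) (R n)" for n
    using profile_suminf(1)[OF e skn, of n] unfolding R_def by simp
  have WPR: "W j t y = P n j t y + R n j t y" if "j \<le> 2" "t \<in> {t0..T}" "y \<ge> 0" for n j t y
    unfolding W_def P_def R_def using suminf_split_initial_segment[OF profile_suminf(2)[OF e sk that], of n] by simp
  define F where "F = (\<lambda>j t y. G j t y + forcing W j t y)"
  have F: "profile (\<kappa>G + forcing_const * suminf \<kappa>) F"
    unfolding F_def by (intro profile_add G profile_forcing W)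
  \<comment> \<open>One step of the iteration shifts the index: the source with
    \<open>forcing (P n)\<close> reproduces the partial sum with one more term.\<close>
  have Pn: "duhamel (\<lambda>j t y. G j t y + forcing (P n) j t y) j t y = P (Suc n) j t y"
    if "j \<le> 2" "t \<in> {t0..T}" for n j t y
  proof (induction n)
    case 0
    have "tail (\<lambda>j t y. 0) t y = 0" for t y by (simp add: tail_def)
    moreover from this have "mass (\<lambda>j t y. 0) = (\<lambda>t. 0)" by (simp add: mass_def fun_eq_iff)
    ultimately have "forcing (\<lambda>j t y. 0) j t y = 0" if "j \<le> 2" for j t y
      using less_3_cases[OF that] by (auto simp: forcing_def mass_integral_def)
    then have "duhamel (\<lambda>j t y. G j t y + forcing (P 0) j t y) j t y = duhamel G j t y"
      using that by (intro duhamel_cong) (auto simp: P_def)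
    then show ?case by (simp add: P_def e_def)
  next
    case (Suc n)
    have "P (Suc n) = (\<lambda>j t y. P n j t y + e n j t y)" by (simp add: P_def fun_eq_iff)
    then have "duhamel (\<lambda>j t y. G j t y + forcing (P (Suc n)) j t y) j t y =
       duhamel (\<lambda>j t y. (G j t y + forcing (P n) j t y) + forcing (e n) j t y) j t y"
      using that by (intro duhamel_cong) (auto simp: forcing_add[OF P e])
    also have "\<dots> = duhamel (\<lambda>j t y. G j t y + forcing (P n) j t y) j t y + duhamel (forcing (e n)) j t y"
      by (rule duhamel_add[OF profile_add[OF G profile_forcing[OF P]] profile_forcing[OF e] that(2,1)])
    also have "\<dots> = P (Suc (Suc n)) j t y" by (simp add: Suc) (simp add: P_def e_def)
    finally show ?case .
  qed
  \<comment> \<open>The limit is not taken inside \<open>duhamel\<close> and \<open>forcing\<close>.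
    Both act by linearity on the partial sum \<open>P n\<close> and the remainder
    \<open>R n\<close>, and the remainder is of size \<open>(1/2)^n\<close> before and
    after.\<close>
  have WF: "W j t y = duhamel F j t y" if j: "j \<le> 2" and t: "t \<in> {t0..T}" and y: "y \<ge> 0" for j t y
  proof -
    have "norm (W j t y - duhamel F j t y) \<le> (4 * \<kappa>0 * exp \<Lambda>) * (1/2)^n" for n
    proof -
      have "duhamel F j t y = duhamel (\<lambda>j t y. (G j t y + forcing (P n) j t y) + forcing (R n) j t y) j t y"
      proof (rule duhamel_cong)
        fix s y assume sy: "s \<in> {t0..T}" "0 \<le> (y::real)"
        have "forcing W j s y = forcing (\<lambda>j t y. P n j t y + R n j t y) j s y"
          by (rule forcing_cong[OF WPR sy j])
        then show "F j s y = G j s y + forcing (P n) j s y + forcing (R n) j s y"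
          unfolding F_def by (simp add: forcing_add[OF P R sy j])
      qed (use t in auto)
      also have "\<dots> = duhamel (\<lambda>j t y. G j t y + forcing (P n) j t y) j t y + duhamel (forcing (R n)) j t y"
        by (rule duhamel_add[OF profile_add[OF G profile_forcing[OF P]] profile_forcing[OF R] t j])
      also have "\<dots> = P (Suc n) j t y + duhamel (forcing (R n)) j t y" by (simp only: Pn[OF j t])
      finally have "W j t y - duhamel F j t y = R (Suc n) j t y - duhamel (forcing (R n)) j t y"
        using WPR[OF j t y, of "Suc n"] by simp
      moreover have "norm (R (Suc n) j t y) \<le> 2 * \<kappa>0 * (1/2)^Suc n * exp \<Lambda>"
        by (rule norm_profile_le_const[OF R t y j])
      moreover have "norm (duhamel (forcing (R n)) j t y) \<le> (2 * \<kappa>0 * (1/2)^n) / 2 * exp \<Lambda>"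
        by (rule norm_profile_le_const[OF step[OF R] t y j])
      ultimately have "norm (W j t y - duhamel F j t y) \<le> 2 * \<kappa>0 * (1/2)^Suc n * exp \<Lambda> + (2 * \<kappa>0 * (1/2)^n) / 2 * exp \<Lambda>"
        using norm_diff_le by metis
      also have "\<dots> \<le> (4 * \<kappa>0 * exp \<Lambda>) * (1/2)^n" using k0 by (simp add: mult_ac)
      finally show ?thesis .
    qed
    moreover have "(\<lambda>n. (4 * \<kappa>0 * exp \<Lambda>) * (1/2)^n) \<longlonglongrightarrow> (4 * \<kappa>0 * exp \<Lambda>) * 0"
      by (intro tendsto_intros LIMSEQ_power_zero) simp
    ultimately have "norm (W j t y - duhamel F j t y) \<le> (4 * \<kappa>0 * exp \<Lambda>) * 0"
      by (intro LIMSEQ_le_const) auto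
    then show ?thesis by simp
  qed
  \<comment> \<open>\<open>W\<close> agrees with \<open>duhamel F\<close> only for
    \<open>y \<ge> 0\<close>. Passing to the latter gives a function to which the statements about
    Duhamel integrals apply literally.\<close>
  define W' where "W' = duhamel F"
  show ?thesis
  proof (rule that[of _ W'])
    show W': "profile ((\<kappa>G + forcing_const * suminf \<kappa>) * gauss_exp_moment / \<Lambda>) W'"
      unfolding W'_def by (rule profile_duhamel[OF F])
    show "W' 0 t0 y = 0" for y unfolding W'_def by (rule duhamel_initial[OF F])
    show "((\<lambda>t. W' 0 t y) has_vector_derivative G 0 t y + forcing W' 0 t y + W' 2 t y) (at t within {t0..T})"
      if "t \<in> {t0..T}" "y > 0" for t y
    proof -
      have "forcing W 0 t y = forcing W' 0 t y"
        by (rule forcing_cong) (use WF that in \<open>auto simp: W'_def\<close>)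
      then have "F 0 t y = G 0 t y + forcing W' 0 t y" by (simp add: F_def)
      then show ?thesis
        using duhamel_has_time_derivative[OF F that(2,1)] unfolding W'_def[symmetric] by (simp only:)
    qed
  qed
qed

text \<open>The derivatives of \<open>(1 - cutoff 0) * s 0\<close>. In the final solution
  \<open>corr 0\<close> belongs to the primitive, \<open>corr 1\<close> to the velocity and
  \<open>corr 3\<close> to its second derivative.\<close>

definition corr :: "nat \<Rightarrow> real \<Rightarrow> real \<Rightarrow> complex" where
  "corr j t y = [(1 - cutoff 0 y) * s 0 t y, (1 - cutoff 0 y) * s 1 t y - cutoff 1 y * s 0 t y,
     (1 - cutoff 0 y) * s 2 t y - 2 * cutoff 1 y * s 1 t y - cutoff 2 y * s 0 t y,
     (1 - cutoff 0 y) * s 3 t y - 3 * cutoff 1 y * s 2 t y - 3 * cutoff 2 y * s 1 t y - cutoff 3 y * s 0 t y] ! j"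

lemma corr_deriv:
  assumes "t \<in> {t0..T}" "y > 0" "j < 3"
  shows "(corr j t has_vector_derivative corr (Suc j) t y) (at y)"
proof -
  note [derivative_intros] = s_deriv[OF _ assms(1,2)] cutoff_deriv
    has_vector_derivative_mult has_vector_derivative_mult_right
  note d = has_vector_derivative_eq_rhs
  have "j = 0 \<or> j = 1 \<or> j = 2" using assms(3) by auto
  moreover have "((\<lambda>y. (1 - cutoff 0 y) * s 0 t y) has_vector_derivative corr 1 t y) (at y)"
    by (rule d, (rule derivative_intros | simp)+) (simp add: corr_def algebra_simps)
  moreover have "((\<lambda>y. (1 - cutoff 0 y) * s 1 t y - cutoff 1 y * s 0 t y) has_vector_derivative corr 2 t y) (at y)"
    by (rule d, (rule derivative_intros | simp)+) (simp add: corr_def eval_nat_numeral algebra_simps)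
  moreover have "((\<lambda>y. (1 - cutoff 0 y) * s 2 t y - 2 * cutoff 1 y * s 1 t y - cutoff 2 y * s 0 t y)
      has_vector_derivative corr 3 t y) (at y)"
    by (rule d, (rule derivative_intros | simp)+) (simp add: corr_def eval_nat_numeral algebra_simps)
  ultimately show ?thesis
    by (elim disjE) (simp_all add: corr_def[abs_def] eval_nat_numeral)
qed

lemma continuous_corr: "j \<le> 3 \<Longrightarrow> continuous_on ({t0..T} \<times> {0<..}) (\<lambda>(t, y). corr j t y)"
proof -
  assume "j \<le> 3"
  then have j: "j = 0 \<or> j = 1 \<or> j = 2 \<or> j = 3" by linarith
  have f: "continuous_on ({t0..T} \<times> {0<..}) (\<lambda>p. s i (fst p) (snd p))" if "i \<le> 4" for i
    using s_cont[OF that] by (simp add: case_prod_beta')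
  have i: "continuous_on ({t0..T} \<times> {0<..}) (\<lambda>p. cutoff i (snd p))" if "i \<le> 5" for i
    by (rule continuous_on_compose2[OF continuous_cutoff[OF that, of UNIV]]) (auto intro: continuous_intros)
  show ?thesis using j
    by (elim disjE) (simp_all add: case_prod_beta' corr_def eval_nat_numeral f i continuous_intros)
qed

lemma norm_corr_wall:
  assumes "t \<in> {t0..T}" "y \<ge> 0" "j < 2" shows "norm (corr j t y) \<le> 10000 * K * y"
proof -
  have a: "norm (1 - cutoff 0 y) \<le> 5000 * y" using norm_cutoff_0_diff[OF assms(2)] by (simp add: norm_minus_commute)
  have 0: "norm ((1 - cutoff 0 y) * s 0 t y) \<le> 5000 * y * K" by (intro norm_mult_le a s_bound) (use assms in auto)
  have 1: "norm ((1 - cutoff 0 y) * s 1 t y - cutoff 1 y * s 0 t y) \<le> 5000 * y * K + 5000 * y * K"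
    by (intro norm_diff_le norm_mult_le a s_bound norm_cutoff_near_wall) (use assms in auto)
  have "0 \<le> y * K" using assms K_nonneg by simp
  moreover have "j = 0 \<or> j = 1" using assms(3) by auto
  ultimately show ?thesis using 0 1 by (elim disjE) (simp_all add: corr_def algebra_simps)
qed

lemma norm_corr_1_le:
  assumes "t \<in> {t0..T}" "y \<ge> 0" shows "norm (corr 1 t y) \<le> 5001 * norm (s 1 t y) + 5000 * K * exp (- y)"
    and "norm (corr 1 t y) \<le> 10001 * K"
proof -
  have e: "exp (- y) \<le> 1" using assms by simp
  have a: "norm (1 - cutoff 0 y) \<le> 1 + 5000"
  proof -
    have "norm (1 - cutoff 0 y) \<le> 1 + 5000 * exp (- y)"
      by (intro norm_diff_le norm_cutoff_le) (use assms in auto)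
    then show ?thesis using e by linarith
  qed
  have "norm (corr 1 t y) \<le> (1 + 5000) * norm (s 1 t y) + 5000 * exp (- y) * K"
    unfolding corr_def nth_Cons_0 One_nat_def nth_Cons_Suc
    by (intro norm_diff_le norm_mult_le a s_bound norm_cutoff_le order_refl) (use assms in auto)
  then show 1: "norm (corr 1 t y) \<le> 5001 * norm (s 1 t y) + 5000 * K * exp (- y)" by (simp add: mult_ac)
  have "norm (s 1 t y) \<le> K" using assms by (intro s_bound) auto
  moreover have "K * exp (- y) \<le> K * 1" using e K_nonneg by (intro mult_left_mono) auto
  ultimately show "norm (corr 1 t y) \<le> 10001 * K" using 1 by linarith
qed

text \<open>The conditions on \<open>D 0\<close> and \<open>D 2\<close> at the wall are those under
  which the datum and its second derivative, which enters as a source, are profiles.\<close>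

theorem mode_solution:
  fixes D :: "nat \<Rightarrow> real \<Rightarrow> complex"
  assumes small: "forcing_const * gauss_exp_moment / \<Lambda> \<le> 1 / 2"
    and s_time: "\<And>j t y. j < 2 \<Longrightarrow> t \<in> {t0..T} \<Longrightarrow> y > 0 \<Longrightarrow>
      ((\<lambda>t. s j t y) has_vector_derivative s (j + 2) t y) (at t within {t0..T})"
    and s_far: "\<And>t. t \<in> {t0..T} \<Longrightarrow> (s 1 t \<longlongrightarrow> 0) at_top"
    and D: "\<And>j y. j < 4 \<Longrightarrow> (D j has_vector_derivative D (Suc j) y) (at y)"
      "\<And>j. j \<le> 4 \<Longrightarrow> continuous_on UNIV (D j)"
      "\<And>j y. j \<le> 4 \<Longrightarrow> y \<ge> 0 \<Longrightarrow> norm (D j y) \<le> \<kappa>0 * exp (- y)" "D 0 0 = 0" "D 2 0 = 0"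
  obtains u ut uy uyy \<psi> :: "real \<Rightarrow> real \<Rightarrow> complex" and B :: real where
    "\<And>y. y \<ge> 0 \<Longrightarrow> u t0 y = D 0 y"
    "continuous_on ({t0..T} \<times> {0..}) (\<lambda>(t, y). u t y)"
    "continuous_on ({t0..T} \<times> {0..}) (\<lambda>(t, y). \<psi> t y)"
    "continuous_on ({t0..T} \<times> {0<..}) (\<lambda>(t, y). ut t y)"
    "continuous_on ({t0..T} \<times> {0<..}) (\<lambda>(t, y). uy t y)"
    "continuous_on ({t0..T} \<times> {0<..}) (\<lambda>(t, y). uyy t y)"
    "\<And>t. t \<in> {t0..T} \<Longrightarrow> u t 0 = 0" "\<And>t. t \<in> {t0..T} \<Longrightarrow> \<psi> t 0 = 0"
    "\<And>t y. t \<in> {t0..T} \<Longrightarrow> y \<ge> 0 \<Longrightarrow> norm (u t y) \<le> B"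
    "\<And>t. t \<in> {t0..T} \<Longrightarrow> (u t \<longlongrightarrow> 0) at_top"
    "\<And>t y. t \<in> {t0..T} \<Longrightarrow> y > 0 \<Longrightarrow> (\<psi> t has_vector_derivative u t y) (at y)"
    "\<And>t y. t \<in> {t0..T} \<Longrightarrow> y > 0 \<Longrightarrow> (u t has_vector_derivative uy t y) (at y)"
    "\<And>t y. t \<in> {t0..T} \<Longrightarrow> y > 0 \<Longrightarrow> (uy t has_vector_derivative uyy t y) (at y)"
    "\<And>t y. t \<in> {t0..T} \<Longrightarrow> y > 0 \<Longrightarrow> ((\<lambda>t. u t y) has_vector_derivative ut t y) (at t within {t0..T})"
    "\<And>t y. t \<in> {t0..T} \<Longrightarrow> y > 0 \<Longrightarrow> ut t y + c * (s 0 t y * u t y - s 1 t y * \<psi> t y) - uyy t y = 0"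
proof -
  have k0: "\<kappa>0 \<ge> 0" using D(3)[of 0 0] order_trans[OF norm_ge_zero] by fastforce
  have lift: "profile \<kappa>0 (\<lambda>j t y. D (j + i) y)" if "i \<in> {0, 2}" for i
    unfolding profile_def
  proof (intro conjI ballI allI impI)
    have c: "continuous_on A (\<lambda>p. D (j + i) (snd p))" if "j \<le> 2" for A :: "(real \<times> real) set" and j
      by (rule continuous_on_compose2[OF D(2)]) (use that \<open>i \<in> {0, 2}\<close> in \<open>auto intro: continuous_intros\<close>)
    show "continuous_on ({t0..T} \<times> {0..}) (\<lambda>(t, y). D (j + i) y)" if "j < 2" for j
      using c[of j] that by (simp add: case_prod_beta')
    show "continuous_on ({t0..T} \<times> {0<..}) (\<lambda>(t, y). D (2 + i) y)"
      using c[of 2] by (simp add: case_prod_beta')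
    show "norm (D (j + i) y) \<le> \<kappa>0 * exp (\<Lambda> * (t - t0) - y)" if "j \<le> 2" "t \<in> {t0..T}" "y \<ge> 0" for j t y
    proof -
      have "norm (D (j + i) y) \<le> \<kappa>0 * exp (- y)" using that \<open>i \<in> {0, 2}\<close> by (intro D(3)) auto
      also have "\<dots> \<le> \<kappa>0 * exp (\<Lambda> * (t - t0) - y)" using that \<Lambda>_pos k0 by (intro mult_left_mono) auto
      finally show ?thesis .
    qed
  qed (use that D(1,4,5) in auto)
  \<comment> \<open>The datum is split off as the stationary profile \<open>P0\<close>; its second
    derivative and its forcing become the source \<open>G\<close> of a problem with zero
    data.\<close>
  define P0 where "P0 = (\<lambda>j (t::real) y. D (j + 0) y)"
  define G where "G = (\<lambda>j t y. D (j + 2) y + forcing P0 j t y)"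
  have P0: "profile \<kappa>0 P0" unfolding P0_def by (rule lift) simp
  have G: "profile (\<kappa>0 + forcing_const * \<kappa>0) G"
    unfolding G_def by (intro profile_add lift profile_forcing P0) simp
  obtain \<kappa> W where W: "profile \<kappa> W" "\<And>y. W 0 t0 y = 0"
    "\<And>t y. t \<in> {t0..T} \<Longrightarrow> y > 0 \<Longrightarrow>
      ((\<lambda>t. W 0 t y) has_vector_derivative G 0 t y + forcing W 0 t y + W 2 t y) (at t within {t0..T})"
    using forced_solution[OF small G] by metis
  define w where "w = (\<lambda>j t y. P0 j t y + W j t y)"
  have w: "profile (\<kappa>0 + \<kappa>) w" unfolding w_def by (intro profile_add P0 W)
  \<comment> \<open>This choice gives \<open>h\<close> the derivative \<open>c * mass w\<close>. In
    the equation \<open>c * mass w * corr 1\<close> then cancels, away from the wall, the part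
    \<open>- c * s 1 * mass w\<close> of the nonlocal term that has no exponential decay.\<close>
  define h where "h t = c * mass_integral w t" for t
  have hd: "(h has_vector_derivative c * mass w t) (at t within {t0..T})" if "t \<in> {t0..T}" for t
    unfolding h_def[abs_def]
    by (rule has_vector_derivative_mult_right[OF mass_integral_has_derivative[OF w that]])
  have hc: "continuous_on {t0..T} h"
    by (meson continuous_on_eq_continuous_within has_vector_derivative_continuous hd)
  have hcp: "continuous_on ({t0..T} \<times> A) (\<lambda>p. h (fst p))" for A :: "real set"
    by (rule continuous_on_compose2[OF hc]) (auto intro: continuous_intros)
  have mcp: "continuous_on ({t0..T} \<times> A) (\<lambda>p. mass w (fst p))" for A :: "real set"
    by (rule continuous_on_compose2[OF continuous_mass[OF w]]) (auto intro: continuous_intros)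
  have h0: "h t0 = 0" by (simp add: h_def mass_integral_def)
  define Bh where "Bh = norm c * ((\<kappa>0 + \<kappa>) * exp \<Lambda>)"
  have hb: "norm (h t) \<le> Bh" if "t \<in> {t0..T}" for t
  proof -
    have "(\<kappa>0 + \<kappa>) * exp (\<Lambda> * (t - t0)) \<le> (\<kappa>0 + \<kappa>) * exp \<Lambda>"
      using that T_le \<Lambda>_pos profileD(6)[OF w] by (intro mult_left_mono) auto
    then have "norm (mass_integral w t) \<le> (\<kappa>0 + \<kappa>) * exp \<Lambda>" using norm_mass_integral_le[OF w that] by linarith
    then show ?thesis unfolding h_def Bh_def by (intro norm_mult_le order_refl)
  qed
  have c0: "continuous_on ({t0..T} \<times> {0..}) (\<lambda>p. corr j (fst p) (snd p))" if "j < 2" for j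
    using continuous_on_wall[OF continuous_corr[of j] norm_corr_wall] that by (simp add: case_prod_beta')
  have cw: "continuous_on ({t0..T} \<times> {0..}) (\<lambda>p. w 0 (fst p) (snd p))"
    using profileD(2)[OF w, of 0] by (simp add: case_prod_beta')
  have cw': "continuous_on ({t0..T} \<times> {0<..}) (\<lambda>p. w j (fst p) (snd p))" if "j \<le> 2" for j
    using profileD(3)[OF w that] by (simp add: case_prod_beta')
  have cc: "continuous_on ({t0..T} \<times> {0<..}) (\<lambda>p. corr j (fst p) (snd p))" if "j \<le> 3" for j
    using continuous_corr[OF that] by (simp add: case_prod_beta')
  have ct: "continuous_on ({t0..T} \<times> {0..}) (\<lambda>p. tail w (fst p) (snd p))"
    using continuous_tail[OF w] by (simp add: case_prod_beta')
  have cs: "continuous_on ({t0..T} \<times> {0<..}) (\<lambda>p. s i (fst p) (snd p))" if "i \<le> 4" for i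
    using s_cont[OF that] by (simp add: case_prod_beta')
  have cx: "continuous_on ({t0..T} \<times> {0<..}) (\<lambda>p. cutoff i (snd p))" if "i \<le> 5" for i
    by (rule continuous_on_compose2[OF continuous_cutoff[OF that, of UNIV]]) (auto intro: continuous_intros)
  have cf: "continuous_on ({t0..T} \<times> {0<..}) (\<lambda>p. forcing w 0 (fst p) (snd p))"
    using continuous_forcing[OF w, of 0] by (simp add: case_prod_beta')
  have D20: "D 2 y + forcing P0 0 t y + forcing W 0 t y + W 2 t y = w 2 t y + forcing w 0 t y"
    if "t \<in> {t0..T}" "y \<ge> 0" for t y
    using forcing_add[OF P0 W(1) that, of 0] by (simp add: w_def P0_def)
  have wt: "((\<lambda>t. w 0 t y) has_vector_derivative w 2 t y + forcing w 0 t y) (at t within {t0..T})"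
    if "t \<in> {t0..T}" "y > 0" for t y
  proof -
    have "((\<lambda>t. D 0 y + W 0 t y) has_vector_derivative 0 + (G 0 t y + forcing W 0 t y + W 2 t y)) (at t within {t0..T})"
      by (intro has_vector_derivative_add has_vector_derivative_const W that)
    moreover have "0 + (G 0 t y + forcing W 0 t y + W 2 t y) = w 2 t y + forcing w 0 t y"
      using D20[of t y] that by (simp add: G_def numeral_2_eq_2)
    moreover have "w 0 t y = D 0 y + W 0 t y" for t by (simp add: w_def P0_def)
    ultimately show ?thesis by (simp only:)
  qed
  define corr_t where "corr_t t y = (1 - cutoff 0 y) * s 3 t y - cutoff 1 y * s 2 t y" for t y
  have corr_t: "((\<lambda>t. corr 1 t y) has_vector_derivative corr_t t y) (at t within {t0..T})" if "t \<in> {t0..T}" "y > 0" for t y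
  proof -
    have "((\<lambda>t. (1 - cutoff 0 y) * s 1 t y - cutoff 1 y * s 0 t y) has_vector_derivative
       (1 - cutoff 0 y) * s (1 + 2) t y - cutoff 1 y * s (0 + 2) t y) (at t within {t0..T})"
      by (intro has_vector_derivative_diff has_vector_derivative_mult_right s_time that) auto
    then show ?thesis by (simp add: corr_def corr_t_def numeral_3_eq_3 numeral_2_eq_2)
  qed
  show ?thesis
  proof (rule that[of "\<lambda>t y. w 0 t y + h t * corr 1 t y" "\<lambda>t y. mass w t - tail w t y + h t * corr 0 t y"
        "\<lambda>t y. w 2 t y + forcing w 0 t y + (h t * corr_t t y + c * mass w t * corr 1 t y)"
        "\<lambda>t y. w 1 t y + h t * corr 2 t y" "\<lambda>t y. w 2 t y + h t * corr 3 t y"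
        "(\<kappa>0 + \<kappa>) * exp \<Lambda> + Bh * (10001 * K)"])
    show "w 0 t0 y + h t0 * corr 1 t0 y = D 0 y" for y
      by (simp add: h0 w_def P0_def W(2))
    show "continuous_on ({t0..T} \<times> {0..}) (\<lambda>(t, y). w 0 t y + h t * corr 1 t y)"
      unfolding case_prod_beta' by (intro continuous_intros cw hcp c0) simp
    show "continuous_on ({t0..T} \<times> {0..}) (\<lambda>(t, y). mass w t - tail w t y + h t * corr 0 t y)"
      unfolding case_prod_beta' by (intro continuous_intros mcp ct hcp c0) simp
    show "continuous_on ({t0..T} \<times> {0<..}) (\<lambda>(t, y). w 2 t y + forcing w 0 t y + (h t * corr_t t y + c * mass w t * corr 1 t y))"
      unfolding case_prod_beta' corr_t_def by (intro continuous_intros mcp hcp cw' cf cs cx cc) auto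
    show "continuous_on ({t0..T} \<times> {0<..}) (\<lambda>(t, y). w 1 t y + h t * corr 2 t y)"
      "continuous_on ({t0..T} \<times> {0<..}) (\<lambda>(t, y). w 2 t y + h t * corr 3 t y)"
      unfolding case_prod_beta' by (intro continuous_intros hcp cw' cc; simp)+
    show "w 0 t 0 + h t * corr 1 t 0 = 0" if "t \<in> {t0..T}" for t
      using norm_corr_wall[OF that, of 0 1] profileD(1)[OF w that] by simp
    show "mass w t - tail w t 0 + h t * corr 0 t 0 = 0" if "t \<in> {t0..T}" for t
      using norm_corr_wall[OF that, of 0 0] by (simp add: mass_def)
    show "norm (w 0 t y + h t * corr 1 t y) \<le> (\<kappa>0 + \<kappa>) * exp \<Lambda> + Bh * (10001 * K)"
      if "t \<in> {t0..T}" "y \<ge> 0" for t y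
      by (intro norm_add_le norm_mult_le hb norm_corr_1_le norm_profile_le_const[OF w] that) simp
    show "((\<lambda>y. w 0 t y + h t * corr 1 t y) \<longlongrightarrow> 0) at_top" if t: "t \<in> {t0..T}" for t
    proof (rule Lim_null_comparison)
      show "\<forall>\<^sub>F y in at_top. norm (w 0 t y + h t * corr 1 t y) \<le>
          (\<kappa>0 + \<kappa>) * exp (\<Lambda> * (t - t0)) * exp (- y) + Bh * (5001 * norm (s 1 t y) + 5000 * K * exp (- y))"
        using eventually_ge_at_top[of 0]
      proof eventually_elim
        case (elim y)
        have "norm (w 0 t y) \<le> (\<kappa>0 + \<kappa>) * exp (\<Lambda> * (t - t0)) * exp (- y)"
          using profileD(5)[OF w _ t elim, of 0] by (simp add: exp_minus_mult mult.assoc)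
        then show ?case by (intro norm_add_le norm_mult_le hb norm_corr_1_le t elim)
      qed
      have e: "((\<lambda>y::real. exp (- y)) \<longlongrightarrow> 0) at_top" by real_asymp
      have "((\<lambda>y. (\<kappa>0 + \<kappa>) * exp (\<Lambda> * (t - t0)) * exp (- y) + Bh * (5001 * norm (s 1 t y) + 5000 * K * exp (- y)))
         \<longlongrightarrow> (\<kappa>0 + \<kappa>) * exp (\<Lambda> * (t - t0)) * 0 + Bh * (5001 * norm (0::complex) + 5000 * K * 0)) at_top"
        by (intro tendsto_intros e s_far t)
      then show "((\<lambda>y. (\<kappa>0 + \<kappa>) * exp (\<Lambda> * (t - t0)) * exp (- y) + Bh * (5001 * norm (s 1 t y) + 5000 * K * exp (- y)))
         \<longlongrightarrow> 0) at_top" by simp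
    qed
    fix t y assume t: "t \<in> {t0..T}" and y: "(y::real) > 0"
    note cd = corr_deriv[OF t y]
    have "((\<lambda>y. mass w t - tail w t y + h t * corr 0 t y) has_vector_derivative 0 - (- w 0 t y) + h t * corr (Suc 0) t y) (at y)"
      by (intro has_vector_derivative_add has_vector_derivative_diff has_vector_derivative_const has_vector_derivative_mult_right
          tail_has_derivative[OF w t y] cd) simp
    then show "((\<lambda>y. mass w t - tail w t y + h t * corr 0 t y) has_vector_derivative w 0 t y + h t * corr 1 t y) (at y)"
      by simp
    have "((\<lambda>y. w 0 t y + h t * corr 1 t y) has_vector_derivative w (Suc 0) t y + h t * corr (Suc 1) t y) (at y)"
      by (intro has_vector_derivative_add has_vector_derivative_mult_right cd profileD(4)[OF w t y]) auto
    then show "((\<lambda>y. w 0 t y + h t * corr 1 t y) has_vector_derivative w 1 t y + h t * corr 2 t y) (at y)"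
      by (simp add: numeral_2_eq_2)
    have "((\<lambda>y. w 1 t y + h t * corr 2 t y) has_vector_derivative w (Suc 1) t y + h t * corr (Suc 2) t y) (at y)"
      by (intro has_vector_derivative_add has_vector_derivative_mult_right cd profileD(4)[OF w t y]) auto
    then show "((\<lambda>y. w 1 t y + h t * corr 2 t y) has_vector_derivative w 2 t y + h t * corr 3 t y) (at y)"
      by (simp add: numeral_2_eq_2 numeral_3_eq_3)
    show "((\<lambda>t. w 0 t y + h t * corr 1 t y) has_vector_derivative
       w 2 t y + forcing w 0 t y + (h t * corr_t t y + c * mass w t * corr 1 t y)) (at t within {t0..T})"
      by (intro has_vector_derivative_add has_vector_derivative_mult wt hd corr_t t y)
    show "w 2 t y + forcing w 0 t y + (h t * corr_t t y + c * mass w t * corr 1 t y)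
       + c * (s 0 t y * (w 0 t y + h t * corr 1 t y) - s 1 t y * (mass w t - tail w t y + h t * corr 0 t y))
       - (w 2 t y + h t * corr 3 t y) = 0"
      unfolding forcing_def corr_def corr_t_def far_field_def corrector_residual_def h_def
      by (simp add: numeral_3_eq_3 algebra_simps)
  qed
qed

end

text \<open>The factor \<open>c\<close> will be \<open>\<i> * k\<close>, and \<open>\<psi>\<close>
  is the primitive of \<open>u\<close> that vanishes at the wall. The derivatives are passed along
  so that the construction of a solution and the duality argument share one interface.\<close>

definition mode_flow :: "real \<Rightarrow> real \<Rightarrow> complex \<Rightarrow> (nat \<Rightarrow> real \<Rightarrow> real \<Rightarrow> real) \<Rightarrow>
    (real \<Rightarrow> real \<Rightarrow> complex) \<Rightarrow> (real \<Rightarrow> real \<Rightarrow> complex) \<Rightarrow> (real \<Rightarrow> real \<Rightarrow> complex) \<Rightarrow>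
    (real \<Rightarrow> real \<Rightarrow> complex) \<Rightarrow> (real \<Rightarrow> real \<Rightarrow> complex) \<Rightarrow> bool" where
  "mode_flow t0 T c S u ut uy uyy \<psi> \<longleftrightarrow>
     continuous_on ({t0..T} \<times> {0..}) (\<lambda>(t, y). u t y) \<and>
     continuous_on ({t0..T} \<times> {0..}) (\<lambda>(t, y). \<psi> t y) \<and>
     continuous_on ({t0..T} \<times> {0<..}) (\<lambda>(t, y). ut t y) \<and>
     continuous_on ({t0..T} \<times> {0<..}) (\<lambda>(t, y). uy t y) \<and>
     continuous_on ({t0..T} \<times> {0<..}) (\<lambda>(t, y). uyy t y) \<and>
     (\<exists>B. \<forall>t\<in>{t0..T}. \<forall>y\<ge>0. norm (u t y) \<le> B) \<and>
     (\<forall>t\<in>{t0..T}. u t 0 = 0 \<and> \<psi> t 0 = 0 \<and> (u t \<longlongrightarrow> 0) at_top) \<and>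
     (\<forall>t\<in>{t0..T}. \<forall>y>0.
        (\<psi> t has_vector_derivative u t y) (at y) \<and>
        (u t has_vector_derivative uy t y) (at y) \<and>
        (uy t has_vector_derivative uyy t y) (at y) \<and>
        ((\<lambda>t. u t y) has_vector_derivative ut t y) (at t within {t0..T}) \<and>
        ut t y + c * (of_real (S 0 t y) * u t y - of_real (S 1 t y) * \<psi> t y) - uyy t y = 0)"

lemma mode_flow_restrict:
  assumes "mode_flow t0 T c S u ut uy uyy \<psi>" "T' \<le> T"
  shows "mode_flow t0 T' c S u ut uy uyy \<psi>"
proof -
  have sub: "{t0..T'} \<subseteq> {t0..T}" using assms(2) by auto
  have sub': "{t0..T'} \<times> Y \<subseteq> {t0..T} \<times> Y" for Y :: "real set" using assms(2) by auto
  have d: "((\<lambda>t. u t y) has_vector_derivative ut t y) (at t within {t0..T'})"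
    if "((\<lambda>t. u t y) has_vector_derivative ut t y) (at t within {t0..T})" for t y
    by (rule has_vector_derivative_within_subset[OF that sub])
  show ?thesis
    using assms(1) sub unfolding mode_flow_def
    by (elim conjE, intro conjI) (blast intro: continuous_on_subset[OF _ sub'] d)+
qed

section \<open>Parabolic expansion at a critical point\<close>

text \<open>\<open>S_t\<close> is the heat equation differentiated in \<open>y\<close>. Since
  \<open>t0 > 0\<close> all orders are available near the base point; the expansion draws on those
  up to 5.\<close>

locale critical_point =
  fixes S :: "nat \<Rightarrow> real \<Rightarrow> real \<Rightarrow> real" and t0 a0 :: real
  assumes S_y: "\<And>j t y. t > 0 \<Longrightarrow> y > 0 \<Longrightarrow> (S j t has_real_derivative S (Suc j) t y) (at y)"
    and S_t: "\<And>j t y. t > 0 \<Longrightarrow> y > 0 \<Longrightarrow> ((\<lambda>t. S j t y) has_real_derivative S (j + 2) t y) (at t)"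
    and S_cont: "\<And>j. continuous_on ({0<..} \<times> {0<..}) (\<lambda>(t, y). S j t y)"
    and t0: "t0 > 0" and a0: "a0 > 0" and S1_0: "S 1 t0 a0 = 0" and S2_0: "S 2 t0 a0 \<noteq> 0"
begin

text \<open>The bound \<open>a0 / 2\<close> keeps the box off the wall. The bounds 1/2 for
  \<open>\<eta>\<close> and 1/4 for \<open>\<tau>\<close> make \<open>\<rho> \<le> 1\<close>, so
  that a higher parabolic order implies a lower one.\<close>

definition r1 :: real where "r1 = min (a0 / 2) (1 / 2)"

definition box :: "(real \<times> real) set" where "box = {0..1/4} \<times> {-r1..r1}"

definition \<rho> :: "real \<Rightarrow> real \<Rightarrow> real" where "\<rho> \<tau> \<eta> = \<bar>\<eta>\<bar> + sqrt \<tau>"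

lemma r1: "0 < r1" "r1 \<le> 1/2" "r1 < a0" using a0 by (auto simp: r1_def)

lemma boxD: assumes "(\<tau>, \<eta>) \<in> box"
  shows "0 \<le> \<tau>" "\<tau> \<le> 1/4" "\<bar>\<eta>\<bar> \<le> r1" "t0 + \<tau> > 0" "a0 + \<eta> > 0" "0 \<le> \<rho> \<tau> \<eta>" "\<rho> \<tau> \<eta> \<le> 1" "\<bar>\<eta>\<bar> \<le> \<rho> \<tau> \<eta>"
    "sqrt \<tau> \<le> \<rho> \<tau> \<eta>" "\<tau> \<le> \<rho> \<tau> \<eta> ^ 2"
proof -
  show a: "0 \<le> \<tau>" "\<tau> \<le> 1/4" "\<bar>\<eta>\<bar> \<le> r1" "t0 + \<tau> > 0" "a0 + \<eta> > 0"
    using assms t0 r1 by (auto simp: box_def)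
  have "sqrt \<tau> \<le> sqrt ((1/2)^2)" using a by (intro real_sqrt_le_mono) (simp add: power2_eq_square)
  then have "sqrt \<tau> \<le> 1/2" by simp
  then show "0 \<le> \<rho> \<tau> \<eta>" "\<rho> \<tau> \<eta> \<le> 1" "\<bar>\<eta>\<bar> \<le> \<rho> \<tau> \<eta>" "sqrt \<tau> \<le> \<rho> \<tau> \<eta>"
    using a r1 by (auto simp: \<rho>_def)
  then have "(sqrt \<tau>)^2 \<le> \<rho> \<tau> \<eta> ^ 2" using a by (intro power_mono) auto
  then show "\<tau> \<le> \<rho> \<tau> \<eta> ^ 2" using a by simp
qed

lemma \<rho>_square_le: assumes "(\<tau>, \<eta>) \<in> box" shows "\<rho> \<tau> \<eta> ^ 2 \<le> 2 * (\<tau> + \<eta>\<^sup>2)"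
  using sum_squares_bound[of "\<bar>\<eta>\<bar>" "sqrt \<tau>"] boxD(1)[OF assms] by (simp add: \<rho>_def power2_sum)

text \<open>\<open>Ow m\<close> is vanishing to parabolic order \<open>m\<close>: a time counts as the square of a length.\<close>

definition Ow :: "nat \<Rightarrow> (real \<Rightarrow> real \<Rightarrow> complex) \<Rightarrow> bool" where
  "Ow m f \<longleftrightarrow> (\<exists>C. \<forall>(\<tau>, \<eta>)\<in>box. norm (f \<tau> \<eta>) \<le> C * \<rho> \<tau> \<eta> ^ m)"

lemma OwI: "(\<And>\<tau> \<eta>. (\<tau>, \<eta>) \<in> box \<Longrightarrow> norm (f \<tau> \<eta>) \<le> C * \<rho> \<tau> \<eta> ^ m) \<Longrightarrow> Ow m f"
  unfolding Ow_def by blast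

lemma OwE:
  assumes "Ow m f" obtains C where "C \<ge> 0" "\<And>\<tau> \<eta>. (\<tau>, \<eta>) \<in> box \<Longrightarrow> norm (f \<tau> \<eta>) \<le> C * \<rho> \<tau> \<eta> ^ m"
proof -
  obtain C where C: "\<And>\<tau> \<eta>. (\<tau>, \<eta>) \<in> box \<Longrightarrow> norm (f \<tau> \<eta>) \<le> C * \<rho> \<tau> \<eta> ^ m"
    using assms unfolding Ow_def by blast
  have "norm (f \<tau> \<eta>) \<le> \<bar>C\<bar> * \<rho> \<tau> \<eta> ^ m" if "(\<tau>, \<eta>) \<in> box" for \<tau> \<eta>
    using C[OF that] boxD(6)[OF that] by (meson abs_ge_self mult_right_mono order_trans zero_le_power)
  then show ?thesis using that[of "\<bar>C\<bar>"] by simp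
qed

lemma Ow_add: "Ow m f \<Longrightarrow> Ow m g \<Longrightarrow> Ow m (\<lambda>\<tau> \<eta>. f \<tau> \<eta> + g \<tau> \<eta>)"
proof (elim OwE)
  fix C D assume *: "\<And>\<tau> \<eta>. (\<tau>, \<eta>) \<in> box \<Longrightarrow> norm (f \<tau> \<eta>) \<le> C * \<rho> \<tau> \<eta> ^ m"
    "\<And>\<tau> \<eta>. (\<tau>, \<eta>) \<in> box \<Longrightarrow> norm (g \<tau> \<eta>) \<le> D * \<rho> \<tau> \<eta> ^ m"
  show ?thesis
    by (rule OwI[where C = "C + D"]) (use norm_triangle_mono[OF *] in \<open>simp add: distrib_right\<close>)
qed

lemma Ow_minus: "Ow m f \<Longrightarrow> Ow m (\<lambda>\<tau> \<eta>. - f \<tau> \<eta>)"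
  by (simp add: Ow_def)

lemma Ow_diff: "Ow m f \<Longrightarrow> Ow m g \<Longrightarrow> Ow m (\<lambda>\<tau> \<eta>. f \<tau> \<eta> - g \<tau> \<eta>)"
  using Ow_add[OF _ Ow_minus, of m f g] by simp

lemma Ow_mult: "Ow m f \<Longrightarrow> Ow n g \<Longrightarrow> Ow (m + n) (\<lambda>\<tau> \<eta>. f \<tau> \<eta> * g \<tau> \<eta>)"
proof (elim OwE)
  fix C D assume *: "C \<ge> 0" "D \<ge> 0" "\<And>\<tau> \<eta>. (\<tau>, \<eta>) \<in> box \<Longrightarrow> norm (f \<tau> \<eta>) \<le> C * \<rho> \<tau> \<eta> ^ m"
    "\<And>\<tau> \<eta>. (\<tau>, \<eta>) \<in> box \<Longrightarrow> norm (g \<tau> \<eta>) \<le> D * \<rho> \<tau> \<eta> ^ n"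
  show ?thesis
  proof (rule OwI[where C = "C * D"])
    fix \<tau> \<eta> assume b: "(\<tau>, \<eta>) \<in> box"
    have "norm (f \<tau> \<eta>) * norm (g \<tau> \<eta>) \<le> (C * \<rho> \<tau> \<eta> ^ m) * (D * \<rho> \<tau> \<eta> ^ n)"
      using boxD(6)[OF b] * by (intro mult_mono *(3,4) b) auto
    then show "norm (f \<tau> \<eta> * g \<tau> \<eta>) \<le> C * D * \<rho> \<tau> \<eta> ^ (m + n)" by (simp add: norm_mult power_add mult_ac)
  qed
qed

lemma Ow_mono: "Ow m f \<Longrightarrow> n \<le> m \<Longrightarrow> Ow n f"
proof (elim OwE)
  fix C assume *: "n \<le> m" "C \<ge> 0" "\<And>\<tau> \<eta>. (\<tau>, \<eta>) \<in> box \<Longrightarrow> norm (f \<tau> \<eta>) \<le> C * \<rho> \<tau> \<eta> ^ m"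
  show ?thesis
  proof (rule OwI[where C = C])
    fix \<tau> \<eta> assume b: "(\<tau>, \<eta>) \<in> box"
    have "C * \<rho> \<tau> \<eta> ^ m \<le> C * \<rho> \<tau> \<eta> ^ n"
      using * boxD(6,7)[OF b] by (intro mult_left_mono power_decreasing) auto
    then show "norm (f \<tau> \<eta>) \<le> C * \<rho> \<tau> \<eta> ^ n" using *(3)[OF b] by linarith
  qed
qed

lemma Ow_const: "Ow 0 (\<lambda>\<tau> \<eta>. c)" by (rule OwI[where C = "norm c"]) simp
lemma Ow_cmult: "Ow m f \<Longrightarrow> Ow m (\<lambda>\<tau> \<eta>. c * f \<tau> \<eta>)" using Ow_mult[OF Ow_const, of m f] by simp
lemma Ow_\<eta>: "Ow 1 (\<lambda>\<tau> \<eta>. of_real \<eta>)"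
  by (rule OwI[where C = 1]) (use boxD(8) in auto)
lemma Ow_\<tau>: "Ow 2 (\<lambda>\<tau> \<eta>. of_real \<tau>)"
  by (rule OwI[where C = 1]) (use boxD(1,10) in auto)
lemma Ow_mult': "Ow m f \<Longrightarrow> Ow n g \<Longrightarrow> k \<le> m + n \<Longrightarrow> Ow k (\<lambda>\<tau> \<eta>. f \<tau> \<eta> * g \<tau> \<eta>)"
  using Ow_mult Ow_mono by blast
lemma Ow_cong: "Ow m f \<Longrightarrow> (\<And>\<tau> \<eta>. (\<tau>, \<eta>) \<in> box \<Longrightarrow> f \<tau> \<eta> = g \<tau> \<eta>) \<Longrightarrow> Ow m g"
  unfolding Ow_def by fastforce

lemma box_path:
  assumes "(\<tau>, \<eta>) \<in> box" shows "\<bar>x\<bar> \<le> \<bar>\<eta>\<bar> \<Longrightarrow> (\<tau>, x) \<in> box" "0 \<le> x \<Longrightarrow> x \<le> \<tau> \<Longrightarrow> (x, 0) \<in> box"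
  using assms r1 by (auto simp: box_def)

text \<open>The expansion follows \<open>\<eta>\<close> at fixed \<open>\<tau>\<close> and then
  \<open>\<tau>\<close> at \<open>\<eta> = 0\<close>. Integration in time gains two parabolic orders
  because \<open>\<tau> \<le> \<rho> \<tau> \<eta> ^ 2\<close>, so order \<open>m - 1\<close>
  suffices for the time derivative.\<close>

lemma taylor_step:
  fixes E E1 E2 :: "real \<Rightarrow> real \<Rightarrow> real"
  assumes d1: "\<And>\<tau> \<eta>. (\<tau>, \<eta>) \<in> box \<Longrightarrow> (E \<tau> has_real_derivative E1 \<tau> \<eta>) (at \<eta>)"
    and d2: "\<And>\<tau> \<eta>. (\<tau>, \<eta>) \<in> box \<Longrightarrow> ((\<lambda>\<tau>. E \<tau> \<eta>) has_real_derivative E2 \<tau> \<eta>) (at \<tau>)"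
    and O1: "Ow m (\<lambda>\<tau> \<eta>. of_real (E1 \<tau> \<eta>))" and O2: "Ow (m - 1) (\<lambda>\<tau> \<eta>. of_real (E2 \<tau> \<eta>))" and 0: "E 0 0 = 0"
  shows "Ow (Suc m) (\<lambda>\<tau> \<eta>. of_real (E \<tau> \<eta>))"
  using O1 O2
proof (elim OwE)
  fix C D assume *: "C \<ge> 0" "D \<ge> 0"
    "\<And>\<tau> \<eta>. (\<tau>, \<eta>) \<in> box \<Longrightarrow> norm (complex_of_real (E1 \<tau> \<eta>)) \<le> C * \<rho> \<tau> \<eta> ^ m"
    "\<And>\<tau> \<eta>. (\<tau>, \<eta>) \<in> box \<Longrightarrow> norm (complex_of_real (E2 \<tau> \<eta>)) \<le> D * \<rho> \<tau> \<eta> ^ (m - 1)"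
  show ?thesis
  proof (rule OwI[where C = "C + D"])
    fix \<tau> \<eta> assume b: "(\<tau>, \<eta>) \<in> box"
    let ?r = "\<rho> \<tau> \<eta>"
    have "norm (E \<tau> \<eta> - E \<tau> 0) \<le> (C * ?r ^ m) * norm (\<eta> - 0)"
    proof (rule field_differentiable_bound[where S = "{- \<bar>\<eta>\<bar>..\<bar>\<eta>\<bar>}" and f' = "E1 \<tau>"])
      fix x assume x: "x \<in> {- \<bar>\<eta>\<bar>..\<bar>\<eta>\<bar>}"
      then have bx: "(\<tau>, x) \<in> box" and rx: "\<rho> \<tau> x \<le> ?r" using box_path(1)[OF b, of x] by (auto simp: \<rho>_def)
      show "(E \<tau> has_field_derivative E1 \<tau> x) (at x within {- \<bar>\<eta>\<bar>..\<bar>\<eta>\<bar>})"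
        by (rule has_field_derivative_at_within[OF d1[OF bx]])
      have "C * \<rho> \<tau> x ^ m \<le> C * ?r ^ m" using rx * boxD(6)[OF bx] by (intro mult_left_mono power_mono) auto
      then show "norm (E1 \<tau> x) \<le> C * ?r ^ m" using *(3)[OF bx] by simp
    qed auto
    also have "\<dots> \<le> (C * ?r ^ m) * ?r" using boxD(6,8)[OF b] * by (intro mult_left_mono) auto
    finally have A: "\<bar>E \<tau> \<eta> - E \<tau> 0\<bar> \<le> C * ?r ^ Suc m" by (simp add: mult_ac)
    have "norm (E \<tau> 0 - E 0 0) \<le> (D * ?r ^ (m - 1)) * norm (\<tau> - 0)"
    proof (rule field_differentiable_bound[where S = "{0..\<tau>}" and f' = "\<lambda>\<tau>. E2 \<tau> 0"])
      fix x assume x: "x \<in> {0..\<tau>}"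
      then have bx: "(x, 0) \<in> box" and rx: "\<rho> x 0 \<le> ?r" using box_path(2)[OF b, of x] by (auto simp: \<rho>_def add_increasing)
      show "((\<lambda>\<tau>. E \<tau> 0) has_field_derivative E2 x 0) (at x within {0..\<tau>})"
        by (rule has_field_derivative_at_within[OF d2[OF bx]])
      have "D * \<rho> x 0 ^ (m - 1) \<le> D * ?r ^ (m - 1)" using rx * boxD(6)[OF bx] by (intro mult_left_mono power_mono) auto
      then show "norm (E2 x 0) \<le> D * ?r ^ (m - 1)" using *(4)[OF bx] by simp
    qed (use boxD(1)[OF b] in auto)
    also have "\<dots> \<le> (D * ?r ^ (m - 1)) * ?r ^ 2"
      using boxD(1,6,10)[OF b] * by (intro mult_left_mono) auto
    \<comment> \<open>For \<open>m = 0\<close> the subtraction \<open>m - 1\<close> gives 0, and the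
      two orders gained in time exceed the one claimed; \<open>\<rho> \<le> 1\<close> closes the
      gap.\<close>
    also have "\<dots> \<le> D * ?r ^ Suc m"
    proof (cases m)
      case 0
      then show ?thesis using boxD(6,7)[OF b] * by (simp add: power2_eq_square mult_left_mono mult_left_le)
    qed (simp add: power2_eq_square)
    finally have "\<bar>E \<tau> 0\<bar> \<le> D * ?r ^ Suc m" by (simp add: 0)
    then show "norm (complex_of_real (E \<tau> \<eta>)) \<le> (C + D) * ?r ^ Suc m" using A by (simp add: distrib_right)
  qed
qed

section \<open>Comparison with the caloric Taylor polynomial\<close>

abbreviation s2 where "s2 \<equiv> S 2 t0 a0"
abbreviation s3 where "s3 \<equiv> S 3 t0 a0"

text \<open>The heat polynomial of degree 3 with the jet of the flow at \<open>(t0, a0)\<close>, and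
  its derivatives in \<open>y\<close>; time counts as degree 2. The linear term is absent because
  \<open>S 1 t0 a0 = 0\<close>.\<close>

definition caloric :: "nat \<Rightarrow> real \<Rightarrow> real \<Rightarrow> real" where
  "caloric j \<tau> \<eta> = (if j = 0 then S 0 t0 a0 + s2 * (\<tau> + \<eta>\<^sup>2 / 2) + s3 * (\<eta>^3 / 6 + \<eta> * \<tau>)
     else if j = 1 then s2 * \<eta> + s3 * (\<eta>\<^sup>2 / 2 + \<tau>) else if j = 2 then s2 + s3 * \<eta>
     else if j = 3 then s3 else 0)"

definition E :: "nat \<Rightarrow> real \<Rightarrow> real \<Rightarrow> real" where
  "E j \<tau> \<eta> = S j (t0 + \<tau>) (a0 + \<eta>) - caloric j \<tau> \<eta>"

lemma caloric_y: "(caloric j \<tau> has_real_derivative caloric (Suc j) \<tau> \<eta>) (at \<eta>)"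
proof -
  consider "j = 0" | "j = 1" | "j = 2" | "j \<ge> 3" by linarith
  then show ?thesis
    by cases (auto simp: caloric_def[abs_def] intro!: derivative_eq_intros simp: power2_eq_square algebra_simps)
qed

lemma caloric_t: "((\<lambda>\<tau>. caloric j \<tau> \<eta>) has_real_derivative caloric (j + 2) \<tau> \<eta>) (at \<tau>)"
proof -
  consider "j = 0" | "j = 1" | "j = 2" | "j \<ge> 3" by linarith
  then show ?thesis
    by cases (auto simp: caloric_def[abs_def] intro!: derivative_eq_intros simp: power2_eq_square algebra_simps)
qed

lemma E_y: assumes "(\<tau>, \<eta>) \<in> box" shows "(E j \<tau> has_real_derivative E (Suc j) \<tau> \<eta>) (at \<eta>)"
proof -
  have "((\<lambda>\<eta>. S j (t0 + \<tau>) (a0 + \<eta>)) has_real_derivative S (Suc j) (t0 + \<tau>) (a0 + \<eta>)) (at \<eta>)"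
    using S_y[OF boxD(4,5)[OF assms], of j] DERIV_shift[of "S j (t0 + \<tau>)" _ \<eta> a0] by (simp add: add.commute)
  from DERIV_diff[OF this caloric_y] show ?thesis by (simp add: E_def[abs_def])
qed

lemma E_t: assumes "(\<tau>, \<eta>) \<in> box" shows "((\<lambda>\<tau>. E j \<tau> \<eta>) has_real_derivative E (j + 2) \<tau> \<eta>) (at \<tau>)"
proof -
  have "((\<lambda>\<tau>. S j (t0 + \<tau>) (a0 + \<eta>)) has_real_derivative S (j + 2) (t0 + \<tau>) (a0 + \<eta>)) (at \<tau>)"
    using S_t[OF boxD(4,5)[OF assms], of j] DERIV_shift[of "\<lambda>t. S j t (a0 + \<eta>)" _ \<tau> t0] by (simp add: add.commute)
  from DERIV_diff[OF this caloric_t] show ?thesis by (simp add: E_def)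
qed

lemma Ow_S: "Ow 0 (\<lambda>\<tau> \<eta>. of_real (S j (t0 + \<tau>) (a0 + \<eta>)))"
proof -
  have "continuous_on box (\<lambda>p. S j (t0 + fst p) (a0 + snd p))"
    using boxD(4,5)
    by (intro continuous_on_compose2[OF S_cont[of j, unfolded case_prod_beta'], of _ "\<lambda>p. (t0 + fst p, a0 + snd p)", simplified] continuous_intros) auto
  moreover have "compact box" unfolding box_def by (intro compact_Times) auto
  ultimately have "bounded ((\<lambda>p. S j (t0 + fst p) (a0 + snd p)) ` box)"
    by (intro compact_imp_bounded compact_continuous_image)
  then obtain C where "\<And>p. p \<in> box \<Longrightarrow> norm (S j (t0 + fst p) (a0 + snd p)) \<le> C" by (auto simp: bounded_iff)
  then show ?thesis by (intro OwI[where C = C]) force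
qed

text \<open>Descending in \<open>j\<close>: from order 4 on boundedness is enough, and each
  application of \<open>taylor_step\<close> gains one order from the two derivatives already
  treated.\<close>

lemma Ow_E: "Ow 1 (\<lambda>\<tau> \<eta>. of_real (E 3 \<tau> \<eta>))" "Ow 2 (\<lambda>\<tau> \<eta>. of_real (E 2 \<tau> \<eta>))"
  "Ow 3 (\<lambda>\<tau> \<eta>. of_real (E 1 \<tau> \<eta>))" "Ow 4 (\<lambda>\<tau> \<eta>. of_real (E 0 \<tau> \<eta>))"
proof -
  have e4: "Ow 0 (\<lambda>\<tau> \<eta>. of_real (E j \<tau> \<eta>))" if "j \<ge> 4" for j
    using Ow_S[of j] that by (simp add: E_def caloric_def)
  have "Ow (Suc 0) (\<lambda>\<tau> \<eta>. of_real (E 3 \<tau> \<eta>))"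
    by (rule taylor_step[OF E_y E_t]) (use e4 in \<open>auto simp: E_def caloric_def\<close>)
  then show 3: "Ow 1 (\<lambda>\<tau> \<eta>. of_real (E 3 \<tau> \<eta>))" by simp
  have "Ow (Suc 1) (\<lambda>\<tau> \<eta>. of_real (E 2 \<tau> \<eta>))"
  proof (rule taylor_step[OF E_y E_t])
    show "Ow 1 (\<lambda>\<tau> \<eta>. complex_of_real (E (Suc 2) \<tau> \<eta>))" using 3 by simp
    show "Ow (1 - 1) (\<lambda>\<tau> \<eta>. complex_of_real (E (2 + 2) \<tau> \<eta>))" using e4[of 4] by simp
    show "E 2 0 0 = 0" by (simp add: E_def caloric_def)
  qed
  then show 2: "Ow 2 (\<lambda>\<tau> \<eta>. of_real (E 2 \<tau> \<eta>))" by (simp add: numeral_2_eq_2)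
  have "Ow (Suc 2) (\<lambda>\<tau> \<eta>. of_real (E 1 \<tau> \<eta>))"
  proof (rule taylor_step[OF E_y E_t])
    show "Ow 2 (\<lambda>\<tau> \<eta>. complex_of_real (E (Suc 1) \<tau> \<eta>))" using 2 by (simp only: Suc_1)
    show "Ow (2 - 1) (\<lambda>\<tau> \<eta>. complex_of_real (E (1 + 2) \<tau> \<eta>))" using 3 by (simp add: numeral_3_eq_3)
    show "E 1 0 0 = 0" using S1_0 by (simp add: E_def caloric_def)
  qed
  then show 1: "Ow 3 (\<lambda>\<tau> \<eta>. of_real (E 1 \<tau> \<eta>))" by (simp add: numeral_3_eq_3 numeral_2_eq_2)
  have "Ow (Suc 3) (\<lambda>\<tau> \<eta>. of_real (E 0 \<tau> \<eta>))"
  proof (rule taylor_step[OF E_y E_t])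
    show "Ow 3 (\<lambda>\<tau> \<eta>. complex_of_real (E (Suc 0) \<tau> \<eta>))" using 1 by simp
    show "Ow (3 - 1) (\<lambda>\<tau> \<eta>. complex_of_real (E (0 + 2) \<tau> \<eta>))" using 2 by (simp add: eval_nat_numeral)
    show "E 0 0 0 = 0" by (simp add: E_def caloric_def)
  qed
  then show "Ow 4 (\<lambda>\<tau> \<eta>. of_real (E 0 \<tau> \<eta>))" by (simp add: eval_nat_numeral)
qed

section \<open>The approximate adjoint solution\<close>

text \<open>
  With \<open>\<partial>\<^sub>y phase = \<sigma> 1 * M\<close> the nonlocal adjoint term \<open>\<integral>\<^sub>y\<^sup>\<infinity> \<sigma> 1 * M * F dz\<close> is \<open>F / N\<close>, so the adjoint
  equation for \<open>M * F\<close> becomes an ordinary differential expression \<open>F * (Mt + Myy + N * R1 + N\<^sup>2 * M * R2)\<close>. The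
  constants \<open>\<beta>\<close>, \<open>rate\<close> and \<open>\<gamma>\<close> are the ones for which \<open>R1\<close> and \<open>R2\<close> vanish to second
  and fourth parabolic order at the critical point.
\<close>

definition \<beta> :: complex where "\<beta> = csqrt (\<i> / of_real (8 * s2 ^ 3))"
definition rate :: complex where "rate = 2 * \<beta> * of_real (s2\<^sup>2)"
definition \<gamma> :: complex where "\<gamma> = - 8 * of_real s3 * \<beta> / (9 * of_real (s2\<^sup>2))"

lemma \<beta>_square: "8 * \<beta>\<^sup>2 * of_real s2 ^ 3 = \<i>"
  using S2_0 by (simp add: \<beta>_def)

text \<open>\<open>\<beta>\<^sup>2\<close> is a non-zero imaginary number, so
  \<open>\<bar>Re \<beta>\<bar> = \<bar>Im \<beta>\<bar>\<close>. The principal root has the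
  positive real part that makes the profile a decaying Gaussian, whatever the sign of
  \<open>s2\<close>.\<close>

lemma \<beta>_parts: "Re \<beta> > 0" "(Re \<beta>)\<^sup>2 = 1 / (16 * \<bar>s2\<bar> ^ 3)"
proof -
  have b: "\<beta>\<^sup>2 = \<i> / of_real (8 * s2 ^ 3)" by (simp add: \<beta>_def)
  have re: "Re (\<beta>\<^sup>2) = 0" and im: "Im (\<beta>\<^sup>2) = 1 / (8 * s2 ^ 3)"
    unfolding b by (simp_all add: Re_divide_of_real Im_divide_of_real del: of_real_mult of_real_power)
  have 1: "(Re \<beta>)\<^sup>2 = (Im \<beta>)\<^sup>2" using re by (simp add: Re_power2)
  have 2: "2 * Re \<beta> * Im \<beta> = 1 / (8 * s2 ^ 3)" using im by (simp add: Im_power2)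
  then have "\<bar>2 * Re \<beta> * Im \<beta>\<bar> = 1 / (8 * \<bar>s2\<bar> ^ 3)" by (simp add: abs_mult power_abs)
  moreover have "\<bar>Im \<beta>\<bar> = \<bar>Re \<beta>\<bar>" using 1 by (auto simp: power2_eq_iff abs_eq_iff)
  ultimately have "2 * (\<bar>Re \<beta>\<bar> * \<bar>Re \<beta>\<bar>) = 1 / (8 * \<bar>s2\<bar> ^ 3)" by (simp add: abs_mult)
  then have "2 * (Re \<beta>)\<^sup>2 = 1 / (8 * \<bar>s2\<bar> ^ 3)" by (simp add: power2_eq_square flip: abs_mult)
  then show "(Re \<beta>)\<^sup>2 = 1 / (16 * \<bar>s2\<bar> ^ 3)" by simp
  have "Re \<beta> \<noteq> 0" using 2 S2_0 by auto
  moreover have "Re \<beta> \<ge> 0" using csqrt_principal[of "\<i> / of_real (8 * s2 ^ 3)"] by (auto simp: \<beta>_def)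
  ultimately show "Re \<beta> > 0" by simp
qed

text \<open>The rate depends on \<open>s2\<close> alone, so a lower bound for
  \<open>\<bar>s2\<bar>\<close> that is uniform in \<open>t0\<close> yields one
  \<open>\<sigma>\<close> for all small times.\<close>

lemma Re_rate: "Re rate > 0" "Re rate = sqrt \<bar>s2\<bar> / 2"
proof -
  have r: "Re rate = 2 * Re \<beta> * s2\<^sup>2"
    unfolding rate_def by (simp del: of_real_power)
  then show p: "Re rate > 0" using \<beta>_parts(1) S2_0 by simp
  have "(Re rate)\<^sup>2 = 4 * (Re \<beta>)\<^sup>2 * s2 ^ 4" by (simp add: r power_mult_distrib flip: power_mult)
  also have "\<dots> = 4 * \<bar>s2\<bar> ^ 4 / (16 * \<bar>s2\<bar> ^ 3)" by (simp add: \<beta>_parts power_even_abs)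
  also have "\<dots> = \<bar>s2\<bar> / 4" using S2_0 by (simp add: field_simps eval_nat_numeral)
  also have "\<dots> = (sqrt \<bar>s2\<bar> / 2)\<^sup>2" by (simp add: power_divide)
  finally show "Re rate = sqrt \<bar>s2\<bar> / 2" using p by (simp add: power2_eq_iff_nonneg)
qed

section \<open>Coefficients of the adjoint expression and their first-order expansions\<close>

abbreviation \<sigma> :: "nat \<Rightarrow> real \<Rightarrow> real \<Rightarrow> complex" where "\<sigma> j t y \<equiv> complex_of_real (S j t y)"

definition M where "M t y = (2 * \<beta> + 3 * \<gamma> * \<sigma> 1 t y) * \<sigma> 2 t y"
definition My where "My t y = 3 * \<gamma> * \<sigma> 2 t y * \<sigma> 2 t y + (2 * \<beta> + 3 * \<gamma> * \<sigma> 1 t y) * \<sigma> 3 t y"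
definition Mt where "Mt t y = 3 * \<gamma> * \<sigma> 3 t y * \<sigma> 2 t y + (2 * \<beta> + 3 * \<gamma> * \<sigma> 1 t y) * \<sigma> 4 t y"
definition Myy where "Myy t y = 9 * \<gamma> * \<sigma> 2 t y * \<sigma> 3 t y + (2 * \<beta> + 3 * \<gamma> * \<sigma> 1 t y) * \<sigma> 4 t y"
definition R1 where "R1 t y = \<i> - M t y * (rate + \<sigma> 1 t y * (2 * \<beta> + 3 * \<gamma> * \<sigma> 1 t y) * \<sigma> 3 t y
   + 3 * \<sigma> 1 t y * My t y + \<sigma> 2 t y * M t y)"
definition R2 where "R2 t y = (M t y * \<sigma> 1 t y)\<^sup>2 - \<i> * (\<sigma> 0 t y - \<sigma> 0 t0 a0 - of_real (s2 * (t - t0)))"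

text \<open>An expansion modulo parabolic order 2, hence without a term in \<open>\<tau>\<close>.
  This is the precision to which \<open>R1\<close> has to vanish.\<close>

definition jet :: "(real \<Rightarrow> real \<Rightarrow> complex) \<Rightarrow> complex \<Rightarrow> complex \<Rightarrow> bool" where
  "jet f f0 f1 \<longleftrightarrow> Ow 2 (\<lambda>\<tau> \<eta>. f \<tau> \<eta> - (f0 + f1 * of_real \<eta>))"

lemma Ow_jet_poly: "Ow 0 (\<lambda>\<tau> \<eta>. f0 + f1 * of_real \<eta>)"
  by (intro Ow_add Ow_const Ow_mono[OF Ow_cmult[OF Ow_\<eta>]]) simp

lemma jet_Ow: "jet f f0 f1 \<Longrightarrow> Ow 0 f"
  using Ow_add[OF Ow_mono[of 2 _ 0] Ow_jet_poly[of f0 f1]] unfolding jet_def by fastforce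

lemma jet_const: "jet (\<lambda>\<tau> \<eta>. c) c 0"
  unfolding jet_def by (rule OwI[where C = 0]) simp

lemma jet_add: "jet f f0 f1 \<Longrightarrow> jet g g0 g1 \<Longrightarrow> jet (\<lambda>\<tau> \<eta>. f \<tau> \<eta> + g \<tau> \<eta>) (f0 + g0) (f1 + g1)"
  unfolding jet_def by (drule (1) Ow_add) (simp add: algebra_simps)

lemma jet_minus: "jet f f0 f1 \<Longrightarrow> jet (\<lambda>\<tau> \<eta>. - f \<tau> \<eta>) (- f0) (- f1)"
  unfolding jet_def by (drule Ow_minus) (simp add: algebra_simps)

lemma jet_mult:
  assumes f: "jet f f0 f1" and g: "jet g g0 g1"
  shows "jet (\<lambda>\<tau> \<eta>. f \<tau> \<eta> * g \<tau> \<eta>) (f0 * g0) (f0 * g1 + f1 * g0)"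
  unfolding jet_def
proof (rule Ow_cong)
  show "Ow 2 (\<lambda>\<tau> \<eta>. (f \<tau> \<eta> - (f0 + f1 * of_real \<eta>)) * g \<tau> \<eta>
      + ((f0 + f1 * of_real \<eta>) * (g \<tau> \<eta> - (g0 + g1 * of_real \<eta>)) + f1 * g1 * (of_real \<eta> * of_real \<eta>)))"
    using f g jet_Ow[OF g] unfolding jet_def
    by (intro Ow_add Ow_mult'[where m = 2 and n = 0] Ow_mult'[where m = 0 and n = 2] Ow_jet_poly Ow_const
        Ow_mult'[OF Ow_\<eta> Ow_\<eta>]) auto
qed (simp add: algebra_simps)

lemma jet_\<sigma>: "jet (\<lambda>\<tau> \<eta>. \<sigma> 1 (t0 + \<tau>) (a0 + \<eta>)) 0 (of_real s2)"
  "jet (\<lambda>\<tau> \<eta>. \<sigma> 2 (t0 + \<tau>) (a0 + \<eta>)) (of_real s2) (of_real s3)"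
proof -
  show "jet (\<lambda>\<tau> \<eta>. \<sigma> 2 (t0 + \<tau>) (a0 + \<eta>)) (of_real s2) (of_real s3)"
    using Ow_E(2) unfolding jet_def by (simp add: E_def caloric_def)
  have "Ow 2 (\<lambda>\<tau> \<eta>. of_real (E 1 \<tau> \<eta>) + of_real s3 * (of_real \<eta> * of_real \<eta> / 2 + of_real \<tau>))"
    using Ow_mult[OF Ow_\<eta> Ow_\<eta>, THEN Ow_cmult, of "1/2"]
    by (intro Ow_add Ow_mono[OF Ow_E(3)] Ow_cmult Ow_\<tau>) (auto simp: numeral_2_eq_2)
  then show "jet (\<lambda>\<tau> \<eta>. \<sigma> 1 (t0 + \<tau>) (a0 + \<eta>)) 0 (of_real s2)"
    unfolding jet_def by (simp add: E_def caloric_def power2_eq_square algebra_simps)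
qed

text \<open>Factors that multiply \<open>\<sigma> 1\<close>, which vanishes at the base point, are only needed to
  leading order.\<close>

lemma jet_mult_small:
  assumes f: "jet f 0 f1" and g: "Ow 1 (\<lambda>\<tau> \<eta>. g \<tau> \<eta> - g0)"
  shows "jet (\<lambda>\<tau> \<eta>. f \<tau> \<eta> * g \<tau> \<eta>) 0 (f1 * g0)"
  unfolding jet_def
proof (rule Ow_cong)
  have "Ow 1 (\<lambda>\<tau> \<eta>. (f \<tau> \<eta> - (0 + f1 * of_real \<eta>)) + f1 * of_real \<eta>)"
    using f unfolding jet_def by (intro Ow_add Ow_cmult Ow_\<eta>) (rule Ow_mono, auto)
  then have f1: "Ow 1 f" by simp
  show "Ow 2 (\<lambda>\<tau> \<eta>. (f \<tau> \<eta> - (0 + f1 * of_real \<eta>)) * g0 + f \<tau> \<eta> * (g \<tau> \<eta> - g0))"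
    using f unfolding jet_def
    by (intro Ow_add Ow_mult'[where m = 2 and n = 0] Ow_const Ow_mult'[OF f1 g]) auto
qed (simp add: algebra_simps)

lemma jet_lead: "jet g g0 g1 \<Longrightarrow> Ow 1 (\<lambda>\<tau> \<eta>. g \<tau> \<eta> - g0)"
proof -
  assume g: "jet g g0 g1"
  have "Ow 1 (\<lambda>\<tau> \<eta>. (g \<tau> \<eta> - (g0 + g1 * of_real \<eta>)) + g1 * of_real \<eta>)"
    using g unfolding jet_def by (intro Ow_add Ow_cmult Ow_\<eta>) (rule Ow_mono, auto)
  then show ?thesis by (simp add: algebra_simps)
qed

abbreviation M0 where "M0 \<equiv> 2 * \<beta> * of_real s2"
abbreviation M1 where "M1 \<equiv> - 2 / 3 * \<beta> * of_real s3"

lemma \<gamma>_s2: "3 * \<gamma> * of_real s2 * of_real s2 = - 8 / 3 * \<beta> * of_real s3"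
  using S2_0 by (simp add: \<gamma>_def power2_eq_square)

text \<open>The slope is \<open>2 * \<beta> * s3\<close> corrected by
  \<open>- 8/3 * \<beta> * s3\<close> through \<open>\<gamma>\<close>. The first-order part of
  \<open>R1\<close> and the cubic part of \<open>R2\<close> both force the resulting value
  \<open>M1\<close>.\<close>

lemma jet_M: "jet (\<lambda>\<tau> \<eta>. M (t0 + \<tau>) (a0 + \<eta>)) M0 M1"
proof -
  have "jet (\<lambda>\<tau> \<eta>. (2 * \<beta> + 3 * \<gamma> * \<sigma> 1 (t0 + \<tau>) (a0 + \<eta>)) * \<sigma> 2 (t0 + \<tau>) (a0 + \<eta>))
     ((2 * \<beta> + 3 * \<gamma> * 0) * of_real s2)
     ((2 * \<beta> + 3 * \<gamma> * 0) * of_real s3 + (0 + (3 * \<gamma> * of_real s2 + 0 * 0)) * of_real s2)"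
    by (intro jet_mult jet_add jet_const jet_\<sigma>)
  moreover have "(2 * \<beta> + 3 * \<gamma> * 0) * of_real s3 + (0 + (3 * \<gamma> * of_real s2 + 0 * 0)) * of_real s2 = M1"
    using \<gamma>_s2 by (simp add: algebra_simps)
  ultimately show ?thesis by (simp add: M_def)
qed

lemma Ow_\<sigma>3: "Ow 1 (\<lambda>\<tau> \<eta>. \<sigma> 3 (t0 + \<tau>) (a0 + \<eta>) - of_real s3)"
  using Ow_E(1) by (simp add: E_def caloric_def)

lemma Ow_lead_mult:
  assumes "Ow 1 (\<lambda>\<tau> \<eta>. f \<tau> \<eta> - f0)" "Ow 1 (\<lambda>\<tau> \<eta>. g \<tau> \<eta> - g0)"
  shows "Ow 1 (\<lambda>\<tau> \<eta>. f \<tau> \<eta> * g \<tau> \<eta> - f0 * g0)"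
proof (rule Ow_cong)
  show "Ow 1 (\<lambda>\<tau> \<eta>. (f \<tau> \<eta> - f0) * (g \<tau> \<eta> - g0) + ((f \<tau> \<eta> - f0) * g0 + f0 * (g \<tau> \<eta> - g0)))"
    by (intro Ow_add Ow_mult'[OF assms] Ow_mult'[OF assms(1) Ow_const] Ow_cmult assms) auto
qed (simp add: algebra_simps)

lemma Ow_lead_add:
  assumes "Ow 1 (\<lambda>\<tau> \<eta>. f \<tau> \<eta> - f0)" "Ow 1 (\<lambda>\<tau> \<eta>. g \<tau> \<eta> - g0)"
  shows "Ow 1 (\<lambda>\<tau> \<eta>. f \<tau> \<eta> + g \<tau> \<eta> - (f0 + g0))"
  using Ow_add[OF assms] by (simp add: algebra_simps)

lemma lead_factor: "Ow 1 (\<lambda>\<tau> \<eta>. (2 * \<beta> + 3 * \<gamma> * \<sigma> 1 (t0 + \<tau>) (a0 + \<eta>)) - 2 * \<beta>)"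
  using Ow_cmult[OF jet_lead[OF jet_\<sigma>(1)], of "3 * \<gamma>"] by simp

lemma lead_My: "Ow 1 (\<lambda>\<tau> \<eta>. My (t0 + \<tau>) (a0 + \<eta>) - M1)"
proof -
  have "Ow 1 (\<lambda>\<tau> \<eta>. 3 * \<gamma> * \<sigma> 2 (t0 + \<tau>) (a0 + \<eta>) * \<sigma> 2 (t0 + \<tau>) (a0 + \<eta>)
     + (2 * \<beta> + 3 * \<gamma> * \<sigma> 1 (t0 + \<tau>) (a0 + \<eta>)) * \<sigma> 3 (t0 + \<tau>) (a0 + \<eta>)
     - (3 * \<gamma> * of_real s2 * of_real s2 + 2 * \<beta> * of_real s3))"
    by (intro Ow_lead_add Ow_lead_mult lead_factor Ow_\<sigma>3 jet_lead[OF jet_\<sigma>(2)] jet_lead[OF jet_const])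
  moreover have "3 * \<gamma> * of_real s2 * of_real s2 + 2 * \<beta> * of_real s3 = M1"
    using \<gamma>_s2 by (simp add: algebra_simps)
  ultimately show ?thesis by (simp add: My_def)
qed

lemma Ow_R1: "Ow 2 (\<lambda>\<tau> \<eta>. R1 (t0 + \<tau>) (a0 + \<eta>))"
proof -
  let ?s1 = "\<lambda>\<tau> \<eta>. \<sigma> 1 (t0 + \<tau>) (a0 + \<eta>)"
  have a: "jet (\<lambda>\<tau> \<eta>. ?s1 \<tau> \<eta> * ((2 * \<beta> + 3 * \<gamma> * ?s1 \<tau> \<eta>) * \<sigma> 3 (t0 + \<tau>) (a0 + \<eta>)))
     0 (of_real s2 * (2 * \<beta> * of_real s3))"
    by (intro jet_mult_small jet_\<sigma> Ow_lead_mult lead_factor Ow_\<sigma>3)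
  have b: "jet (\<lambda>\<tau> \<eta>. ?s1 \<tau> \<eta> * (3 * My (t0 + \<tau>) (a0 + \<eta>))) 0 (of_real s2 * (3 * M1))"
    by (intro jet_mult_small jet_\<sigma> Ow_lead_mult lead_My jet_lead[OF jet_const])
  have c: "jet (\<lambda>\<tau> \<eta>. \<sigma> 2 (t0 + \<tau>) (a0 + \<eta>) * M (t0 + \<tau>) (a0 + \<eta>))
     (of_real s2 * M0) (of_real s2 * M1 + of_real s3 * M0)"
    by (intro jet_mult jet_\<sigma> jet_M)
  have "jet (\<lambda>\<tau> \<eta>. \<i> + - (M (t0 + \<tau>) (a0 + \<eta>) * (rate + ?s1 \<tau> \<eta> * ((2 * \<beta> + 3 * \<gamma> * ?s1 \<tau> \<eta>) * \<sigma> 3 (t0 + \<tau>) (a0 + \<eta>))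
     + ?s1 \<tau> \<eta> * (3 * My (t0 + \<tau>) (a0 + \<eta>)) + \<sigma> 2 (t0 + \<tau>) (a0 + \<eta>) * M (t0 + \<tau>) (a0 + \<eta>))))
     (\<i> + - (M0 * (rate + 0 + 0 + of_real s2 * M0)))
     (0 + - (M0 * (0 + of_real s2 * (2 * \<beta> * of_real s3) + of_real s2 * (3 * M1) + (of_real s2 * M1 + of_real s3 * M0))
        + M1 * (rate + 0 + 0 + of_real s2 * M0)))" (is "jet ?F _ _")
    by (intro jet_add jet_minus jet_mult jet_const jet_M a b c)
  \<comment> \<open>By \<open>\<beta>_square\<close> the products \<open>M0 * rate\<close> and
    \<open>s2 * M0\<^sup>2\<close> are both \<open>\<i> / 2\<close>.\<close>
  moreover have "\<i> + - (M0 * (rate + 0 + 0 + of_real s2 * M0)) = 0"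
    using \<beta>_square by (simp add: rate_def power2_eq_square power3_eq_cube algebra_simps)
  \<comment> \<open>The contributions with the factors \<open>M0\<close> and \<open>M1\<close> are
    \<open>8/3\<close> and \<open>- 8/3\<close> times
    \<open>\<beta>\<^sup>2 * s2\<^sup>2 * s3\<close>.\<close>
  moreover have "0 + - (M0 * (0 + of_real s2 * (2 * \<beta> * of_real s3) + of_real s2 * (3 * M1) + (of_real s2 * M1 + of_real s3 * M0))
        + M1 * (rate + 0 + 0 + of_real s2 * M0)) = 0"
    by (simp add: rate_def power2_eq_square algebra_simps)
  ultimately have "jet ?F 0 0" by (simp only:)
  then show ?thesis unfolding jet_def by (rule Ow_cong) (simp add: R1_def algebra_simps)
qed

text \<open>\<open>M * \<sigma> 1\<close> is split by parabolic order into \<open>x1\<close>,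
  \<open>x2\<close> and a remainder \<open>x3\<close>. In the square, \<open>x1 * x1\<close>
  reproduces the quadratic part of the flow by the choice of \<open>\<beta>\<close>, and
  \<open>2 * x1 * x2\<close> its cubic part by the choice of \<open>\<gamma>\<close>; all other
  products have order at least 4. The part linear in time is subtracted in \<open>R2\<close>, being
  carried by the oscillating factor of \<open>F\<close>.\<close>

lemma Ow_R2: "Ow 4 (\<lambda>\<tau> \<eta>. R2 (t0 + \<tau>) (a0 + \<eta>))"
proof -
  let ?s2 = "complex_of_real s2" and ?s3 = "complex_of_real s3"
  define x1 where "x1 \<tau> \<eta> = M0 * ?s2 * of_real \<eta>" for \<tau> \<eta> :: real
  define x2 where "x2 \<tau> \<eta> = M1 * ?s2 * (of_real \<eta> * of_real \<eta>) + M0 * ?s3 * (1/2 * (of_real \<eta> * of_real \<eta>) + of_real \<tau>)" for \<tau> \<eta> :: real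
  define x3 where "x3 \<tau> \<eta> = M (t0 + \<tau>) (a0 + \<eta>) * \<sigma> 1 (t0 + \<tau>) (a0 + \<eta>) - x1 \<tau> \<eta> - x2 \<tau> \<eta>" for \<tau> \<eta>
  have O1: "Ow 1 x1" unfolding x1_def[abs_def] by (intro Ow_cmult Ow_\<eta>)
  have O\<eta>\<eta>: "Ow 2 (\<lambda>\<tau> \<eta>. of_real \<eta> * of_real \<eta>)" using Ow_mult[OF Ow_\<eta> Ow_\<eta>] by (simp add: numeral_2_eq_2)
  have Op: "Ow 2 (\<lambda>\<tau> \<eta>. 1/2 * (of_real \<eta> * of_real \<eta>) + of_real \<tau>)" by (intro Ow_add Ow_cmult O\<eta>\<eta> Ow_\<tau>)
  have O2: "Ow 2 x2" unfolding x2_def[abs_def] by (intro Ow_add Ow_cmult O\<eta>\<eta> Ow_\<tau>)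
  have O3: "Ow 3 x3"
  proof (rule Ow_cong)
    show "Ow 3 (\<lambda>\<tau> \<eta>. (M (t0 + \<tau>) (a0 + \<eta>) - (M0 + M1 * of_real \<eta>)) * \<sigma> 1 (t0 + \<tau>) (a0 + \<eta>)
       + ((M0 + M1 * of_real \<eta>) * of_real (E 1 \<tau> \<eta>) + M1 * ?s3 * (of_real \<eta> * (1/2 * (of_real \<eta> * of_real \<eta>) + of_real \<tau>))))"
    proof (intro Ow_add Ow_cmult)
      show "Ow 3 (\<lambda>\<tau> \<eta>. (M (t0 + \<tau>) (a0 + \<eta>) - (M0 + M1 * of_real \<eta>)) * \<sigma> 1 (t0 + \<tau>) (a0 + \<eta>))"
        using jet_lead[OF jet_\<sigma>(1)] by (intro Ow_mult'[OF jet_M[unfolded jet_def]]) auto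
      show "Ow 3 (\<lambda>\<tau> \<eta>. (M0 + M1 * of_real \<eta>) * of_real (E 1 \<tau> \<eta>))"
        by (rule Ow_mult'[OF Ow_jet_poly Ow_E(3)]) simp
      show "Ow 3 (\<lambda>\<tau> \<eta>. of_real \<eta> * (1/2 * (of_real \<eta> * of_real \<eta>) + of_real \<tau>))"
        by (rule Ow_mult'[OF Ow_\<eta> Op]) simp
    qed
    show "(M (t0 + \<tau>) (a0 + \<eta>) - (M0 + M1 * of_real \<eta>)) * \<sigma> 1 (t0 + \<tau>) (a0 + \<eta>)
       + ((M0 + M1 * of_real \<eta>) * of_real (E 1 \<tau> \<eta>) + M1 * ?s3 * (of_real \<eta> * (1/2 * (of_real \<eta> * of_real \<eta>) + of_real \<tau>))) = x3 \<tau> \<eta>" for \<tau> \<eta>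
    proof -
      have "\<sigma> 1 (t0 + \<tau>) (a0 + \<eta>) = of_real (E 1 \<tau> \<eta>) + ?s2 * of_real \<eta> + ?s3 * (1/2 * (of_real \<eta> * of_real \<eta>) + of_real \<tau>)"
        by (simp add: E_def caloric_def power2_eq_square)
      then show ?thesis by (simp add: x1_def x2_def x3_def algebra_simps)
    qed
  qed
  show ?thesis
  proof (rule Ow_cong)
    show "Ow 4 (\<lambda>\<tau> \<eta>. (x2 \<tau> \<eta> * x2 \<tau> \<eta> + 2 * (x1 \<tau> \<eta> * x3 \<tau> \<eta>)) + (2 * (x2 \<tau> \<eta> * x3 \<tau> \<eta>) + x3 \<tau> \<eta> * x3 \<tau> \<eta>)
        - \<i> * of_real (E 0 \<tau> \<eta>))"
      by (intro Ow_add Ow_diff Ow_cmult Ow_E Ow_mult'[OF O2 O2] Ow_mult'[OF O1 O3] Ow_mult'[OF O2 O3] Ow_mult'[OF O3 O3]) auto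
    fix \<tau> \<eta> :: real
    have q: "x1 \<tau> \<eta> * x1 \<tau> \<eta> + 2 * (x1 \<tau> \<eta> * x2 \<tau> \<eta>)
       = \<i> * (?s2 * (of_real \<eta> * of_real \<eta> / 2) + ?s3 * (of_real \<eta> * of_real \<eta> * of_real \<eta> / 6 + of_real \<eta> * of_real \<tau>))"
    proof -
      have b4: "4 * (\<beta> * \<beta>) * (?s2 * ?s2 * ?s2 * ?s2) = \<i> * ?s2 / 2"
        using \<beta>_square by (simp add: power2_eq_square power3_eq_cube algebra_simps)
      have b3: "8 * (\<beta> * \<beta>) * (?s2 * ?s2 * ?s2) * ?s3 = \<i> * ?s3"
        using \<beta>_square by (simp add: power2_eq_square power3_eq_cube mult.assoc)
      have "x1 \<tau> \<eta> * x1 \<tau> \<eta> = (4 * (\<beta> * \<beta>) * (?s2 * ?s2 * ?s2 * ?s2)) * (of_real \<eta> * of_real \<eta>)"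
        by (simp add: x1_def algebra_simps)
      moreover have "2 * (x1 \<tau> \<eta> * x2 \<tau> \<eta>) = (8 * (\<beta> * \<beta>) * (?s2 * ?s2 * ?s2) * ?s3) *
          (of_real \<eta> * of_real \<eta> * of_real \<eta> / 6 + of_real \<eta> * of_real \<tau>)"
        by (simp add: x1_def x2_def algebra_simps)
      ultimately show ?thesis unfolding b3 b4 by (simp add: algebra_simps)
    qed
    have "\<sigma> 0 (t0 + \<tau>) (a0 + \<eta>) - \<sigma> 0 t0 a0 - of_real (s2 * (t0 + \<tau> - t0)) = of_real (E 0 \<tau> \<eta>)
       + (?s2 * (of_real \<eta> * of_real \<eta> / 2) + ?s3 * (of_real \<eta> * of_real \<eta> * of_real \<eta> / 6 + of_real \<eta> * of_real \<tau>))"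
      by (simp add: E_def caloric_def power2_eq_square power3_eq_cube algebra_simps)
    then have "R2 (t0 + \<tau>) (a0 + \<eta>) = (x1 \<tau> \<eta> + x2 \<tau> \<eta> + x3 \<tau> \<eta>)\<^sup>2 - \<i> * of_real (E 0 \<tau> \<eta>)
       - (x1 \<tau> \<eta> * x1 \<tau> \<eta> + 2 * (x1 \<tau> \<eta> * x2 \<tau> \<eta>))"
      unfolding q R2_def x3_def by (simp add: algebra_simps)
    then show "x2 \<tau> \<eta> * x2 \<tau> \<eta> + 2 * (x1 \<tau> \<eta> * x3 \<tau> \<eta>) + (2 * (x2 \<tau> \<eta> * x3 \<tau> \<eta>) + x3 \<tau> \<eta> * x3 \<tau> \<eta>)
        - \<i> * of_real (E 0 \<tau> \<eta>) = R2 (t0 + \<tau>) (a0 + \<eta>)"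
      by (simp add: power2_eq_square algebra_simps)
  qed
qed

lemma Ow_M: "Ow 0 (\<lambda>\<tau> \<eta>. M (t0 + \<tau>) (a0 + \<eta>))" "Ow 0 (\<lambda>\<tau> \<eta>. My (t0 + \<tau>) (a0 + \<eta>))"
  "Ow 0 (\<lambda>\<tau> \<eta>. Mt (t0 + \<tau>) (a0 + \<eta>) + Myy (t0 + \<tau>) (a0 + \<eta>))"
  unfolding M_def My_def Mt_def Myy_def
  by (intro Ow_add Ow_mult[where m = 0 and n = 0, simplified] Ow_const Ow_S)+

end

text \<open>Turns Gaussian decay in \<open>q = N * \<eta>\<^sup>2\<close> with polynomial losses
  into a Lorentz profile, whose integral over \<open>\<eta>\<close> is explicit and at most
  \<open>pi / sqrt N\<close>. The 6 is \<open>3!\<close> from the cubic term of the exponential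
  series.\<close>

lemma cube_exp_bound:
  fixes c :: real assumes "c > 0"
  obtains C where "C > 0" "\<And>q. q \<ge> 0 \<Longrightarrow> (1 + q)\<^sup>2 * exp (- c * q) \<le> C / (1 + q)"
proof
  show "6 * exp c / c^3 > 0" using assms by simp
  fix q :: real assume q: "q \<ge> 0"
  have "(c * (1 + q))^3 /\<^sub>R fact 3 \<le> exp (c * (1 + q))"
  proof -
    have "sum (\<lambda>n. (c * (1 + q)) ^ n /\<^sub>R fact n) {3} \<le> (\<Sum>n. (c * (1 + q)) ^ n /\<^sub>R fact n)"
      by (intro sum_le_suminf summable_exp_generic) (use q assms in auto)
    then show ?thesis by (simp add: exp_def)
  qed
  then have "(c * (1 + q))^3 \<le> 6 * exp (c * (1 + q))" by (simp add: fact_numeral)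
  then have "c^3 * (1 + q)^3 \<le> 6 * (exp c * exp (c * q))"
    unfolding power_mult_distrib by (simp only: distrib_left exp_add mult_1_right)
  then have "(1 + q)^3 * exp (- c * q) \<le> 6 * exp c / c^3"
    using assms by (simp add: field_simps exp_minus)
  then show "(1 + q)\<^sup>2 * exp (- c * q) \<le> 6 * exp c / c^3 / (1 + q)"
  proof -
    have "((1 + q)\<^sup>2 * exp (- c * q)) * (1 + q) = (1 + q)^3 * exp (- c * q)"
      by (simp only: power2_eq_square power3_eq_cube mult_ac)
    moreover have "1 + q > 0" using q by simp
    ultimately show ?thesis
      using \<open>(1 + q)^3 * exp (- c * q) \<le> 6 * exp c / c^3\<close> by (simp only: pos_le_divide_eq)
  qed
qed

text \<open>It is applied for \<open>\<bar>x\<bar> \<le> r\<close>. The outer cube makes the value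
  and the first derivative vanish at \<open>\<bar>x\<bar> = r\<close>, as integration by parts
  requires. The inner fourth power makes the derivative of size \<open>\<bar>x\<bar>^3\<close>, so
  that at the scale \<open>1 / sqrt N\<close> of the profile the factor \<open>N\<^sup>2\<close> of
  the nonlocal term shrinks to \<open>sqrt N\<close>.\<close>

definition quartic_cutoff :: "real \<Rightarrow> real \<Rightarrow> real" where
  "quartic_cutoff r x = (1 - (x / r) ^ 4) ^ 3"
definition quartic_cutoff' :: "real \<Rightarrow> real \<Rightarrow> real" where
  "quartic_cutoff' r x = - 12 * (x ^ 3 / r ^ 4) * (1 - (x / r) ^ 4)\<^sup>2"
definition quartic_cutoff'' :: "real \<Rightarrow> real \<Rightarrow> real" where
  "quartic_cutoff'' r x = 96 * (x ^ 3 / r ^ 4)\<^sup>2 * (1 - (x / r) ^ 4) - 36 * (x\<^sup>2 / r ^ 4) * (1 - (x / r) ^ 4)\<^sup>2"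

lemma quartic_cutoff_deriv:
  assumes "r > 0"
  shows "(quartic_cutoff r has_real_derivative quartic_cutoff' r x) (at x)"
    "(quartic_cutoff' r has_real_derivative quartic_cutoff'' r x) (at x)"
  unfolding quartic_cutoff_def[abs_def] quartic_cutoff'_def[abs_def] quartic_cutoff''_def
  by (rule derivative_eq_intros refl | use assms in \<open>simp add: field_simps power2_eq_square power3_eq_cube eval_nat_numeral\<close>)+

lemma quartic_cutoff_boundary:
  assumes "r > 0" "\<bar>x\<bar> = r"
  shows "quartic_cutoff r x = 0" "quartic_cutoff' r x = 0"
proof -
  have "x = r \<or> x = - r" using assms by auto
  then have "(x / r) ^ 4 = 1" using assms by auto
  then show "quartic_cutoff r x = 0" "quartic_cutoff' r x = 0"
    by (simp_all add: quartic_cutoff_def quartic_cutoff'_def)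
qed

lemma quartic_cutoff_bounds:
  assumes r: "r > 0" and x: "\<bar>x\<bar> \<le> r"
  shows "0 \<le> quartic_cutoff r x" "quartic_cutoff r x \<le> 1" "\<bar>quartic_cutoff' r x\<bar> \<le> 12 / r^4 * \<bar>x\<bar>^3"
    "\<bar>quartic_cutoff'' r x\<bar> \<le> 132 / r^4 * x\<^sup>2"
    "\<bar>x\<bar> \<le> r / 2 \<Longrightarrow> quartic_cutoff r x \<ge> 1/2"
proof -
  define z where "z = (x / r) ^ 4"
  have xr: "\<bar>x / r\<bar> \<le> 1" using r x by simp
  have z: "0 \<le> z" "z \<le> 1"
    unfolding z_def using power_mono[OF xr, of 4] power_even_abs[of 4 "x / r"] by simp_all
  have w: "0 \<le> 1 - z" "1 - z \<le> 1" using z by auto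
  show "0 \<le> quartic_cutoff r x" "quartic_cutoff r x \<le> 1"
    unfolding quartic_cutoff_def z_def[symmetric] using w by (auto intro: power_le_one)
  have w2: "0 \<le> (1 - z)\<^sup>2" "(1 - z)\<^sup>2 \<le> 1" using w by (auto intro: power_le_one)
  have "\<bar>quartic_cutoff' r x\<bar> = 12 * (\<bar>x\<bar>^3 / r^4) * (1 - z)\<^sup>2"
    unfolding quartic_cutoff'_def z_def[symmetric] using r by (simp add: abs_mult power_abs)
  also have "\<dots> \<le> 12 * (\<bar>x\<bar>^3 / r^4) * 1" using w2 by (intro mult_left_mono) auto
  finally show "\<bar>quartic_cutoff' r x\<bar> \<le> 12 / r^4 * \<bar>x\<bar>^3" by simp
  have "(x^3 / r^4)\<^sup>2 = x\<^sup>2 / r^4 * z" using r unfolding z_def by (simp add: field_simps eval_nat_numeral)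
  then have "quartic_cutoff'' r x = 96 * (x\<^sup>2 / r^4 * z) * (1 - z) - 36 * (x\<^sup>2 / r^4) * (1 - z)\<^sup>2"
    unfolding quartic_cutoff''_def z_def[symmetric] by (simp only:)
  then have "quartic_cutoff'' r x = x\<^sup>2 / r^4 * (96 * z * (1 - z) - 36 * (1 - z)\<^sup>2)"
    by (simp only: right_diff_distrib mult_ac)
  moreover have "\<bar>96 * z * (1 - z) - 36 * (1 - z)\<^sup>2\<bar> \<le> 132"
  proof -
    have "0 \<le> 96 * z * (1 - z)" "z * (1 - z) \<le> 1" using z w mult_mono[of z 1 "1 - z" 1] by auto
    then show ?thesis using w2 by linarith
  qed
  ultimately show "\<bar>quartic_cutoff'' r x\<bar> \<le> 132 / r^4 * x\<^sup>2"
    using r mult_left_mono[of "\<bar>96 * z * (1 - z) - 36 * (1 - z)\<^sup>2\<bar>" 132 "x\<^sup>2 / r^4"]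
    by (simp add: abs_mult ac_simps)
  show "quartic_cutoff r x \<ge> 1/2" if "\<bar>x\<bar> \<le> r / 2"
  proof -
    have "\<bar>x / r\<bar> \<le> 1/2" using that r by (simp add: field_simps)
    then have "\<bar>x / r\<bar> ^ 4 \<le> (1/2)^4" by (rule power_mono) simp
    moreover have "\<bar>x / r\<bar> ^ 4 = z" unfolding z_def by (rule power_even_abs) simp
    ultimately have "z \<le> (1/2)^4" by (simp only:)
    then have "15/16 \<le> 1 - z" by (simp add: power_one_over)
    then have "(15/16)^3 \<le> (1 - z)^3" by (intro power_mono) auto
    then show ?thesis unfolding quartic_cutoff_def z_def[symmetric] by (simp add: power_divide)
  qed
qed

section \<open>Size of the dual profile and of its defect\<close>

context critical_point begin

definition phase :: "real \<Rightarrow> real \<Rightarrow> complex" where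
  "phase t y = \<beta> * (\<sigma> 1 t y)\<^sup>2 + \<gamma> * (\<sigma> 1 t y)^3"

text \<open>The last exponent has modulus 1. It removes the oscillation caused by the flow at
  \<open>a0\<close>, whose caloric approximation is
  \<open>S 0 t0 a0 + s2 * (t - t0)\<close>.\<close>

definition F :: "real \<Rightarrow> real \<Rightarrow> real \<Rightarrow> complex" where
  "F N t y = exp (- of_real N * (phase t y + rate * of_real (t - t0))
     + \<i> * of_real (N\<^sup>2 * (S 0 t0 a0 * (t - t0) + s2 * (t - t0)\<^sup>2 / 2)))"

lemma norm_F: "norm (F N t y) = exp (- N * Re (phase t y)) * exp (- Re rate * N * (t - t0))"
  by (simp add: F_def algebra_simps flip: exp_add)

text \<open>The defect of the localized profile in the adjoint equation, apart from the nonlocal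
  contribution of the cutoff: the main bracket with \<open>R1\<close> and \<open>R2\<close>, and the
  terms in which the cutoff is differentiated.\<close>

definition residual :: "real \<Rightarrow> real \<Rightarrow> real \<Rightarrow> real \<Rightarrow> complex" where
  "residual N r t y = of_real N * (of_real (quartic_cutoff r (y - a0)) *
       ((Mt t y + Myy t y) + of_real N * R1 t y + of_real (N\<^sup>2) * (M t y * R2 t y))
     + 2 * of_real (quartic_cutoff' r (y - a0)) * (My t y - of_real N * \<sigma> 1 t y * M t y * M t y)
     + of_real (quartic_cutoff'' r (y - a0)) * M t y) * F N t y"

lemma S1_estimate:
  obtains A where "A > 0" "\<And>\<tau> \<eta>. (\<tau>, \<eta>) \<in> box \<Longrightarrow> \<bar>S 1 (t0 + \<tau>) (a0 + \<eta>) - s2 * \<eta>\<bar> \<le> A * (\<tau> + \<eta>\<^sup>2)"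
proof -
  obtain C where C: "C \<ge> 0" "\<And>\<tau> \<eta>. (\<tau>, \<eta>) \<in> box \<Longrightarrow>
      norm (\<sigma> 1 (t0 + \<tau>) (a0 + \<eta>) - (0 + of_real s2 * of_real \<eta>)) \<le> C * \<rho> \<tau> \<eta> ^ 2"
    using jet_\<sigma>(1) unfolding jet_def by (rule OwE) blast
  show ?thesis
  proof (rule that[of "2 * C + 1"])
    show "2 * C + 1 > 0" using C by simp
    fix \<tau> \<eta> assume b: "(\<tau>, \<eta>) \<in> box"
    have "\<bar>S 1 (t0 + \<tau>) (a0 + \<eta>) - s2 * \<eta>\<bar> = norm (\<sigma> 1 (t0 + \<tau>) (a0 + \<eta>) - (0 + of_real s2 * of_real \<eta>))"
      by (metis add_0 norm_of_real of_real_diff of_real_mult)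
    also have "\<dots> \<le> C * \<rho> \<tau> \<eta> ^ 2" by (rule C(2)[OF b])
    also have "\<dots> \<le> C * (2 * (\<tau> + \<eta>\<^sup>2))" using C(1) \<rho>_square_le[OF b] by (intro mult_left_mono) auto
    also have "\<dots> \<le> (2 * C + 1) * (\<tau> + \<eta>\<^sup>2)" using boxD(1)[OF b] by (simp add: algebra_simps)
    finally show "\<bar>S 1 (t0 + \<tau>) (a0 + \<eta>) - s2 * \<eta>\<bar> \<le> (2 * C + 1) * (\<tau> + \<eta>\<^sup>2)" .
  qed
qed

text \<open>\<open>\<sigma> 1\<close> is \<open>s2 * \<eta>\<close> up to an error of size
  \<open>\<tau> + \<eta>\<^sup>2\<close>, so its zero may have moved by a distance of order
  \<open>\<tau>\<close>. This costs the term \<open>C1 * \<tau>\<^sup>2\<close>, which is harmless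
  in the exponent while \<open>N * \<tau>\<^sup>2 \<le> 1\<close>.\<close>

lemma phase_lower_bound:
  obtains r \<tau>1 c1 C1 where "0 < r" "r \<le> r1" "0 < \<tau>1" "\<tau>1 \<le> 1/4" "c1 > 0" "C1 \<ge> 0"
    "\<And>\<tau> \<eta>. 0 \<le> \<tau> \<Longrightarrow> \<tau> \<le> \<tau>1 \<Longrightarrow> \<bar>\<eta>\<bar> \<le> r \<Longrightarrow> Re (phase (t0 + \<tau>) (a0 + \<eta>)) \<ge> c1 * \<eta>\<^sup>2 - C1 * \<tau>\<^sup>2"
    "\<And>\<eta>. \<bar>\<eta>\<bar> \<le> r \<Longrightarrow> norm (phase t0 (a0 + \<eta>)) \<le> C1 * \<eta>\<^sup>2"
    "\<And>\<eta>. \<bar>\<eta>\<bar> \<le> r \<Longrightarrow> norm (M t0 (a0 + \<eta>)) \<ge> norm M0 / 2"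
proof -
  obtain A where A: "A > 0" "\<And>\<tau> \<eta>. (\<tau>, \<eta>) \<in> box \<Longrightarrow> \<bar>S 1 (t0 + \<tau>) (a0 + \<eta>) - s2 * \<eta>\<bar> \<le> A * (\<tau> + \<eta>\<^sup>2)"
    using S1_estimate by blast
  obtain CM where CM: "CM \<ge> 0" "\<And>\<tau> \<eta>. (\<tau>, \<eta>) \<in> box \<Longrightarrow> norm (M (t0 + \<tau>) (a0 + \<eta>) - M0) \<le> CM * \<rho> \<tau> \<eta> ^ 1"
    using jet_lead[OF jet_M] by (rule OwE) blast
  \<comment> \<open>A bound for \<open>\<bar>S 1\<bar>\<close> under which the cubic term of the
    phase is at most half of the quadratic one.\<close>
  define h where "h = Re \<beta> / (2 * (norm \<gamma> + 1))"
  have h: "h > 0" "norm \<gamma> * h \<le> Re \<beta> / 2"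
    using \<beta>_parts(1) by (auto simp: h_def field_simps add_pos_nonneg)
  have M0: "norm M0 > 0" using \<beta>_parts(1) S2_0 by auto
  \<comment> \<open>In turn: stay in the box, make the quadratic error of \<open>S 1\<close> at most
    half of its linear part, keep \<open>\<bar>S 1\<bar> \<le> h\<close>, and keep \<open>M\<close>
    within \<open>norm M0 / 2\<close> of \<open>M0\<close>.\<close>
  define r where "r = Min {r1, \<bar>s2\<bar> / (2 * A), h / (2 * (\<bar>s2\<bar> + A)), norm M0 / (2 * (CM + 1))}"
  define \<tau>1 where "\<tau>1 = min (1/4) (h / (2 * A))"
  have pos: "\<bar>s2\<bar> / (2 * A) > 0" "h / (2 * (\<bar>s2\<bar> + A)) > 0" "norm M0 / (2 * (CM + 1)) > 0"
    using A h M0 CM S2_0 by (auto intro!: divide_pos_pos add_nonneg_pos)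
  have r: "0 < r" "r \<le> r1" "r \<le> \<bar>s2\<bar> / (2 * A)" "r \<le> h / (2 * (\<bar>s2\<bar> + A))" "r \<le> norm M0 / (2 * (CM + 1))"
  proof -
    show "0 < r" unfolding r_def using pos r1 by (subst Min_gr_iff) auto
    show "r \<le> r1" "r \<le> \<bar>s2\<bar> / (2 * A)" "r \<le> h / (2 * (\<bar>s2\<bar> + A))" "r \<le> norm M0 / (2 * (CM + 1))"
      unfolding r_def by (rule Min_le; simp)+
  qed
  have \<tau>1: "0 < \<tau>1" "\<tau>1 \<le> 1/4" "\<tau>1 \<le> h / (2 * A)" using A h by (auto simp: \<tau>1_def)
  define c1 where "c1 = Re \<beta> * s2\<^sup>2 / 16"
  define C1 where "C1 = Re \<beta> * A\<^sup>2 / 2 + (norm \<beta> + norm \<gamma> * h) * (\<bar>s2\<bar> + A)\<^sup>2"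
  have C1': "Re \<beta> * A\<^sup>2 / 2 \<le> C1" "(norm \<beta> + norm \<gamma> * h) * (\<bar>s2\<bar> + A)\<^sup>2 \<le> C1" "C1 \<ge> 0"
    using h \<beta>_parts(1) by (auto simp: C1_def add_nonneg_nonneg)
  have small: "\<bar>S 1 (t0 + \<tau>) (a0 + \<eta>)\<bar> \<le> h" "\<bar>S 1 (t0 + \<tau>) (a0 + \<eta>)\<bar> \<le> (\<bar>s2\<bar> + A) * \<bar>\<eta>\<bar> + A * \<tau>"
    "\<bar>s2\<bar> / 2 * \<bar>\<eta>\<bar> \<le> \<bar>S 1 (t0 + \<tau>) (a0 + \<eta>)\<bar> + A * \<tau>"
    if "0 \<le> \<tau>" "\<tau> \<le> \<tau>1" "\<bar>\<eta>\<bar> \<le> r" for \<tau> \<eta>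
  proof -
    have b: "(\<tau>, \<eta>) \<in> box" using that r \<tau>1 by (auto simp: box_def)
    have e: "\<bar>S 1 (t0 + \<tau>) (a0 + \<eta>) - s2 * \<eta>\<bar> \<le> A * (\<tau> + \<eta>\<^sup>2)" by (rule A(2)[OF b])
    have \<eta>1: "\<bar>\<eta>\<bar> \<le> 1" using that r r1 by auto
    have "\<bar>\<eta>\<bar> * \<bar>\<eta>\<bar> \<le> \<bar>\<eta>\<bar> * 1" using \<eta>1 by (intro mult_left_mono) auto
    then have \<eta>2: "A * \<eta>\<^sup>2 \<le> A * \<bar>\<eta>\<bar>" using A by (intro mult_left_mono) (auto simp: power2_eq_square)
    have 1: "\<bar>s2 * \<eta>\<bar> = \<bar>s2\<bar> * \<bar>\<eta>\<bar>" by (rule abs_mult)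
    show 2: "\<bar>S 1 (t0 + \<tau>) (a0 + \<eta>)\<bar> \<le> (\<bar>s2\<bar> + A) * \<bar>\<eta>\<bar> + A * \<tau>"
      using e \<eta>2 1 by (simp add: algebra_simps)
    have "(\<bar>s2\<bar> + A) * \<bar>\<eta>\<bar> \<le> (\<bar>s2\<bar> + A) * (h / (2 * (\<bar>s2\<bar> + A)))"
      using that r A by (intro mult_left_mono) auto
    also have "\<dots> = h / 2" using A by (simp add: field_simps)
    finally have 3: "(\<bar>s2\<bar> + A) * \<bar>\<eta>\<bar> \<le> h / 2" .
    have "A * \<tau> \<le> A * (h / (2 * A))" using that \<tau>1 A by (intro mult_left_mono) auto
    also have "\<dots> = h / 2" using A by simp
    finally show "\<bar>S 1 (t0 + \<tau>) (a0 + \<eta>)\<bar> \<le> h" using 2 3 by linarith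
    have "A * \<bar>\<eta>\<bar> \<le> A * (\<bar>s2\<bar> / (2 * A))" using that r A by (intro mult_left_mono) auto
    then have "A * \<bar>\<eta>\<bar> \<le> \<bar>s2\<bar> / 2" using A by simp
    then have "A * \<bar>\<eta>\<bar> * \<bar>\<eta>\<bar> \<le> \<bar>s2\<bar> / 2 * \<bar>\<eta>\<bar>" by (rule mult_right_mono) simp
    then have "A * \<eta>\<^sup>2 \<le> \<bar>s2\<bar> / 2 * \<bar>\<eta>\<bar>" by (simp add: power2_eq_square mult.assoc)
    then show "\<bar>s2\<bar> / 2 * \<bar>\<eta>\<bar> \<le> \<bar>S 1 (t0 + \<tau>) (a0 + \<eta>)\<bar> + A * \<tau>"
      using e 1 by (simp add: algebra_simps)
  qed
  show ?thesis
  proof (rule that[of r \<tau>1 c1 C1])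
    show "c1 > 0" using \<beta>_parts(1) S2_0 by (simp add: c1_def)
    show "Re (phase (t0 + \<tau>) (a0 + \<eta>)) \<ge> c1 * \<eta>\<^sup>2 - C1 * \<tau>\<^sup>2"
      if t: "0 \<le> \<tau>" "\<tau> \<le> \<tau>1" "\<bar>\<eta>\<bar> \<le> r" for \<tau> \<eta>
    proof -
      define x where "x = S 1 (t0 + \<tau>) (a0 + \<eta>)"
      note sm = small[OF t, folded x_def]
      have "Re (phase (t0 + \<tau>) (a0 + \<eta>)) = Re \<beta> * x\<^sup>2 + Re \<gamma> * x^3"
        unfolding phase_def x_def by (simp flip: of_real_power)
      moreover have "\<bar>Re \<gamma> * x^3\<bar> \<le> Re \<beta> / 2 * x\<^sup>2"
      proof -
        have "\<bar>Re \<gamma> * x^3\<bar> = \<bar>Re \<gamma>\<bar> * \<bar>x\<bar> * x\<^sup>2" by (simp add: abs_mult power3_eq_cube power2_eq_square)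
        also have "\<dots> \<le> norm \<gamma> * h * x\<^sup>2"
          using abs_Re_le_cmod[of \<gamma>] sm(1) h by (intro mult_right_mono mult_mono) auto
        also have "\<dots> \<le> Re \<beta> / 2 * x\<^sup>2" using h by (intro mult_right_mono) auto
        finally show ?thesis .
      qed
      ultimately have 1: "Re (phase (t0 + \<tau>) (a0 + \<eta>)) \<ge> Re \<beta> / 2 * x\<^sup>2" by (simp add: field_simps abs_if split: if_splits)
      have "(\<bar>s2\<bar> / 2 * \<bar>\<eta>\<bar>)\<^sup>2 \<le> (\<bar>x\<bar> + A * \<tau>)\<^sup>2" using sm(3) by (intro power_mono) auto
      also have "\<dots> \<le> 2 * x\<^sup>2 + 2 * (A * \<tau>)\<^sup>2"
        using sum_squares_bound[of "\<bar>x\<bar>" "A * \<tau>"] by (simp add: power2_sum)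
      finally have "s2\<^sup>2 / 8 * \<eta>\<^sup>2 - A\<^sup>2 * \<tau>\<^sup>2 \<le> x\<^sup>2" by (simp add: power_mult_distrib power_divide)
      then have "Re \<beta> / 2 * (s2\<^sup>2 / 8 * \<eta>\<^sup>2 - A\<^sup>2 * \<tau>\<^sup>2) \<le> Re \<beta> / 2 * x\<^sup>2"
        using \<beta>_parts(1) by (intro mult_left_mono) auto
      moreover have "Re \<beta> / 2 * (s2\<^sup>2 / 8 * \<eta>\<^sup>2 - A\<^sup>2 * \<tau>\<^sup>2) = c1 * \<eta>\<^sup>2 - (Re \<beta> * A\<^sup>2 / 2) * \<tau>\<^sup>2"
        by (simp add: c1_def algebra_simps)
      moreover have "(Re \<beta> * A\<^sup>2 / 2) * \<tau>\<^sup>2 \<le> C1 * \<tau>\<^sup>2" using C1' by (intro mult_right_mono) auto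
      ultimately show ?thesis using 1 by linarith
    qed
    show "norm (phase t0 (a0 + \<eta>)) \<le> C1 * \<eta>\<^sup>2" if "\<bar>\<eta>\<bar> \<le> r" for \<eta>
    proof -
      define x where "x = S 1 t0 (a0 + \<eta>)"
      have sm: "\<bar>x\<bar> \<le> h" "\<bar>x\<bar> \<le> (\<bar>s2\<bar> + A) * \<bar>\<eta>\<bar>"
        using small(1,2)[of 0 \<eta>] that \<tau>1 by (auto simp: x_def)
      have "norm (phase t0 (a0 + \<eta>)) \<le> norm \<beta> * x\<^sup>2 + norm \<gamma> * \<bar>x\<bar>^3"
        unfolding phase_def x_def[symmetric]
        by (rule order_trans[OF norm_triangle_ineq]) (simp add: norm_mult norm_power)
      also have "\<dots> = (norm \<beta> + norm \<gamma> * \<bar>x\<bar>) * x\<^sup>2" by (simp add: algebra_simps power3_eq_cube power2_eq_square)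
      also have "\<dots> \<le> (norm \<beta> + norm \<gamma> * h) * ((\<bar>s2\<bar> + A) * \<bar>\<eta>\<bar>)\<^sup>2"
        using sm h by (intro mult_mono add_mono mult_left_mono abs_le_square_iff[THEN iffD1]) auto
      also have "\<dots> = (norm \<beta> + norm \<gamma> * h) * (\<bar>s2\<bar> + A)\<^sup>2 * \<eta>\<^sup>2" by (simp add: power_mult_distrib mult.assoc)
      also have "\<dots> \<le> C1 * \<eta>\<^sup>2" using C1' by (intro mult_right_mono) auto
      finally show ?thesis .
    qed
    show "norm (M t0 (a0 + \<eta>)) \<ge> norm M0 / 2" if "\<bar>\<eta>\<bar> \<le> r" for \<eta>
    proof -
      have b: "(0, \<eta>) \<in> box" using that r by (auto simp: box_def)
      have "norm (M t0 (a0 + \<eta>) - M0) \<le> CM * \<bar>\<eta>\<bar>" using CM(2)[OF b] by (simp add: \<rho>_def)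
      also have "\<dots> \<le> (CM + 1) * (norm M0 / (2 * (CM + 1)))" using that r CM by (intro mult_mono) auto
      also have "\<dots> = norm M0 / 2" using CM by (simp add: field_simps)
      finally have "norm (M t0 (a0 + \<eta>) - M0) \<le> norm M0 / 2" .
      then show ?thesis using norm_triangle_ineq2[of M0 "M t0 (a0 + \<eta>)"] by (simp add: norm_minus_commute)
    qed
  qed (use r \<tau>1 C1' in auto)
qed

end

context critical_point begin

lemma Ow_0_bound:
  assumes "Ow 0 f" shows "\<exists>C\<ge>0. \<forall>(\<tau>, \<eta>)\<in>box. norm (f \<tau> \<eta>) \<le> C"
proof -
  obtain C where "C \<ge> 0" "\<And>\<tau> \<eta>. (\<tau>, \<eta>) \<in> box \<Longrightarrow> norm (f \<tau> \<eta>) \<le> C * \<rho> \<tau> \<eta> ^ 0"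
    using OwE[OF assms] by blast
  then show ?thesis by (intro exI[of _ C]) auto
qed

lemma Ow_2_bound:
  assumes "Ow 2 f" shows "\<exists>C\<ge>0. \<forall>(\<tau>, \<eta>)\<in>box. norm (f \<tau> \<eta>) \<le> C * (\<tau> + \<eta>\<^sup>2)"
proof -
  obtain C where C: "C \<ge> 0" "\<And>\<tau> \<eta>. (\<tau>, \<eta>) \<in> box \<Longrightarrow> norm (f \<tau> \<eta>) \<le> C * \<rho> \<tau> \<eta> ^ 2"
    using OwE[OF assms] by blast
  have "norm (f \<tau> \<eta>) \<le> (2 * C) * (\<tau> + \<eta>\<^sup>2)" if "(\<tau>, \<eta>) \<in> box" for \<tau> \<eta>
    using C(2)[OF that] mult_left_mono[OF \<rho>_square_le[OF that] C(1)] by (simp add: ac_simps)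
  then show ?thesis using C(1) by (intro exI[of _ "2 * C"]) auto
qed

lemma Ow_4_bound:
  assumes "Ow 4 f" shows "\<exists>C\<ge>0. \<forall>(\<tau>, \<eta>)\<in>box. norm (f \<tau> \<eta>) \<le> C * (\<tau> + \<eta>\<^sup>2)\<^sup>2"
proof -
  obtain C where C: "C \<ge> 0" "\<And>\<tau> \<eta>. (\<tau>, \<eta>) \<in> box \<Longrightarrow> norm (f \<tau> \<eta>) \<le> C * \<rho> \<tau> \<eta> ^ 4"
    using OwE[OF assms] by blast
  have "norm (f \<tau> \<eta>) \<le> (4 * C) * (\<tau> + \<eta>\<^sup>2)\<^sup>2" if b: "(\<tau>, \<eta>) \<in> box" for \<tau> \<eta>
  proof -
    have "(\<rho> \<tau> \<eta> ^ 2)^2 \<le> (2 * (\<tau> + \<eta>\<^sup>2))^2" using \<rho>_square_le[OF b] by (intro power_mono) auto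
    then have "\<rho> \<tau> \<eta> ^ 4 \<le> 4 * (\<tau> + \<eta>\<^sup>2)\<^sup>2"
      unfolding power_mult_distrib power_mult[symmetric] by simp
    from mult_left_mono[OF this C(1)] show ?thesis using C(2)[OF b] by linarith
  qed
  then show ?thesis using C(1) by (intro exI[of _ "4 * C"]) auto
qed

lemma coefficient_bounds:
  obtains K where "K \<ge> 1"
    "\<And>\<tau> \<eta>. (\<tau>, \<eta>) \<in> box \<Longrightarrow> norm (M (t0 + \<tau>) (a0 + \<eta>)) \<le> K"
    "\<And>\<tau> \<eta>. (\<tau>, \<eta>) \<in> box \<Longrightarrow> norm (My (t0 + \<tau>) (a0 + \<eta>)) \<le> K"
    "\<And>\<tau> \<eta>. (\<tau>, \<eta>) \<in> box \<Longrightarrow> norm (Mt (t0 + \<tau>) (a0 + \<eta>) + Myy (t0 + \<tau>) (a0 + \<eta>)) \<le> K"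
    "\<And>\<tau> \<eta>. (\<tau>, \<eta>) \<in> box \<Longrightarrow> norm (\<sigma> 1 (t0 + \<tau>) (a0 + \<eta>)) \<le> K"
    "\<And>\<tau> \<eta>. (\<tau>, \<eta>) \<in> box \<Longrightarrow> norm (R1 (t0 + \<tau>) (a0 + \<eta>)) \<le> K * (\<tau> + \<eta>\<^sup>2)"
    "\<And>\<tau> \<eta>. (\<tau>, \<eta>) \<in> box \<Longrightarrow> norm (R2 (t0 + \<tau>) (a0 + \<eta>)) \<le> K * (\<tau> + \<eta>\<^sup>2)\<^sup>2"
proof -
  obtain A where A: "A \<ge> 0" "\<forall>(\<tau>, \<eta>)\<in>box. norm (M (t0 + \<tau>) (a0 + \<eta>)) \<le> A" using Ow_0_bound[OF Ow_M(1)] by blast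
  obtain B where B: "B \<ge> 0" "\<forall>(\<tau>, \<eta>)\<in>box. norm (My (t0 + \<tau>) (a0 + \<eta>)) \<le> B" using Ow_0_bound[OF Ow_M(2)] by blast
  obtain C where C: "C \<ge> 0" "\<forall>(\<tau>, \<eta>)\<in>box. norm (Mt (t0 + \<tau>) (a0 + \<eta>) + Myy (t0 + \<tau>) (a0 + \<eta>)) \<le> C"
    using Ow_0_bound[OF Ow_M(3)] by blast
  obtain D where D: "D \<ge> 0" "\<forall>(\<tau>, \<eta>)\<in>box. norm (\<sigma> 1 (t0 + \<tau>) (a0 + \<eta>)) \<le> D" using Ow_0_bound[OF Ow_S[of 1]] by blast
  obtain G where G: "G \<ge> 0" "\<forall>(\<tau>, \<eta>)\<in>box. norm (R1 (t0 + \<tau>) (a0 + \<eta>)) \<le> G * (\<tau> + \<eta>\<^sup>2)" using Ow_2_bound[OF Ow_R1] by blast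
  obtain H where H: "H \<ge> 0" "\<forall>(\<tau>, \<eta>)\<in>box. norm (R2 (t0 + \<tau>) (a0 + \<eta>)) \<le> H * (\<tau> + \<eta>\<^sup>2)\<^sup>2" using Ow_4_bound[OF Ow_R2] by blast
  have m: "a * x \<le> (1 + A + B + C + D + G + H) * x" if "a \<in> {G, H}" "x \<ge> 0" for a x
    using that A(1) B(1) C(1) D(1) G(1) H(1) by (intro mult_right_mono) auto
  show ?thesis
  proof (rule that[of "1 + A + B + C + D + G + H"])
    fix \<tau> \<eta> assume b: "(\<tau>, \<eta>) \<in> box"
    have t: "\<tau> \<ge> 0" by (rule boxD(1)[OF b])
    show "norm (M (t0 + \<tau>) (a0 + \<eta>)) \<le> 1 + A + B + C + D + G + H"
      "norm (My (t0 + \<tau>) (a0 + \<eta>)) \<le> 1 + A + B + C + D + G + H"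
      "norm (Mt (t0 + \<tau>) (a0 + \<eta>) + Myy (t0 + \<tau>) (a0 + \<eta>)) \<le> 1 + A + B + C + D + G + H"
      "norm (\<sigma> 1 (t0 + \<tau>) (a0 + \<eta>)) \<le> 1 + A + B + C + D + G + H"
      using A B C D G(1) H(1) bspec[OF A(2) b] bspec[OF B(2) b] bspec[OF C(2) b] bspec[OF D(2) b] by auto
    show "norm (R1 (t0 + \<tau>) (a0 + \<eta>)) \<le> (1 + A + B + C + D + G + H) * (\<tau> + \<eta>\<^sup>2)"
      using bspec[OF G(2) b] m[of G "\<tau> + \<eta>\<^sup>2"] t by simp
    show "norm (R2 (t0 + \<tau>) (a0 + \<eta>)) \<le> (1 + A + B + C + D + G + H) * (\<tau> + \<eta>\<^sup>2)\<^sup>2"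
      using bspec[OF H(2) b] m[of H "(\<tau> + \<eta>\<^sup>2)\<^sup>2"] by simp
  qed (use A B C D G H in auto)
qed

text \<open>In the variables \<open>p = N * \<tau>\<close> and \<open>q = N * \<eta>\<^sup>2\<close>
  every term is at most quadratic, by the vanishing orders of \<open>R1\<close> and
  \<open>R2\<close>. The product form of the bound separates time from space, so that each factor
  can be absorbed by its own exponential.\<close>

lemma residual_bracket_bound:
  fixes m my mt s a b :: complex and x0 x1 x2 :: real
  assumes K: "K \<ge> 1" and D: "D \<ge> 0" and N: "N \<ge> 1" and \<tau>: "\<tau> \<ge> 0" and \<eta>: "\<bar>\<eta>\<bar> \<le> 1"
    and m: "norm m \<le> K" "norm my \<le> K" "norm mt \<le> K" "norm s \<le> K" "norm a \<le> K * (\<tau> + \<eta>\<^sup>2)" "norm b \<le> K * (\<tau> + \<eta>\<^sup>2)\<^sup>2"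
    and x: "\<bar>x0\<bar> \<le> 1" "\<bar>x1\<bar> \<le> D * \<bar>\<eta>\<bar>^3" "\<bar>x2\<bar> \<le> D * \<eta>\<^sup>2"
  shows "norm (of_real x0 * (mt + of_real N * a + of_real (N\<^sup>2) * (m * b)) + 2 * of_real x1 * (my - of_real N * s * m * m)
     + of_real x2 * m) \<le> (2 * K + K * K + 3 * D * K + 2 * D * K * K * K) * ((1 + N * \<tau>)\<^sup>2 * (1 + N * \<eta>\<^sup>2)\<^sup>2)"
proof -
  define p where "p = N * \<tau>"
  define q where "q = N * \<eta>\<^sup>2"
  have p: "p \<ge> 0" and q: "q \<ge> 0" using N \<tau> by (auto simp: p_def q_def)
  have e3: "\<bar>\<eta>\<bar>^3 \<le> 1" "\<eta>\<^sup>2 \<le> 1" using \<eta> power_le_one[of "\<bar>\<eta>\<bar>" 3] power_le_one[of "\<bar>\<eta>\<bar>" 2] by auto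
  have "\<bar>\<eta>\<bar> * \<eta>\<^sup>2 \<le> 1 * \<eta>\<^sup>2" using \<eta> by (intro mult_right_mono) auto
  then have "\<bar>\<eta>\<bar>^3 \<le> \<eta>\<^sup>2" by (simp add: power3_eq_cube power2_eq_square mult.assoc)
  then have n3: "N * \<bar>\<eta>\<bar>^3 \<le> q" using N by (simp add: q_def)
  have bb: "norm (of_real x0 * (mt + of_real N * a + of_real (N\<^sup>2) * (m * b)) + 2 * of_real x1 * (my - of_real N * s * m * m)
     + of_real x2 * m) \<le> 1 * (K + N * (K * (\<tau> + \<eta>\<^sup>2)) + N\<^sup>2 * (K * (K * (\<tau> + \<eta>\<^sup>2)\<^sup>2)))
       + 2 * (D * \<bar>\<eta>\<bar>^3) * (K + N * K * K * K) + D * \<eta>\<^sup>2 * K"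
    by (intro norm_add_le norm_diff_le norm_mult_le m) (use N x in \<open>auto simp: norm_power\<close>)
  define Z where "Z = (1 + p)\<^sup>2 * (1 + q)\<^sup>2"
  have Zx: "Z = ((1 + p) * (1 + q))\<^sup>2" by (simp add: Z_def power_mult_distrib)
  have pq: "1 + (p + q) \<le> (1 + p) * (1 + q)" using p q by (simp add: algebra_simps)
  have Z1: "(1 + (p + q))\<^sup>2 \<le> Z" unfolding Zx using pq p q by (intro power_mono) auto
  define w where "w = (p + q)\<^sup>2"
  have "(1 + (p + q))\<^sup>2 = 1 + 2 * (p + q) + w" unfolding w_def by (simp add: power2_sum)
  with Z1 have Z2: "1 + 2 * (p + q) + w \<le> Z" by simp
  have w: "0 \<le> w" by (simp add: w_def)
  have "1 \<le> Z" using p q w Z2 by argo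
  moreover have "p + q \<le> Z" using p q w Z2 by argo
  moreover have "(p + q)\<^sup>2 \<le> Z" using p q w Z2 unfolding w_def by argo
  moreover have "q \<le> Z" using p q w Z2 by argo
  ultimately have Z: "1 \<le> Z" "p + q \<le> Z" "(p + q)\<^sup>2 \<le> Z" "q \<le> Z" by auto
  have t1: "K + N * (K * (\<tau> + \<eta>\<^sup>2)) + N\<^sup>2 * (K * (K * (\<tau> + \<eta>\<^sup>2)\<^sup>2)) = K * 1 + K * (p + q) + K * K * (p + q)\<^sup>2"
    by (simp add: p_def q_def power2_eq_square algebra_simps)
  have "1 * (K + N * (K * (\<tau> + \<eta>\<^sup>2)) + N\<^sup>2 * (K * (K * (\<tau> + \<eta>\<^sup>2)\<^sup>2))) \<le> K * Z + K * Z + K * K * Z"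
    unfolding t1 mult_1 using K Z by (intro add_mono mult_left_mono) auto
  moreover have "2 * (D * \<bar>\<eta>\<bar>^3) * (K + N * K * K * K) \<le> 2 * D * K * Z + 2 * D * K * K * K * Z"
  proof -
    have "2 * (D * \<bar>\<eta>\<bar>^3) * (K + N * K * K * K) = 2 * D * K * \<bar>\<eta>\<bar>^3 + 2 * D * K * K * K * (N * \<bar>\<eta>\<bar>^3)"
      by (simp add: algebra_simps)
    also have "\<dots> \<le> 2 * D * K * Z + 2 * D * K * K * K * Z"
      using K D e3 n3 Z by (intro add_mono mult_left_mono) auto
    finally show ?thesis .
  qed
  moreover have "D * \<eta>\<^sup>2 * K \<le> D * K * Z"
  proof -
    have "D * K * \<eta>\<^sup>2 \<le> D * K * Z" using K D e3 Z by (intro mult_left_mono) auto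
    then show ?thesis by (simp add: ac_simps)
  qed
  ultimately show ?thesis using bb unfolding Z_def[symmetric] p_def[symmetric] q_def[symmetric]
    by (simp add: algebra_simps)
qed

abbreviation g where "g \<equiv> Re rate"

text \<open>In the defect a quarter of the temporal decay is spent on the factor
  \<open>(1 + N * \<tau>)\<^sup>2\<close>. The remaining \<open>3/4 * g\<close> is still above the
  growth exponent \<open>g / 2\<close> that will be allowed for the solution.\<close>

lemma adjoint_bounds:
  obtains r \<tau>1 C c where "0 < r" "r \<le> r1" "0 < \<tau>1" "\<tau>1 \<le> 1/4" "C > 0" "c > 0"
    "\<And>N \<tau> \<eta>. 1 \<le> N \<Longrightarrow> 0 \<le> \<tau> \<Longrightarrow> \<tau> \<le> \<tau>1 \<Longrightarrow> N * \<tau>\<^sup>2 \<le> 1 \<Longrightarrow> \<bar>\<eta>\<bar> \<le> r \<Longrightarrow>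
      norm (of_real N * M (t0 + \<tau>) (a0 + \<eta>) * F N (t0 + \<tau>) (a0 + \<eta>)) \<le> C * N / (1 + N * \<eta>\<^sup>2) * exp (- g * N * \<tau>)"
    "\<And>N \<tau> \<eta>. 1 \<le> N \<Longrightarrow> 0 \<le> \<tau> \<Longrightarrow> \<tau> \<le> \<tau>1 \<Longrightarrow> N * \<tau>\<^sup>2 \<le> 1 \<Longrightarrow> \<bar>\<eta>\<bar> \<le> r \<Longrightarrow>
      norm (residual N r (t0 + \<tau>) (a0 + \<eta>)) \<le> C * N / (1 + N * \<eta>\<^sup>2) * exp (- (3/4) * g * N * \<tau>)"
    "\<And>N \<tau> \<eta>. 1 \<le> N \<Longrightarrow> 0 \<le> \<tau> \<Longrightarrow> \<tau> \<le> \<tau>1 \<Longrightarrow> N * \<tau>\<^sup>2 \<le> 1 \<Longrightarrow> \<bar>\<eta>\<bar> \<le> r \<Longrightarrow>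
      N\<^sup>2 * norm (of_real (quartic_cutoff' r \<eta>) * F N (t0 + \<tau>) (a0 + \<eta>)) \<le> C * sqrt N / (1 + N * \<eta>\<^sup>2) * exp (- g * N * \<tau>)"
    "\<And>N \<eta>. 1 \<le> N \<Longrightarrow> \<bar>\<eta>\<bar> \<le> r \<Longrightarrow> norm (M t0 (a0 + \<eta>) * F N t0 (a0 + \<eta>)) \<le> C"
    "\<And>N \<eta>. 1 \<le> N \<Longrightarrow> \<bar>\<eta>\<bar> \<le> r \<Longrightarrow> N * \<eta>\<^sup>2 \<le> 1 \<Longrightarrow> norm (M t0 (a0 + \<eta>) * F N t0 (a0 + \<eta>)) \<ge> c"
proof -
  obtain K where K: "K \<ge> 1"
    "\<And>\<tau> \<eta>. (\<tau>, \<eta>) \<in> box \<Longrightarrow> norm (M (t0 + \<tau>) (a0 + \<eta>)) \<le> K"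
    "\<And>\<tau> \<eta>. (\<tau>, \<eta>) \<in> box \<Longrightarrow> norm (My (t0 + \<tau>) (a0 + \<eta>)) \<le> K"
    "\<And>\<tau> \<eta>. (\<tau>, \<eta>) \<in> box \<Longrightarrow> norm (Mt (t0 + \<tau>) (a0 + \<eta>) + Myy (t0 + \<tau>) (a0 + \<eta>)) \<le> K"
    "\<And>\<tau> \<eta>. (\<tau>, \<eta>) \<in> box \<Longrightarrow> norm (\<sigma> 1 (t0 + \<tau>) (a0 + \<eta>)) \<le> K"
    "\<And>\<tau> \<eta>. (\<tau>, \<eta>) \<in> box \<Longrightarrow> norm (R1 (t0 + \<tau>) (a0 + \<eta>)) \<le> K * (\<tau> + \<eta>\<^sup>2)"
    "\<And>\<tau> \<eta>. (\<tau>, \<eta>) \<in> box \<Longrightarrow> norm (R2 (t0 + \<tau>) (a0 + \<eta>)) \<le> K * (\<tau> + \<eta>\<^sup>2)\<^sup>2"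
    using coefficient_bounds by blast
  obtain r \<tau>1 c1 C1 where r: "0 < r" "r \<le> r1" "0 < \<tau>1" "\<tau>1 \<le> 1/4" "c1 > 0" "C1 \<ge> 0"
    and lower: "\<And>\<tau> \<eta>. 0 \<le> \<tau> \<Longrightarrow> \<tau> \<le> \<tau>1 \<Longrightarrow> \<bar>\<eta>\<bar> \<le> r \<Longrightarrow> Re (phase (t0 + \<tau>) (a0 + \<eta>)) \<ge> c1 * \<eta>\<^sup>2 - C1 * \<tau>\<^sup>2"
    and upper: "\<And>\<eta>. \<bar>\<eta>\<bar> \<le> r \<Longrightarrow> norm (phase t0 (a0 + \<eta>)) \<le> C1 * \<eta>\<^sup>2"
    and Ml: "\<And>\<eta>. \<bar>\<eta>\<bar> \<le> r \<Longrightarrow> norm (M t0 (a0 + \<eta>)) \<ge> norm M0 / 2"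
    using phase_lower_bound by blast
  obtain Ca where Ca: "Ca > 0" "\<And>q. q \<ge> 0 \<Longrightarrow> (1 + q)\<^sup>2 * exp (- c1 * q) \<le> Ca / (1 + q)"
    using cube_exp_bound[OF r(5)] by blast
  obtain Cb where Cb: "Cb > 0" "\<And>p. p \<ge> 0 \<Longrightarrow> (1 + p)\<^sup>2 * exp (- (g / 4) * p) \<le> Cb / (1 + p)"
    using cube_exp_bound[of "g / 4"] Re_rate(1) by auto
  define D where "D = 132 / r^4"
  define K' where "K' = 2 * K + K * K + 3 * D * K + 2 * D * K * K * K"
  define e1 where "e1 = exp C1"
  have D: "D > 0" "12 / r^4 \<le> D" using r by (auto simp: D_def divide_right_mono)
  have e1: "e1 \<ge> 1" using r by (simp add: e1_def)
  have K': "K' \<ge> 0" using K D by (auto simp: K'_def intro!: add_nonneg_nonneg mult_nonneg_nonneg)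
  have FN: "norm (F N (t0 + \<tau>) (a0 + \<eta>)) \<le> e1 * exp (- c1 * (N * \<eta>\<^sup>2)) * exp (- g * N * \<tau>)"
    if "1 \<le> N" "0 \<le> \<tau>" "\<tau> \<le> \<tau>1" "N * \<tau>\<^sup>2 \<le> 1" "\<bar>\<eta>\<bar> \<le> r" for N \<tau> \<eta>
  proof -
    have "N * (c1 * \<eta>\<^sup>2 - C1 * \<tau>\<^sup>2) \<le> N * Re (phase (t0 + \<tau>) (a0 + \<eta>))"
      using lower[of \<tau> \<eta>] that by (intro mult_left_mono) auto
    moreover have "C1 * (N * \<tau>\<^sup>2) \<le> C1 * 1" using that r by (intro mult_left_mono) auto
    ultimately have "- N * Re (phase (t0 + \<tau>) (a0 + \<eta>)) \<le> C1 + - c1 * (N * \<eta>\<^sup>2)" by (simp add: algebra_simps)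
    then have "exp (- N * Re (phase (t0 + \<tau>) (a0 + \<eta>))) \<le> exp (C1 + - c1 * (N * \<eta>\<^sup>2))" by (simp only: exp_le_cancel_iff)
    also have "\<dots> = e1 * exp (- c1 * (N * \<eta>\<^sup>2))" unfolding e1_def by (rule exp_add)
    finally show ?thesis unfolding norm_F by (simp add: mult_right_mono)
  qed
  have c1q: "exp (- c1 * q) \<le> Ca / (1 + q)" if "q \<ge> 0" for q
  proof -
    have "1 * exp (- c1 * q) \<le> (1 + q)\<^sup>2 * exp (- c1 * q)" using that by (intro mult_right_mono one_le_power) auto
    from order_trans[OF this Ca(2)[OF that]] show ?thesis by simp
  qed
  define C where "C = K * e1 * Ca + K' * e1 * Ca * Cb + D * e1 * Ca + K * e1"
  have pos: "0 < K * e1 * Ca" "0 \<le> K' * e1 * Ca * Cb" "0 < D * e1 * Ca" "0 < K * e1"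
    using K K' e1 Ca Cb D by (auto intro!: mult_pos_pos mult_nonneg_nonneg)
  have C: "C > 0" "K * e1 * Ca \<le> C" "K' * e1 * Ca * Cb \<le> C" "D * e1 * Ca \<le> C" "K * e1 \<le> C"
    using pos unfolding C_def by linarith+
  have M0: "norm M0 > 0" using \<beta>_parts(1) S2_0 by auto
  show ?thesis
  proof (rule that[of r \<tau>1 C "norm M0 / 2 * exp (- C1)"])
    fix N \<tau> \<eta> assume a: "1 \<le> N" "0 \<le> \<tau>" "\<tau> \<le> \<tau>1" "N * \<tau>\<^sup>2 \<le> 1" "\<bar>\<eta>\<bar> \<le> r"
    have b: "(\<tau>, \<eta>) \<in> box" using a r by (auto simp: box_def)
    define p where "p = N * \<tau>"
    define q where "q = N * \<eta>\<^sup>2"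
    have pq: "p \<ge> 0" "q \<ge> 0" using a by (auto simp: p_def q_def)
    have f: "norm (F N (t0 + \<tau>) (a0 + \<eta>)) \<le> e1 * exp (- c1 * q) * exp (- g * p)"
      using FN[OF a] by (simp add: p_def q_def mult.assoc)
    have "norm (of_real N * M (t0 + \<tau>) (a0 + \<eta>) * F N (t0 + \<tau>) (a0 + \<eta>)) \<le> N * K * (e1 * exp (- c1 * q) * exp (- g * p))"
      using a by (intro norm_mult_le K b f) auto
    also have "\<dots> \<le> N * K * (e1 * (Ca / (1 + q)) * exp (- g * p))"
      using a K e1 by (intro mult_left_mono mult_right_mono c1q pq) auto
    also have "\<dots> = (K * e1 * Ca) * (N / (1 + q) * exp (- g * p))" by simp
    also have "\<dots> \<le> C * (N / (1 + q) * exp (- g * p))" using C a pq by (intro mult_right_mono) auto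
    finally show "norm (of_real N * M (t0 + \<tau>) (a0 + \<eta>) * F N (t0 + \<tau>) (a0 + \<eta>)) \<le> C * N / (1 + N * \<eta>\<^sup>2) * exp (- g * N * \<tau>)"
      by (simp add: p_def q_def mult.assoc)
    have xb: "\<bar>quartic_cutoff r \<eta>\<bar> \<le> 1" "\<bar>quartic_cutoff' r \<eta>\<bar> \<le> D * \<bar>\<eta>\<bar>^3" "\<bar>quartic_cutoff'' r \<eta>\<bar> \<le> D * \<eta>\<^sup>2"
    proof -
      show "\<bar>quartic_cutoff r \<eta>\<bar> \<le> 1" using quartic_cutoff_bounds(1,2)[OF r(1) a(5)] by simp
      have "12 / r^4 * \<bar>\<eta>\<bar>^3 \<le> D * \<bar>\<eta>\<bar>^3" using D by (intro mult_right_mono) auto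
      then show "\<bar>quartic_cutoff' r \<eta>\<bar> \<le> D * \<bar>\<eta>\<bar>^3" using quartic_cutoff_bounds(3)[OF r(1) a(5)] by linarith
      show "\<bar>quartic_cutoff'' r \<eta>\<bar> \<le> D * \<eta>\<^sup>2" using quartic_cutoff_bounds(4)[OF r(1) a(5)] by (simp add: D_def)
    qed
    have "norm (residual N r (t0 + \<tau>) (a0 + \<eta>)) \<le> N * (K' * ((1 + p)\<^sup>2 * (1 + q)\<^sup>2)) * (e1 * exp (- c1 * q) * exp (- g * p))"
      unfolding residual_def
    proof (intro norm_mult_le f)
      show "norm (of_real (quartic_cutoff r (a0 + \<eta> - a0)) * (Mt (t0 + \<tau>) (a0 + \<eta>) + Myy (t0 + \<tau>) (a0 + \<eta>)
          + of_real N * R1 (t0 + \<tau>) (a0 + \<eta>) + of_real (N\<^sup>2) * (M (t0 + \<tau>) (a0 + \<eta>) * R2 (t0 + \<tau>) (a0 + \<eta>)))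
        + 2 * of_real (quartic_cutoff' r (a0 + \<eta> - a0)) * (My (t0 + \<tau>) (a0 + \<eta>)
          - of_real N * \<sigma> 1 (t0 + \<tau>) (a0 + \<eta>) * M (t0 + \<tau>) (a0 + \<eta>) * M (t0 + \<tau>) (a0 + \<eta>))
        + of_real (quartic_cutoff'' r (a0 + \<eta> - a0)) * M (t0 + \<tau>) (a0 + \<eta>)) \<le> K' * ((1 + p)\<^sup>2 * (1 + q)\<^sup>2)"
        unfolding K'_def p_def q_def add_diff_cancel_left'
        by (rule residual_bracket_bound) (use K a b r r1 D xb in auto)
    qed (use a in auto)
    also have "\<dots> = (N * K' * e1) * (((1 + p)\<^sup>2 * exp (- (g/4) * p)) * ((1 + q)\<^sup>2 * exp (- c1 * q)) * exp (- (3/4) * g * p))"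
    proof -
      have "exp (- g * p) = exp (- (g/4) * p) * exp (- (3/4) * g * p)" by (simp add: field_simps flip: exp_add)
      then show ?thesis by (simp only: mult_ac)
    qed
    also have "\<dots> \<le> (N * K' * e1) * ((Cb * (Ca / (1 + q))) * exp (- (3/4) * g * p))"
    proof (intro mult_left_mono mult_right_mono mult_mono Ca(2) pq)
      have "Cb / (1 + p) \<le> Cb" using Cb pq by (simp add: field_simps)
      then show "(1 + p)\<^sup>2 * exp (- (g/4) * p) \<le> Cb" using Cb(2)[OF pq(1)] by linarith
    qed (use a K' e1 Cb in auto)
    also have "\<dots> = (K' * e1 * Ca * Cb) * (N / (1 + q) * exp (- (3/4) * g * p))" by simp
    also have "\<dots> \<le> C * (N / (1 + q) * exp (- (3/4) * g * p))" using C a pq by (intro mult_right_mono) auto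
    finally show "norm (residual N r (t0 + \<tau>) (a0 + \<eta>)) \<le> C * N / (1 + N * \<eta>\<^sup>2) * exp (- (3/4) * g * N * \<tau>)"
      by (simp add: p_def q_def mult.assoc)
    define x where "x = sqrt N * \<bar>\<eta>\<bar>"
    have x: "x \<ge> 0" "x\<^sup>2 = q"
      using a real_sqrt_pow2[of N] by (simp_all add: x_def power_mult_distrib q_def)
    have x3: "x^3 \<le> (1 + q)\<^sup>2"
    proof (cases "x \<le> 1")
      case True
      then have "x^3 \<le> 1" using x by (intro power_le_one) auto
      also have "1 \<le> (1 + q)\<^sup>2" using pq by (intro one_le_power) auto
      finally show ?thesis .
    next
      case False
      then have "x^3 \<le> x^4" by (intro power_increasing) auto
      also have "x^4 = q\<^sup>2" by (simp flip: x(2) power_mult)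
      also have "\<dots> \<le> (1 + q)\<^sup>2" using pq by (intro power_mono) auto
      finally show ?thesis .
    qed
    \<comment> \<open>\<open>N\<^sup>2\<close> is the fourth power of \<open>sqrt N\<close>: three
      factors go to \<open>\<bar>\<eta>\<bar>^3\<close>, one is left.\<close>
    have N3: "N\<^sup>2 * \<bar>\<eta>\<bar>^3 = sqrt N * x^3"
    proof -
      have "(sqrt N)\<^sup>2 = N" using a by simp
      then have "sqrt N ^ 4 = N\<^sup>2" using power_mult[of "sqrt N" 2 2] by simp
      moreover have "sqrt N * x^3 = sqrt N ^ Suc 3 * \<bar>\<eta>\<bar>^3"
        by (simp only: x_def power_mult_distrib power_Suc mult.assoc)
      ultimately show ?thesis by simp
    qed
    have "N\<^sup>2 * norm (of_real (quartic_cutoff' r \<eta>) * F N (t0 + \<tau>) (a0 + \<eta>))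
       \<le> N\<^sup>2 * ((D * \<bar>\<eta>\<bar>^3) * (e1 * exp (- c1 * q) * exp (- g * p)))"
      using xb by (intro mult_left_mono norm_mult_le f) auto
    also have "\<dots> = D * e1 * exp (- g * p) * (N\<^sup>2 * \<bar>\<eta>\<bar>^3) * exp (- c1 * q)" by simp
    also have "\<dots> = D * e1 * exp (- g * p) * sqrt N * (x^3 * exp (- c1 * q))" unfolding N3 by simp
    also have "\<dots> \<le> D * e1 * exp (- g * p) * sqrt N * ((1 + q)\<^sup>2 * exp (- c1 * q))"
      using D e1 a x3 by (intro mult_left_mono mult_right_mono) auto
    also have "\<dots> \<le> D * e1 * exp (- g * p) * sqrt N * (Ca / (1 + q))"
      using D e1 a by (intro mult_left_mono Ca(2) pq) auto
    also have "\<dots> = (D * e1 * Ca) * (sqrt N / (1 + q) * exp (- g * p))" by simp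
    also have "\<dots> \<le> C * (sqrt N / (1 + q) * exp (- g * p))" using C a pq by (intro mult_right_mono) auto
    finally show "N\<^sup>2 * norm (of_real (quartic_cutoff' r \<eta>) * F N (t0 + \<tau>) (a0 + \<eta>)) \<le> C * sqrt N / (1 + N * \<eta>\<^sup>2) * exp (- g * N * \<tau>)"
      by (simp add: p_def q_def mult.assoc)
  next
    fix N \<eta> :: real assume a: "1 \<le> N" "\<bar>\<eta>\<bar> \<le> r"
    have b: "(0, \<eta>) \<in> box" using a r by (auto simp: box_def)
    have "norm (F N (t0 + 0) (a0 + \<eta>)) \<le> e1 * exp (- c1 * (N * \<eta>\<^sup>2)) * exp (- g * N * 0)"
      by (rule FN) (use a r in auto)
    also have "\<dots> \<le> e1 * 1 * 1" using e1 a r by (intro mult_mono mult_left_mono) auto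
    finally have "norm (M (t0 + 0) (a0 + \<eta>) * F N (t0 + 0) (a0 + \<eta>)) \<le> K * e1"
      by (intro norm_mult_le K b) simp
    then show "norm (M t0 (a0 + \<eta>) * F N t0 (a0 + \<eta>)) \<le> C" using C by simp
    assume q: "N * \<eta>\<^sup>2 \<le> 1"
    have "N * Re (phase t0 (a0 + \<eta>)) \<le> N * (C1 * \<eta>\<^sup>2)"
      using upper[OF a(2)] complex_Re_le_cmod[of "phase t0 (a0 + \<eta>)"] a by (intro mult_left_mono) auto
    also have "\<dots> \<le> C1" using q r mult_left_mono[of "N * \<eta>\<^sup>2" 1 C1] by (simp add: ac_simps)
    finally have "norm (F N t0 (a0 + \<eta>)) \<ge> exp (- C1)" by (simp add: norm_F)
    then show "norm M0 / 2 * exp (- C1) \<le> norm (M t0 (a0 + \<eta>) * F N t0 (a0 + \<eta>))"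
      unfolding norm_mult[of "M t0 (a0 + \<eta>)"] using Ml[OF a(2)] by (intro mult_mono) auto
  qed (use r C M0 in auto)
qed

end

section \<open>Pairing a mode with the adjoint solution\<close>

lemma has_vector_derivative_exp:
  fixes p :: "real \<Rightarrow> complex"
  assumes "(p has_vector_derivative p') (at x)"
  shows "((\<lambda>x. exp (p x)) has_vector_derivative p' * exp (p x)) (at x)"
  using field_vector_diff_chain_at[OF assms DERIV_exp] by (simp add: o_def)

context critical_point begin

lemma \<sigma>_y: "t > 0 \<Longrightarrow> y > 0 \<Longrightarrow> (\<sigma> j t has_vector_derivative \<sigma> (Suc j) t y) (at y)"
  by (rule has_vector_derivative_of_real[OF S_y])

lemma \<sigma>_t: "t > 0 \<Longrightarrow> y > 0 \<Longrightarrow> ((\<lambda>t. \<sigma> j t y) has_vector_derivative \<sigma> (j + 2) t y) (at t)"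
  by (rule has_vector_derivative_of_real[OF S_t])

lemmas \<sigma>_y' = \<sigma>_y[of _ _ 0] \<sigma>_y[of _ _ "Suc 0"] \<sigma>_y[of _ _ 2] \<sigma>_y[of _ _ 3]
lemmas \<sigma>_t' = \<sigma>_t[of _ _ 0] \<sigma>_t[of _ _ "Suc 0"] \<sigma>_t[of _ _ 2] \<sigma>_t[of _ _ 3]

context
  fixes t y :: real assumes pos: "t > 0" "y > 0"
begin

lemma M_y: "(M t has_vector_derivative My t y) (at y)"
  and My_y: "(My t has_vector_derivative Myy t y) (at y)"
  and M_t: "((\<lambda>t. M t y) has_vector_derivative Mt t y) (at t)"
  and phase_y: "(phase t has_vector_derivative \<sigma> 1 t y * M t y) (at y)"
  and phase_t: "((\<lambda>t. phase t y) has_vector_derivative \<sigma> 1 t y * (2 * \<beta> + 3 * \<gamma> * \<sigma> 1 t y) * \<sigma> 3 t y) (at t)"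
proof -
  note [derivative_intros] = \<sigma>_y'[OF pos] \<sigma>_t'[OF pos] has_vector_derivative_mult has_vector_derivative_mult_right
  note d = has_vector_derivative_eq_rhs
  show "(M t has_vector_derivative My t y) (at y)"
    unfolding M_def[abs_def] One_nat_def
    by (rule d, (rule derivative_intros)+) (simp add: My_def eval_nat_numeral algebra_simps)
  show "(My t has_vector_derivative Myy t y) (at y)"
    unfolding My_def[abs_def] One_nat_def
    by (rule d, (rule derivative_intros)+) (simp add: Myy_def eval_nat_numeral algebra_simps)
  show "((\<lambda>t. M t y) has_vector_derivative Mt t y) (at t)"
    unfolding M_def[abs_def] One_nat_def
    by (rule d, (rule derivative_intros)+) (simp add: Mt_def eval_nat_numeral algebra_simps)
  show "(phase t has_vector_derivative \<sigma> 1 t y * M t y) (at y)"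
    unfolding phase_def[abs_def] One_nat_def power2_eq_square power3_eq_cube
    by (rule d, (rule derivative_intros)+) (simp add: M_def eval_nat_numeral algebra_simps)
  show "((\<lambda>t. phase t y) has_vector_derivative \<sigma> 1 t y * (2 * \<beta> + 3 * \<gamma> * \<sigma> 1 t y) * \<sigma> 3 t y) (at t)"
    unfolding phase_def[abs_def] One_nat_def power2_eq_square power3_eq_cube
    by (rule d, (rule derivative_intros)+) (simp add: eval_nat_numeral algebra_simps)
qed

lemma F_y: "(F N t has_vector_derivative - of_real N * \<sigma> 1 t y * M t y * F N t y) (at y)"
proof -
  have "((\<lambda>y. - of_real N * (phase t y + rate * of_real (t - t0)) + \<i> * of_real (N\<^sup>2 * (S 0 t0 a0 * (t - t0) + s2 * (t - t0)\<^sup>2 / 2)))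
     has_vector_derivative - of_real N * (\<sigma> 1 t y * M t y + 0) + 0) (at y)"
    by (intro has_vector_derivative_add has_vector_derivative_mult_right has_vector_derivative_const phase_y)
  from has_vector_derivative_exp[OF this] show ?thesis by (simp add: F_def[abs_def] mult.assoc)
qed

lemma F_t: "((\<lambda>t. F N t y) has_vector_derivative (- of_real N * (\<sigma> 1 t y * (2 * \<beta> + 3 * \<gamma> * \<sigma> 1 t y) * \<sigma> 3 t y + rate)
    + \<i> * of_real (N\<^sup>2) * (\<sigma> 0 t0 a0 + of_real (s2 * (t - t0)))) * F N t y) (at t)"
proof -
  have 1: "((\<lambda>t. complex_of_real (t - t0)) has_vector_derivative of_real 1) (at t)"
    by (rule has_vector_derivative_of_real) (auto intro!: derivative_eq_intros)
  have 2: "((\<lambda>t. complex_of_real (N\<^sup>2 * (S 0 t0 a0 * (t - t0) + s2 * (t - t0)\<^sup>2 / 2))) has_vector_derivative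
     of_real (N\<^sup>2 * (S 0 t0 a0 + s2 * (t - t0)))) (at t)"
    by (rule has_vector_derivative_of_real) (auto intro!: derivative_eq_intros simp: field_simps)
  have "((\<lambda>t. - of_real N * (phase t y + rate * of_real (t - t0)) + \<i> * of_real (N\<^sup>2 * (S 0 t0 a0 * (t - t0) + s2 * (t - t0)\<^sup>2 / 2)))
     has_vector_derivative - of_real N * (\<sigma> 1 t y * (2 * \<beta> + 3 * \<gamma> * \<sigma> 1 t y) * \<sigma> 3 t y + rate * of_real 1)
       + \<i> * of_real (N\<^sup>2 * (S 0 t0 a0 + s2 * (t - t0)))) (at t)"
    by (intro has_vector_derivative_add has_vector_derivative_mult_right phase_t 1 2)
  from has_vector_derivative_exp[OF this] show ?thesis by (simp add: F_def[abs_def] mult.assoc)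
qed

end

section \<open>The localized dual profile and its derivatives\<close>

abbreviation cut where "cut r y \<equiv> complex_of_real (quartic_cutoff r (y - a0))"
abbreviation cut' where "cut' r y \<equiv> complex_of_real (quartic_cutoff' r (y - a0))"
abbreviation cut'' where "cut'' r y \<equiv> complex_of_real (quartic_cutoff'' r (y - a0))"

lemma cut_y:
  assumes "r > 0"
  shows "(cut r has_vector_derivative cut' r y) (at y)" "(cut' r has_vector_derivative cut'' r y) (at y)"
proof -
  have d: "((\<lambda>y. y - a0) has_real_derivative 1) (at y)" by (auto intro!: derivative_eq_intros)
  show "(cut r has_vector_derivative cut' r y) (at y)"
    using has_vector_derivative_of_real[OF DERIV_chain2[OF quartic_cutoff_deriv(1)[OF assms] d]] by simp
  show "(cut' r has_vector_derivative cut'' r y) (at y)"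
    using has_vector_derivative_of_real[OF DERIV_chain2[OF quartic_cutoff_deriv(2)[OF assms] d]] by simp
qed

definition test where "test N r t y = of_real N * cut r y * M t y * F N t y"
definition test_y where "test_y N r t y = of_real N * (cut' r y * M t y + cut r y * My t y
   - of_real N * cut r y * M t y * \<sigma> 1 t y * M t y) * F N t y"
definition test_yy where "test_yy N r t y = of_real N * (cut'' r y * M t y + 2 * cut' r y * My t y + cut r y * Myy t y
   - of_real N * (2 * cut' r y * M t y * \<sigma> 1 t y * M t y + cut r y * (3 * My t y * \<sigma> 1 t y * M t y + M t y * \<sigma> 2 t y * M t y))
   + of_real (N\<^sup>2) * cut r y * M t y * (\<sigma> 1 t y * M t y)\<^sup>2) * F N t y"
definition test_t where "test_t N r t y = of_real N * cut r y * (Mt t y + M t y *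
   (- of_real N * (\<sigma> 1 t y * (2 * \<beta> + 3 * \<gamma> * \<sigma> 1 t y) * \<sigma> 3 t y + rate)
    + \<i> * of_real (N\<^sup>2) * (\<sigma> 0 t0 a0 + of_real (s2 * (t - t0))))) * F N t y"

lemma test_derivs:
  assumes "t > 0" "y > 0" "r > 0"
  shows "(test N r t has_vector_derivative test_y N r t y) (at y)"
    "(test_y N r t has_vector_derivative test_yy N r t y) (at y)"
    "((\<lambda>t. test N r t y) has_vector_derivative test_t N r t y) (at t)"
proof -
  note [derivative_intros] = \<sigma>_y'[OF assms(1,2)] M_y[OF assms(1,2)] My_y[OF assms(1,2)] M_t[OF assms(1,2)]
    F_y[OF assms(1,2)] F_t[OF assms(1,2)] cut_y[OF assms(3)] has_vector_derivative_mult has_vector_derivative_mult_right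
  note d = has_vector_derivative_eq_rhs
  show "(test N r t has_vector_derivative test_y N r t y) (at y)"
    unfolding test_def[abs_def] One_nat_def
    by (rule d, (rule derivative_intros)+) (simp add: test_y_def algebra_simps)
  show "(test_y N r t has_vector_derivative test_yy N r t y) (at y)"
    unfolding test_y_def[abs_def] One_nat_def
    by (rule d, (rule derivative_intros)+) (simp add: test_yy_def power2_eq_square numeral_2_eq_2 algebra_simps)
  show "((\<lambda>t. test N r t y) has_vector_derivative test_t N r t y) (at t)"
    unfolding test_def[abs_def] One_nat_def
    by (rule d, (rule derivative_intros)+) (simp add: test_t_def algebra_simps)
qed

text \<open>Of the nonlocal term, the integral of \<open>\<sigma> 1 * test\<close> from
  \<open>y\<close> on, only the main part \<open>cut * F\<close> is included. The rest is the
  integral of \<open>cut' * F\<close>, which the pairing argument treats separately as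
  \<open>X\<close>.\<close>

lemma test_residual:
  "test_t N r t y + test_yy N r t y - \<i> * of_real (N\<^sup>2) * \<sigma> 0 t y * test N r t y + \<i> * of_real (N\<^sup>2) * (cut r y * F N t y)
     = residual N r t y"
  unfolding test_t_def test_yy_def test_def residual_def R1_def R2_def
  by (simp add: power2_eq_square algebra_simps)

lemma test_boundary:
  assumes "r > 0" "\<bar>y - a0\<bar> = r" shows "test N r t y = 0" "test_y N r t y = 0" "cut r y = 0"
  using quartic_cutoff_boundary[OF assms] by (simp_all add: test_def test_y_def)

lemma continuous_parts:
  assumes "A \<subseteq> {0<..} \<times> {0<..}"
  shows "continuous_on A (\<lambda>p. \<sigma> j (fst p) (snd p))" "continuous_on A (\<lambda>p. F N (fst p) (snd p))"
    "continuous_on A (\<lambda>p. M (fst p) (snd p))" "continuous_on A (\<lambda>p. My (fst p) (snd p))"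
    "continuous_on A (\<lambda>p. Mt (fst p) (snd p))" "continuous_on A (\<lambda>p. Myy (fst p) (snd p))"
    "continuous_on A (\<lambda>p. R1 (fst p) (snd p))" "continuous_on A (\<lambda>p. R2 (fst p) (snd p))"
proof -
  have s: "continuous_on A (\<lambda>p. S j (fst p) (snd p))" for j
    using continuous_on_subset[OF S_cont[of j] assms] by (simp add: case_prod_beta')
  show "continuous_on A (\<lambda>p. \<sigma> j (fst p) (snd p))" for j
    by (intro continuous_on_of_real s)
  show "continuous_on A (\<lambda>p. F N (fst p) (snd p))"
    unfolding F_def phase_def by (intro continuous_intros s) auto
  show m: "continuous_on A (\<lambda>p. M (fst p) (snd p))" "continuous_on A (\<lambda>p. My (fst p) (snd p))"
    "continuous_on A (\<lambda>p. Mt (fst p) (snd p))" "continuous_on A (\<lambda>p. Myy (fst p) (snd p))"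
    unfolding M_def My_def Mt_def Myy_def by (intro continuous_intros s)+
  show "continuous_on A (\<lambda>p. R1 (fst p) (snd p))" "continuous_on A (\<lambda>p. R2 (fst p) (snd p))"
    unfolding R1_def R2_def by (intro continuous_intros s m)+
qed

lemma continuous_cuts:
  "continuous_on A (\<lambda>p. quartic_cutoff r (snd p - a0))" "continuous_on A (\<lambda>p. quartic_cutoff' r (snd p - a0))"
  "continuous_on A (\<lambda>p. quartic_cutoff'' r (snd p - a0))"
  unfolding quartic_cutoff_def quartic_cutoff'_def quartic_cutoff''_def divide_inverse
  by (intro continuous_intros)+

lemma continuous_test:
  assumes "A \<subseteq> {0<..} \<times> {0<..}"
  shows "continuous_on A (\<lambda>p. test N r (fst p) (snd p))" "continuous_on A (\<lambda>p. test_y N r (fst p) (snd p))"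
    "continuous_on A (\<lambda>p. test_yy N r (fst p) (snd p))" "continuous_on A (\<lambda>p. test_t N r (fst p) (snd p))"
    "continuous_on A (\<lambda>p. residual N r (fst p) (snd p))" "continuous_on A (\<lambda>p. cut' r (snd p) * F N (fst p) (snd p))"
proof -
  have s: "continuous_on A (\<lambda>p. S j (fst p) (snd p))" for j
    using continuous_on_subset[OF S_cont[of j] assms] by (simp add: case_prod_beta')
  note c = continuous_intros s continuous_parts(2-)[OF assms] continuous_cuts
  show "continuous_on A (\<lambda>p. test N r (fst p) (snd p))" unfolding test_def by (intro c)
  show "continuous_on A (\<lambda>p. test_y N r (fst p) (snd p))" unfolding test_y_def by (intro c)
  show "continuous_on A (\<lambda>p. test_yy N r (fst p) (snd p))" unfolding test_yy_def by (intro c)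
  show "continuous_on A (\<lambda>p. test_t N r (fst p) (snd p))" unfolding test_t_def by (intro c)
  show "continuous_on A (\<lambda>p. residual N r (fst p) (snd p))" unfolding residual_def by (intro c)
  show "continuous_on A (\<lambda>p. cut' r (snd p) * F N (fst p) (snd p))" by (intro c)
qed

end

lemma lorentz_integral:
  assumes "N \<ge> 1" "r > 0"
  shows "(\<lambda>y. 1 / (1 + N * (y - a)\<^sup>2)) integrable_on {a - r..a + r}"
    "integral {a - r..a + r} (\<lambda>y. 1 / (1 + N * (y - a)\<^sup>2)) \<le> pi / sqrt N"
proof -
  have N: "sqrt N > 0" "sqrt N * sqrt N = N" using assms by auto
  have pos: "1 + N * (y - a)\<^sup>2 > 0" for y using assms by (intro add_pos_nonneg) auto
  have "((\<lambda>y. 1 / (1 + N * (y - a)\<^sup>2)) has_integral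
      arctan (sqrt N * ((a + r) - a)) / sqrt N - arctan (sqrt N * ((a - r) - a)) / sqrt N) {a - r..a + r}"
  proof (rule fundamental_theorem_of_calculus)
    fix x assume "x \<in> {a - r..a + r}"
    have "((\<lambda>y. arctan (sqrt N * (y - a))) has_real_derivative inverse (1 + (sqrt N * (x - a))\<^sup>2) * sqrt N) (at x)"
      by (auto intro!: derivative_eq_intros)
    note DERIV_cdivide[OF this, of "sqrt N"]
    moreover have "(inverse (1 + (sqrt N * (x - a))\<^sup>2) * sqrt N) / sqrt N = 1 / (1 + N * (x - a)\<^sup>2)"
    proof -
      have "(sqrt N * (x - a))\<^sup>2 = N * (x - a)\<^sup>2" using assms by (simp add: power_mult_distrib)
      moreover have "(b * sqrt N) / sqrt N = b" for b using N(1) by (rule nonzero_mult_div_cancel_right[OF less_imp_neq[symmetric]])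
      ultimately show ?thesis by (simp only: inverse_eq_divide)
    qed
    ultimately have "((\<lambda>y. arctan (sqrt N * (y - a)) / sqrt N) has_real_derivative 1 / (1 + N * (x - a)\<^sup>2)) (at x)"
      by simp
    then show "((\<lambda>y. arctan (sqrt N * (y - a)) / sqrt N) has_vector_derivative 1 / (1 + N * (x - a)\<^sup>2)) (at x within {a - r..a + r})"
      by (simp add: has_real_derivative_iff_has_vector_derivative has_vector_derivative_at_within)
  qed (use assms in auto)
  moreover have "arctan (sqrt N * ((a + r) - a)) / sqrt N - arctan (sqrt N * ((a - r) - a)) / sqrt N \<le> pi / sqrt N"
    using arctan_ubound[of "sqrt N * r"] N
    by (simp add: arctan_minus divide_right_mono flip: add_divide_distrib)
  ultimately show "(\<lambda>y. 1 / (1 + N * (y - a)\<^sup>2)) integrable_on {a - r..a + r}"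
    "integral {a - r..a + r} (\<lambda>y. 1 / (1 + N * (y - a)\<^sup>2)) \<le> pi / sqrt N"
    by (auto simp: integral_unique)
qed

lemma norm_integral_lorentz:
  fixes f :: "real \<Rightarrow> complex"
  assumes "N \<ge> 1" "r > 0" "continuous_on {a - r..a + r} f" "B \<ge> 0"
    and b: "\<And>y. y \<in> {a - r..a + r} \<Longrightarrow> norm (f y) \<le> B * (1 / (1 + N * (y - a)\<^sup>2))"
  shows "norm (integral {a - r..a + r} f) \<le> B * (pi / sqrt N)"
proof -
  have "norm (integral {a - r..a + r} f) \<le> integral {a - r..a + r} (\<lambda>y. B * (1 / (1 + N * (y - a)\<^sup>2)))"
    by (intro integral_norm_bound_integral integrable_continuous_interval assms(3) integrable_on_mult_right lorentz_integral assms b)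
  also have "\<dots> = B * integral {a - r..a + r} (\<lambda>y. 1 / (1 + N * (y - a)\<^sup>2))"
    by (rule integral_mult_right)
  also have "\<dots> \<le> B * (pi / sqrt N)" by (intro mult_left_mono lorentz_integral assms)
  finally show ?thesis .
qed

section \<open>The pairing of a solution with the dual profile\<close>

context critical_point begin

text \<open>The defect decays at the rate \<open>3/4 * g\<close>, the solution grows at most at the
  rate \<open>g / 2\<close>. The surplus \<open>g / 4\<close> bounds the derivative of the pairing
  by \<open>sqrt N * exp (- (g / 4) * N * (t - t0))\<close> up to constants, so the total variation
  is of order \<open>1 / sqrt N\<close>; division by the initial size \<open>sqrt N\<close> gives
  the term \<open>1 / N\<close>. The exponential term is the pairing at the final time.\<close>

theorem growth_bound:
  obtains r \<tau>1 C :: real where "0 < r" "r < a0" "0 < \<tau>1" "C > 0"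
    "\<And>N y. N \<ge> 1 \<Longrightarrow> \<bar>y - a0\<bar> \<le> r \<Longrightarrow> norm (M t0 y * F N t0 y) \<le> C"
    "\<And>N \<Delta> Q b b0 u ut uy uyy \<psi>.
      \<lbrakk>N \<ge> 1; 0 < \<Delta>; \<Delta> \<le> \<tau>1; N * \<Delta>\<^sup>2 \<le> 1; Q \<ge> 0; b0 > 0;
       \<And>y. b y \<ge> 0; \<And>y. \<bar>y - a0\<bar> \<le> r / 2 \<Longrightarrow> b y \<ge> b0;
       \<And>y. \<bar>y - a0\<bar> \<le> r \<Longrightarrow> u t0 y = cnj (M t0 y * F N t0 y) * of_real (b y);
       mode_flow t0 (t0 + \<Delta>) (\<i> * of_real (N\<^sup>2)) S u ut uy uyy \<psi>;
       \<And>t y. t \<in> {t0<..t0 + \<Delta>} \<Longrightarrow> y > 0 \<Longrightarrow> norm (u t y) \<le> Q * exp (g / 2 * N * (t - t0))\<rbrakk>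
      \<Longrightarrow> b0 \<le> C * Q * (exp (- (g / 2) * N * \<Delta>) + 1 / N)"
proof -
  obtain r \<tau>1 C c where r: "0 < r" "r \<le> r1" "0 < \<tau>1" "\<tau>1 \<le> 1/4" "C > 0" "c > 0"
    and B1: "\<And>N \<tau> \<eta>. 1 \<le> N \<Longrightarrow> 0 \<le> \<tau> \<Longrightarrow> \<tau> \<le> \<tau>1 \<Longrightarrow> N * \<tau>\<^sup>2 \<le> 1 \<Longrightarrow> \<bar>\<eta>\<bar> \<le> r \<Longrightarrow>
      norm (of_real N * M (t0 + \<tau>) (a0 + \<eta>) * F N (t0 + \<tau>) (a0 + \<eta>)) \<le> C * N / (1 + N * \<eta>\<^sup>2) * exp (- g * N * \<tau>)"
    and B2: "\<And>N \<tau> \<eta>. 1 \<le> N \<Longrightarrow> 0 \<le> \<tau> \<Longrightarrow> \<tau> \<le> \<tau>1 \<Longrightarrow> N * \<tau>\<^sup>2 \<le> 1 \<Longrightarrow> \<bar>\<eta>\<bar> \<le> r \<Longrightarrow>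
      norm (residual N r (t0 + \<tau>) (a0 + \<eta>)) \<le> C * N / (1 + N * \<eta>\<^sup>2) * exp (- (3/4) * g * N * \<tau>)"
    and B3: "\<And>N \<tau> \<eta>. 1 \<le> N \<Longrightarrow> 0 \<le> \<tau> \<Longrightarrow> \<tau> \<le> \<tau>1 \<Longrightarrow> N * \<tau>\<^sup>2 \<le> 1 \<Longrightarrow> \<bar>\<eta>\<bar> \<le> r \<Longrightarrow>
      N\<^sup>2 * norm (of_real (quartic_cutoff' r \<eta>) * F N (t0 + \<tau>) (a0 + \<eta>)) \<le> C * sqrt N / (1 + N * \<eta>\<^sup>2) * exp (- g * N * \<tau>)"
    and B4: "\<And>N \<eta>. 1 \<le> N \<Longrightarrow> \<bar>\<eta>\<bar> \<le> r \<Longrightarrow> norm (M t0 (a0 + \<eta>) * F N t0 (a0 + \<eta>)) \<le> C"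
    and B5: "\<And>N \<eta>. 1 \<le> N \<Longrightarrow> \<bar>\<eta>\<bar> \<le> r \<Longrightarrow> N * \<eta>\<^sup>2 \<le> 1 \<Longrightarrow> norm (M t0 (a0 + \<eta>) * F N t0 (a0 + \<eta>)) \<ge> c"
    using adjoint_bounds by blast
  have ra: "r < a0" using r r1 by linarith
  have g: "g > 0" by (rule Re_rate(1))
  define c2 where "c2 = c\<^sup>2 * min (r / 2) 1 / 2"
  have c2: "c2 > 0" using r by (simp add: c2_def)
  \<comment> \<open>Collects the three parts of the derivative of the pairing: the defect,
    \<open>X\<close> integrated over an interval of length \<open>2 * r\<close>, and the boundary
    term, in which \<open>\<psi>\<close> is an integral over a length below
    \<open>a0\<close>.\<close>
  define A where "A = C * pi * (1 + 2 * r + a0)"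
  have A: "A > 0" using r a0 by (auto simp: A_def intro!: mult_pos_pos add_pos_nonneg)
  define C' where "C' = max C (max (C * pi / c2) (4 * A / g / c2))"
  have C': "C \<le> C'" "C * pi / c2 \<le> C'" "4 * A / g / c2 \<le> C'" "C' > 0"
    using r unfolding C'_def by (auto simp: le_max_iff_disj less_max_iff_disj)
  show ?thesis
  proof (rule that[of r \<tau>1 C'])
    show "norm (M t0 y * F N t0 y) \<le> C'" if "N \<ge> 1" "\<bar>y - a0\<bar> \<le> r" for N y
      using B4[OF that] C' by simp
    fix N \<Delta> Q b0 :: real and b :: "real \<Rightarrow> real" and u ut uy uyy \<psi> :: "real \<Rightarrow> real \<Rightarrow> complex"
    assume N: "N \<ge> 1" and \<Delta>: "0 < \<Delta>" "\<Delta> \<le> \<tau>1" "N * \<Delta>\<^sup>2 \<le> 1" and Q: "Q \<ge> 0" and b0: "b0 > 0"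
      and b: "\<And>y. b y \<ge> 0" "\<And>y. \<bar>y - a0\<bar> \<le> r / 2 \<Longrightarrow> b y \<ge> b0"
      and init: "\<And>y. \<bar>y - a0\<bar> \<le> r \<Longrightarrow> u t0 y = cnj (M t0 y * F N t0 y) * of_real (b y)"
      and flow: "mode_flow t0 (t0 + \<Delta>) (\<i> * of_real (N\<^sup>2)) S u ut uy uyy \<psi>"
      and ub: "\<And>t y. t \<in> {t0<..t0 + \<Delta>} \<Longrightarrow> y > 0 \<Longrightarrow> norm (u t y) \<le> Q * exp (g / 2 * N * (t - t0))"
    have cu: "continuous_on ({t0..t0 + \<Delta>} \<times> {0..}) (\<lambda>(t, y). u t y)"
      and c\<psi>: "continuous_on ({t0..t0 + \<Delta>} \<times> {0..}) (\<lambda>(t, y). \<psi> t y)"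
      and cut: "continuous_on ({t0..t0 + \<Delta>} \<times> {0<..}) (\<lambda>(t, y). ut t y)"
      and cuyy: "continuous_on ({t0..t0 + \<Delta>} \<times> {0<..}) (\<lambda>(t, y). uyy t y)"
      using flow by (simp_all add: mode_flow_def)
    have \<psi>0: "\<psi> t 0 = 0" if "t \<in> {t0..t0 + \<Delta>}" for t
      using flow that unfolding mode_flow_def by blast
    have \<psi>_y: "(\<psi> t has_vector_derivative u t y) (at y)"
      and u_y: "(u t has_vector_derivative uy t y) (at y)"
      and u_yy: "(uy t has_vector_derivative uyy t y) (at y)"
      and u_t: "((\<lambda>t. u t y) has_vector_derivative ut t y) (at t within {t0..t0 + \<Delta>})"
      and eq: "ut t y + \<i> * of_real (N\<^sup>2) * (\<sigma> 0 t y * u t y - \<sigma> 1 t y * \<psi> t y) - uyy t y = 0"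
      if "t \<in> {t0..t0 + \<Delta>}" "y > 0" for t y
      using flow that unfolding mode_flow_def by blast+
    let ?I = "{t0..t0 + \<Delta>}" and ?Y = "{a0 - r..a0 + r}"
    let ?k = "\<i> * of_real (N\<^sup>2)"
    have Ypos: "y > 0" if "y \<in> ?Y" for y using that ra by auto
    have Yr: "\<bar>y - a0\<bar> \<le> r" if "y \<in> ?Y" for y using that by auto
    have tpos: "t > 0" if "t \<in> ?I" for t using that t0 by auto
    have tN: "N * (t - t0)\<^sup>2 \<le> 1" "t - t0 \<le> \<tau>1" if "t \<in> ?I" for t
    proof -
      have "(t - t0)\<^sup>2 \<le> \<Delta>\<^sup>2" using that by (intro power_mono) auto
      then have "N * (t - t0)\<^sup>2 \<le> N * \<Delta>\<^sup>2" using N by (intro mult_left_mono) auto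
      then show "N * (t - t0)\<^sup>2 \<le> 1" using \<Delta> by linarith
      show "t - t0 \<le> \<tau>1" using that \<Delta> by auto
    qed
    have ss: "?I \<times> ?Y \<subseteq> {0<..} \<times> {0<..}" using Ypos tpos by auto
    note cT = continuous_test[OF ss, where N = N and r = r] continuous_parts[OF ss]
    have sub: "?I \<times> ?Y \<subseteq> ?I \<times> {0..}" "?I \<times> ?Y \<subseteq> ?I \<times> {0<..}" using Ypos by force+
    have cU: "continuous_on (?I \<times> ?Y) (\<lambda>p. u (fst p) (snd p))" "continuous_on (?I \<times> ?Y) (\<lambda>p. \<psi> (fst p) (snd p))"
      "continuous_on (?I \<times> ?Y) (\<lambda>p. ut (fst p) (snd p))" "continuous_on (?I \<times> ?Y) (\<lambda>p. uyy (fst p) (snd p))"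
      using continuous_on_subset[OF cu sub(1)] continuous_on_subset[OF c\<psi> sub(1)]
        continuous_on_subset[OF cut sub(2)] continuous_on_subset[OF cuyy sub(2)] by (simp_all add: case_prod_beta')
    have slice: "continuous_on ?Y (\<lambda>y. h t y)" if "continuous_on (?I \<times> ?Y) (\<lambda>p. h (fst p) (snd p))" "t \<in> ?I"
      for h :: "real \<Rightarrow> real \<Rightarrow> complex" and t
    proof -
      have "continuous_on ?Y (\<lambda>y. (t, y))" by (intro continuous_on_Pair continuous_on_const continuous_on_id)
      moreover have "(\<lambda>y. (t, y)) ` ?Y \<subseteq> ?I \<times> ?Y" using that(2) by blast
      ultimately show ?thesis using continuous_on_compose2[OF that(1), of ?Y "\<lambda>y. (t, y)"] by simp
    qed
    note sT = cT(1-5)[THEN slice] and sU = cU[THEN slice]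
    have sX: "continuous_on ?Y (\<lambda>y. cut' r y * F N t y)" if "t \<in> ?I" for t
      using slice[of "\<lambda>t y. cut' r y * F N t y", OF cT(6) that] .
    define J where "J t = integral ?Y (\<lambda>y. u t y * test N r t y)" for t
    \<comment> \<open>The nonlocal remainder due to the cutoff:
      \<open>cut r y * F N t y + X t y\<close> has derivative
      \<open>- \<sigma> 1 t y * test N r t y\<close> and vanishes at \<open>a0 + r\<close>.\<close>
    define X where "X t y = integral {y..a0 + r} (\<lambda>y. cut' r y * F N t y)" for t y
    have lor: "C * N / (1 + N * (y - a0)\<^sup>2) * e = C * N * e * (1 / (1 + N * (y - a0)\<^sup>2))"
      "C * sqrt N / (1 + N * (y - a0)\<^sup>2) * e = C * sqrt N * e * (1 / (1 + N * (y - a0)\<^sup>2))" for y e by simp_all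
    have sq: "N / sqrt N = sqrt N" "sqrt N / sqrt N = 1" "sqrt N > 0" using N by (auto simp: real_div_sqrt)
    have dv: "x \<le> B / N\<^sup>2 * q" if "N\<^sup>2 * x \<le> B * q" for x B q :: real
      using that N by (simp add: field_simps)
    have dv2: "N\<^sup>2 * x \<le> B" if "x \<le> B / N\<^sup>2" for x B :: real
      using that N by (simp add: field_simps)
    \<comment> \<open>The factor \<open>N\<^sup>2\<close> is the frequency, with which
      \<open>X\<close> always occurs. The flatness of the cutoff at \<open>a0\<close> leaves a bound
      without any power of \<open>N\<close>.\<close>
    have Xb: "N\<^sup>2 * norm (X t y) \<le> C * pi * exp (- g * N * (t - t0))" if t: "t \<in> ?I" and y: "y \<in> ?Y" for t y
    proof -
      have "norm (X t y) \<le> integral {y..a0 + r} (\<lambda>y. C * sqrt N * exp (- g * N * (t - t0)) / N\<^sup>2 * (1 / (1 + N * (y - a0)\<^sup>2)))"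
        unfolding X_def
      proof (rule integral_norm_bound_integral)
        show "(\<lambda>y. cut' r y * F N t y) integrable_on {y..a0 + r}"
          by (intro integrable_continuous_interval continuous_on_subset[OF sX[OF t]]) (use y in auto)
        show "(\<lambda>y. C * sqrt N * exp (- g * N * (t - t0)) / N\<^sup>2 * (1 / (1 + N * (y - a0)\<^sup>2))) integrable_on {y..a0 + r}"
          by (rule integrable_on_subinterval[OF integrable_on_mult_right[OF lorentz_integral(1)[OF N r(1)]]]) (use y in auto)
        fix x assume "x \<in> {y..a0 + r}"
        then have x: "\<bar>x - a0\<bar> \<le> r" using y by auto
        have "N\<^sup>2 * norm (cut' r x * F N t x) \<le> C * sqrt N * exp (- g * N * (t - t0)) * (1 / (1 + N * (x - a0)\<^sup>2))"
          using B3[OF N _ tN(2)[OF t] tN(1)[OF t] x] t by (simp add: lor)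
        then show "norm (cut' r x * F N t x) \<le> C * sqrt N * exp (- g * N * (t - t0)) / N\<^sup>2 * (1 / (1 + N * (x - a0)\<^sup>2))"
          by (rule dv)
      qed
      also have "\<dots> \<le> integral ?Y (\<lambda>y. C * sqrt N * exp (- g * N * (t - t0)) / N\<^sup>2 * (1 / (1 + N * (y - a0)\<^sup>2)))"
      proof (rule integral_subset_le)
        show "(\<lambda>y. C * sqrt N * exp (- g * N * (t - t0)) / N\<^sup>2 * (1 / (1 + N * (y - a0)\<^sup>2))) integrable_on {y..a0 + r}"
          by (rule integrable_on_subinterval[OF integrable_on_mult_right[OF lorentz_integral(1)[OF N r(1)]]]) (use y in auto)
        show "(\<lambda>y. C * sqrt N * exp (- g * N * (t - t0)) / N\<^sup>2 * (1 / (1 + N * (y - a0)\<^sup>2))) integrable_on ?Y"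
          by (rule integrable_on_mult_right[OF lorentz_integral(1)[OF N r(1)]])
      qed (use y N r in \<open>auto intro!: mult_nonneg_nonneg divide_nonneg_nonneg\<close>)
      also have "\<dots> = C * sqrt N * exp (- g * N * (t - t0)) / N\<^sup>2 * integral ?Y (\<lambda>y. 1 / (1 + N * (y - a0)\<^sup>2))"
        by (rule integral_mult_right)
      also have "\<dots> \<le> C * sqrt N * exp (- g * N * (t - t0)) / N\<^sup>2 * (pi / sqrt N)"
        by (intro mult_left_mono lorentz_integral N r divide_nonneg_nonneg mult_nonneg_nonneg) (use r N in auto)
      also have "\<dots> = C * pi * exp (- g * N * (t - t0)) / N\<^sup>2" using sq(3) by simp
      finally show ?thesis by (rule dv2)
    qed
    have XY: "((X t) has_vector_derivative - (cut' r y * F N t y)) (at y within ?Y)" if t: "t \<in> ?I" and y: "y \<in> ?Y" for t y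
    proof -
      have i: "(\<lambda>y. cut' r y * F N t y) integrable_on ?Y" by (intro integrable_continuous_interval sX[OF t])
      have "((\<lambda>y. integral {a0 - r..y} (\<lambda>y. cut' r y * F N t y)) has_vector_derivative cut' r y * F N t y) (at y within ?Y)"
        by (rule integral_has_vector_derivative[OF sX[OF t] y])
      then have "((\<lambda>y. X t (a0 - r) - integral {a0 - r..y} (\<lambda>y. cut' r y * F N t y)) has_vector_derivative 0 - cut' r y * F N t y) (at y within ?Y)"
        by (intro has_vector_derivative_diff has_vector_derivative_const)
      then have "((\<lambda>y. X t (a0 - r) - integral {a0 - r..y} (\<lambda>y. cut' r y * F N t y)) has_vector_derivative - (cut' r y * F N t y)) (at y within ?Y)"
        by simp
      then show ?thesis
      proof (rule has_vector_derivative_transform[OF y, rotated])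
        fix x assume x: "x \<in> ?Y"
        show "X t x = X t (a0 - r) - integral {a0 - r..x} (\<lambda>y. cut' r y * F N t y)"
          using Henstock_Kurzweil_Integration.integral_combine[OF _ _ i, of x] x by (simp add: X_def algebra_simps)
      qed
    qed
    have cX: "continuous_on ?Y (X t)" if "t \<in> ?I" for t
      by (meson XY[OF that] continuous_on_eq_continuous_within has_vector_derivative_continuous)
    \<comment> \<open>Up to the left end the primitive accumulates \<open>u\<close> from the wall
      on, outside the support of the profile, where the sup bound has to be used.\<close>
    have c\<psi>Y: "norm (\<psi> t (a0 - r)) \<le> a0 * (Q * exp (g / 2 * N * (t - t0)))" if t: "t \<in> {t0<..t0 + \<Delta>}" for t
    proof -
      have tI: "t \<in> ?I" using t by auto
      have p: "0 < a0 - r" using ra by simp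
      have "norm (\<psi> t (a0 - r) - \<psi> t 0) \<le> Q * exp (g / 2 * N * (t - t0)) * (a0 - r) - Q * exp (g / 2 * N * (t - t0)) * 0"
      proof (rule differentiable_bound_general[OF p, where f' = "u t" and \<phi>' = "\<lambda>_. Q * exp (g / 2 * N * (t - t0))"])
        have "continuous_on {0..} (\<psi> t)"
        proof -
          have "continuous_on {0..} (\<lambda>y. (t, y))" by (intro continuous_on_Pair continuous_on_const continuous_on_id)
          moreover have "(\<lambda>y. (t, y)) ` {0..} \<subseteq> ?I \<times> {0..}" using tI by blast
          ultimately show ?thesis using continuous_on_compose2[OF c\<psi>, of "{0..}" "\<lambda>y. (t, y)"] by simp
        qed
        then show "continuous_on {0..a0 - r} (\<psi> t)" by (rule continuous_on_subset) auto
        show "((\<lambda>y. Q * exp (g / 2 * N * (t - t0)) * y) has_vector_derivative Q * exp (g / 2 * N * (t - t0))) (at x)" for x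
          by (auto intro!: derivative_eq_intros simp: has_real_derivative_iff_has_vector_derivative[symmetric])
      qed (use \<psi>_y tI ub t in \<open>auto intro!: continuous_intros\<close>)
      also have "\<dots> \<le> a0 * (Q * exp (g / 2 * N * (t - t0)))" using r Q by (simp add: mult.commute mult_right_mono)
      finally show ?thesis using \<psi>0[OF tI] by simp
    qed
    have J': "(J has_vector_derivative (integral ?Y (\<lambda>y. u t y * (residual N r t y + ?k * X t y)) + ?k * (\<psi> t (a0 - r) * X t (a0 - r))))
        (at t within ?I)" if t: "t \<in> ?I" for t
    proof -
      have D: "(J has_vector_derivative integral ?Y (\<lambda>y. ut t y * test N r t y + u t y * test_t N r t y)) (at t within ?I)"
        unfolding J_def[abs_def]
      proof (rule leibniz_rule_vector_derivative[where a = "a0 - r" and b = "a0 + r", unfolded cbox_interval])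
        fix s y assume s: "s \<in> ?I" and y: "y \<in> ?Y"
        have "((\<lambda>t. u t y * test N r t y) has_vector_derivative u s y * test_t N r s y + ut s y * test N r s y) (at s within ?I)"
          by (intro has_vector_derivative_mult u_t has_vector_derivative_at_within[OF test_derivs(3)])
            (use s y Ypos tpos r in auto)
        then show "((\<lambda>t. u t y * test N r t y) has_vector_derivative ut s y * test N r s y + u s y * test_t N r s y) (at s within ?I)"
          by (simp add: add.commute)
      next
        show "(\<lambda>y. u s y * test N r s y) integrable_on ?Y" if "s \<in> ?I" for s
          by (intro integrable_continuous_interval continuous_intros sU sT that)
        show "continuous_on (?I \<times> ?Y) (\<lambda>(t, y). ut t y * test N r t y + u t y * test_t N r t y)"
          unfolding case_prod_beta' by (intro continuous_intros cU cT)
      qed (use t in auto)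
      have E1: "((\<lambda>y. uyy t y * test N r t y - u t y * test_yy N r t y) has_integral 0) ?Y"
      proof -
        have "((\<lambda>y. uyy t y * test N r t y - u t y * test_yy N r t y) has_integral
           ((uy t (a0 + r) * test N r t (a0 + r) - u t (a0 + r) * test_y N r t (a0 + r))
          - (uy t (a0 - r) * test N r t (a0 - r) - u t (a0 - r) * test_y N r t (a0 - r)))) ?Y"
        proof (rule fundamental_theorem_of_calculus)
          fix y assume y: "y \<in> ?Y"
          have "((\<lambda>y. uy t y * test N r t y - u t y * test_y N r t y) has_vector_derivative
             (uy t y * test_y N r t y + uyy t y * test N r t y) - (u t y * test_yy N r t y + uy t y * test_y N r t y)) (at y)"
            by (intro has_vector_derivative_diff has_vector_derivative_mult u_y u_yy test_derivs t Ypos[OF y] tpos[OF t] r)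
          then show "((\<lambda>y. uy t y * test N r t y - u t y * test_y N r t y) has_vector_derivative
             uyy t y * test N r t y - u t y * test_yy N r t y) (at y within ?Y)"
            by (simp add: has_vector_derivative_at_within)
        qed (use r in auto)
        then show ?thesis using test_boundary[OF r(1), of "a0 + r"] test_boundary[OF r(1), of "a0 - r"] r by simp
      qed
      \<comment> \<open>Integration by parts moves the primitive \<open>\<psi>\<close> back to
        \<open>u\<close>. The cutoff vanishes at both ends and \<open>X\<close> at the right one, so
        a boundary term remains at \<open>a0 - r\<close>.\<close>
      have E2: "((\<lambda>y. u t y * (cut r y * F N t y + X t y) - \<psi> t y * (\<sigma> 1 t y * test N r t y)) has_integral
          - (\<psi> t (a0 - r) * X t (a0 - r))) ?Y"
      proof -
        have "((\<lambda>y. u t y * (cut r y * F N t y + X t y) - \<psi> t y * (\<sigma> 1 t y * test N r t y)) has_integral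
           (\<psi> t (a0 + r) * (cut r (a0 + r) * F N t (a0 + r) + X t (a0 + r))
            - \<psi> t (a0 - r) * (cut r (a0 - r) * F N t (a0 - r) + X t (a0 - r)))) ?Y"
        proof (rule fundamental_theorem_of_calculus)
          fix y assume y: "y \<in> ?Y"
          have "((\<lambda>y. \<psi> t y * (cut r y * F N t y + X t y)) has_vector_derivative
             \<psi> t y * ((cut r y * (- of_real N * \<sigma> 1 t y * M t y * F N t y) + cut' r y * F N t y) + - (cut' r y * F N t y))
             + u t y * (cut r y * F N t y + X t y)) (at y within ?Y)"
            by (intro has_vector_derivative_mult has_vector_derivative_add XY t y
                has_vector_derivative_at_within[OF \<psi>_y] has_vector_derivative_at_within[OF F_y]
                has_vector_derivative_at_within[OF cut_y(1)] Ypos[OF y] tpos[OF t] r)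
          then show "((\<lambda>y. \<psi> t y * (cut r y * F N t y + X t y)) has_vector_derivative
             u t y * (cut r y * F N t y + X t y) - \<psi> t y * (\<sigma> 1 t y * test N r t y)) (at y within ?Y)"
            by (simp add: test_def algebra_simps)
        qed (use r in auto)
        moreover have "X t (a0 + r) = 0" by (simp add: X_def)
        ultimately show ?thesis using test_boundary(3)[OF r(1), of "a0 + r"] test_boundary(3)[OF r(1), of "a0 - r"] r
          by simp
      qed
      have E3: "((\<lambda>y. u t y * (residual N r t y + ?k * X t y)) has_integral integral ?Y (\<lambda>y. u t y * (residual N r t y + ?k * X t y))) ?Y"
        by (intro integrable_integral integrable_continuous_interval continuous_intros sU sT cX t)
      have "((\<lambda>y. u t y * (residual N r t y + ?k * X t y) + (uyy t y * test N r t y - u t y * test_yy N r t y)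
          - ?k * (u t y * (cut r y * F N t y + X t y) - \<psi> t y * (\<sigma> 1 t y * test N r t y))) has_integral
          integral ?Y (\<lambda>y. u t y * (residual N r t y + ?k * X t y)) + 0 - ?k * (- (\<psi> t (a0 - r) * X t (a0 - r)))) ?Y"
        by (intro has_integral_diff has_integral_add has_integral_mult_right E1 E2 E3)
      then have "((\<lambda>y. ut t y * test N r t y + u t y * test_t N r t y) has_integral
          integral ?Y (\<lambda>y. u t y * (residual N r t y + ?k * X t y)) + 0 - ?k * (- (\<psi> t (a0 - r) * X t (a0 - r)))) ?Y"
      proof (rule has_integral_eq[rotated])
        fix y assume y: "y \<in> ?Y"
        have ut: "ut t y = uyy t y - ?k * (\<sigma> 0 t y * u t y - \<sigma> 1 t y * \<psi> t y)"
          using eq[OF t Ypos[OF y]] by (simp add: algebra_simps)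
        show "u t y * (residual N r t y + ?k * X t y) + (uyy t y * test N r t y - u t y * test_yy N r t y)
          - ?k * (u t y * (cut r y * F N t y + X t y) - \<psi> t y * (\<sigma> 1 t y * test N r t y)) =
          ut t y * test N r t y + u t y * test_t N r t y"
          unfolding test_residual[symmetric] ut by (simp add: algebra_simps)
      qed
      then have "integral ?Y (\<lambda>y. ut t y * test N r t y + u t y * test_t N r t y) =
          integral ?Y (\<lambda>y. u t y * (residual N r t y + ?k * X t y)) + ?k * (\<psi> t (a0 - r) * X t (a0 - r))"
        by (simp add: integral_unique)
      with D show ?thesis by simp
    qed
    have kN: "norm ?k = N\<^sup>2" by (simp add: norm_mult norm_power)
    have J'b: "norm (integral ?Y (\<lambda>y. u t y * (residual N r t y + ?k * X t y)) + ?k * (\<psi> t (a0 - r) * X t (a0 - r)))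
       \<le> A * Q * sqrt N * exp (- (g / 4) * N * (t - t0))" if t: "t \<in> {t0<..t0 + \<Delta>}" for t
    proof -
      have tI: "t \<in> ?I" using t by auto
      define p where "p = N * (t - t0)"
      have p: "p \<ge> 0" using N t by (simp add: p_def)
      let ?U = "Q * exp (g / 2 * p)"
      have U: "norm (u t y) \<le> ?U" if "y > 0" for y using ub[OF t that] by (simp add: p_def mult.assoc)
      have U0: "?U \<ge> 0" using Q by simp
      have gp: "exp (- g * p) \<le> exp (- (3/4) * g * p)" using g p by simp
      have i1: "norm (integral ?Y (\<lambda>y. u t y * residual N r t y)) \<le> (?U * (C * N * exp (- (3/4) * g * p))) * (pi / sqrt N)"
      proof (rule norm_integral_lorentz[OF N r(1)])
        show "continuous_on ?Y (\<lambda>y. u t y * residual N r t y)" by (intro continuous_intros sU sT tI)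
        fix y assume y: "y \<in> ?Y"
        have "norm (residual N r t y) \<le> C * N * exp (- (3/4) * g * p) * (1 / (1 + N * (y - a0)\<^sup>2))"
          using B2[OF N _ tN(2)[OF tI] tN(1)[OF tI] Yr[OF y]] t by (simp add: lor p_def mult.assoc)
        from norm_mult_le[OF U[OF Ypos[OF y]] this]
        show "norm (u t y * residual N r t y) \<le> ?U * (C * N * exp (- (3/4) * g * p)) * (1 / (1 + N * (y - a0)\<^sup>2))"
          by (simp only: mult.assoc)
      qed (use U0 r N in auto)
      have kX: "norm (?k * X t y) \<le> C * pi * exp (- g * p)" if "y \<in> ?Y" for y
        using Xb[OF tI that] unfolding norm_mult[of ?k] kN by (simp add: p_def mult.assoc)
      have i2: "norm (integral ?Y (\<lambda>y. u t y * (?k * X t y))) \<le> (?U * (C * pi * exp (- g * p))) * ((a0 + r) - (a0 - r))"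
      proof (rule integral_bound)
        show "continuous_on ?Y (\<lambda>y. u t y * (?k * X t y))" by (intro continuous_intros sU cX tI)
        show "norm (u t y * (?k * X t y)) \<le> ?U * (C * pi * exp (- g * p))" if "y \<in> ?Y" for y
          by (intro norm_mult_le U kX Ypos that)
      qed (use r in auto)
      have i3: "norm (\<psi> t (a0 - r) * (?k * X t (a0 - r))) \<le> (a0 * ?U) * (C * pi * exp (- g * p))"
        using c\<psi>Y[OF t] r by (intro norm_mult_le kX) (auto simp: p_def mult.assoc)
      have s: "integral ?Y (\<lambda>y. u t y * (residual N r t y + ?k * X t y)) =
          integral ?Y (\<lambda>y. u t y * residual N r t y) + integral ?Y (\<lambda>y. u t y * (?k * X t y))"
        unfolding distrib_left
        by (intro Henstock_Kurzweil_Integration.integral_add integrable_continuous_interval continuous_intros sU sT cX tI)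
      have "norm (integral ?Y (\<lambda>y. u t y * (residual N r t y + ?k * X t y)) + \<psi> t (a0 - r) * (?k * X t (a0 - r)))
        \<le> (?U * (C * N * exp (- (3/4) * g * p))) * (pi / sqrt N) + (?U * (C * pi * exp (- g * p))) * ((a0 + r) - (a0 - r))
          + (a0 * ?U) * (C * pi * exp (- g * p))"
        unfolding s by (intro norm_add_le i1 i2 i3)
      also have "\<dots> = ?U * (C * pi) * (N / sqrt N * exp (- (3/4) * g * p) + (2 * r + a0) * exp (- g * p))"
        by (simp add: field_simps)
      also have "\<dots> \<le> ?U * (C * pi) * (sqrt N * exp (- (3/4) * g * p) + (2 * r + a0) * (sqrt N * exp (- (3/4) * g * p)))"
      proof -
        have "1 * exp (- g * p) \<le> sqrt N * exp (- (3/4) * g * p)" using gp N by (intro mult_mono) auto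
        then have h: "(2 * r + a0) * exp (- g * p) \<le> (2 * r + a0) * (sqrt N * exp (- (3/4) * g * p))"
          using r a0 by (intro mult_left_mono) auto
        have "0 \<le> ?U * (C * pi)" by (rule mult_nonneg_nonneg[OF U0]) (use r in auto)
        then show ?thesis unfolding sq by (rule mult_left_mono[OF add_left_mono[OF h]])
      qed
      also have "\<dots> = A * Q * sqrt N * (exp (g / 2 * p) * exp (- (3/4) * g * p))"
        by (simp add: A_def algebra_simps)
      also have "exp (g / 2 * p) * exp (- (3/4) * g * p) = exp (- (g / 4) * p)" by (simp add: field_simps flip: exp_add)
      finally show ?thesis by (simp add: p_def ac_simps)
    qed
    have JT: "norm (J (t0 + \<Delta>)) \<le> C * pi * Q * sqrt N * exp (- (g / 2) * N * \<Delta>)"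
    proof -
      let ?t = "t0 + \<Delta>"
      have tI: "?t \<in> ?I" "?t \<in> {t0<..t0 + \<Delta>}" using \<Delta> by auto
      have "norm (J ?t) \<le> (Q * exp (g / 2 * N * \<Delta>) * (C * N * exp (- g * N * \<Delta>))) * (pi / sqrt N)"
        unfolding J_def
      proof (rule norm_integral_lorentz[OF N r(1)])
        show "continuous_on ?Y (\<lambda>y. u ?t y * test N r ?t y)" by (intro continuous_intros sU sT tI)
        fix y assume y: "y \<in> ?Y"
        have "norm (test N r ?t y) \<le> 1 * (C * N / (1 + N * (y - a0)\<^sup>2) * exp (- g * N * \<Delta>))"
        proof -
          have e: "test N r ?t y = cut r y * (of_real N * M ?t y * F N ?t y)" by (simp add: test_def mult_ac)
          have z: "a0 + (y - a0) = y" by simp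
          have "norm (cut r y) \<le> 1" using quartic_cutoff_bounds(1,2)[OF r(1) Yr[OF y]] by simp
          from norm_mult_le[OF this B1[OF N less_imp_le[OF \<Delta>(1)] \<Delta>(2,3) Yr[OF y], unfolded z]]
          show ?thesis unfolding e .
        qed
        also have "\<dots> = C * N * exp (- g * N * \<Delta>) * (1 / (1 + N * (y - a0)\<^sup>2))" unfolding mult_1 by (rule lor)
        finally have "norm (test N r ?t y) \<le> C * N * exp (- g * N * \<Delta>) * (1 / (1 + N * (y - a0)\<^sup>2))" .
        from norm_mult_le[OF ub[OF tI(2) Ypos[OF y]] this]
        show "norm (u ?t y * test N r ?t y) \<le> Q * exp (g / 2 * N * \<Delta>) * (C * N * exp (- g * N * \<Delta>)) * (1 / (1 + N * (y - a0)\<^sup>2))"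
          by (simp only: mult.assoc add_diff_cancel_left')
      qed (use Q r N in auto)
      also have "\<dots> = C * pi * Q * (N / sqrt N) * (exp (g / 2 * N * \<Delta>) * exp (- g * N * \<Delta>))" by simp
      also have "exp (g / 2 * N * \<Delta>) * exp (- g * N * \<Delta>) = exp (- (g / 2) * N * \<Delta>)" by (simp add: field_simps flip: exp_add)
      finally show ?thesis unfolding sq .
    qed
    have JD: "norm (J (t0 + \<Delta>) - J t0) \<le> 4 * A * Q / (g * sqrt N)"
    proof -
      \<comment> \<open>A primitive of the bound for the derivative. It is never positive, so its
        increment is at most \<open>- f t0\<close>.\<close>
      define f where "f t = - (4 * A * Q / (g * sqrt N)) * exp (- (g / 4) * N * (t - t0))" for t
      have "norm (J (t0 + \<Delta>) - J t0) \<le> f (t0 + \<Delta>) - f t0"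
      proof (rule differentiable_bound_general[where
          f' = "\<lambda>t. integral ?Y (\<lambda>y. u t y * (residual N r t y + ?k * X t y)) + ?k * (\<psi> t (a0 - r) * X t (a0 - r))"
          and \<phi>' = "\<lambda>t. A * Q * sqrt N * exp (- (g / 4) * N * (t - t0))"])
        show "continuous_on ?I J"
          by (meson J' continuous_on_eq_continuous_within has_vector_derivative_continuous)
        show "continuous_on ?I f" unfolding f_def by (intro continuous_intros)
        fix t assume t: "t0 < t" "t < t0 + \<Delta>"
        have "at t within ?I = at t" using t by (intro at_within_interior) auto
        then show "(J has_vector_derivative (integral ?Y (\<lambda>y. u t y * (residual N r t y + ?k * X t y)) + ?k * (\<psi> t (a0 - r) * X t (a0 - r)))) (at t)"
          using J'[of t] t by auto
        show "norm (integral ?Y (\<lambda>y. u t y * (residual N r t y + ?k * X t y)) + ?k * (\<psi> t (a0 - r) * X t (a0 - r)))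
           \<le> A * Q * sqrt N * exp (- (g / 4) * N * (t - t0))" using t by (intro J'b) auto
        have "(f has_real_derivative - (4 * A * Q / (g * sqrt N)) * (exp (- (g / 4) * N * (t - t0)) * (- (g / 4) * N))) (at t)"
          unfolding f_def[abs_def] by (rule DERIV_cmult) (auto intro!: derivative_eq_intros)
        moreover have "- (4 * A * Q / (g * sqrt N)) * (exp (- (g / 4) * N * (t - t0)) * (- (g / 4) * N)) =
            A * Q * (N / sqrt N) * exp (- (g / 4) * N * (t - t0))"
        proof -
          have "- (4 * A * Q / (g * w)) * (e * (- (g / 4) * N)) = A * Q * (N / w) * e" if "w > 0" for w e
            using g that by (simp add: field_simps)
          from this[OF sq(3)] show ?thesis .
        qed
        ultimately show "(f has_vector_derivative A * Q * sqrt N * exp (- (g / 4) * N * (t - t0))) (at t)"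
          unfolding sq by (simp add: has_real_derivative_iff_has_vector_derivative)
      qed (use \<Delta> in auto)
      also have "\<dots> \<le> 4 * A * Q / (g * sqrt N)"
        using A Q g N by (simp add: f_def)
      finally show ?thesis .
    qed
    have J0: "b0 * c2 * sqrt N \<le> norm (J t0)"
    proof -
      \<comment> \<open>Half the width on which the integrand is bounded below:
        \<open>1 / sqrt N\<close> keeps \<open>N * \<eta>\<^sup>2 \<le> 1\<close>, and
        \<open>r / 2\<close> keeps both the quartic cutoff and \<open>b\<close> away from 0.\<close>
      define m where "m = min (r / 2) (1 / sqrt N)"
      have m: "m > 0" "m \<le> r / 2" "m \<le> 1 / sqrt N" using r sq by (auto simp: m_def)
      have Nm: "min (r / 2) 1 * sqrt N \<le> N * m"
      proof -
        have sqN: "sqrt N \<le> N"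
          using real_sqrt_le_mono[of N "N\<^sup>2"] N by (simp add: power2_eq_square)
        have 1: "N * (r / 2) \<ge> sqrt N * (r / 2)" using sqN r by (intro mult_right_mono) auto
        have 2: "N * (1 / sqrt N) = sqrt N" using sq by simp
        have "min (r / 2) 1 * sqrt N \<le> N * (r / 2)" by (rule order_trans[OF mult_right_mono[OF min.cobounded1] 1[unfolded mult.commute[of "sqrt N"]]]) (use sq in auto)
        moreover have "min (r / 2) 1 * sqrt N \<le> N * (1 / sqrt N)" unfolding 2
          using mult_right_mono[OF min.cobounded2[of "r / 2" 1], of "sqrt N"] sq by simp
        ultimately show ?thesis unfolding m_def by (auto simp: min_def)
      qed
      have t0I: "t0 \<in> ?I" using \<Delta> by simp
      \<comment> \<open>The datum contains the complex conjugate of \<open>M * F\<close>, so the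
        initial pairing is the integral of a non-negative function and nothing can cancel.\<close>
      define f where "f y = N * quartic_cutoff r (y - a0) * b y * (norm (M t0 y * F N t0 y))\<^sup>2" for y
      have fe: "u t0 y * test N r t0 y = of_real (f y)" if "y \<in> ?Y" for y
      proof -
        have "u t0 y * test N r t0 y = of_real N * cut r y * of_real (b y) * ((M t0 y * F N t0 y) * cnj (M t0 y * F N t0 y))"
          unfolding init[OF Yr[OF that]] test_def by (simp only: mult_ac)
        then show ?thesis unfolding complex_norm_square[symmetric] f_def by simp
      qed
      have fi: "f integrable_on ?Y"
      proof -
        have "(\<lambda>y. Re (u t0 y * test N r t0 y)) integrable_on ?Y"
          by (intro integrable_continuous_interval continuous_intros sU sT t0I)
        then show ?thesis by (rule integrable_eq) (simp add: fe)
      qed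
      have "J t0 = integral ?Y (\<lambda>y. of_real (f y))"
        unfolding J_def by (rule Henstock_Kurzweil_Integration.integral_cong) (rule fe)
      also have "\<dots> = of_real (integral ?Y f)"
        using integral_linear[OF fi bounded_linear_of_real] by (simp add: o_def)
      finally have "norm (J t0) \<ge> integral ?Y f" by simp
      have sub: "{a0 - m..a0 + m} \<subseteq> ?Y" using m r by auto
      have "integral {a0 - m..a0 + m} (\<lambda>_. N * (1/2) * b0 * c\<^sup>2) \<le> integral {a0 - m..a0 + m} f"
      proof (rule integral_le)
        show "f integrable_on {a0 - m..a0 + m}" by (rule integrable_on_subinterval[OF fi sub])
        fix y assume y: "y \<in> {a0 - m..a0 + m}"
        have ya: "\<bar>y - a0\<bar> \<le> m" using y by auto
        have "\<bar>y - a0\<bar>\<^sup>2 \<le> (1 / sqrt N)\<^sup>2" using ya m by (intro power_mono) auto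
        then have q: "N * (y - a0)\<^sup>2 \<le> 1" using N by (simp add: power_divide field_simps)
        have yr: "\<bar>y - a0\<bar> \<le> r / 2" "\<bar>y - a0\<bar> \<le> r" using ya m r by auto
        have "c \<le> norm (M t0 y * F N t0 y)" using B5[OF N yr(2) q] by simp
        then have "c\<^sup>2 \<le> (norm (M t0 y * F N t0 y))\<^sup>2" using r by (intro power_mono) auto
        then show "N * (1/2) * b0 * c\<^sup>2 \<le> f y" unfolding f_def
          using b(2)[OF yr(1)] quartic_cutoff_bounds(5)[OF r(1) yr(2) yr(1)] N b0
          by (intro mult_mono mult_nonneg_nonneg) auto
      qed auto
      also have "\<dots> \<le> integral ?Y f"
        by (intro integral_subset_le sub fi integrable_on_subinterval[OF fi sub])
          (use N b quartic_cutoff_bounds(1)[OF r(1) Yr] in \<open>auto simp: f_def intro!: mult_nonneg_nonneg\<close>)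
      finally have "N * (1/2) * b0 * c\<^sup>2 * (2 * m) \<le> norm (J t0)" using \<open>norm (J t0) \<ge> integral ?Y f\<close> m by (simp add: mult_ac)
      moreover have "b0 * c2 * sqrt N \<le> N * (1/2) * b0 * c\<^sup>2 * (2 * m)"
      proof -
        have "b0 * c2 * sqrt N = (b0 * c\<^sup>2 / 2) * (min (r / 2) 1 * sqrt N)" by (simp add: c2_def)
        also have "\<dots> \<le> (b0 * c\<^sup>2 / 2) * (N * m)" using b0 by (intro mult_left_mono Nm) auto
        also have "\<dots> \<le> (b0 * c\<^sup>2) * (N * m)" using b0 N m by (intro mult_right_mono) auto
        finally show ?thesis by (simp add: mult_ac)
      qed
      ultimately show ?thesis by linarith
    qed
    have "b0 * c2 * sqrt N \<le> 4 * A * Q / (g * sqrt N) + C * pi * Q * sqrt N * exp (- (g / 2) * N * \<Delta>)"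
      using J0 JT JD norm_triangle_ineq2[of "J t0" "J (t0 + \<Delta>)"] by (simp add: norm_minus_commute)
    also have "\<dots> = Q * sqrt N * (4 * A / g * (1 / N) + C * pi * exp (- (g / 2) * N * \<Delta>))"
    proof -
      have "1 / sqrt N = sqrt N * (1 / N)" using sq N by (simp add: field_simps)
      moreover have "4 * A * Q / (g * sqrt N) = 4 * A * Q / g * (1 / sqrt N)" by simp
      ultimately have "4 * A * Q / (g * sqrt N) = 4 * A * Q / g * (sqrt N * (1 / N))" by (simp only:)
      then show ?thesis by (simp add: algebra_simps)
    qed
    finally have "b0 * c2 \<le> Q * (4 * A / g * (1 / N) + C * pi * exp (- (g / 2) * N * \<Delta>))"
      using sq(3) by (simp add: mult.assoc mult.left_commute[of _ "sqrt N"])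
    then have "b0 \<le> Q * (4 * A / g / c2 * (1 / N) + C * pi / c2 * exp (- (g / 2) * N * \<Delta>))"
      using c2 by (simp add: field_simps)
    also have "\<dots> \<le> Q * (C' * (1 / N) + C' * exp (- (g / 2) * N * \<Delta>))"
      using C' Q N by (intro mult_left_mono add_mono mult_right_mono) auto
    also have "\<dots> = C' * Q * (exp (- (g / 2) * N * \<Delta>) + 1 / N)" by (simp add: algebra_simps)
    finally show "b0 \<le> C' * Q * (exp (- (g / 2) * N * \<Delta>) + 1 / N)" .
  qed (use r ra C' in auto)
qed

end

section \<open>Smooth cutoffs and test functions\<close>

text \<open>Iterated differentiability by recursion on some derivative, so that closure under
  products, exponentials and gluing follows by induction without formulas for higher
  derivatives.\<close>

fun Ck :: "real set \<Rightarrow> nat \<Rightarrow> (real \<Rightarrow> 'a::real_normed_vector) \<Rightarrow> bool" where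
  "Ck A 0 f = True"
| "Ck A (Suc n) f = (\<exists>f'. (\<forall>y\<in>A. (f has_vector_derivative f' y) (at y)) \<and> Ck A n f')"

lemma Ck_SucI: "(\<And>y. y \<in> A \<Longrightarrow> (f has_vector_derivative f' y) (at y)) \<Longrightarrow> Ck A n f' \<Longrightarrow> Ck A (Suc n) f"
  by auto

lemma Ck_SucE:
  assumes "Ck A (Suc n) f"
  obtains f' where "\<And>y. y \<in> A \<Longrightarrow> (f has_vector_derivative f' y) (at y)" "Ck A n f'"
  using assms unfolding Ck.simps by blast

lemma Ck_Suc_imp: "Ck A (Suc n) f \<Longrightarrow> Ck A n f"
proof (induction n arbitrary: f)
  case (Suc n)
  from Suc.prems obtain f' where "\<And>y. y \<in> A \<Longrightarrow> (f has_vector_derivative f' y) (at y)" "Ck A (Suc n) f'"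
    by (metis Ck_SucE)
  with Suc.IH show ?case by (intro Ck_SucI[of _ _ f'])
qed simp

lemma Ck_subset: "Ck A n f \<Longrightarrow> B \<subseteq> A \<Longrightarrow> Ck B n f"
proof (induction n arbitrary: f)
  case (Suc n)
  from Suc.prems(1) obtain f' where "\<And>y. y \<in> A \<Longrightarrow> (f has_vector_derivative f' y) (at y)" "Ck A n f'"
    by (metis Ck_SucE)
  with Suc show ?case by (intro Ck_SucI[of _ _ f']) auto
qed simp

lemma Ck_cong:
  assumes "open A" "\<And>y. y \<in> A \<Longrightarrow> f y = g y" "Ck A n f"
  shows "Ck A n g"
proof (cases n)
  case (Suc m)
  with assms(3) obtain f' where f': "\<And>y. y \<in> A \<Longrightarrow> (f has_vector_derivative f' y) (at y)" "Ck A m f'"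
    by (metis Ck_SucE)
  have "(g has_vector_derivative f' y) (at y)" if "y \<in> A" for y
    by (rule has_vector_derivative_transform_within_open[OF f'(1)[OF that] assms(1) that]) (rule assms(2))
  with f'(2) show ?thesis unfolding Suc by (intro Ck_SucI)
qed simp

lemma Ck_const: "Ck A n (\<lambda>_. c)"
proof (induction n arbitrary: c)
  case (Suc n)
  show ?case by (rule Ck_SucI[OF _ Suc[of 0]]) simp
qed simp

lemma Ck_add: "Ck A n f \<Longrightarrow> Ck A n g \<Longrightarrow> Ck A n (\<lambda>y. f y + g y)"
proof (induction n arbitrary: f g)
  case (Suc n)
  from Suc.prems obtain f' g' where
    "\<And>y. y \<in> A \<Longrightarrow> (f has_vector_derivative f' y) (at y)" "Ck A n f'"
    "\<And>y. y \<in> A \<Longrightarrow> (g has_vector_derivative g' y) (at y)" "Ck A n g'" by (metis Ck_SucE)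
  with Suc.IH show ?case
    by (intro Ck_SucI[of _ _ "\<lambda>y. f' y + g' y"] has_vector_derivative_add) auto
qed simp

lemma Ck_linear:
  assumes "bounded_linear h"
  shows "Ck A n f \<Longrightarrow> Ck A n (\<lambda>y. h (f y))"
proof (induction n arbitrary: f)
  case (Suc n)
  from Suc.prems obtain f' where
    "\<And>y. y \<in> A \<Longrightarrow> (f has_vector_derivative f' y) (at y)" "Ck A n f'" by (metis Ck_SucE)
  with Suc.IH show ?case
    by (intro Ck_SucI[of _ _ "\<lambda>y. h (f' y)"] bounded_linear.has_vector_derivative[OF assms]) auto
qed simp

lemma Ck_mult: "Ck A n f \<Longrightarrow> Ck A n g \<Longrightarrow> Ck A n (\<lambda>y. f y * g y :: 'a::real_normed_algebra)"
proof (induction n arbitrary: f g)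
  case (Suc n)
  from Suc.prems obtain f' g' where
    "\<And>y. y \<in> A \<Longrightarrow> (f has_vector_derivative f' y) (at y)" "Ck A n f'"
    "\<And>y. y \<in> A \<Longrightarrow> (g has_vector_derivative g' y) (at y)" "Ck A n g'" by (metis Ck_SucE)
  with Suc.IH show ?case
    using Suc.prems[THEN Ck_Suc_imp]
    by (intro Ck_SucI[of _ _ "\<lambda>y. f y * g' y + f' y * g y"] has_vector_derivative_mult Ck_add) auto
qed simp

lemma Ck_exp: "Ck A n f \<Longrightarrow> Ck A n (\<lambda>y. exp (f y :: complex))"
proof (induction n arbitrary: f)
  case (Suc n)
  from Suc.prems obtain f' where f':
    "\<And>y. y \<in> A \<Longrightarrow> (f has_vector_derivative f' y) (at y)" "Ck A n f'" by (metis Ck_SucE)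
  have "((\<lambda>y. exp (f y)) has_vector_derivative f' y * exp (f y)) (at y)" if "y \<in> A" for y
    using field_vector_diff_chain_within[OF f'(1)[OF that], of exp "exp (f y)"]
    by (simp add: o_def DERIV_exp has_field_derivative_at_within)
  moreover have "Ck A n (\<lambda>y. f' y * exp (f y))"
    by (intro Ck_mult f' Suc.IH Ck_Suc_imp[OF Suc.prems])
  ultimately show ?case by (rule Ck_SucI)
qed simp

lemma Ck_glue:
  assumes "open A" "open B"
  shows "Ck A n f \<Longrightarrow> Ck B n f \<Longrightarrow> Ck (A \<union> B) n f"
proof (induction n arbitrary: f)
  case (Suc n)
  from Suc.prems obtain f' g' where *:
    "\<And>y. y \<in> A \<Longrightarrow> (f has_vector_derivative f' y) (at y)" "Ck A n f'"
    "\<And>y. y \<in> B \<Longrightarrow> (f has_vector_derivative g' y) (at y)" "Ck B n g'" by (metis Ck_SucE)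
  define h where "h y = (if y \<in> A then f' y else g' y)" for y
  have h: "h y = g' y" if "y \<in> B" for y
    using * that vector_derivative_unique_at by (fastforce simp: h_def)
  have "Ck A n h" by (rule Ck_cong[OF assms(1) _ *(2)]) (simp add: h_def)
  moreover have "Ck B n h" by (rule Ck_cong[OF assms(2) _ *(4)]) (simp add: h)
  ultimately have "Ck (A \<union> B) n h" by (rule Suc.IH)
  then show ?case by (rule Ck_SucI[rotated]) (use * h in \<open>auto simp: h_def\<close>)
qed simp

lemma Ck_affine: "Ck UNIV n f \<Longrightarrow> Ck UNIV n (\<lambda>y. f (c * y + d))"
proof (induction n arbitrary: f)
  case (Suc n)
  from Suc.prems obtain f' where f':
    "\<And>y. (f has_vector_derivative f' y) (at y)" "Ck UNIV n f'" by (metis Ck_SucE UNIV_I)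
  have "((\<lambda>y. f (c * y + d)) has_vector_derivative c *\<^sub>R f' (c * y + d)) (at y)" for y
  proof -
    have "((\<lambda>y. c * y + d) has_real_derivative c) (at y)" by (auto intro!: derivative_eq_intros)
    then have "((\<lambda>y. c * y + d) has_vector_derivative c) (at y)"
      by (simp only: has_real_derivative_iff_has_vector_derivative)
    from vector_diff_chain_at[OF this f'(1)] show ?thesis by (simp add: o_def)
  qed
  moreover have "Ck UNIV n (\<lambda>y. c *\<^sub>R f' (c * y + d))"
    by (intro Ck_linear[OF bounded_linear_scaleR_right] Suc.IH f')
  ultimately show ?case by (intro Ck_SucI)
qed simp

lemma Ck_sequence:
  "Ck A n f \<Longrightarrow> \<exists>D. D 0 = f \<and> (\<forall>j<n. \<forall>y\<in>A. (D j has_vector_derivative D (Suc j) y) (at y))"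
proof (induction n arbitrary: f)
  case (Suc n)
  from Suc.prems obtain f' where f':
    "\<And>y. y \<in> A \<Longrightarrow> (f has_vector_derivative f' y) (at y)" "Ck A n f'" by (metis Ck_SucE)
  from Suc.IH[OF f'(2)] obtain D where
    "D 0 = f'" "\<And>j y. j < n \<Longrightarrow> y \<in> A \<Longrightarrow> (D j has_vector_derivative D (Suc j) y) (at y)" by blast
  then show ?case using f' by (intro exI[of _ "\<lambda>j. case j of 0 \<Rightarrow> f | Suc i \<Rightarrow> D i"]) (auto split: nat.splits)
qed auto

lemma Ck_from_sequence:
  "(\<And>j y. y \<in> A \<Longrightarrow> (D j has_vector_derivative D (Suc j) y) (at y)) \<Longrightarrow> Ck A n (D j)"
  by (induction n arbitrary: j) (auto simp del: Ck.simps(2) intro: Ck_SucI)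

lemma higher_deriv_differentiable: "Ck UNIV (Suc n) f \<Longrightarrow> (deriv ^^ n) f differentiable_on UNIV"
  for f :: "real \<Rightarrow> real"
proof (induction n arbitrary: f)
  case 0
  then show ?case
    by (auto simp: differentiable_on_def has_vector_derivative_def differentiable_def dest: has_derivative_at_withinI)
next
  case (Suc n)
  from Suc.prems obtain f' where f': "\<And>y. (f has_vector_derivative f' y) (at y)" "Ck UNIV (Suc n) f'"
    by (metis Ck_SucE UNIV_I)
  have "deriv f = f'"
    using f'(1) by (auto simp: has_real_derivative_iff_has_vector_derivative[symmetric] intro!: DERIV_imp_deriv)
  then show ?case using Suc.IH[OF f'(2)] by (simp add: funpow_swap1)
qed

text \<open>The index makes the span of the family closed under differentiation; index 0 is the
  standard smooth function that is flat at the origin.\<close>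

definition exp_recip :: "nat \<Rightarrow> real \<Rightarrow> real" where
  "exp_recip n x = (if x > 0 then exp (- 1 / x) / x ^ n else 0)"

lemma exp_recip_tendsto: "(exp_recip n \<longlongrightarrow> 0) (at 0)"
proof -
  have "((\<lambda>x. inverse x ^ n / exp (inverse x)) \<longlongrightarrow> 0) (at_right (0::real))"
    by (rule filterlim_compose[OF tendsto_power_div_exp_0 filterlim_inverse_at_top_right])
  then have "(exp_recip n \<longlongrightarrow> 0) (at_right 0)"
    by (rule Lim_transform_eventually)
      (auto simp: eventually_at_filter exp_recip_def exp_minus field_simps intro!: always_eventually)
  moreover have "(exp_recip n \<longlongrightarrow> 0) (at_left 0)"
    by (rule tendsto_eventually) (auto simp: eventually_at_filter exp_recip_def)
  ultimately show ?thesis by (simp add: filterlim_at_split)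
qed

lemma exp_recip_has_derivative:
  "(exp_recip n has_vector_derivative exp_recip (Suc (Suc n)) x - real n * exp_recip (Suc n) x) (at x)"
proof -
  consider "x > 0" | "x < 0" | "x = 0" by linarith
  then show ?thesis
  proof cases
    case 1
    have "((\<lambda>x. exp (- 1 / x) / x ^ n) has_real_derivative exp_recip (Suc (Suc n)) x - real n * exp_recip (Suc n) x) (at x)"
    proof -
      have "((\<lambda>x. exp (- 1 / x) / x ^ n) has_real_derivative
          (exp (- 1 / x) * (1 / x\<^sup>2) * x ^ n - exp (- 1 / x) * (real n * x ^ (n - 1))) / (x ^ n * x ^ n)) (at x)"
        using 1 by (auto intro!: derivative_eq_intros simp: power2_eq_square)
      moreover have "(exp (- 1 / x) * (1 / x\<^sup>2) * x ^ n - exp (- 1 / x) * (real n * x ^ (n - 1))) / (x ^ n * x ^ n) =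
          exp_recip (Suc (Suc n)) x - real n * exp_recip (Suc n) x"
        using 1 by (cases n) (auto simp: exp_recip_def field_simps power2_eq_square)
      ultimately show ?thesis by simp
    qed
    then have "((\<lambda>x. exp (- 1 / x) / x ^ n) has_vector_derivative exp_recip (Suc (Suc n)) x - real n * exp_recip (Suc n) x) (at x)"
      by (simp add: has_real_derivative_iff_has_vector_derivative)
    then show ?thesis
      by (rule has_vector_derivative_transform_within_open[where S = "{0<..}"]) (use 1 in \<open>auto simp: exp_recip_def\<close>)
  next
    case 2
    have "((\<lambda>_. 0) has_vector_derivative exp_recip (Suc (Suc n)) x - real n * exp_recip (Suc n) x) (at x)"
      using 2 by (simp add: exp_recip_def)
    then show ?thesis
      by (rule has_vector_derivative_transform_within_open[where S = "{..<0}"]) (use 2 in \<open>auto simp: exp_recip_def\<close>)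
  next
    case 3
    \<comment> \<open>The difference quotient at 0 is the next member
      \<open>exp_recip (Suc n)\<close>, on both sides.\<close>
    have "((\<lambda>h. (exp_recip n (0 + h) - exp_recip n 0) / h) \<longlongrightarrow> 0) (at 0)"
      by (rule Lim_transform_eventually[OF exp_recip_tendsto[of "Suc n"]])
        (auto simp: exp_recip_def eventually_at_filter)
    then have "(exp_recip n has_real_derivative 0) (at 0)" by (simp add: DERIV_def)
    then show ?thesis using 3 by (simp add: has_real_derivative_iff_has_vector_derivative exp_recip_def)
  qed
qed

lemma Ck_exp_recip: "Ck UNIV k (exp_recip n)"
proof (induction k arbitrary: n)
  case (Suc k)
  have "Ck UNIV k (\<lambda>x. exp_recip (Suc (Suc n)) x + (- real n) * exp_recip (Suc n) x)"
    by (intro Ck_add Ck_mult Ck_const Suc.IH)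
  then show ?case by (intro Ck_SucI[OF exp_recip_has_derivative]) simp
qed simp

definition bump :: "real \<Rightarrow> real \<Rightarrow> real \<Rightarrow> real" where
  "bump a b x = exp_recip 0 (x - a) * exp_recip 0 (b - x)"

lemma Ck_bump: "Ck UNIV k (bump a b)"
  using Ck_mult[OF Ck_affine[OF Ck_exp_recip[of k 0], of 1 "-a"] Ck_affine[OF Ck_exp_recip[of k 0], of "-1" b]]
  by (simp add: bump_def[abs_def])

lemma bump_eq_0: "x \<notin> {a<..<b} \<Longrightarrow> bump a b x = 0"
  by (auto simp: bump_def exp_recip_def)

lemma bump_pos: "x \<in> {a<..<b} \<Longrightarrow> bump a b x > 0"
  by (auto simp: bump_def exp_recip_def)

lemma bump_nonneg: "bump a b x \<ge> 0"
  by (auto simp: bump_def exp_recip_def)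

lemma test_function_bump: "0 < a \<Longrightarrow> test_function (bump a b)"
  unfolding test_function_def using higher_deriv_differentiable[OF Ck_bump, of _ a b]
  by (metis bump_eq_0 greaterThanLessThan_subseteq_atLeastAtMost_iff order.refl subsetD)

section \<open>Test functions and weak derivatives on the half-line\<close>

lemma space_halfline: "space halfline = {0<..}"
  by (simp add: halfline_def space_restrict_space)

lemma halfline_integral:
  fixes f :: "real \<Rightarrow> real"
  shows "(LINT y|halfline. f y) = (LINT y|lborel. indicator {0<..} y * f y)"
  unfolding halfline_def by (subst integral_restrict_space) auto

lemma halfline_integrable:
  fixes f :: "real \<Rightarrow> real"
  assumes "0 < a" "\<And>y. y \<notin> {a..b} \<Longrightarrow> f y = 0" "continuous_on {0<..} f"
  shows "integrable halfline f"
proof -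
  have sub: "{a..b} \<subseteq> {0<..}" using assms(1) by auto
  have "integrable lborel (\<lambda>y. indicator {a..b} y *\<^sub>R f y)"
    using borel_integrable_compact[of "{a..b}" f] continuous_on_subset[OF assms(3) sub]
    by (auto simp: indicator_def if_distrib if_distribR cong: if_cong)
  moreover have "(\<lambda>y. indicator {a..b} y *\<^sub>R f y) = (\<lambda>y. indicator {0<..} y *\<^sub>R f y)"
  proof
    fix y show "indicator {a..b} y *\<^sub>R f y = indicator {0<..} y *\<^sub>R f y"
      using assms(1) assms(2)[of y] by (cases "y \<in> {a..b}") auto
  qed
  ultimately have "integrable lborel (\<lambda>y. indicator {0<..} y *\<^sub>R f y)" by (simp only:)
  then show ?thesis unfolding halfline_def by (subst integrable_restrict_space) (auto simp: set_integrable_def)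
qed

lemma test_function_deriv:
  assumes "test_function \<phi>"
  shows "test_function (deriv \<phi>)" "(\<phi> has_real_derivative deriv \<phi> y) (at y)"
proof -
  have d: "(deriv ^^ n) \<phi> differentiable_on UNIV" for n using assms by (simp add: test_function_def)
  from d[of 0] show D: "(\<phi> has_real_derivative deriv \<phi> y) (at y)" for y
    by (simp add: differentiable_on_eq_differentiable_at DERIV_deriv_iff_real_differentiable)
  obtain a b where ab: "0 < a" "\<And>y. y \<notin> {a..b} \<Longrightarrow> \<phi> y = 0" using assms by (auto simp: test_function_def)
  have "deriv \<phi> y = 0" if "y \<notin> {a..b}" for y
  proof -
    have "(\<phi> has_real_derivative 0) (at y)"
      by (rule has_field_derivative_transform_within_open[of "\<lambda>_. 0" _ _ "- {a..b}"]) (use that ab in auto)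
    then show ?thesis by (rule DERIV_imp_deriv)
  qed
  moreover have "(deriv ^^ n) (deriv \<phi>) differentiable_on UNIV" for n
    using d[of "Suc n"] by (simp only: funpow_Suc_right o_def)
  ultimately show "test_function (deriv \<phi>)" using ab(1) unfolding test_function_def by blast
qed

lemma test_function_funpow: "test_function \<phi> \<Longrightarrow> test_function ((deriv ^^ n) \<phi>)"
  by (induction n) (auto intro: test_function_deriv)

lemma test_function_continuous: "test_function \<phi> \<Longrightarrow> continuous_on A \<phi>"
  by (meson DERIV_isCont continuous_at_imp_continuous_on test_function_deriv(2))

lemma test_function_integrable:
  fixes f :: "real \<Rightarrow> real"
  assumes "test_function \<phi>" "continuous_on {0<..} f"
  shows "integrable halfline (\<lambda>y. \<phi> y * f y)"
proof -
  obtain a b where ab: "0 < a" "\<And>y. y \<notin> {a..b} \<Longrightarrow> \<phi> y = 0" using assms by (auto simp: test_function_def)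
  show ?thesis
    by (rule halfline_integrable[OF ab(1), of b])
      (use ab in \<open>auto intro!: continuous_on_mult assms(2) test_function_continuous[OF assms(1)]\<close>)
qed

lemma test_function_integration_by_parts:
  fixes f :: "real \<Rightarrow> real"
  assumes \<phi>: "test_function \<phi>" and f: "\<And>y. y > 0 \<Longrightarrow> (f has_real_derivative f' y) (at y)" "continuous_on {0<..} f'"
  shows "(LINT y|halfline. deriv \<phi> y * f y) = - (LINT y|halfline. \<phi> y * f' y)"
proof -
  obtain a' b' where ab': "0 < a'" "\<And>y. y \<notin> {a'..b'} \<Longrightarrow> \<phi> y = 0" using \<phi> by (auto simp: test_function_def)
  obtain a2 b2 where ab2: "0 < a2" "\<And>y. y \<notin> {a2..b2} \<Longrightarrow> deriv \<phi> y = 0"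
    using test_function_deriv(1)[OF \<phi>] by (auto simp: test_function_def)
  \<comment> \<open>The new interval contains the supports of \<open>\<phi>\<close> and of its
    derivative in its interior, so the boundary terms vanish.\<close>
  define a where "a = min a' a2 / 2"
  define b where "b = max a (max b' b2) + 1"
  have ab: "0 < a" "a \<le> b" using ab' ab2 by (auto simp: a_def b_def)
  have "y \<notin> {a'..b'}" "y \<notin> {a2..b2}" if "y \<notin> {a<..<b}" for y
    using that ab' ab2 by (auto simp: a_def b_def)
  then have ab3: "\<phi> y = 0" "deriv \<phi> y = 0" if "y \<notin> {a<..<b}" for y
    using that ab'(2) ab2(2) by blast+
  have cf: "continuous_on {0<..} f" by (meson DERIV_isCont continuous_at_imp_continuous_on f(1) greaterThan_iff)
  have sub: "{a..b} \<subseteq> {0<..}" using ab by auto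
  have "has_bochner_integral lborel (\<lambda>y. (deriv \<phi> y * f y + \<phi> y * f' y) * indicator {a..b} y) (\<phi> b * f b - \<phi> a * f a)"
  proof (rule has_bochner_integral_FTC_Icc_real)
    show "((\<lambda>y. \<phi> y * f y) has_real_derivative deriv \<phi> y * f y + \<phi> y * f' y) (at y)" if "a \<le> y" for y
      using DERIV_mult[OF test_function_deriv(2)[OF \<phi>] f(1), of y] that ab by (simp add: add.commute mult.commute)
    show "isCont (\<lambda>y. deriv \<phi> y * f y + \<phi> y * f' y) y" if "a \<le> y" for y
    proof -
      have "continuous_on {0<..} (\<lambda>y. deriv \<phi> y * f y + \<phi> y * f' y)"
        by (intro continuous_intros cf f(2) test_function_continuous \<phi> test_function_deriv)
      then show ?thesis using that ab by (simp add: continuous_on_eq_continuous_at)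
    qed
  qed (use ab in auto)
  moreover have "(\<lambda>y. (deriv \<phi> y * f y + \<phi> y * f' y) * indicator {a..b} y) = (\<lambda>y. indicator {0<..} y * (deriv \<phi> y * f y + \<phi> y * f' y))"
  proof
    fix y show "(deriv \<phi> y * f y + \<phi> y * f' y) * indicator {a..b} y = indicator {0<..} y * (deriv \<phi> y * f y + \<phi> y * f' y)"
      using ab ab3[of y] by (cases "y \<in> {a..b}") auto
  qed
  ultimately have "(LINT y|lborel. indicator {0<..} y * (deriv \<phi> y * f y + \<phi> y * f' y)) = 0"
    using ab3(1)[of a] ab3(1)[of b] by (simp add: has_bochner_integral_iff)
  then have "(LINT y|halfline. deriv \<phi> y * f y + \<phi> y * f' y) = 0" by (simp add: halfline_integral)
  then show ?thesis
    by (subst (asm) Bochner_Integration.integral_add)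
      (auto intro!: test_function_integrable \<phi> test_function_deriv cf f(2))
qed

lemma test_function_iterated_parts:
  fixes f :: "nat \<Rightarrow> real \<Rightarrow> real"
  assumes "\<And>j y. y > 0 \<Longrightarrow> (f j has_real_derivative f (Suc j) y) (at y)"
  shows "test_function \<phi> \<Longrightarrow> (LINT y|halfline. (deriv ^^ j) \<phi> y * f 0 y) = (- 1) ^ j * (LINT y|halfline. \<phi> y * f j y)"
proof (induction j arbitrary: \<phi>)
  case (Suc j)
  have "continuous_on {0<..} (f i)" for i
    by (meson DERIV_isCont assms continuous_at_imp_continuous_on greaterThan_iff)
  from test_function_integration_by_parts[OF Suc.prems assms this, of j] Suc.IH[OF test_function_deriv(1)[OF Suc.prems]]
  show ?case by (simp add: funpow_swap1)
qed simp

text \<open>A norm below \<open>A\<close> provides a chain of weak derivatives, along which the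
  derivatives of \<open>\<phi>\<close> are moved to \<open>w\<close>. In the form of integrals
  against test functions, bounds for several functions can simply be added.\<close>

lemma W_norm_test:
  fixes w :: "real \<Rightarrow> real"
  assumes "W_norm 0 m w < ennreal A" "j \<le> m" "test_function \<phi>"
  shows "\<bar>LINT y|halfline. (deriv ^^ j) \<phi> y * w y\<bar> \<le> A * (LINT y|halfline. \<bar>\<phi> y\<bar>)"
proof -
  obtain g where g: "\<And>y. y > 0 \<Longrightarrow> g 0 y = w y" "\<And>j. j \<le> m \<Longrightarrow> g j \<in> borel_measurable halfline"
    "\<And>j. j < m \<Longrightarrow> weak_derivative (g j) (g (Suc j))" "(\<Sum>j\<le>m. Linf_norm (g j)) < ennreal A"
    using assms(1) unfolding W_norm_def INF_less_iff by auto
  have A: "A > 0"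
    using le_less_trans[OF zero_le g(4)] by (simp add: ennreal_less_zero_iff)
  have "Linf_norm (g j) \<le> (\<Sum>j\<le>m. Linf_norm (g j))" using assms(2) by (intro member_le_sum) auto
  then have L: "Linf_norm (g j) < ennreal A" using g(4) by simp
  have m: "(\<lambda>y. ennreal (norm (g j y))) \<in> borel_measurable halfline" using g(2)[OF assms(2)] by measurable
  have AE: "AE y in halfline. \<bar>g j y\<bar> \<le> A"
    using esssup_AE[of "\<lambda>y. ennreal (norm (g j y))" halfline]
  proof eventually_elim
    case (elim y)
    then have "ennreal \<bar>g j y\<bar> \<le> ennreal A" using L by (simp add: Linf_norm_def)
    then show ?case using A by (simp add: ennreal_le_iff)
  qed
  have "(LINT y|halfline. (deriv ^^ i) \<psi> y * g 0 y) = (- 1) ^ i * (LINT y|halfline. \<psi> y * g i y)"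
    if "test_function \<psi>" "i \<le> m" for \<psi> i
    using that
  proof (induction i arbitrary: \<psi>)
    case (Suc i)
    have "(LINT y|halfline. deriv \<psi> y *\<^sub>R g i y) = - (LINT y|halfline. \<psi> y *\<^sub>R g (Suc i) y)"
      using g(3)[of i] Suc.prems by (auto simp: weak_derivative_def)
    with Suc.IH[OF test_function_deriv(1)[OF Suc.prems(1)]] Suc.prems show ?case by (simp add: funpow_swap1)
  qed simp
  note * = this[OF assms(3,2)]
  have "(LINT y|halfline. (deriv ^^ j) \<phi> y * w y) = (LINT y|halfline. (deriv ^^ j) \<phi> y * g 0 y)"
    by (rule Bochner_Integration.integral_cong) (auto simp: g(1) space_halfline)
  also have "\<bar>\<dots>\<bar> = \<bar>LINT y|halfline. \<phi> y * g j y\<bar>" unfolding * by (simp add: abs_mult power_abs)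
  also have "\<dots> \<le> (LINT y|halfline. A * \<bar>\<phi> y\<bar>)"
  proof (rule order_trans[OF integral_abs_bound])
    have i: "integrable halfline (\<lambda>y. A * \<bar>\<phi> y\<bar>)"
      using test_function_integrable[OF assms(3), of "\<lambda>_. 1"] by (simp add: integrable_abs)
    have "\<phi> \<in> borel_measurable halfline"
      using test_function_integrable[OF assms(3), of "\<lambda>_. 1"] by (simp add: borel_measurable_integrable)
    then have "integrable halfline (\<lambda>y. \<phi> y * g j y)"
      by (intro Bochner_Integration.integrable_bound[OF i])
        (use g(2)[OF assms(2)] AE A in \<open>auto simp: abs_mult mult.commute[of A] elim!: eventually_mono intro!: mult_left_mono\<close>)
    then show "(LINT y|halfline. \<bar>\<phi> y * g j y\<bar>) \<le> (LINT y|halfline. A * \<bar>\<phi> y\<bar>)"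
      by (intro integral_mono_AE i integrable_abs)
        (use AE in \<open>auto simp: abs_mult mult.commute[of A] elim!: eventually_mono intro!: mult_left_mono\<close>)
  qed
  finally show ?thesis by simp
qed

text \<open>If the bound failed at \<open>y\<close>, continuity would keep a fixed sign and a
  modulus above some \<open>L > K\<close> near \<open>y\<close>; a bump supported there contradicts
  the tested bound.\<close>

lemma derivative_bound_from_tests:
  fixes f :: "nat \<Rightarrow> real \<Rightarrow> real"
  assumes f: "\<And>j y. y > 0 \<Longrightarrow> (f j has_real_derivative f (Suc j) y) (at y)"
    and K: "\<And>\<phi>. test_function \<phi> \<Longrightarrow> \<bar>LINT y|halfline. (deriv ^^ j) \<phi> y * f 0 y\<bar> \<le> K * (LINT y|halfline. \<bar>\<phi> y\<bar>)"
    and y: "y > 0"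
  shows "\<bar>f j y\<bar> \<le> K"
proof (rule ccontr)
  assume "\<not> \<bar>f j y\<bar> \<le> K"
  define L where "L = (\<bar>f j y\<bar> + K) / 2"
  define e where "e = sgn (f j y)"
  have c: "continuous_on {0<..} (f j)"
    by (meson DERIV_isCont f continuous_at_imp_continuous_on greaterThan_iff)
  have L: "L > K" "e * f j y > L" using \<open>\<not> \<bar>f j y\<bar> \<le> K\<close>
    by (auto simp: L_def e_def abs_sgn[symmetric] mult.commute)
  have "isCont (\<lambda>y. e * f j y) y" using c y by (auto simp: continuous_on_eq_continuous_at)
  then have "\<forall>\<^sub>F x in at y. e * f j x > L" unfolding isCont_def by (rule order_tendstoD(1)) (rule L(2))
  then obtain d where "d > 0" "\<And>x. x \<noteq> y \<Longrightarrow> dist x y < d \<Longrightarrow> e * f j x > L" by (auto simp: eventually_at)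
  with L(2) have d: "d > 0" "\<And>x. dist x y < d \<Longrightarrow> e * f j x > L" by metis+
  define r where "r = min d y / 2"
  have r: "0 < r" "r < d" "r < y" using d y by (auto simp: r_def)
  let ?\<phi> = "bump (y - r) (y + r)"
  have t: "test_function ?\<phi>" by (rule test_function_bump) (use r in auto)
  note i = test_function_integrable[OF t]
  have pos: "(LINT x|halfline. ?\<phi> x) > 0"
  proof -
    have "(LINT x|halfline. ?\<phi> x) \<noteq> 0"
    proof
      assume "(LINT x|halfline. ?\<phi> x) = 0"
      then have "AE x in halfline. ?\<phi> x = 0"
        using integral_nonneg_eq_0_iff_AE[of halfline ?\<phi>] i[of "\<lambda>_. 1"] bump_nonneg by auto
      then have "AE x in lborel. x \<in> {0<..} \<longrightarrow> ?\<phi> x = 0"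
        unfolding halfline_def by (subst (asm) AE_restrict_space_iff) auto
      then have "AE x in lborel. x \<notin> {y - r<..<y + r}"
        by eventually_elim (use r bump_pos in force)
      then have "emeasure lborel {y - r<..<y + r} = 0"
        using AE_iff_null_sets[of "{y - r<..<y + r}" lborel] by auto
      then show False using r by simp
    qed
    then show ?thesis using integral_nonneg_AE[of ?\<phi> halfline] bump_nonneg by (simp add: less_le)
  qed
  have "L * (LINT x|halfline. ?\<phi> x) = (LINT x|halfline. ?\<phi> x * L)" by simp
  also have "\<dots> \<le> (LINT x|halfline. ?\<phi> x * (e * f j x))"
  proof (rule integral_mono)
    fix x show "?\<phi> x * L \<le> ?\<phi> x * (e * f j x)"
    proof (cases "x \<in> {y - r<..<y + r}")
      case True
      then have "dist x y < d" using r by (auto simp: dist_real_def)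
      then show ?thesis using d(2)[of x] bump_nonneg by (intro mult_left_mono) auto
    qed (simp add: bump_eq_0)
  qed (intro i continuous_on_const continuous_on_mult c)+
  also have "\<dots> = e * (LINT x|halfline. ?\<phi> x * f j x)" by (simp add: mult.left_commute)
  also have "\<dots> \<le> \<bar>LINT x|halfline. ?\<phi> x * f j x\<bar>" by (auto simp: e_def sgn_if)
  also have "\<dots> = \<bar>LINT x|halfline. (deriv ^^ j) ?\<phi> x * f 0 x\<bar>"
  proof -
    have "(LINT x|halfline. (deriv ^^ j) ?\<phi> x * f 0 x) = (- 1) ^ j * (LINT x|halfline. ?\<phi> x * f j x)"
      by (rule test_function_iterated_parts[where f = f, OF _ t]) (rule f)
    then show ?thesis by (simp add: abs_mult power_abs)
  qed
  also have "\<dots> \<le> K * (LINT x|halfline. \<bar>?\<phi> x\<bar>)" by (rule K[OF t])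
  finally show False using L(1) pos by (simp add: bump_nonneg)
qed

section \<open>Regularity of the shear flow\<close>

text \<open>The Lipschitz condition makes \<open>f s - K * s\<close> non-increasing, so its supremum
  is the limit at 0, and the comparison \<open>*\<close> gives the error bound.\<close>

lemma lipschitz_limit_at_0:
  fixes f :: "real \<Rightarrow> real"
  assumes "0 < T" "\<And>s t. 0 < s \<Longrightarrow> s \<le> t \<Longrightarrow> t \<le> T \<Longrightarrow> \<bar>f t - f s\<bar> \<le> K * (t - s)"
  obtains L where "\<And>t. 0 < t \<Longrightarrow> t \<le> T \<Longrightarrow> \<bar>f t - L\<bar> \<le> K * t"
proof -
  have K: "K \<ge> 0" using assms(2)[of "T/2" T] assms(1)
    by (smt (verit) field_sum_of_halves zero_le_mult_iff)
  have *: "f s - K * s \<le> f t + K * t" if "0 < s" "s \<le> T" "0 < t" "t \<le> T" for s t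
  proof (cases "s \<le> t")
    case True
    with assms(2)[of s t] that show ?thesis by (auto simp: abs_le_iff right_diff_distrib) (smt (verit) K mult_nonneg_nonneg)
  next
    case False
    with assms(2)[of t s] that show ?thesis by (auto simp: abs_le_iff right_diff_distrib) (smt (verit) K mult_nonneg_nonneg)
  qed
  define L where "L = (SUP s\<in>{0<..T}. f s - K * s)"
  have bdd: "bdd_above ((\<lambda>s. f s - K * s) ` {0<..T})"
    using *[of _ T] assms(1) by (auto intro!: bdd_aboveI2[where M = "f T + K * T"])
  show ?thesis
  proof (rule that[of L])
    fix t assume t: "0 < t" "t \<le> T"
    have "f t - K * t \<le> L" unfolding L_def by (rule cSUP_upper[OF _ bdd]) (use t in auto)
    moreover have "L \<le> f t + K * t" unfolding L_def by (rule cSUP_least) (use t assms(1) * in auto)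
    ultimately show "\<bar>f t - L\<bar> \<le> K * t" by (simp add: abs_le_iff)
  qed
qed

text \<open>The mean value inequality is applied twice, which gives \<open>K\<close> where Taylor's
  formula would give \<open>K / 2\<close>.\<close>

lemma second_order_remainder:
  fixes f f' f'' :: "real \<Rightarrow> real"
  assumes "\<And>z. z > 0 \<Longrightarrow> (f has_real_derivative f' z) (at z)" "\<And>z. z > 0 \<Longrightarrow> (f' has_real_derivative f'' z) (at z)"
    "\<And>z. z > 0 \<Longrightarrow> \<bar>f'' z\<bar> \<le> K" "x > 0" "y > 0"
  shows "\<bar>f y - f x - f' x * (y - x)\<bar> \<le> K * (y - x)\<^sup>2"
proof -
  have K: "K \<ge> 0" using assms(3)[of 1] by simp
  let ?S = "closed_segment x y"
  have S: "z > 0" "\<bar>z - x\<bar> \<le> \<bar>y - x\<bar>" if "z \<in> ?S" for z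
    using that assms(4,5) by (auto simp: closed_segment_eq_real_ivl split: if_splits)
  have 1: "\<bar>f' z - f' x\<bar> \<le> K * \<bar>y - x\<bar>" if z: "z \<in> ?S" for z
  proof -
    have "norm (f' z - f' x) \<le> K * norm (z - x)"
      by (rule field_differentiable_bound[of ?S f' f''])
        (use assms(3) S z in \<open>auto intro!: has_field_derivative_at_within assms(2)\<close>)
    also have "\<dots> \<le> K * \<bar>y - x\<bar>" using S(2)[OF z] K by (simp add: mult_left_mono)
    finally show ?thesis by simp
  qed
  have "norm ((f y - f' x * y) - (f x - f' x * x)) \<le> K * \<bar>y - x\<bar> * norm (y - x)"
  proof (rule field_differentiable_bound[of ?S "\<lambda>z. f z - f' x * z" "\<lambda>z. f' z - f' x"])
    fix z assume z: "z \<in> ?S"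
    have "((\<lambda>z. f z - f' x * z) has_real_derivative f' z - f' x * 1) (at z within ?S)"
      by (intro DERIV_diff DERIV_cmult DERIV_ident has_field_derivative_at_within[OF assms(1)] S(1)[OF z])
    then show "((\<lambda>z. f z - f' x * z) has_real_derivative f' z - f' x) (at z within ?S)" by simp
    show "norm (f' z - f' x) \<le> K * \<bar>y - x\<bar>" using 1[OF z] by simp
  qed auto
  also have "K * \<bar>y - x\<bar> * norm (y - x) = K * (y - x)\<^sup>2"
    by (simp only: power2_eq_square mult.assoc real_norm_def abs_mult_self_eq)
  finally show ?thesis by (simp add: algebra_simps)
qed

lemma has_real_derivative_of_quadratic_remainder:
  fixes f :: "real \<Rightarrow> real"
  assumes "r > 0" "\<And>y. \<bar>y - x\<bar> < r \<Longrightarrow> \<bar>f y - f x - l * (y - x)\<bar> \<le> K * (y - x)\<^sup>2"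
  shows "(f has_real_derivative l) (at x)"
  unfolding DERIV_def
proof (rule Lim_transform_eventually[rotated])
  show "\<forall>\<^sub>F h in at 0. l + ((f (x + h) - f x) / h - l) = (f (x + h) - f x) / h" by simp
  have "((\<lambda>h. (f (x + h) - f x) / h - l) \<longlongrightarrow> 0) (at 0)"
  proof (rule Lim_null_comparison)
    show "((\<lambda>h. K * \<bar>h\<bar>) \<longlongrightarrow> 0) (at (0::real))" by (auto intro!: tendsto_eq_intros)
    show "\<forall>\<^sub>F h in at 0. norm ((f (x + h) - f x) / h - l) \<le> K * \<bar>h\<bar>"
      unfolding eventually_at
    proof (intro exI[of _ r] conjI ballI impI assms(1))
      fix h :: real assume h: "h \<noteq> 0 \<and> dist h 0 < r"
      have "norm ((f (x + h) - f x) / h - l) = \<bar>f (x + h) - f x - l * h\<bar> / \<bar>h\<bar>"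
        using h by (simp add: field_simps flip: abs_divide)
      also have "\<dots> \<le> K * h\<^sup>2 / \<bar>h\<bar>" using assms(2)[of "x + h"] h by (intro divide_right_mono) (auto simp: dist_real_def)
      also have "\<dots> = K * \<bar>h\<bar>" using h by (simp add: power2_eq_square field_simps abs_if)
      finally show "norm ((f (x + h) - f x) / h - l) \<le> K * \<bar>h\<bar>" .
    qed
  qed
  from tendsto_add[OF tendsto_const this, of l]
  show "((\<lambda>h. l + ((f (x + h) - f x) / h - l)) \<longlongrightarrow> l) (at 0)" by simp
qed

text \<open>\<open>S_t\<close> is the heat equation in terms of derivatives in \<open>y\<close>. The
  derivatives up to order 4 are bounded uniformly down to time 0, while smoothness of all orders is
  available at positive times.\<close>

locale shear =
  fixes us :: "real \<Rightarrow> real \<Rightarrow> real" and U0 K t1 :: real and S :: "nat \<Rightarrow> real \<Rightarrow> real \<Rightarrow> real"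
  assumes S0: "\<And>t y. t > 0 \<Longrightarrow> y > 0 \<Longrightarrow> S 0 t y = us t y"
    and S_y: "\<And>j t y. t > 0 \<Longrightarrow> y > 0 \<Longrightarrow> (S j t has_real_derivative S (Suc j) t y) (at y)"
    and S_t: "\<And>j t y. t > 0 \<Longrightarrow> y > 0 \<Longrightarrow> ((\<lambda>t. S j t y) has_real_derivative S (j + 2) t y) (at t)"
    and S_cont: "\<And>j. continuous_on ({0<..} \<times> {0<..}) (\<lambda>(t, y). S j t y)"
    and t1: "t1 > 0" and S_bound: "\<And>j t y. 0 < t \<Longrightarrow> t \<le> t1 \<Longrightarrow> y > 0 \<Longrightarrow> j \<le> 4 \<Longrightarrow> \<bar>S j t y\<bar> \<le> K"
    and us_cont: "continuous_on ({0..} \<times> {0..}) (\<lambda>(t, y). us t y)"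
    and us_0: "\<And>t. t \<ge> 0 \<Longrightarrow> us t 0 = 0"
    and us_lim: "\<And>t. t \<ge> 0 \<Longrightarrow> (us t \<longlongrightarrow> U0) at_top"
begin

lemma K_nonneg: "K \<ge> 0"
  using S_bound[of t1 1 0] t1 by simp

lemma deriv_us: assumes "t > 0" "y > 0" shows "deriv (us t) y = S 1 t y"
proof -
  have "(us t has_real_derivative S (Suc 0) t y) (at y)"
    by (rule has_field_derivative_transform_within_open[OF S_y[OF assms], of "{0<..}"]) (use assms S0 in auto)
  then show ?thesis by (simp add: DERIV_imp_deriv)
qed

lemma us_wall: assumes "0 < t" "t \<le> t1" "y > 0" shows "\<bar>us t y\<bar> \<le> K * y"
proof -
  have "norm (us t y - us t 0) \<le> K * y - K * 0"
  proof (rule differentiable_bound_general[where f' = "S 1 t" and \<phi>' = "\<lambda>_. K"])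
    have "continuous_on {0..y} (\<lambda>y. (t, y))" by (intro continuous_intros)
    then show "continuous_on {0..y} (us t)"
      using continuous_on_compose2[OF us_cont, of "{0..y}" "\<lambda>y. (t, y)"] assms by force
    fix x assume x: "0 < x" "x < y"
    have "(us t has_real_derivative S (Suc 0) t x) (at x)"
      by (rule has_field_derivative_transform_within_open[OF S_y, of _ _ "{0<..}"]) (use assms x S0 in auto)
    then show "(us t has_vector_derivative S 1 t x) (at x)"
      by (simp add: has_real_derivative_iff_has_vector_derivative)
    show "((*) K has_vector_derivative K) (at x)"
      by (auto intro!: derivative_eq_intros simp: has_real_derivative_iff_has_vector_derivative[symmetric])
    show "norm (S 1 t x) \<le> K" using S_bound[of t x 1] assms x by simp
  qed (use assms in \<open>auto intro!: continuous_intros\<close>)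
  then show ?thesis using us_0[of t] assms by simp
qed

text \<open>Interpolation: for a fixed step \<open>h\<close> the difference quotient of
  \<open>us t\<close> tends to 0 at infinity, and it differs from \<open>S 1 t\<close> by at most
  \<open>K * h\<close> through the bound for the second derivative. The step is chosen with
  \<open>K * h \<le> e / 2\<close>.\<close>

lemma S1_lim: assumes "0 < t" "t \<le> t1" shows "(S 1 t \<longlongrightarrow> 0) at_top"
proof (rule tendstoI)
  fix e :: real assume e: "e > 0"
  define h where "h = e / (2 * (K + 1))"
  have h: "h > 0" "K * h \<le> e / 2" using e K_nonneg by (auto simp: h_def field_simps)
  have "((\<lambda>y. us t (y + h)) \<longlongrightarrow> U0) at_top"
    by (rule filterlim_compose[OF us_lim]) (use assms in \<open>auto intro!: filterlim_tendsto_add_at_top[OF tendsto_const] filterlim_ident simp: add.commute[of _ h]\<close>)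
  then have "((\<lambda>y. (us t (y + h) - us t y) / h) \<longlongrightarrow> (U0 - U0) / h) at_top"
    using us_lim[of t] assms h by (intro tendsto_intros) auto
  then have "\<forall>\<^sub>F y in at_top. dist ((us t (y + h) - us t y) / h) 0 < e / 2"
    using e by (intro tendstoD) auto
  then show "\<forall>\<^sub>F y in at_top. dist (S 1 t y) 0 < e"
    using eventually_gt_at_top[of 0]
  proof eventually_elim
    case (elim y)
    have "\<bar>S 0 t (y + h) - S 0 t y - S 1 t y * ((y + h) - y)\<bar> \<le> K * ((y + h) - y)\<^sup>2"
      by (rule second_order_remainder[where f'' = "S 2 t"])
        (use S_y[of t _ 0] S_y[of t _ 1] S_bound[of t _ 2] assms elim h in \<open>auto simp: numeral_2_eq_2\<close>)
    then have "\<bar>us t (y + h) - us t y - S 1 t y * h\<bar> \<le> K * h\<^sup>2" using assms elim h by (simp add: S0)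
    then have "\<bar>us t (y + h) - us t y - S 1 t y * h\<bar> / h \<le> K * h" using h by (simp add: field_simps power2_eq_square)
    moreover define q where "q = (us t (y + h) - us t y) / h"
    moreover have "q - S 1 t y = (us t (y + h) - us t y - S 1 t y * h) / h" using h by (simp add: q_def field_simps)
    ultimately have "\<bar>q - S 1 t y\<bar> \<le> K * h" using h by (simp add: abs_divide)
    moreover have "\<bar>q\<bar> < e / 2" using elim(1) by (simp add: q_def)
    ultimately show ?case using h(2) unfolding dist_real_def by linarith
  qed
qed

text \<open>A time derivative costs two orders in \<open>y\<close>, so the bound up to order 4
  covers \<open>j \<le> 2\<close>.\<close>

lemma S_lipschitz:
  assumes "0 < s" "s \<le> t" "t \<le> t1" "y > 0" "j \<le> 2"
  shows "\<bar>S j t y - S j s y\<bar> \<le> K * (t - s)"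
proof -
  have "norm (S j t y - S j s y) \<le> K * norm (t - s)"
  proof (rule field_differentiable_bound[of "{s..t}" "\<lambda>t. S j t y" "\<lambda>t. S (j + 2) t y"])
    fix r assume r: "r \<in> {s..t}"
    show "((\<lambda>t. S j t y) has_real_derivative S (j + 2) r y) (at r within {s..t})"
      by (rule has_field_derivative_at_within[OF S_t]) (use r assms in auto)
    show "norm (S (j + 2) r y) \<le> K" using S_bound[of r y "j + 2"] r assms by simp
  qed (use assms in auto)
  then show ?thesis using assms by simp
qed

text \<open>The Lipschitz bound yields a limit at time 0; continuity of \<open>us\<close> up to the
  initial time identifies it as the initial value.\<close>

lemma us_initial: assumes "0 < t" "t \<le> t1" "y > 0" shows "\<bar>us t y - us 0 y\<bar> \<le> K * t"
proof -
  obtain L where L: "\<And>t. 0 < t \<Longrightarrow> t \<le> t1 \<Longrightarrow> \<bar>S 0 t y - L\<bar> \<le> K * t"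
    using lipschitz_limit_at_0[of t1 "\<lambda>t. S 0 t y" K] S_lipschitz[OF _ _ _ assms(3), of _ _ 0] t1 by auto
  have "((\<lambda>t. us t y) \<longlongrightarrow> us 0 y) (at_right 0)"
  proof -
    have "continuous_on {0..} (\<lambda>t. (t, y))" by (intro continuous_intros)
    then have "continuous_on {0..} (\<lambda>t. us t y)"
      using continuous_on_compose2[OF us_cont, of "{0..}" "\<lambda>t. (t, y)"] assms by force
    then show ?thesis unfolding continuous_on_def
      by (metis atLeast_iff greaterThan_subset_iff order.refl tendsto_within_subset atLeast_subset_iff Ioi_le_Ico)
  qed
  moreover have "((\<lambda>t. us t y) \<longlongrightarrow> L) (at_right 0)"
  proof (rule LIM_zero_cancel, rule Lim_null_comparison)
    show "((\<lambda>t. K * t) \<longlongrightarrow> 0) (at_right 0)" by (auto intro!: tendsto_eq_intros)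
    show "\<forall>\<^sub>F t in at_right 0. norm (us t y - L) \<le> K * t"
      unfolding eventually_at_right_field using L t1 assms by (intro exI[of _ t1]) (auto simp: S0[symmetric])
  qed
  ultimately have "us 0 y = L" using tendsto_unique trivial_limit_at_right_real by blast
  with L[OF assms(1,2)] assms show ?thesis by (simp add: S0)
qed

text \<open>The derivatives up to order 2 have traces at time 0 by the Lipschitz bound, and these
  are the derivatives of \<open>us 0\<close>. Near \<open>a\<close> the slope of
  \<open>S 1 t\<close> keeps the sign of the second derivative and at least half of its size, so a
  small value at \<open>a\<close> forces a zero nearby. The lower bound for \<open>S 2\<close> does
  not depend on \<open>e\<close>.\<close>

lemma critical_points:
  assumes crit: "nondegenerate_critical_point (us 0) a" and a: "a > 0"
  obtains d where "d > 0"
    "\<And>e. e > 0 \<Longrightarrow> \<exists>t0 a0. 0 < t0 \<and> t0 < e \<and> t0 < t1 \<and> a0 > 0 \<and> S 1 t0 a0 = 0 \<and> \<bar>S 2 t0 a0\<bar> \<ge> d"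
proof -
  have "\<exists>L. \<forall>t. 0 < t \<longrightarrow> t \<le> t1 \<longrightarrow> \<bar>S j t y - L\<bar> \<le> K * t" if "y > 0" "j \<le> 2" for j y
    using lipschitz_limit_at_0[of t1 "\<lambda>t. S j t y" K] S_lipschitz[OF _ _ _ that] t1 by metis
  note ex = this
  define L where "L j y = (SOME L. \<forall>t. 0 < t \<longrightarrow> t \<le> t1 \<longrightarrow> \<bar>S j t y - L\<bar> \<le> K * t)" for j y
  have L: "\<bar>S j t y - L j y\<bar> \<le> K * t" if "y > 0" "j \<le> 2" "0 < t" "t \<le> t1" for j y t
    using someI_ex[OF ex[OF that(1,2)]] that(3,4) unfolding L_def by blast
  have Slim: "((\<lambda>t. S j t y) \<longlongrightarrow> L j y) (at_right 0)" if "y > 0" "j \<le> 2" for j y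
  proof (rule LIM_zero_cancel, rule Lim_null_comparison)
    show "((\<lambda>t. K * t) \<longlongrightarrow> 0) (at_right 0)" by (auto intro!: tendsto_eq_intros)
    show "\<forall>\<^sub>F t in at_right 0. norm (S j t y - L j y) \<le> K * t"
      unfolding eventually_at_right_field using L[OF that] t1 by (intro exI[of _ t1]) auto
  qed
  have "((\<lambda>t. S 0 t y) \<longlongrightarrow> us 0 y) (at_right 0)" if "y > 0" for y
  proof (rule LIM_zero_cancel, rule Lim_null_comparison)
    show "((\<lambda>t. K * t) \<longlongrightarrow> 0) (at_right 0)" by (auto intro!: tendsto_eq_intros)
    show "\<forall>\<^sub>F t in at_right 0. norm (S 0 t y - us 0 y) \<le> K * t"
      unfolding eventually_at_right_field using us_initial t1 that by (intro exI[of _ t1]) (auto simp: S0)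
  qed
  then have L0: "L 0 y = us 0 y" if "y > 0" for y
    using tendsto_unique[OF trivial_limit_at_right_real Slim[OF that, of 0]] that by auto
  \<comment> \<open>Differentiability survives the limit in time because the quadratic remainder
    bound is uniform in \<open>t\<close>.\<close>
  have Ld: "(L j has_real_derivative L (Suc j) x) (at x)" if x: "x > 0" and j: "j \<le> 1" for j x
  proof (rule has_real_derivative_of_quadratic_remainder[OF x])
    fix y assume "\<bar>y - x\<bar> < x"
    then have y: "y > 0" by linarith
    have "((\<lambda>t. \<bar>S j t y - S j t x - S (Suc j) t x * (y - x)\<bar>) \<longlongrightarrow> \<bar>L j y - L j x - L (Suc j) x * (y - x)\<bar>) (at_right 0)"
      using x y j by (intro tendsto_intros Slim) auto
    then show "\<bar>L j y - L j x - L (Suc j) x * (y - x)\<bar> \<le> K * (y - x)\<^sup>2"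
    proof (rule tendsto_upperbound)
      show "\<forall>\<^sub>F t in at_right 0. \<bar>S j t y - S j t x - S (Suc j) t x * (y - x)\<bar> \<le> K * (y - x)\<^sup>2"
        unfolding eventually_at_right_field
      proof (intro exI[of _ t1] conjI allI impI t1)
        fix t assume t: "0 < t" "t < t1"
        show "\<bar>S j t y - S j t x - S (Suc j) t x * (y - x)\<bar> \<le> K * (y - x)\<^sup>2"
          by (rule second_order_remainder[where f'' = "S (Suc (Suc j)) t"])
            (use t x y j S_bound[of t _ "Suc (Suc j)"] in \<open>auto intro!: S_y\<close>)
      qed
    qed simp
  qed
  have us0: "(us 0 has_real_derivative L 1 y) (at y)" if "y > 0" for y
    by (rule has_field_derivative_transform_within_open[of "L 0" _ _ "{0<..}"]) (use that Ld[OF that, of 0] L0 in auto)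
  obtain d where d: "d \<noteq> 0" "(us 0 has_real_derivative 0) (at a)" "(deriv (us 0) has_real_derivative d) (at a)"
    using crit by (auto simp: nondegenerate_critical_point_def)
  have L1: "L 1 a = 0" using DERIV_unique[OF us0[OF a] d(2)] .
  have "(L 1 has_real_derivative d) (at a)"
    by (rule has_field_derivative_transform_within_open[OF d(3), of "{0<..}"]) (use a DERIV_imp_deriv[OF us0] in auto)
  then have L2: "L 2 a = d" using DERIV_unique[OF Ld[OF a, of 1]] by (simp add: numeral_2_eq_2)
  have dpos: "\<bar>d\<bar> > 0" using d by simp
  show ?thesis
  proof (rule that[of "\<bar>d\<bar> / 2"])
    fix e :: real assume e: "e > 0"
    \<comment> \<open>Within this radius \<open>S 2 t\<close> varies by at most a quarter of
      \<open>\<bar>d\<bar>\<close>, since the third derivative is bounded by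
      \<open>K\<close>.\<close>
    define \<rho> where "\<rho> = min (a / 2) (\<bar>d\<bar> / (4 * (K + 1)))"
    have \<rho>: "0 < \<rho>" "\<rho> < a" "K * \<rho> \<le> \<bar>d\<bar> / 4"
    proof -
      show "0 < \<rho>" "\<rho> < a" using a dpos K_nonneg by (auto simp: \<rho>_def)
      have "K * \<rho> \<le> (K + 1) * (\<bar>d\<bar> / (4 * (K + 1)))" using K_nonneg \<open>0 < \<rho>\<close> by (intro mult_mono) (auto simp: \<rho>_def)
      also have "\<dots> = \<bar>d\<bar> / 4" using K_nonneg by (simp add: field_simps)
      finally show "K * \<rho> \<le> \<bar>d\<bar> / 4" .
    qed
    \<comment> \<open>The first entry keeps \<open>S 2 t a\<close> near \<open>d\<close>; the second
      keeps \<open>S 1 t a\<close> below what the slope \<open>\<bar>d\<bar> / 2\<close> recovers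
      over the distance \<open>\<rho>\<close>.\<close>
    define m where "m = min (\<bar>d\<bar> / 4) (\<bar>d\<bar> * \<rho> / 4) / (K + 1)"
    have m: "m > 0" using dpos \<rho> K_nonneg by (auto simp: m_def)
    define t where "t = min m (min e t1) / 2"
    have t: "0 < t" "t < e" "t < t1" "t < m" using m e t1 by (auto simp: t_def)
    have Kt: "K * t \<le> \<bar>d\<bar> / 4" "K * t \<le> \<bar>d\<bar> * \<rho> / 4"
    proof -
      have "K * t \<le> (K + 1) * m" using K_nonneg t by (intro mult_mono) auto
      also have "\<dots> = min (\<bar>d\<bar> / 4) (\<bar>d\<bar> * \<rho> / 4)" using K_nonneg by (simp add: m_def)
      finally show "K * t \<le> \<bar>d\<bar> / 4" "K * t \<le> \<bar>d\<bar> * \<rho> / 4" by auto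
    qed
    have 1: "\<bar>S 1 t a\<bar> \<le> \<bar>d\<bar> * \<rho> / 4" using L[OF a, of 1 t] L1 t Kt by simp
    have 2: "\<bar>S 2 t a - d\<bar> \<le> \<bar>d\<bar> / 4" using L[OF a, of 2 t] L2 t Kt by simp
    have 3: "\<bar>S 2 t y - d\<bar> \<le> \<bar>d\<bar> / 2" if "y \<in> {a - \<rho>..a + \<rho>}" for y
    proof -
      have y: "y > 0" "\<bar>y - a\<bar> \<le> \<rho>" using that \<rho> by auto
      have "norm (S 2 t y - S 2 t a) \<le> K * norm (y - a)"
      proof (rule field_differentiable_bound[of "{a - \<rho>..a + \<rho>}" "S 2 t" "S (Suc 2) t"])
        fix z assume z: "z \<in> {a - \<rho>..a + \<rho>}"
        show "(S 2 t has_real_derivative S (Suc 2) t z) (at z within {a - \<rho>..a + \<rho>})"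
          by (rule has_field_derivative_at_within[OF S_y]) (use z \<rho> t in auto)
        show "norm (S (Suc 2) t z) \<le> K" using S_bound[of t z "Suc 2"] z \<rho> t by simp
      qed (use that \<rho> in auto)
      also have "\<dots> \<le> K * \<rho>" using y K_nonneg by (intro mult_left_mono) auto
      finally have "\<bar>S 2 t y - S 2 t a\<bar> \<le> K * \<rho>" by simp
      with 2 \<rho>(3) show ?thesis unfolding abs_le_iff by argo
    qed
    \<comment> \<open>The factor \<open>sgn d\<close> makes the function increasing whatever the
      sign of \<open>d\<close>.\<close>
    define q where "q y = sgn d * S 1 t y" for y
    have qd: "(q has_real_derivative sgn d * S 2 t y) (at y)" if "y \<in> {a - \<rho>..a + \<rho>}" for y
      unfolding q_def[abs_def] numeral_2_eq_2 using that \<rho> t by (intro DERIV_cmult) (auto intro!: S_y[of t y 1, simplified])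
    have q2: "sgn d * S 2 t y \<ge> \<bar>d\<bar> / 2" if "y \<in> {a - \<rho>..a + \<rho>}" for y
      using 3[OF that] dpos by (auto simp: sgn_if abs_if split: if_splits)
    have qa: "\<bar>q a\<bar> \<le> \<bar>d\<bar> * \<rho> / 4" using 1 d(1) by (simp add: q_def abs_mult)
    have inc: "q z - q x \<ge> \<bar>d\<bar> / 2 * (z - x)" if "x \<le> z" "x \<in> {a - \<rho>..a + \<rho>}" "z \<in> {a - \<rho>..a + \<rho>}" for x z
    proof -
      have "q x - \<bar>d\<bar> / 2 * x \<le> q z - \<bar>d\<bar> / 2 * z"
      proof (rule DERIV_nonneg_imp_nondecreasing[OF that(1)])
        fix y assume "x \<le> y" "y \<le> z"
        then have "y \<in> {a - \<rho>..a + \<rho>}" using that by auto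
        then show "\<exists>l. ((\<lambda>y. q y - \<bar>d\<bar> / 2 * y) has_real_derivative l) (at y) \<and> 0 \<le> l"
          using q2[of y] by (intro exI[of _ "sgn d * S 2 t y - \<bar>d\<bar> / 2"]) (auto intro!: derivative_eq_intros qd)
      qed
      then show ?thesis unfolding right_diff_distrib by argo
    qed
    have dr: "\<bar>d\<bar> * \<rho> > 0" using dpos \<rho> by simp
    have "q (a + \<rho>) \<ge> 0" using inc[of a "a + \<rho>"] qa \<rho> dr by auto
    moreover have "q (a - \<rho>) \<le> 0" using inc[of "a - \<rho>" a] qa \<rho> dr by auto
    moreover have "continuous_on {a - \<rho>..a + \<rho>} q"
      by (meson DERIV_isCont continuous_at_imp_continuous_on qd)
    ultimately obtain x where x: "a - \<rho> \<le> x" "x \<le> a + \<rho>" "q x = 0"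
      using IVT'[of q "a - \<rho>" 0 "a + \<rho>"] \<rho> by auto
    then have "S 1 t x = 0" "x > 0" using d(1) \<rho> by (auto simp: q_def sgn_zero_iff)
    moreover have "\<bar>d\<bar> / 2 \<le> \<bar>S 2 t x\<bar>" using 3[of x] x abs_triangle_ineq2_sym[of d "S 2 t x"] by auto
    ultimately show "\<exists>t0 a0. 0 < t0 \<and> t0 < e \<and> t0 < t1 \<and> a0 > 0 \<and> S 1 t0 a0 = 0 \<and> \<bar>S 2 t0 a0\<bar> \<ge> \<bar>d\<bar> / 2"
      using t by blast
  qed (use dpos in auto)
qed

end

text \<open>
  The classical derivatives of \<open>us t\<close> are bounded uniformly for small \<open>t\<close> because the continuity
  in \<open>W\<^bsup>4,\<infinity>\<^esup>\<close> at time 0 bounds them as distributions.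
\<close>

theorem heat_solution_shear:
  assumes us: "heat_solution U0 Us us" and C0: "C0_W 0 4 (\<lambda>t y. us t y - U0)"
  obtains K t1 S where "shear us U0 K t1 S"
proof -
  obtain D :: "nat \<Rightarrow> nat \<Rightarrow> real \<Rightarrow> real \<Rightarrow> real" where D0: "\<And>t y. t > 0 \<Longrightarrow> y > 0 \<Longrightarrow> D 0 0 t y = us t y"
    and Dc: "\<And>i j. continuous_on ({0<..} \<times> {0<..}) (\<lambda>(t, y). D i j t y)"
    and Dt: "\<And>i j t y. t > 0 \<Longrightarrow> y > 0 \<Longrightarrow> ((\<lambda>\<tau>. D i j \<tau> y) has_real_derivative D (Suc i) j t y) (at t)"
    and Dy: "\<And>i j t y. t > 0 \<Longrightarrow> y > 0 \<Longrightarrow> (D i j t has_real_derivative D i (Suc j) t y) (at y)"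
    using us unfolding heat_solution_def smooth_quadrant_def by metis
  have uc: "continuous_on ({0..} \<times> {0..}) (\<lambda>(t, y). us t y)"
    and ut: "\<And>t y. t > 0 \<Longrightarrow> y > 0 \<Longrightarrow> deriv (\<lambda>\<tau>. us \<tau> y) t - deriv (deriv (us t)) y = 0"
    and u0: "\<And>t. t \<ge> 0 \<Longrightarrow> us t 0 = 0" and ul: "\<And>t. t \<ge> 0 \<Longrightarrow> (us t \<longlongrightarrow> U0) at_top"
    using us by (auto simp: heat_solution_def)
  \<comment> \<open>Differentiating the heat equation \<open>j\<close> times in \<open>y\<close>
    identifies a time derivative with a derivative in \<open>y\<close> two orders higher.\<close>
  have heat: "D 1 j t y = D 0 (j + 2) t y" if "t > 0" "y > 0" for j t y
    using that
  proof (induction j arbitrary: y)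
    case 0
    have "((\<lambda>\<tau>. us \<tau> y) has_real_derivative D (Suc 0) 0 t y) (at t)"
      by (rule has_field_derivative_transform_within_open[OF Dt, of _ _ "{0<..}"]) (use 0 D0 in auto)
    moreover have y1: "(us t has_real_derivative D 0 (Suc 0) t y) (at y)" if "y > 0" for y
      by (rule has_field_derivative_transform_within_open[OF Dy, of _ _ "{0<..}"]) (use 0 D0 that in auto)
    have "(deriv (us t) has_real_derivative D 0 (Suc (Suc 0)) t y) (at y)"
      by (rule has_field_derivative_transform_within_open[OF Dy, of _ _ "{0<..}"]) (use 0 DERIV_imp_deriv[OF y1] in auto)
    ultimately show ?case using ut[OF 0] by (simp add: DERIV_imp_deriv numeral_2_eq_2)
  next
    case (Suc j)
    have "(D 1 j t has_real_derivative D 0 (Suc (j + 2)) t y) (at y)"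
      by (rule has_field_derivative_transform_within_open[OF Dy, of _ _ "{0<..}"]) (use Suc in auto)
    from DERIV_unique[OF this Dy[OF Suc.prems]] show ?case by simp
  qed
  define w where "w t y = us t y - U0" for t y
  have "W_norm 0 4 (w 0) < \<infinity>" "((\<lambda>\<tau>. W_norm 0 4 (\<lambda>y. w \<tau> y - w 0 y)) \<longlongrightarrow> 0) (at 0 within {0..})"
    using C0 unfolding C0_W_def w_def by auto
  moreover then have "\<forall>\<^sub>F \<tau> in at 0 within {0..}. W_norm 0 4 (\<lambda>y. w \<tau> y - w 0 y) < 1"
    by (intro order_tendstoD(2)) auto
  ultimately obtain B e where B: "W_norm 0 4 (w 0) < ennreal B" and e: "e > 0"
    and we: "\<And>\<tau>. 0 < \<tau> \<Longrightarrow> \<tau> < e \<Longrightarrow> W_norm 0 4 (\<lambda>y. w \<tau> y - w 0 y) < ennreal 1"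
  proof -
    assume a: "W_norm 0 4 (w 0) < \<infinity>" "\<forall>\<^sub>F \<tau> in at 0 within {0..}. W_norm 0 4 (\<lambda>y. w \<tau> y - w 0 y) < 1"
    obtain e where "e > 0" "\<And>\<tau>. \<tau> \<in> {0..} \<Longrightarrow> \<tau> \<noteq> 0 \<Longrightarrow> dist \<tau> 0 < e \<Longrightarrow> W_norm 0 4 (\<lambda>y. w \<tau> y - w 0 y) < 1"
      using a(2) by (auto simp: eventually_at)
    moreover have "W_norm 0 4 (w 0) < ennreal (enn2real (W_norm 0 4 (w 0)) + 1)"
    proof -
      have "W_norm 0 4 (w 0) = ennreal (enn2real (W_norm 0 4 (w 0)))" using a(1) by (simp add: less_top)
      also have "\<dots> < ennreal (enn2real (W_norm 0 4 (w 0)) + 1)" by (intro ennreal_lessI) (auto simp: add_nonneg_pos)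
      finally show ?thesis .
    qed
    ultimately show ?thesis using that[of "enn2real (W_norm 0 4 (w 0)) + 1" e] by (auto simp: dist_real_def)
  qed
  \<comment> \<open>1 bounds the increment from time 0, \<open>B\<close> the state at time 0, and
    \<open>\<bar>U0\<bar>\<close> restores the constant that is subtracted at order 0.\<close>
  define K where "K = 1 + B + \<bar>U0\<bar>"
  have bound: "\<bar>D 0 j t y\<bar> \<le> K" if t: "0 < t" "t \<le> e / 2" and y: "y > 0" and j: "j \<le> 4" for j t y
  proof -
    define f where "f i z = (if i = 0 then D 0 0 t z - U0 else D 0 i t z)" for i z
    have fd: "(f i has_real_derivative f (Suc i) z) (at z)" if "z > 0" for i z
    proof (cases "i = 0")
      case True
      have "((\<lambda>z. D 0 0 t z - U0) has_real_derivative D 0 (Suc 0) t z - 0) (at z)"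
        by (intro DERIV_diff Dy DERIV_const that t)
      then show ?thesis using True by (simp add: f_def[abs_def])
    next
      case False
      then show ?thesis using Dy[of t z 0 i] that t by (simp add: f_def[abs_def])
    qed
    have "\<bar>f j y\<bar> \<le> 1 + B"
    proof (rule derivative_bound_from_tests[where f = f, OF _ _ y])
      show "(f i has_real_derivative f (Suc i) z) (at z)" if "z > 0" for i z by (rule fd[OF that])
      fix \<phi> assume \<phi>: "test_function \<phi>"
      have c: "continuous_on {0<..} (\<lambda>z. w s z)" if "s \<ge> 0" for s
      proof -
        have "continuous_on {0<..} (\<lambda>y. (s, y))" by (intro continuous_intros)
        then have "continuous_on {0<..} (us s)"
          using continuous_on_compose2[OF uc, of "{0<..}" "\<lambda>y. (s, y)"] that by force
        then show ?thesis unfolding w_def by (intro continuous_intros)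
      qed
      let ?\<psi> = "(deriv ^^ j) \<phi>"
      have i: "integrable halfline (\<lambda>y. ?\<psi> y * (w t y - w 0 y))" "integrable halfline (\<lambda>y. ?\<psi> y * w 0 y)"
        using t by (intro test_function_integrable test_function_funpow \<phi> continuous_intros c; simp)+
      have "(LINT y|halfline. ?\<psi> y * f 0 y) = (LINT y|halfline. ?\<psi> y * (w t y - w 0 y) + ?\<psi> y * w 0 y)"
        by (rule Bochner_Integration.integral_cong) (use t in \<open>auto simp: f_def w_def D0 space_halfline algebra_simps\<close>)
      also have "\<dots> = (LINT y|halfline. ?\<psi> y * (w t y - w 0 y)) + (LINT y|halfline. ?\<psi> y * w 0 y)"
        by (rule Bochner_Integration.integral_add[OF i])
      finally have eq: "(LINT y|halfline. ?\<psi> y * f 0 y) = (LINT y|halfline. ?\<psi> y * (w t y - w 0 y)) + (LINT y|halfline. ?\<psi> y * w 0 y)" .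
      have t2: "t < e" using t e by simp
      have "\<bar>LINT y|halfline. ?\<psi> y * f 0 y\<bar> \<le> 1 * (LINT y|halfline. \<bar>\<phi> y\<bar>) + B * (LINT y|halfline. \<bar>\<phi> y\<bar>)"
        unfolding eq by (rule order_trans[OF abs_triangle_ineq add_mono[OF W_norm_test[OF we[OF t(1) t2] j \<phi>] W_norm_test[OF B j \<phi>]]])
      then show "\<bar>LINT y|halfline. ?\<psi> y * f 0 y\<bar> \<le> (1 + B) * (LINT y|halfline. \<bar>\<phi> y\<bar>)"
        by (simp add: distrib_right)
    qed
    then show ?thesis by (auto simp: f_def K_def split: if_splits)
  qed
  show ?thesis
  proof (rule that, unfold_locales)
    show "((\<lambda>t. D 0 j t y) has_real_derivative D 0 (j + 2) t y) (at t)" if "t > 0" "y > 0" for j t y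
      using Dt[OF that, of 0 j] heat[OF that, of j] by simp
    show "0 < e / 2" using e by simp
  qed (use D0 Dc Dy bound uc u0 ul in auto)
qed

section \<open>Norms of a single Fourier mode\<close>

lemma integral_cis:
  "(LINT x:{0..2*pi}|lborel. cis (of_int n * x)) = (if n = 0 then of_real (2 * pi) else 0)"
proof (cases "n = 0")
  case False
  have "has_bochner_integral lborel (\<lambda>x. indicator {0..2*pi} x *\<^sub>R cis (of_int n * x))
      (cis (of_int n * (2 * pi)) / (\<i> * of_int n) - cis (of_int n * 0) / (\<i> * of_int n))"
  proof (rule has_bochner_integral_FTC_Icc[where F = "\<lambda>x. cis (of_int n * x) / (\<i> * of_int n)"])
    fix x :: real
    have "((\<lambda>z. exp (\<i> * of_int n * z)) has_field_derivative exp (\<i> * of_int n * of_real x) * (\<i> * of_int n)) (at (of_real x))"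
      by (auto intro!: derivative_eq_intros)
    then have "((\<lambda>x. exp (\<i> * of_int n * of_real x)) has_vector_derivative exp (\<i> * of_int n * of_real x) * (\<i> * of_int n))
        (at x within {0..2*pi})" by (rule has_vector_derivative_real_field)
    then have "((\<lambda>x. cis (of_int n * x)) has_vector_derivative cis (of_int n * x) * (\<i> * of_int n)) (at x within {0..2*pi})"
      by (simp add: cis_conv_exp mult.assoc)
    from has_vector_derivative_divide[OF this, of "\<i> * of_int n"]
    show "((\<lambda>x. cis (of_int n * x) / (\<i> * of_int n)) has_vector_derivative cis (of_int n * x)) (at x within {0..2*pi})"
      using False by simp
  qed (auto intro!: continuous_intros)
  moreover have "cis (of_int n * (2 * pi)) = 1" using cis_multiple_2pi[of "of_int n"] by (simp add: mult.commute)
  ultimately show ?thesis using False by (simp add: set_lebesgue_integral_def has_bochner_integral_iff)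
qed (simp add: set_lebesgue_integral_def scaleR_conv_of_real)

lemma fourier_coeff_mode:
  "fourier_coeff (\<lambda>x y. cis (of_int k * x) * h y) j y = (if j = k then h y else 0)"
proof -
  have "(LINT x:{0..2*pi}|lborel. cis (- (of_int j * x)) * (cis (of_int k * x) * h y)) =
      (LINT x:{0..2*pi}|lborel. cis (of_int (k - j) * x) * h y)"
    by (rule set_lebesgue_integral_cong) (auto simp: cis_mult mult.assoc[symmetric] left_diff_distrib)
  also have "\<dots> = (if j = k then of_real (2 * pi) * h y else 0)"
    by (subst set_integral_mult_left, subst integral_cis) simp
  finally show ?thesis by (simp add: fourier_coeff_def)
qed

lemma fourier_multiplier_mode:
  "fourier_multiplier p (\<lambda>x y. cis (of_int k * x) * h y) = (\<lambda>x y. cis (of_int k * x) * (p k * h y))"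
proof (intro ext)
  fix x y
  have "fourier_multiplier p (\<lambda>x y. cis (of_int k * x) * h y) x y =
      (\<Sum>\<^sub>\<infinity>j\<in>{k}. p j * h y * cis (of_int j * x))"
    unfolding fourier_multiplier_def by (rule infsum_cong_neutral) (auto simp: fourier_coeff_mode)
  then show "fourier_multiplier p (\<lambda>x y. cis (of_int k * x) * h y) x y = cis (of_int k * x) * (p k * h y)"
    by simp
qed

section \<open>Sobolev norms of a mode from above and from below\<close>

lemma Linf_norm_le:
  assumes "f \<in> borel_measurable halfline" "\<And>y. y > 0 \<Longrightarrow> norm (f y) \<le> B"
  shows "Linf_norm f \<le> ennreal B"
  unfolding Linf_norm_def
  by (rule esssup_I) (use assms in \<open>auto simp: halfline_def space_restrict_space intro!: ennreal_leI AE_I2\<close>)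

text \<open>The infimum is bounded by one explicit competitor, the mode multiplied by its Sobolev
  weight. It is built from \<open>D\<close> rather than \<open>h\<close> because a competitor must
  be measurable on the whole plane, while \<open>h\<close> is controlled for \<open>y > 0\<close>
  only.\<close>

lemma H_norm_mode_le:
  fixes h D :: "real \<Rightarrow> complex"
  assumes D: "continuous_on UNIV D" "\<And>y. y > 0 \<Longrightarrow> h y = D y"
    and B: "\<And>y. y > 0 \<Longrightarrow> exp (\<alpha> * y) * norm (D y) \<le> B"
  shows "H_norm \<alpha> m (\<lambda>x y. cis (of_int k * x) * h y) \<le>
    ennreal (sqrt (2 * pi) * ((1 + (of_int k)\<^sup>2) powr (m / 2) * B))"
proof -
  define w where "w = (1 + (real_of_int k)\<^sup>2) powr (m / 2)"
  have "1 + (real_of_int k)\<^sup>2 > 0" by (rule add_pos_nonneg) auto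
  then have w: "w > 0" by (simp add: w_def)
  have B0: "B \<ge> 0" using B[of 1] by (meson exp_ge_zero mult_nonneg_nonneg norm_ge_zero order_trans zero_less_one)
  define G where "G x y = cis (of_int k * x) * (of_real w * D y)" for x y
  have meas: "(\<lambda>(x, y). G x y) \<in> borel_measurable borel"
    unfolding G_def case_prod_beta'
    by (intro borel_measurable_continuous_onI continuous_intros continuous_on_compose2[OF D(1)]) auto
  have "W_norm \<alpha> 0 (G x) \<le> ennreal (w * B)" for x
  proof -
    let ?g = "\<lambda>(j::nat) y. exp (\<alpha> * y) *\<^sub>R G x y"
    have c: "continuous_on UNIV (\<lambda>y. exp (\<alpha> * y) *\<^sub>R G x y)"
      unfolding G_def by (intro continuous_intros D)
    have m: "(\<lambda>y. exp (\<alpha> * y) *\<^sub>R G x y) \<in> borel_measurable halfline"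
      unfolding halfline_def by (rule measurable_restrict_space1) (use borel_measurable_continuous_onI[OF c] in simp)
    have "W_norm \<alpha> 0 (G x) \<le> (\<Sum>j\<le>0. Linf_norm (?g j))"
      unfolding W_norm_def by (rule INF_lower) (use m in auto)
    also have "\<dots> = Linf_norm (?g 0)" by simp
    also have "\<dots> \<le> ennreal (w * B)"
    proof (rule Linf_norm_le[OF m])
      fix y :: real assume "y > 0"
      from mult_left_mono[OF B[OF this], of w] w
      show "norm (exp (\<alpha> * y) *\<^sub>R G x y) \<le> w * B" by (simp add: G_def norm_mult mult_ac)
    qed
    finally show ?thesis .
  qed
  then have "(\<integral>\<^sup>+x\<in>{0..2*pi}. (W_norm \<alpha> 0 (G x))\<^sup>2 \<partial>lborel) \<le> (\<integral>\<^sup>+x\<in>{0..2*pi}. (ennreal (w * B))\<^sup>2 \<partial>lborel)"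
    by (intro nn_integral_mono mult_right_mono power_mono) auto
  also have "\<dots> = ennreal ((w * B)\<^sup>2 * (2 * pi))"
    using w B0 by (simp add: nn_integral_cmult_indicator ennreal_power ennreal_mult[symmetric])
  finally have le: "(\<integral>\<^sup>+x\<in>{0..2*pi}. (W_norm \<alpha> 0 (G x))\<^sup>2 \<partial>lborel) \<le> ennreal ((w * B)\<^sup>2 * (2 * pi))" (is "?I \<le> _") .
  have fin: "?I \<noteq> \<infinity>" using le by (metis ennreal_less_top infinity_ennreal_def leD)
  have "enn2real ?I \<le> (w * B)\<^sup>2 * (2 * pi)" using le by (intro enn2real_leI) auto
  then have "sqrt (enn2real ?I) \<le> sqrt (2 * pi) * (w * B)"
    using real_sqrt_le_mono w B0 by (fastforce simp: real_sqrt_mult mult_ac)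
  then have L2: "L2_W_norm \<alpha> G \<le> ennreal (sqrt (2 * pi) * (w * B))"
    unfolding L2_W_norm_def ennreal_sqrt_def using fin by (simp add: ennreal_leI)
  have "H_norm \<alpha> m (\<lambda>x y. cis (of_int k * x) * h y) \<le> L2_W_norm \<alpha> G"
    unfolding H_norm_def
  proof (rule INF_lower, intro CollectI conjI allI meas)
    have "set_integrable lborel {0..2*pi} (\<lambda>x. cis (of_int k * x) * h y)" for y
      by (rule borel_integrable_atLeastAtMost') (intro continuous_intros)
    then show "AE y in halfline. set_integrable lborel {0..2*pi} (\<lambda>x. cis (of_int k * x) * h y)" by simp
    fix j
    show "AE y in halfline. fourier_coeff G j y = of_real ((1 + (of_int j)\<^sup>2) powr (m / 2)) *
        fourier_coeff (\<lambda>x y. cis (of_int k * x) * h y) j y"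
      unfolding G_def[abs_def] fourier_coeff_mode
      by (rule AE_I2) (auto simp: D w_def halfline_def space_restrict_space)
  qed
  then show ?thesis using L2 unfolding w_def by (rule order_trans)
qed

lemma norm_fourier_coeff_le:
  "ennreal (norm (fourier_coeff g k y)) \<le>
     ennreal (1 / (2 * pi)) * (\<integral>\<^sup>+x. ennreal (norm (g x y)) * indicator {0..2*pi} x \<partial>lborel)"
proof -
  have "ennreal (norm (LINT x:{0..2*pi}|lborel. cis (- (of_int k * x)) * g x y)) \<le>
      (\<integral>\<^sup>+x. ennreal (norm (g x y)) * indicator {0..2*pi} x \<partial>lborel)"
  proof (cases "set_integrable lborel {0..2*pi} (\<lambda>x. cis (- (of_int k * x)) * g x y)")
    case True
    then have "ennreal (norm (LINT x:{0..2*pi}|lborel. cis (- (of_int k * x)) * g x y)) \<le>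
        (\<integral>\<^sup>+x. ennreal (norm (indicator {0..2*pi} x *\<^sub>R (cis (- (of_int k * x)) * g x y))) \<partial>lborel)"
      unfolding set_lebesgue_integral_def set_integrable_def by (rule integral_norm_bound_ennreal)
    also have "\<dots> = (\<integral>\<^sup>+x. ennreal (norm (g x y)) * indicator {0..2*pi} x \<partial>lborel)"
      by (rule nn_integral_cong) (auto simp: norm_mult indicator_def)
    finally show ?thesis .
  next
    case False
    \<comment> \<open>The coefficient has the default value 0 here.\<close>
    then show ?thesis by (simp add: set_lebesgue_integral_def set_integrable_def not_integrable_integral_eq)
  qed
  from mult_left_mono[OF this, of "ennreal (1 / (2 * pi))"] show ?thesis
    by (simp add: fourier_coeff_def norm_divide ennreal_mult[symmetric] field_simps)
qed

lemma nn_integral_le_W_norm: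
  assumes "0 < a" "a < b"
  shows "ennreal (1 / (b - a)) * (\<integral>\<^sup>+y. ennreal (norm (f y)) * indicator {a..b} y \<partial>lborel) \<le> W_norm 0 0 f"
  unfolding W_norm_def
proof (rule INF_greatest)
  fix g assume "g \<in> {g :: nat \<Rightarrow> real \<Rightarrow> 'a. (\<forall>y>0. g 0 y = exp (0 * y) *\<^sub>R f y) \<and>
      (\<forall>j\<le>0. g j \<in> borel_measurable halfline) \<and> (\<forall>j<0. weak_derivative (g j) (g (Suc j)))}"
  then have g: "\<And>y. y > 0 \<Longrightarrow> g 0 y = f y" "g 0 \<in> borel_measurable halfline" by auto
  have "AE y in halfline. ennreal (norm (g 0 y)) \<le> Linf_norm (g 0)"
    unfolding Linf_norm_def by (rule esssup_AE)
  then have "AE y in lborel. y \<in> {0<..} \<longrightarrow> ennreal (norm (g 0 y)) \<le> Linf_norm (g 0)"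
    unfolding halfline_def by (subst (asm) AE_restrict_space_iff) auto
  then have "(\<integral>\<^sup>+y. ennreal (norm (f y)) * indicator {a..b} y \<partial>lborel) \<le> (\<integral>\<^sup>+y. Linf_norm (g 0) * indicator {a..b} y \<partial>lborel)"
    by (intro nn_integral_mono_AE) (use assms in \<open>auto elim!: eventually_mono simp: g indicator_def\<close>)
  also have "\<dots> = Linf_norm (g 0) * ennreal (b - a)" using assms by (simp add: nn_integral_cmult_indicator)
  finally have "ennreal (1 / (b - a)) * (\<integral>\<^sup>+y. ennreal (norm (f y)) * indicator {a..b} y \<partial>lborel)
      \<le> ennreal (1 / (b - a)) * (Linf_norm (g 0) * ennreal (b - a))" by (rule mult_left_mono) simp
  also have "\<dots> = ennreal (1 / (b - a) * (b - a)) * Linf_norm (g 0)"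
    using assms by (subst ennreal_mult) (auto simp: mult_ac)
  finally show "ennreal (1 / (b - a)) * (\<integral>\<^sup>+y. ennreal (norm (f y)) * indicator {a..b} y \<partial>lborel)
      \<le> (\<Sum>j\<le>0. Linf_norm (g j))" using assms by simp
qed

lemma ennreal_sqrt_less:
  assumes "ennreal_sqrt x < ennreal A"
  shows "x \<le> ennreal (A\<^sup>2)"
proof (cases x)
  case (real r)
  with assms have "ennreal (sqrt r) < ennreal A" by (simp add: ennreal_sqrt_def)
  with real have "sqrt r < A" by (simp add: ennreal_less_iff)
  then have "r \<le> A\<^sup>2" using sqrt_le_D by auto
  with real show ?thesis by (simp add: ennreal_leI)
qed (use assms in \<open>auto simp: ennreal_sqrt_def\<close>)

text \<open>Averaging in \<open>y\<close> over an interval avoids the measurability of \<open>x \<mapsto> \<parallel>g x\<parallel>\<close>.\<close>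

lemma average_fourier_coeff:
  fixes g :: "real \<Rightarrow> real \<Rightarrow> complex"
  assumes g: "(\<lambda>(x, y). g x y) \<in> borel_measurable borel" and A: "L2_W_norm 0 g < ennreal A"
    and ab: "0 < a" "a < b" and L: "AE y in halfline. y \<in> {a..b} \<longrightarrow> L \<le> norm (fourier_coeff g k y)"
    and L0: "L \<ge> 0"
  shows "L \<le> A"
proof -
  have A0: "A > 0" using le_less_trans[OF zero_le A] by (simp add: ennreal_less_zero_iff)
  define H where "H x = ennreal (1 / (b - a)) * (\<integral>\<^sup>+y. ennreal (norm (g x y)) * indicator {a..b} y \<partial>lborel)" for x
  have gm[measurable]: "(\<lambda>p. g (fst p) (snd p)) \<in> borel_measurable (borel \<Otimes>\<^sub>M borel)"
    using g by (simp add: borel_prod case_prod_beta')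
  have gm'[measurable]: "(\<lambda>p. g (snd p) (fst p)) \<in> borel_measurable (borel \<Otimes>\<^sub>M borel)"
    using measurable_compose[OF measurable_pair_swap' gm] by (simp add: case_prod_beta')
  have gx[measurable]: "g x \<in> borel_measurable borel" for x
    using measurable_compose_Pair1[OF _ gm, of x] by simp
  have Hm[measurable]: "H \<in> borel_measurable lborel"
    unfolding H_def by measurable
  let ?X = "indicator {0..2*pi} :: real \<Rightarrow> ennreal"
  define I where "I = (\<integral>\<^sup>+x. H x * ?X x \<partial>lborel)"
  have "AE y in lborel. y \<in> {a..b} \<longrightarrow> L \<le> norm (fourier_coeff g k y)"
    using L ab unfolding halfline_def by (subst (asm) AE_restrict_space_iff) (auto elim!: eventually_mono)
  then have "(\<integral>\<^sup>+y. ennreal L * indicator {a..b} y \<partial>lborel) \<le>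
      (\<integral>\<^sup>+y. (ennreal (1 / (2 * pi)) * (\<integral>\<^sup>+x. ennreal (norm (g x y)) * ?X x \<partial>lborel)) * indicator {a..b} y \<partial>lborel)"
  proof (intro nn_integral_mono_AE, elim eventually_mono)
    fix y assume y: "y \<in> {a..b} \<longrightarrow> L \<le> norm (fourier_coeff g k y)"
    show "ennreal L * indicator {a..b} y \<le>
        ennreal (1 / (2 * pi)) * (\<integral>\<^sup>+x. ennreal (norm (g x y)) * ?X x \<partial>lborel) * indicator {a..b} y"
    proof (cases "y \<in> {a..b}")
      case True
      with y have "ennreal L \<le> ennreal (norm (fourier_coeff g k y))" by (simp add: ennreal_leI)
      from order_trans[OF this norm_fourier_coeff_le] True show ?thesis by simp
    qed simp
  qed
  also have "\<dots> = (\<integral>\<^sup>+y. ennreal (1 / (2 * pi)) * (\<integral>\<^sup>+x. ennreal (norm (g x y)) * indicator {a..b} y * ?X x \<partial>lborel) \<partial>lborel)"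
    by (intro nn_integral_cong) (auto simp: indicator_def)
  also have "\<dots> = ennreal (1 / (2 * pi)) * (\<integral>\<^sup>+y. (\<integral>\<^sup>+x. ennreal (norm (g x y)) * indicator {a..b} y * ?X x \<partial>lborel) \<partial>lborel)"
    by (rule nn_integral_cmult) measurable
  also have "(\<integral>\<^sup>+y. (\<integral>\<^sup>+x. ennreal (norm (g x y)) * indicator {a..b} y * ?X x \<partial>lborel) \<partial>lborel) =
      (\<integral>\<^sup>+x. (\<integral>\<^sup>+y. ennreal (norm (g x y)) * indicator {a..b} y * ?X x \<partial>lborel) \<partial>lborel)"
    by (rule lborel_pair.Fubini') measurable
  also have "\<dots> = (\<integral>\<^sup>+x. ennreal (b - a) * (H x * ?X x) \<partial>lborel)"
  proof (rule nn_integral_cong)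
    fix x :: real
    have "(\<integral>\<^sup>+y. ennreal (norm (g x y)) * indicator {a..b} y * ?X x \<partial>lborel) =
        (\<integral>\<^sup>+y. ennreal (norm (g x y)) * indicator {a..b} y \<partial>lborel) * ?X x"
      by (rule nn_integral_multc) measurable
    also have "\<dots> = ennreal ((b - a) * (1 / (b - a))) * (\<integral>\<^sup>+y. ennreal (norm (g x y)) * indicator {a..b} y \<partial>lborel) * ?X x"
      using ab by simp
    also have "\<dots> = ennreal (b - a) * (H x * ?X x)"
      using ab by (subst ennreal_mult) (auto simp: H_def mult_ac)
    finally show "(\<integral>\<^sup>+y. ennreal (norm (g x y)) * indicator {a..b} y * ?X x \<partial>lborel) = ennreal (b - a) * (H x * ?X x)" .
  qed
  also have "\<dots> = ennreal (b - a) * I" unfolding I_def by (rule nn_integral_cmult) measurable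
  finally have "ennreal (b - a) * ennreal L \<le> ennreal (b - a) * (ennreal (1 / (2 * pi)) * I)"
    using ab by (simp add: nn_integral_cmult_indicator mult_ac)
  then have LI: "ennreal L \<le> ennreal (1 / (2 * pi)) * I"
    using ab by (subst (asm) ennreal_mult_le_mult_iff) auto
  \<comment> \<open>The indicator is doubled so that Cauchy-Schwarz can give one copy to each
    factor.\<close>
  have "I\<^sup>2 = (\<integral>\<^sup>+x. (H x * ?X x) * ?X x \<partial>lborel)\<^sup>2"
    unfolding I_def by (intro arg_cong[where f = "\<lambda>t. t\<^sup>2"] nn_integral_cong) (auto simp: indicator_def)
  also have "\<dots> \<le> (\<integral>\<^sup>+x. (H x * ?X x)\<^sup>2 \<partial>lborel) * (\<integral>\<^sup>+x. (?X x)\<^sup>2 \<partial>lborel)"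
    by (rule Cauchy_Schwarz_nn_integral) measurable
  also have "(\<integral>\<^sup>+x. (?X x)\<^sup>2 \<partial>lborel) = (\<integral>\<^sup>+x. ?X x \<partial>lborel)"
    by (intro nn_integral_cong) (auto simp: indicator_def)
  also have "\<dots> = ennreal (2 * pi)" by simp
  finally have I1: "I\<^sup>2 \<le> (\<integral>\<^sup>+x. (H x * ?X x)\<^sup>2 \<partial>lborel) * ennreal (2 * pi)" .
  have "(\<integral>\<^sup>+x. (H x * ?X x)\<^sup>2 \<partial>lborel) \<le> (\<integral>\<^sup>+x\<in>{0..2*pi}. (W_norm 0 0 (g x))\<^sup>2 \<partial>lborel)"
  proof (rule nn_integral_mono)
    fix x :: real
    have "H x \<le> W_norm 0 0 (g x)" unfolding H_def by (rule nn_integral_le_W_norm[OF ab])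
    then have "(H x)\<^sup>2 \<le> (W_norm 0 0 (g x))\<^sup>2" by (rule power_mono) simp
    then show "(H x * ?X x)\<^sup>2 \<le> (W_norm 0 0 (g x))\<^sup>2 * ?X x" by (cases "x \<in> {0..2*pi}") auto
  qed
  also have "\<dots> \<le> ennreal (A\<^sup>2)" using A unfolding L2_W_norm_def by (rule ennreal_sqrt_less)
  finally have I2: "I\<^sup>2 \<le> ennreal (A\<^sup>2) * ennreal (2 * pi)"
    by (rule order_trans[OF I1 mult_right_mono]) simp
  have "ennreal (L\<^sup>2) = (ennreal L)\<^sup>2" using L0 by (simp add: ennreal_power)
  also have "\<dots> \<le> (ennreal (1 / (2 * pi)) * I)\<^sup>2" by (rule power_mono[OF LI]) simp
  also have "\<dots> \<le> (ennreal (1 / (2 * pi)))\<^sup>2 * (ennreal (A\<^sup>2) * ennreal (2 * pi))"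
    unfolding power_mult_distrib by (rule mult_left_mono[OF I2]) simp
  also have "\<dots> = ennreal ((1 / (2 * pi))\<^sup>2 * (A\<^sup>2 * (2 * pi)))"
    by (simp add: ennreal_power ennreal_mult)
  finally have "L\<^sup>2 \<le> (1 / (2 * pi))\<^sup>2 * (A\<^sup>2 * (2 * pi))" by (simp add: ennreal_le_iff)
  also have "\<dots> = A\<^sup>2 / (2 * pi)" by (simp add: power2_eq_square)
  also have "\<dots> \<le> A\<^sup>2 / 1" using pi_gt3 by (intro divide_left_mono) auto
  finally have "L\<^sup>2 \<le> A\<^sup>2" by simp
  then show ?thesis by (rule power2_le_imp_le) (rule less_imp_le[OF A0])
qed

text \<open>All competitors in the infimum have the same Fourier coefficient of order
  \<open>k\<close> up to null sets in \<open>y\<close>, and continuity of \<open>h\<close> spreads a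
  violation at one point to an interval of positive length.\<close>

lemma H_norm_mode_lower:
  fixes h :: "real \<Rightarrow> complex"
  assumes c: "continuous_on {0<..} h" and H: "H_norm 0 r (\<lambda>x y. cis (of_int k * x) * h y) < ennreal A" and y: "y > 0"
  shows "(1 + (of_int k)\<^sup>2) powr (r / 2) * norm (h y) \<le> A"
proof (rule ccontr)
  define w where "w = (1 + (real_of_int k)\<^sup>2) powr (r / 2)"
  have "1 + (real_of_int k)\<^sup>2 > 0" by (rule add_pos_nonneg) auto
  then have w: "w > 0" by (simp add: w_def)
  assume "\<not> ?thesis"
  then have A: "A < w * norm (h y)" by (simp add: w_def)
  define L where "L = (A + w * norm (h y)) / 2"
  have L: "A < L" "L < w * norm (h y)" using A by (auto simp: L_def)
  have A0: "A > 0" using le_less_trans[OF zero_le H] by (simp add: ennreal_less_zero_iff)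
  obtain g where g: "(\<lambda>(x, y). g x y) \<in> borel_measurable borel" "L2_W_norm 0 g < ennreal A"
    "\<And>j. AE y in halfline. fourier_coeff g j y = of_real ((1 + (of_int j)\<^sup>2) powr (r / 2)) *
        fourier_coeff (\<lambda>x y. cis (of_int k * x) * h y) j y"
    using H unfolding H_norm_def INF_less_iff by blast
  have "isCont (\<lambda>y. w * norm (h y)) y"
    using c y by (intro continuous_intros) (simp add: continuous_on_eq_continuous_at)
  then have "\<forall>\<^sub>F x in at y. w * norm (h x) > L" unfolding isCont_def by (rule order_tendstoD(1)) (rule L(2))
  then obtain d where "d > 0" "\<And>x. x \<noteq> y \<Longrightarrow> dist x y < d \<Longrightarrow> w * norm (h x) > L" by (auto simp: eventually_at)
  with L(2) have d: "d > 0" "\<And>x. dist x y < d \<Longrightarrow> w * norm (h x) > L" by metis+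
  have "L \<le> A"
  proof (rule average_fourier_coeff[OF g(1,2), of y "y + d / 2" L k])
    show "AE z in halfline. z \<in> {y..y + d / 2} \<longrightarrow> L \<le> norm (fourier_coeff g k z)"
      using g(3)[of k]
    proof eventually_elim
      case (elim z)
      show ?case
      proof
        assume "z \<in> {y..y + d / 2}"
        then have "L < w * norm (h z)" using d(1) by (intro d(2)) (auto simp: dist_real_def)
        then show "L \<le> norm (fourier_coeff g k z)" using w by (simp add: elim fourier_coeff_mode norm_mult w_def)
      qed
    qed
  qed (use y d A0 L in auto)
  with L(1) show False by simp
qed

section \<open>Instability\<close>

lemma continuous_on_sequence:
  assumes "\<And>y. (D has_vector_derivative D' y) (at y)"
  shows "continuous_on A (D :: real \<Rightarrow> 'a::real_normed_vector)"
  by (meson assms continuous_at_imp_continuous_on has_vector_derivative_continuous)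

text \<open>A support away from the wall yields the two compatibility conditions at 0. The constant
  contains \<open>exp b\<close> to pay for the weight \<open>exp (- y)\<close> on the
  support.\<close>

lemma compactly_supported_sequence:
  fixes f :: "real \<Rightarrow> complex"
  assumes f: "Ck UNIV 5 f" and supp: "\<And>y. y \<notin> {a..b} \<Longrightarrow> f y = 0" and a: "a > 0"
  obtains D \<kappa> where "D 0 = f" "\<And>j y. j < 4 \<Longrightarrow> (D j has_vector_derivative D (Suc j) y) (at y)"
    "\<And>j. j \<le> 4 \<Longrightarrow> continuous_on UNIV (D j)" "\<And>j y. j \<le> 4 \<Longrightarrow> y \<ge> 0 \<Longrightarrow> norm (D j y) \<le> \<kappa> * exp (- y)"
    "D 0 0 = 0" "D 2 0 = 0"
proof -
  obtain D where D: "D 0 = f" "\<And>j y. j < 5 \<Longrightarrow> (D j has_vector_derivative D (Suc j) y) (at y)"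
    using Ck_sequence[OF f] by auto
  have c: "continuous_on A (D j)" if "j \<le> 4" for j A
    by (rule continuous_on_sequence[of _ "D (Suc j)"]) (use D(2) that in auto)
  have z: "D j y = 0" if "j \<le> 5" "y \<notin> {a..b}" for j y
    using that
  proof (induction j arbitrary: y)
    case 0
    then show ?case using D(1) supp by simp
  next
    case (Suc j)
    have "(D j has_vector_derivative 0) (at y)"
      by (rule has_vector_derivative_transform_within_open[of "\<lambda>_. 0" _ _ "- {a..b}"]) (use Suc in auto)
    then show ?case using vector_derivative_unique_at[OF D(2)] Suc.prems by auto
  qed
  have "\<exists>B. \<forall>y\<in>{a..b}. norm (D j y) \<le> B" if "j \<le> 4" for j
    using compact_imp_bounded[OF compact_continuous_image[OF c[OF that] compact_Icc]] unfolding bounded_iff by auto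
  then obtain B where B: "\<And>j y. j \<le> 4 \<Longrightarrow> y \<in> {a..b} \<Longrightarrow> norm (D j y) \<le> B j" by metis
  define \<kappa> where "\<kappa> = (\<Sum>j\<le>4. \<bar>B j\<bar>) * exp b"
  have "norm (D j y) \<le> \<kappa> * exp (- y)" if j: "j \<le> 4" for j y
  proof (cases "y \<in> {a..b}")
    case True
    have "norm (D j y) \<le> \<bar>B j\<bar>" using B[OF j True] by simp
    also have "\<bar>B j\<bar> \<le> (\<Sum>j\<le>4. \<bar>B j\<bar>)" using j by (intro member_le_sum) auto
    also have "\<dots> = (\<Sum>j\<le>4. \<bar>B j\<bar>) * 1" by simp
    also have "\<dots> \<le> (\<Sum>j\<le>4. \<bar>B j\<bar>) * exp (b - y)" using True by (intro mult_left_mono sum_nonneg) auto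
    finally show ?thesis by (simp add: \<kappa>_def exp_diff exp_minus field_simps)
  next
    case False
    then show ?thesis using z[of j y] j by (auto simp: \<kappa>_def intro!: mult_nonneg_nonneg sum_nonneg)
  qed
  with D c z[of 0 0] z[of 2 0] a show ?thesis by (intro that[of D \<kappa>]) auto
qed

section \<open>From the mode equation to the linearized Prandtl equations\<close>

context shear begin

lemma mode_flow_exists:
  fixes D :: "nat \<Rightarrow> real \<Rightarrow> complex"
  assumes t: "0 < t0" "t0 < T" "T \<le> t1" "T \<le> t0 + 1"
    and D: "\<And>j y. j < 4 \<Longrightarrow> (D j has_vector_derivative D (Suc j) y) (at y)"
      "\<And>j. j \<le> 4 \<Longrightarrow> continuous_on UNIV (D j)"
      "\<And>j y. j \<le> 4 \<Longrightarrow> y \<ge> 0 \<Longrightarrow> norm (D j y) \<le> \<kappa>0 * exp (- y)" "D 0 0 = 0" "D 2 0 = 0"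
  obtains u ut uy uyy \<psi> where "mode_flow t0 T c S u ut uy uyy \<psi>" "\<And>y. y \<ge> 0 \<Longrightarrow> u t0 y = D 0 y"
proof -
  \<comment> \<open>Extended by 0, as the flow is controlled for \<open>y > 0\<close> while the mode
    problem asks for bounds at the wall as well; the value 0 there also agrees with
    \<open>s_wall\<close>.\<close>
  define s where "s j t y = complex_of_real (if y > 0 then S j t y else 0)" for j t y
  \<comment> \<open>Large enough for the contraction; the added 1 keeps it positive.\<close>
  define \<Lambda> where "\<Lambda> = 2 * \<bar>mode_problem.forcing_const c K * gauss_exp_moment\<bar> + 1"
  have \<Lambda>: "\<Lambda> > 0" by (simp add: \<Lambda>_def add_nonneg_pos)
  have pos: "t > 0" if "t \<in> {t0..T}" for t using that t by auto
  have of_real_vd: "((\<lambda>x. complex_of_real (f x)) has_vector_derivative of_real f') (at x within A)"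
    if "(f has_real_derivative f') (at x within A)" for f f' x A
    using that by (simp add: has_real_derivative_iff_has_vector_derivative has_vector_derivative_of_real)
  have s_y: "(s j t has_vector_derivative s (Suc j) t y) (at y)" if "t \<in> {t0..T}" "y > 0" for j t y
  proof (rule has_vector_derivative_transform_within_open[where S = "{0<..}"])
    show "((\<lambda>y. complex_of_real (S j t y)) has_vector_derivative s (Suc j) t y) (at y)"
      using of_real_vd[OF S_y[OF pos[OF that(1)] that(2)]] that by (simp add: s_def)
  qed (use that in \<open>auto simp: s_def\<close>)
  interpret mode_problem t0 T \<Lambda> s c K
  proof unfold_locales
    show "continuous_on ({t0..T} \<times> {0<..}) (\<lambda>(t, y). s j t y)" for j
    proof -
      have "continuous_on ({t0..T} \<times> {0<..}) (\<lambda>p. complex_of_real ((\<lambda>(t, y). S j t y) p))"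
        by (intro continuous_on_of_real continuous_on_subset[OF S_cont]) (use t in auto)
      then show ?thesis by (rule continuous_on_eq) (auto simp: s_def)
    qed
    show "norm (s j t y) \<le> K" if "j \<le> 4" "t \<in> {t0..T}" for j t y
      using S_bound[of t y j] that t K_nonneg by (auto simp: s_def)
    show "norm (s 0 t y) \<le> K * y" if "t \<in> {t0..T}" "y \<ge> 0" for t y
      using us_wall[of t y] that t K_nonneg by (auto simp: s_def S0)
  qed (use t \<Lambda> s_y in auto)
  have small: "mode_problem.forcing_const c K * gauss_exp_moment / \<Lambda> \<le> 1 / 2"
    using \<Lambda> by (simp add: \<Lambda>_def field_simps)
  have s_t: "((\<lambda>t. s j t y) has_vector_derivative s (j + 2) t y) (at t within {t0..T})"
    if "j < 2" "t \<in> {t0..T}" "y > 0" for j t y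
    using of_real_vd[OF has_field_derivative_at_within[OF S_t[OF pos[OF that(2)] that(3)]]] that(3)
    by (simp add: s_def)
  have s_far: "(s 1 t \<longlongrightarrow> 0) at_top" if "t \<in> {t0..T}" for t
  proof -
    have "((\<lambda>y. complex_of_real (S 1 t y)) \<longlongrightarrow> of_real 0) at_top"
      using that t by (intro tendsto_of_real S1_lim) auto
    moreover have "\<forall>\<^sub>F y in at_top. complex_of_real (S 1 t y) = s 1 t y"
      using eventually_gt_at_top[of 0] by eventually_elim (simp add: s_def)
    ultimately have "(s 1 t \<longlongrightarrow> of_real 0) at_top" by (rule Lim_transform_eventually)
    then show ?thesis by simp
  qed
  obtain u ut uy uyy \<psi> B where u: "\<And>y. y \<ge> 0 \<Longrightarrow> u t0 y = D 0 y"
    "continuous_on ({t0..T} \<times> {0..}) (\<lambda>(t, y). u t y)"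
    "continuous_on ({t0..T} \<times> {0..}) (\<lambda>(t, y). \<psi> t y)"
    "continuous_on ({t0..T} \<times> {0<..}) (\<lambda>(t, y). ut t y)"
    "continuous_on ({t0..T} \<times> {0<..}) (\<lambda>(t, y). uy t y)"
    "continuous_on ({t0..T} \<times> {0<..}) (\<lambda>(t, y). uyy t y)"
    "\<And>t. t \<in> {t0..T} \<Longrightarrow> u t 0 = 0" "\<And>t. t \<in> {t0..T} \<Longrightarrow> \<psi> t 0 = 0"
    "\<And>t y. t \<in> {t0..T} \<Longrightarrow> y \<ge> 0 \<Longrightarrow> norm (u t y) \<le> B"
    "\<And>t. t \<in> {t0..T} \<Longrightarrow> (u t \<longlongrightarrow> 0) at_top"
    "\<And>t y. t \<in> {t0..T} \<Longrightarrow> y > 0 \<Longrightarrow> (\<psi> t has_vector_derivative u t y) (at y)"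
    "\<And>t y. t \<in> {t0..T} \<Longrightarrow> y > 0 \<Longrightarrow> (u t has_vector_derivative uy t y) (at y)"
    "\<And>t y. t \<in> {t0..T} \<Longrightarrow> y > 0 \<Longrightarrow> (uy t has_vector_derivative uyy t y) (at y)"
    "\<And>t y. t \<in> {t0..T} \<Longrightarrow> y > 0 \<Longrightarrow> ((\<lambda>t. u t y) has_vector_derivative ut t y) (at t within {t0..T})"
    "\<And>t y. t \<in> {t0..T} \<Longrightarrow> y > 0 \<Longrightarrow> ut t y + c * (s 0 t y * u t y - s 1 t y * \<psi> t y) - uyy t y = 0"
    by (rule mode_solution[OF small s_t s_far D]) ((rule that; (assumption | blast)) | assumption)+
  have eq: "ut t y + c * (of_real (S 0 t y) * u t y - of_real (S 1 t y) * \<psi> t y) - uyy t y = 0"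
    if "t \<in> {t0..T}" "y > 0" for t y
    using u(15)[OF that] that(2) by (simp add: s_def)
  have "mode_flow t0 T c S u ut uy uyy \<psi>"
    unfolding mode_flow_def by (intro conjI ballI allI impI exI[of _ B]) (rule u(2-14) eq; assumption?)+
  with u(1) that show ?thesis by blast
qed

text \<open>Incompressibility and the wall condition make the normal velocity of the mode
  \<open>- \<i> * k\<close> times the primitive \<open>\<psi>\<close>, which is how the nonlocal
  term of the mode equation arises.\<close>

lemma mode_flow_prandtl:
  assumes flow: "mode_flow t0 T (\<i> * of_int k) S u ut uy uyy \<psi>" and t: "0 < t0" "t0 < T"
  shows "linearized_prandtl us t0 T (\<lambda>t x y. cis (of_int k * x) * u t y)
    (\<lambda>t x y. cis (of_int k * x) * (- (\<i> * of_int k) * \<psi> t y))"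
proof -
  let ?e = "\<lambda>x. cis (of_int k * x)"
  have u: "continuous_on ({t0..T} \<times> {0..}) (\<lambda>(t, y). u t y)" "continuous_on ({t0..T} \<times> {0..}) (\<lambda>(t, y). \<psi> t y)"
    "continuous_on ({t0..T} \<times> {0<..}) (\<lambda>(t, y). ut t y)" "continuous_on ({t0..T} \<times> {0<..}) (\<lambda>(t, y). uy t y)"
    "continuous_on ({t0..T} \<times> {0<..}) (\<lambda>(t, y). uyy t y)" using flow by (auto simp: mode_flow_def)
  have u': "u t 0 = 0 \<and> \<psi> t 0 = 0 \<and> (u t \<longlongrightarrow> 0) at_top" if "t \<in> {t0..T}" for t
    using flow that unfolding mode_flow_def by blast
  have d: "(\<psi> t has_vector_derivative u t y) (at y)" "(u t has_vector_derivative uy t y) (at y)"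
    "(uy t has_vector_derivative uyy t y) (at y)" "((\<lambda>t. u t y) has_vector_derivative ut t y) (at t within {t0..T})"
    "ut t y + \<i> * of_int k * (of_real (S 0 t y) * u t y - of_real (S 1 t y) * \<psi> t y) - uyy t y = 0"
    if "t \<in> {t0..T}" "y > 0" for t y
    using flow that unfolding mode_flow_def by blast+
  obtain B where B: "\<And>t y. t \<in> {t0..T} \<Longrightarrow> y \<ge> 0 \<Longrightarrow> norm (u t y) \<le> B" using flow unfolding mode_flow_def by blast
  have per: "?e (x + 2 * pi) = ?e x" for x
    using cis_multiple_2pi[of "of_int k"] by (simp add: distrib_left cis_mult[symmetric] mult_ac)
  have e': "(?e has_vector_derivative \<i> * of_int k * ?e x) (at x)" for x
  proof -
    have "((\<lambda>z. exp (\<i> * of_int k * z)) has_field_derivative exp (\<i> * of_int k * of_real x) * (\<i> * of_int k)) (at (of_real x))"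
      by (auto intro!: derivative_eq_intros)
    from has_vector_derivative_real_field[OF this] show ?thesis by (simp add: cis_conv_exp mult_ac)
  qed
  have cont: "continuous_on (I \<times> UNIV \<times> Y) (\<lambda>(t, x, y). ?e x * f t y)"
    if "continuous_on ({t0..T} \<times> Y) (\<lambda>(t, y). f t y)" "I \<subseteq> {t0..T}" for I Y and f :: "real \<Rightarrow> real \<Rightarrow> complex"
  proof -
    have "continuous_on (I \<times> UNIV \<times> Y) (\<lambda>p. (fst p, snd (snd p)))" by (intro continuous_intros)
    moreover have "(\<lambda>p. (fst p, snd (snd p))) ` (I \<times> (UNIV :: real set) \<times> Y) \<subseteq> {t0..T} \<times> Y" using that(2) by auto
    ultimately have "continuous_on (I \<times> UNIV \<times> Y) (\<lambda>p. f (fst p) (snd (snd p)))"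
      using continuous_on_compose2[OF that(1)] by force
    then show ?thesis unfolding case_prod_beta' by (intro continuous_intros) auto
  qed
  have sub: "{t0..T} \<times> {0<..} \<subseteq> {t0..T} \<times> {0::real..}" by auto
  have c\<psi>: "continuous_on ({t0..T} \<times> {0..}) (\<lambda>(t, y). - (\<i> * of_int k) * \<psi> t y)"
    and cux: "continuous_on ({t0..T} \<times> {0<..}) (\<lambda>(t, y). \<i> * of_int k * u t y)"
    using u(2) continuous_on_subset[OF u(1) sub] unfolding case_prod_beta'
    by (auto intro!: continuous_intros)
  show ?thesis
    unfolding linearized_prandtl_def
  proof (intro conjI ballI allI impI)
    show "continuous_on ({t0..T} \<times> UNIV \<times> {0..}) (\<lambda>(t, x, y). ?e x * u t y)" by (rule cont[OF u(1)]) simp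
    show "continuous_on ({t0<..T} \<times> UNIV \<times> {0..}) (\<lambda>(t, x, y). ?e x * (- (\<i> * of_int k) * \<psi> t y))"
      by (rule cont[OF c\<psi>]) auto
    show "\<exists>B. \<forall>t\<in>{t0..T}. \<forall>x. \<forall>y\<ge>0. norm (?e x * u t y) \<le> B" using B by (intro exI[of _ B]) (auto simp: norm_mult)
    show "((\<lambda>y. ?e x * u t y) \<longlongrightarrow> 0) at_top" if "t \<in> {t0<..T}" for t x
      using u'[of t] that by (intro tendsto_mult_right_zero) auto
    show "\<exists>ut ux uy uyy.
        continuous_on ({t0<..T} \<times> UNIV \<times> {0<..}) (\<lambda>(t, x, y). ut t x y) \<and>
        continuous_on ({t0<..T} \<times> UNIV \<times> {0<..}) (\<lambda>(t, x, y). ux t x y) \<and>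
        continuous_on ({t0<..T} \<times> UNIV \<times> {0<..}) (\<lambda>(t, x, y). uy t x y) \<and>
        continuous_on ({t0<..T} \<times> UNIV \<times> {0<..}) (\<lambda>(t, x, y). uyy t x y) \<and>
        (\<forall>t\<in>{t0<..T}. \<forall>x. \<forall>y>0.
           ((\<lambda>\<tau>. ?e x * u \<tau> y) has_vector_derivative ut t x y) (at t within {t0..T}) \<and>
           ((\<lambda>\<xi>. ?e \<xi> * u t y) has_vector_derivative ux t x y) (at x) \<and>
           ((\<lambda>z. ?e x * u t z) has_vector_derivative uy t x y) (at y) \<and>
           ((\<lambda>z. uy t x z) has_vector_derivative uyy t x y) (at y) \<and>
           ((\<lambda>z. ?e x * (- (\<i> * of_int k) * \<psi> t z)) has_vector_derivative - ux t x y) (at y) \<and>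
           ut t x y + of_real (us t y) * ux t x y + ?e x * (- (\<i> * of_int k) * \<psi> t y) * of_real (deriv (us t) y)
             - uyy t x y = 0)"
    proof (rule exI[of _ "\<lambda>t x y. ?e x * ut t y"], rule exI[of _ "\<lambda>t x y. ?e x * (\<i> * of_int k * u t y)"],
        rule exI[of _ "\<lambda>t x y. ?e x * uy t y"], rule exI[of _ "\<lambda>t x y. ?e x * uyy t y"],
        intro conjI ballI allI impI)
      fix t x y :: real assume t': "t \<in> {t0<..T}" and y: "y > 0"
      have tI: "t \<in> {t0..T}" "t > 0" using t' t by auto
      show "((\<lambda>\<tau>. ?e x * u \<tau> y) has_vector_derivative ?e x * ut t y) (at t within {t0..T})"
        "((\<lambda>z. ?e x * u t z) has_vector_derivative ?e x * uy t y) (at y)"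
        "((\<lambda>z. ?e x * uy t z) has_vector_derivative ?e x * uyy t y) (at y)"
        using d(2-4)[OF tI(1) y] by (auto intro: has_vector_derivative_mult_right)
      show "((\<lambda>\<xi>. ?e \<xi> * u t y) has_vector_derivative ?e x * (\<i> * of_int k * u t y)) (at x)"
        using has_vector_derivative_mult_left[OF e', of "u t y" x] by (simp add: mult_ac)
      have "((\<lambda>z. ?e x * (- (\<i> * of_int k) * \<psi> t z)) has_vector_derivative ?e x * (- (\<i> * of_int k) * u t y)) (at y)"
        by (intro has_vector_derivative_mult_right d(1)[OF tI(1) y])
      then show "((\<lambda>z. ?e x * (- (\<i> * of_int k) * \<psi> t z)) has_vector_derivative - (?e x * (\<i> * of_int k * u t y))) (at y)"
        by simp
      have "?e x * ut t y + of_real (S 0 t y) * (?e x * (\<i> * of_int k * u t y)) +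
          ?e x * (- (\<i> * of_int k) * \<psi> t y) * of_real (S 1 t y) - ?e x * uyy t y =
        ?e x * (ut t y + \<i> * of_int k * (of_real (S 0 t y) * u t y - of_real (S 1 t y) * \<psi> t y) - uyy t y)"
        by (simp add: algebra_simps)
      then show "?e x * ut t y + of_real (us t y) * (?e x * (\<i> * of_int k * u t y)) +
          ?e x * (- (\<i> * of_int k) * \<psi> t y) * of_real (deriv (us t) y) - ?e x * uyy t y = 0"
        unfolding d(5)[OF tI(1) y] using deriv_us[OF tI(2) y] S0[OF tI(2) y] by simp
    qed (rule cont; use u cux in auto)+
  qed (use per u' in auto)
qed

text \<open>For one mode the Sobolev weights of order \<open>m\<close> cancel and leave the power
  \<open>\<mu> / 2\<close>, and the Fourier multiplier is a positive number that can be moved to the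
  right. The weight \<open>exp (\<alpha> * y)\<close> enters through the datum, the target space
  having exponent 0.\<close>

lemma mode_flow_bound:
  assumes flow: "mode_flow t0 T (\<i> * of_int k) S u ut uy uyy \<psi>" and t: "0 < t0" "t \<in> {t0<..T}"
    and D: "continuous_on UNIV D" "\<And>y. y \<ge> 0 \<Longrightarrow> u t0 y = D y" "\<And>y. y > 0 \<Longrightarrow> exp (\<alpha> * y) * norm (D y) \<le> B" "B > 0"
    and op: "operator_norm (H_norm \<alpha> m) (H_norm 0 (m - \<mu>)) (regularized_solution_operator us \<sigma>0 t t0) < ennreal C0"
    and y: "y > 0"
  shows "norm (u t y) \<le> C0 * sqrt (2 * pi) * B * (1 + (of_int k)\<^sup>2) powr (\<mu> / 2) * exp (\<sigma>0 * (t - t0) * sqrt \<bar>of_int k\<bar>)"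
proof -
  define w where "w = 1 + (real_of_int k)\<^sup>2"
  have w: "w > 0" unfolding w_def by (rule add_pos_nonneg) auto
  define p where "p j = complex_of_real (exp (- \<sigma>0 * (t - t0) * sqrt \<bar>of_int j\<bar>))" for j :: int
  define X where "X = sqrt (2 * pi) * (w powr (m / 2) * B)"
  have X: "X > 0" using w D(4) by (simp add: X_def)
  obtain C where C: "0 \<le> C" "ennreal C < ennreal C0"
    "\<And>f h. H_norm \<alpha> m f < \<infinity> \<Longrightarrow> regularized_solution_operator us \<sigma>0 t t0 f h \<Longrightarrow> H_norm 0 (m - \<mu>) h \<le> ennreal C * H_norm \<alpha> m f"
    using op unfolding operator_norm_def INF_less_iff by blast
  let ?f = "\<lambda>x y. cis (of_int k * x) * u t0 y"
  have f: "H_norm \<alpha> m ?f \<le> ennreal X"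
    unfolding X_def w_def by (rule H_norm_mode_le[OF D(1) _ D(3)]) (use D(2) in auto)
  \<comment> \<open>The solution operator looks at the time interval from \<open>t0\<close> to
    \<open>t\<close>, so the flow is restricted to it.\<close>
  have lp: "linearized_prandtl us t0 t (\<lambda>t x y. cis (of_int k * x) * u t y)
      (\<lambda>t x y. cis (of_int k * x) * (- (\<i> * of_int k) * \<psi> t y))"
    by (rule mode_flow_prandtl[OF mode_flow_restrict[OF flow]]) (use t in auto)
  have "regularized_solution_operator us \<sigma>0 t t0 ?f (fourier_multiplier p (\<lambda>x y. cis (of_int k * x) * u t y))"
    unfolding regularized_solution_operator_def solution_operator_def p_def using lp by blast
  then have "regularized_solution_operator us \<sigma>0 t t0 ?f (\<lambda>x y. cis (of_int k * x) * (p k * u t y))"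
    by (simp only: fourier_multiplier_mode)
  moreover have "H_norm \<alpha> m ?f < \<infinity>" by (rule le_less_trans[OF f]) simp
  ultimately have "H_norm 0 (m - \<mu>) (\<lambda>x y. cis (of_int k * x) * (p k * u t y)) \<le> ennreal C * H_norm \<alpha> m ?f"
    by (intro C(3))
  also have "\<dots> \<le> ennreal C * ennreal X" by (intro mult_left_mono f) simp
  also have "\<dots> = ennreal (C * X)" using C(1) X by (simp add: ennreal_mult)
  also have "\<dots> < ennreal (C0 * X)" using C(1,2) X by (simp add: ennreal_less_iff)
  finally have H: "H_norm 0 (m - \<mu>) (\<lambda>x y. cis (of_int k * x) * (p k * u t y)) < ennreal (C0 * X)" .
  have cu: "continuous_on {0<..} (\<lambda>y. p k * u t y)"
  proof -
    have "continuous_on {0<..} (\<lambda>y. (t, y))" by (intro continuous_intros)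
    moreover have "continuous_on ({t0..T} \<times> {0..}) (\<lambda>(t, y). u t y)" using flow by (simp add: mode_flow_def)
    ultimately have "continuous_on {0<..} (u t)"
      using continuous_on_compose2[of "{t0..T} \<times> {0..}" "\<lambda>(t, y). u t y" "{0<..}" "\<lambda>y. (t, y)"] t by force
    then show ?thesis by (intro continuous_intros)
  qed
  define v where "v = \<sigma>0 * (t - t0) * sqrt \<bar>real_of_int k\<bar>"
  have "w powr ((m - \<mu>) / 2) * norm (p k * u t y) \<le> C0 * X"
    unfolding w_def by (rule H_norm_mode_lower[OF cu H y])
  moreover have "norm (p k * u t y) = exp (- v) * norm (u t y)" by (simp add: p_def v_def norm_mult)
  ultimately have "w powr ((m - \<mu>) / 2) * (exp (- v) * norm (u t y)) \<le> C0 * X" by simp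
  then have le: "(w powr (\<mu> / 2 - m / 2) * exp v) * (w powr ((m - \<mu>) / 2) * (exp (- v) * norm (u t y))) \<le>
      (w powr (\<mu> / 2 - m / 2) * exp v) * (C0 * X)" by (intro mult_left_mono) auto
  have e1: "(w powr (\<mu> / 2 - m / 2) * exp v) * (w powr ((m - \<mu>) / 2) * (exp (- v) * norm (u t y))) =
      (w powr (\<mu> / 2 - m / 2) * w powr ((m - \<mu>) / 2)) * (exp v * exp (- v)) * norm (u t y)" by (simp only: mult_ac)
  have e2: "w powr (\<mu> / 2 - m / 2) * w powr ((m - \<mu>) / 2) = 1"
    using w by (simp add: powr_add[symmetric] diff_divide_distrib)
  have e3: "(w powr (\<mu> / 2 - m / 2) * exp v) * (C0 * X) =
      C0 * sqrt (2 * pi) * B * (w powr (\<mu> / 2 - m / 2) * w powr (m / 2)) * exp v" by (simp only: X_def mult_ac)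
  have e4: "w powr (\<mu> / 2 - m / 2) * w powr (m / 2) = w powr (\<mu> / 2)"
    using w by (simp add: powr_add[symmetric])
  have e5: "exp v * exp (- v) = 1" by (simp add: exp_minus)
  from le have "norm (u t y) \<le> C0 * sqrt (2 * pi) * B * w powr (\<mu> / 2) * exp v"
    unfolding e1 e3 unfolding e2 e4 e5 mult_1 mult_1_right .
  then show ?thesis unfolding w_def v_def .
qed

end

context critical_point begin

lemma Ck_S: "Ck {0<..} n (\<lambda>y. \<sigma> j t0 y)"
proof (rule Ck_from_sequence[where D = "\<lambda>j y. \<sigma> j t0 y"])
  fix j y :: nat and z :: real assume "z \<in> {0<..}"
  then show "((\<lambda>y. \<sigma> j t0 y) has_vector_derivative \<sigma> (Suc j) t0 z) (at z)"
    using S_y[OF t0, of z j] by (simp add: has_real_derivative_iff_has_vector_derivative has_vector_derivative_of_real)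
qed

text \<open>\<open>M\<close> and \<open>F\<close> are differentiable for \<open>y > 0\<close>. Left
  of \<open>a > 0\<close> the bump makes the product 0, and the two open half-lines cover the
  line.\<close>

lemma Ck_initial:
  assumes "0 < a"
  shows "Ck UNIV n (\<lambda>y. cnj (M t0 y * F N t0 y) * of_real (bump a b y))"
proof -
  have "Ck {0<..} n (\<lambda>y. - of_real N * (\<beta> * (\<sigma> 1 t0 y * \<sigma> 1 t0 y) + \<gamma> * (\<sigma> 1 t0 y * \<sigma> 1 t0 y * \<sigma> 1 t0 y)))"
    by (intro Ck_mult Ck_add Ck_const Ck_S)
  from Ck_exp[OF this] have F: "Ck {0<..} n (F N t0)"
    by (simp add: F_def[abs_def] phase_def power2_eq_square power3_eq_cube)
  have M: "Ck {0<..} n (M t0)"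
    unfolding M_def by (intro Ck_mult Ck_add Ck_const Ck_S)
  have "Ck {0<..} n (\<lambda>y. complex_of_real (bump a b y))"
    by (rule Ck_subset[OF Ck_linear[OF bounded_linear_of_real Ck_bump]]) simp
  then have "Ck {0<..} n (\<lambda>y. cnj (M t0 y * F N t0 y) * of_real (bump a b y))"
    by (intro Ck_mult[OF Ck_linear[OF bounded_linear_cnj Ck_mult[OF M F]]])
  moreover have "Ck {..<a} n (\<lambda>y. cnj (M t0 y * F N t0 y) * of_real (bump a b y))"
    by (rule Ck_cong[OF _ _ Ck_const[of _ _ 0]]) (auto simp: bump_eq_0)
  ultimately have "Ck ({0<..} \<union> {..<a}) n (\<lambda>y. cnj (M t0 y * F N t0 y) * of_real (bump a b y))"
    by (intro Ck_glue) auto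
  moreover have "{0<..} \<union> {..<a} = UNIV" using assms by auto
  ultimately show ?thesis by simp
qed

end

lemma bump_le_1: "bump a b y \<le> 1"
  by (auto simp: bump_def exp_recip_def mult_le_one)

lemma bump_ge:
  assumes "r > 0" "\<bar>y - c\<bar> \<le> r / 2"
  shows "exp (- 2 / r) * exp (- 2 / r) \<le> bump (c - r) (c + r) y"
proof -
  have *: "exp (- 2 / r) \<le> exp_recip 0 x" if "x \<ge> r / 2" for x
    using that assms(1) by (auto simp: exp_recip_def field_simps)
  have "y - (c - r) \<ge> r / 2" "c + r - y \<ge> r / 2" using assms(2) unfolding abs_le_iff by argo+
  then show ?thesis unfolding bump_def by (intro mult_mono * ) (auto simp: exp_recip_def)
qed

section \<open>The contradiction with a uniform operator bound\<close>

context shear begin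

text \<open>The squares \<open>k = n\<^sup>2\<close> make \<open>sqrt \<bar>k\<bar>\<close> the
  integer \<open>N = n\<close>, so that multiplier, profile and window are expressed through one
  parameter. The lower bound \<open>b0\<close> is independent of \<open>N\<close>, whereas the upper
  bound contains \<open>N powr (2 * \<mu>) / N\<close> and an exponentially small term, and tends to
  0 for \<open>\<mu> < 1/2\<close>.\<close>

lemma growth_contradiction:
  assumes d: "d > 0" and \<delta>: "\<delta> > 0" and \<alpha>: "\<alpha> \<ge> 0" and \<mu>: "0 \<le> \<mu>" "\<mu> < 1 / 2"
    and crit: "\<And>e. e > 0 \<Longrightarrow> \<exists>t0 a0. 0 < t0 \<and> t0 < e \<and> t0 < t1 \<and> a0 > 0 \<and> S 1 t0 a0 = 0 \<and> \<bar>S 2 t0 a0\<bar> \<ge> d"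
    and op: "\<And>t s. 0 \<le> s \<Longrightarrow> s < t \<Longrightarrow> t \<le> \<delta> \<Longrightarrow>
      operator_norm (H_norm \<alpha> m) (H_norm 0 (m - \<mu>)) (regularized_solution_operator us (sqrt d / 4) t s) < ennreal C0"
  shows False
proof -
  obtain t0 a0 where t0: "0 < t0" "t0 < \<delta>" "t0 < t1" and a0: "a0 > 0" "S 1 t0 a0 = 0" "\<bar>S 2 t0 a0\<bar> \<ge> d"
    using crit[OF \<delta>] by blast
  interpret cp: critical_point S t0 a0
    by unfold_locales (use t0 a0 d S_y S_t S_cont in auto)
  define T where "T = min (t0 + 1) (min \<delta> t1)"
  have T: "t0 < T" "T \<le> t1" "T \<le> t0 + 1" "T \<le> \<delta>" using t0 by (auto simp: T_def)
  let ?g = "Re cp.rate"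
  have g: "?g > 0" "?g = sqrt \<bar>S 2 t0 a0\<bar> / 2" by (rule cp.Re_rate)+
  have \<sigma>g: "sqrt d / 4 \<le> ?g / 2" using a0(3) g(2) by simp
  have C0: "C0 > 0"
    using le_less_trans[OF zero_le op[of t0 T]] T t0 by (simp add: ennreal_less_zero_iff)
  show False
  proof (rule cp.growth_bound)
    fix r \<tau>1 C :: real assume r: "0 < r" "r < a0" "0 < \<tau>1" "C > 0"
      and MF: "\<And>N y. N \<ge> 1 \<Longrightarrow> \<bar>y - a0\<bar> \<le> r \<Longrightarrow> norm (cp.M t0 y * cp.F N t0 y) \<le> C"
      and growth: "\<And>N \<Delta> Q b b0 u ut uy uyy \<psi>.
        \<lbrakk>N \<ge> 1; 0 < \<Delta>; \<Delta> \<le> \<tau>1; N * \<Delta>\<^sup>2 \<le> 1; Q \<ge> 0; b0 > 0;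
         \<And>y. b y \<ge> 0; \<And>y. \<bar>y - a0\<bar> \<le> r / 2 \<Longrightarrow> b y \<ge> b0;
         \<And>y. \<bar>y - a0\<bar> \<le> r \<Longrightarrow> u t0 y = cnj (cp.M t0 y * cp.F N t0 y) * of_real (b y);
         mode_flow t0 (t0 + \<Delta>) (\<i> * of_real (N\<^sup>2)) S u ut uy uyy \<psi>;
         \<And>t y. t \<in> {t0<..t0 + \<Delta>} \<Longrightarrow> y > 0 \<Longrightarrow> norm (u t y) \<le> Q * exp (?g / 2 * N * (t - t0))\<rbrakk>
        \<Longrightarrow> b0 \<le> C * Q * (exp (- (?g / 2) * N * \<Delta>) + 1 / N)"
    define b0 where "b0 = exp (- 2 / r) * exp (- 2 / r)"
    have b0: "b0 > 0" by (simp add: b0_def)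
    let ?b = "bump (a0 - r) (a0 + r)"
    define B where "B = exp (\<alpha> * (a0 + r)) * C"
    have B: "B > 0" using r by (simp add: B_def)
    \<comment> \<open>The 2 comes from
      \<open>(1 + N ^ 4) powr (\<mu> / 2) \<le> 2 * N powr (2 * \<mu>)\<close>.\<close>
    define D1 where "D1 = 2 * (C0 * sqrt (2 * pi) * B)"
    have D1: "D1 > 0" using C0 B by (simp add: D1_def)
    have key: "b0 \<le> C * (D1 * real n powr (2 * \<mu>)) * (exp (- (?g / 2) * real n * (1 / sqrt (real n))) + 1 / real n)"
      if n: "n \<ge> 1" "1 / sqrt (real n) \<le> \<tau>1" "1 / sqrt (real n) \<le> T - t0" for n :: nat
    proof -
      define N where "N = real n"
      define k where "k = int (n\<^sup>2)"
      \<comment> \<open>The longest window with \<open>N * \<Delta>\<^sup>2 \<le> 1\<close>; still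
        \<open>N * \<Delta> = sqrt N\<close> tends to infinity.\<close>
      define \<Delta> where "\<Delta> = 1 / sqrt N"
      have N: "N \<ge> 1" using n by (simp add: N_def)
      have \<Delta>: "0 < \<Delta>" "\<Delta> \<le> \<tau>1" "N * \<Delta>\<^sup>2 \<le> 1" "t0 + \<Delta> \<le> T"
        using n N by (auto simp: \<Delta>_def N_def power_divide)
      have k: "real_of_int k = N\<^sup>2" "sqrt \<bar>real_of_int k\<bar> = N" using N by (auto simp: k_def N_def)
      define f where "f y = cnj (cp.M t0 y * cp.F N t0 y) * of_real (?b y)" for y
      have f5: "Ck UNIV 5 f" unfolding f_def using r by (intro cp.Ck_initial) simp
      have f0: "f y = 0" if "y \<notin> {a0 - r..a0 + r}" for y
      proof -
        have "y \<notin> {a0 - r<..<a0 + r}" using that by auto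
        then show ?thesis unfolding f_def by (simp add: bump_eq_0)
      qed
      obtain D \<kappa> where D: "D 0 = f" "\<And>j y. j < 4 \<Longrightarrow> (D j has_vector_derivative D (Suc j) y) (at y)"
        "\<And>j. j \<le> 4 \<Longrightarrow> continuous_on UNIV (D j)" "\<And>j y. j \<le> 4 \<Longrightarrow> y \<ge> 0 \<Longrightarrow> norm (D j y) \<le> \<kappa> * exp (- y)"
        "D 0 0 = 0" "D 2 0 = 0"
        using compactly_supported_sequence[OF f5 f0] r by (metis diff_gt_0_iff_gt)
      obtain u ut uy uyy \<psi> where flow: "mode_flow t0 T (\<i> * of_int k) S u ut uy uyy \<psi>"
        and init: "\<And>y. y \<ge> 0 \<Longrightarrow> u t0 y = D 0 y"
        using mode_flow_exists[OF t0(1) T(1,2,3) D(2-6)] by metis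
      have fB: "exp (\<alpha> * y) * norm (f y) \<le> B" for y
      proof (cases "y \<in> {a0 - r..a0 + r}")
        case True
        have "norm (f y) = norm (cp.M t0 y * cp.F N t0 y) * ?b y" by (simp add: f_def norm_mult bump_nonneg)
        also have "\<dots> \<le> C * 1" using True MF[OF N, of y] r by (intro mult_mono bump_le_1) (auto simp: bump_nonneg abs_le_iff)
        finally have "norm (f y) \<le> C" by simp
        then show ?thesis unfolding B_def using True \<alpha> by (intro mult_mono) (auto intro: mult_left_mono)
      qed (use B f0 in simp)
      define Q where "Q = D1 * N powr (2 * \<mu>)"
      have Q: "Q \<ge> 0" using D1 by (simp add: Q_def)
      have ub: "norm (u t y) \<le> Q * exp (?g / 2 * N * (t - t0))" if t: "t \<in> {t0<..t0 + \<Delta>}" and y: "y > 0" for t y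
      proof -
        have tT: "t \<in> {t0<..T}" using t \<Delta> by auto
        have "norm (u t y) \<le> C0 * sqrt (2 * pi) * B * (1 + (of_int k)\<^sup>2) powr (\<mu> / 2) * exp (sqrt d / 4 * (t - t0) * sqrt \<bar>of_int k\<bar>)"
          by (rule mode_flow_bound[OF flow t0(1) tT _ _ _ B _ y, where D = f and \<alpha> = \<alpha> and m = m])
            (use D(1) D(3)[of 0] init fB op[of t0 t] t0 tT T in auto)
        also have "\<dots> \<le> C0 * sqrt (2 * pi) * B * (2 * N powr (2 * \<mu>)) * exp (?g / 2 * N * (t - t0))"
        proof (intro mult_mono mult_left_mono)
          have "(N\<^sup>2)\<^sup>2 \<ge> 1" using N by (simp add: one_le_power)
          then have "(1 + (N\<^sup>2)\<^sup>2) powr (\<mu> / 2) \<le> (2 * N ^ 4) powr (\<mu> / 2)"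
            using \<mu> by (intro powr_mono2) auto
          also have "\<dots> = 2 powr (\<mu> / 2) * (N ^ 4) powr (\<mu> / 2)" by (rule powr_mult)
          also have "N ^ 4 = N powr 4" using N by simp
          also have "(N powr 4) powr (\<mu> / 2) = N powr (2 * \<mu>)" by (simp add: powr_powr)
          also have "2 powr (\<mu> / 2) * N powr (2 * \<mu>) \<le> 2 powr 1 * N powr (2 * \<mu>)" using \<mu> by (intro mult_right_mono powr_mono) auto
          finally show "(1 + (real_of_int k)\<^sup>2) powr (\<mu> / 2) \<le> 2 * N powr (2 * \<mu>)" by (simp add: k(1))
          have "sqrt d / 4 * ((t - t0) * N) \<le> ?g / 2 * ((t - t0) * N)"
            using t N by (intro mult_right_mono[OF \<sigma>g]) auto
          then show "exp (sqrt d / 4 * (t - t0) * sqrt \<bar>real_of_int k\<bar>) \<le> exp (?g / 2 * N * (t - t0))"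
            unfolding k(2) by (simp add: mult_ac)
        qed (use C0 B in auto)
        finally show ?thesis by (simp add: Q_def D1_def mult_ac)
      qed
      have ck: "complex_of_int k = of_real (N\<^sup>2)" using k(1) by (metis of_real_of_int_eq)
      have "b0 \<le> C * Q * (exp (- (?g / 2) * N * \<Delta>) + 1 / N)"
      proof (rule growth[OF N \<Delta>(1-3) Q b0, where b = ?b and u = u and ut = ut and uy = uy and uyy = uyy and \<psi> = \<psi>])
        show "?b y \<ge> 0" for y by (rule bump_nonneg)
        show "b0 \<le> ?b y" if "\<bar>y - a0\<bar> \<le> r / 2" for y
          unfolding b0_def by (rule bump_ge[OF r(1) that])
        show "u t0 y = cnj (cp.M t0 y * cp.F N t0 y) * of_real (?b y)" if "\<bar>y - a0\<bar> \<le> r" for y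
          using init[of y] that r D(1) by (auto simp: f_def abs_le_iff)
        show "mode_flow t0 (t0 + \<Delta>) (\<i> * of_real (N\<^sup>2)) S u ut uy uyy \<psi>"
          using mode_flow_restrict[OF flow \<Delta>(4)] unfolding ck .
        show "norm (u t y) \<le> Q * exp (?g / 2 * N * (t - t0))" if "t \<in> {t0<..t0 + \<Delta>}" "y > 0" for t y
          by (rule ub[OF that])
      qed
      then show ?thesis by (simp add: Q_def N_def \<Delta>_def)
    qed
    have lim: "((\<lambda>n. C * (D1 * real n powr (2 * \<mu>)) * (exp (- (?g / 2) * real n * (1 / sqrt (real n))) + 1 / real n)) \<longlonglongrightarrow> 0)"
    proof -
      define c where "c = ?g / 2"
      have c: "c > 0" using g(1) by (simp add: c_def)
      have "((\<lambda>x. x powr (2 * \<mu>) * (exp (- c * x * (1 / sqrt x)) + 1 / x)) \<longlongrightarrow> 0) at_top"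
        using c \<mu> by real_asymp
      from filterlim_compose[OF this filterlim_real_sequentially]
      have "(\<lambda>n. (C * D1) * (real n powr (2 * \<mu>) * (exp (- c * real n * (1 / sqrt (real n))) + 1 / real n))) \<longlonglongrightarrow> (C * D1) * 0"
        by (rule tendsto_mult_left)
      then show ?thesis by (simp add: c_def mult.assoc)
    qed
    have "(\<lambda>n. 1 / sqrt (real n)) \<longlonglongrightarrow> 0" by real_asymp
    then have e1: "\<forall>\<^sub>F n in sequentially. 1 / sqrt (real n) < min \<tau>1 (T - t0)"
      by (rule order_tendstoD(2)) (use r T in auto)
    have e2: "\<forall>\<^sub>F n in sequentially. C * (D1 * real n powr (2 * \<mu>)) * (exp (- (?g / 2) * real n * (1 / sqrt (real n))) + 1 / real n) < b0"
      using lim b0 by (rule order_tendstoD(2))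
    have "\<forall>\<^sub>F n in sequentially. False"
      using e1 e2 eventually_ge_at_top[of 1]
    proof eventually_elim
      case (elim n)
      with key[of n] show ?case by simp
    qed
    then show False by simp
  qed
qed

end

theorem theorem1:
  fixes U0 :: real and Us :: "real \<Rightarrow> real" and us :: "real \<Rightarrow> real \<Rightarrow> real"
  assumes "heat_solution U0 Us us"
    and "C0_W 0 4 (\<lambda>t y. us t y - U0)"
    and "C1_W 0 2 (\<lambda>t y. us t y - U0)"
    and "\<exists>a>0. nondegenerate_critical_point Us a"
  shows "\<exists>\<sigma>>0. \<forall>\<delta>>0. \<forall>\<alpha>\<ge>0. \<forall>m\<ge>0. \<forall>\<mu>\<in>{0..<1/2}.
    (SUP (t, s) \<in> {(t, s). 0 \<le> s \<and> s < t \<and> t \<le> \<delta>}.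
       operator_norm (H_norm \<alpha> m) (H_norm 0 (m - \<mu>))
         (regularized_solution_operator us \<sigma> t s)) = \<infinity>"
proof -
  obtain K t1 S where "shear us U0 K t1 S" using heat_solution_shear[OF assms(1,2)] .
  then interpret shear us U0 K t1 S .
  obtain a d' where a: "a > 0" "(Us has_real_derivative 0) (at a)" "d' \<noteq> 0" "(deriv Us has_real_derivative d') (at a)"
    using assms(4) by (auto simp: nondegenerate_critical_point_def)
  have eq: "us 0 y = Us y" if "y \<ge> 0" for y using assms(1) that by (simp add: heat_solution_def)
  \<comment> \<open>\<open>us 0\<close> and \<open>Us\<close> agree for \<open>y \<ge> 0\<close>, so
    the derivatives are compared on the open half-line, which contains \<open>a\<close>.\<close>
  have "deriv (us 0) y = deriv Us y" if "y > 0" for y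
    by (rule deriv_cong_ev) (use that eq in \<open>auto intro: eventually_mono[OF eventually_nhds_in_open[of "{0<..}"]]\<close>)
  then have "(deriv (us 0) has_real_derivative d') (at a)"
    by (intro has_field_derivative_transform_within_open[OF a(4), of "{0<..}"]) (use a in auto)
  moreover have "(us 0 has_real_derivative 0) (at a)"
    by (rule has_field_derivative_transform_within_open[OF a(2), of "{0<..}"]) (use a eq in auto)
  ultimately have "nondegenerate_critical_point (us 0) a"
    using a(3) by (auto simp: nondegenerate_critical_point_def)
  from critical_points[OF this a(1)] obtain d where d: "d > 0"
    and crit: "\<And>e. e > 0 \<Longrightarrow> \<exists>t0 a0. 0 < t0 \<and> t0 < e \<and> t0 < t1 \<and> a0 > 0 \<and> S 1 t0 a0 = 0 \<and> \<bar>S 2 t0 a0\<bar> \<ge> d"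
    by blast
  \<comment> \<open>\<open>d\<close> depends on the flow alone and is fixed before
    \<open>\<delta>\<close>. At each critical point used, \<open>Re rate\<close> is half the square
    root of a number that is at least \<open>d\<close>, so \<open>sqrt d / 4\<close> is at most
    \<open>Re rate / 2\<close>.\<close>
  show ?thesis
  proof (intro exI[of _ "sqrt d / 4"] conjI allI impI ballI)
    fix \<delta> \<alpha> m \<mu> :: real assume *: "\<delta> > 0" "\<alpha> \<ge> 0" "m \<ge> 0" "\<mu> \<in> {0..<1/2}"
    let ?op = "\<lambda>t s. operator_norm (H_norm \<alpha> m) (H_norm 0 (m - \<mu>)) (regularized_solution_operator us (sqrt d / 4) t s)"
    let ?sup = "SUP (t, s) \<in> {(t, s). 0 \<le> s \<and> s < t \<and> t \<le> \<delta>}. ?op t s"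
    show "?sup = \<infinity>"
    proof (rule ccontr)
      assume "?sup \<noteq> \<infinity>"
      then obtain C where C: "?sup = ennreal C" "C \<ge> 0" by (cases "?sup") auto
      have "?op t s < ennreal (C + 1)" if "0 \<le> s" "s < t" "t \<le> \<delta>" for t s
      proof -
        have "?op t s \<le> ?sup" using that by (intro SUP_upper2[of "(t, s)"]) auto
        also have "\<dots> < ennreal (C + 1)" unfolding C(1) using C(2) by (simp add: ennreal_less_iff)
        finally show ?thesis .
      qed
      from growth_contradiction[OF d *(1,2) _ _ crit this] *(4) show False by simp
    qed
  qed (use d in simp)
qed

end
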